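(* There exists an absolute constant $\alpha\in(0,1)$ such that the following holds for all integers $d\ge1$, $1\le s\le\alpha d$, all $\sigma>0$, any $\boldsymbol\theta\in B_0(s,d)$ and any $\boldsymbol\Sigma$ satisfying Assumptions $(\varepsilon^*0)$ and $(\varepsilon^*1)$. (i) If $s>\|\boldsymbol\Sigma\|_F$, then $\mathbf E_{\boldsymbol\theta,\boldsymbol\Sigma}[(\hat N^*-\|\boldsymbol\theta\|_2)^2]\le c_1\sigma^2\psi^*(s,\boldsymbol\Sigma)$ for an absolute constant $c_1>0$. (ii) If $s\le\|\boldsymbol\Sigma\|_F$, then there is an absolute constant $c_2>0$ such that for any $\eta\in(c_2\|\boldsymbol\Sigma\|_F/d,1)$, \[ \mathbf P_{\boldsymbol\theta,\boldsymbol\Sigma}\left((\hat N^*-\|\boldsymbol\theta\|_2)^2\le c_\eta\sigma^2\psi^*(s,\boldsymbol\Sigma)\right)\ge1-\eta, \] where $c_\eta>0$ depends only on $\eta$. (iii) If in addition $\boldsymbol\Sigma$ is positive definite, then for an absolute constant $c_3>0$, \[ \mathbf E_{\boldsymbol\theta,\boldsymbol\Sigma}[(\hat N^*-\|\boldsymbol\theta\|_2)^2]\le c_3\left(\sqrt{\lambda_{\max}(\boldsymbol\Sigma^{-1})}+1\right)\sigma^2\psi^*(s,\boldsymbol\Sigma)+c_3\sigma^2\frac{\|\boldsymbol\Sigma\|_F^2}{d}\log(1+\|\boldsymbol\Sigma\|_F^2/s^2). \]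
   Context: Model: one observes $\boldsymbol Y=\boldsymbol\theta+\sigma\boldsymbol\varepsilon\in\mathbb R^d$, $\boldsymbol\varepsilon\sim\mathcal N(\boldsymbol0,\boldsymbol\Sigma)$, $\boldsymbol\Sigma$ a covariance matrix with known diagonal entries $\sigma_i^2$ and known $\|\boldsymbol\Sigma\|_F$; $\sigma>0$ is unknown. $\mathbf P_{\boldsymbol\theta,\boldsymbol\Sigma},\mathbf E_{\boldsymbol\theta,\boldsymbol\Sigma}$ refer to this model. $B_0(s,d)=\{\boldsymbol\theta:\|\boldsymbol\theta\|_0\le s\}$. Assumption $(\varepsilon^*0)$: $\max_i\sigma_i^2\le1$. Assumption $(\varepsilon^*1)$: $\min_i\sigma_i^2\ge c_*$ for a constant $c_*>0$. Noise estimators: $\tilde Y_i=Y_i/\sigma_i$, $\tilde{\boldsymbol\Sigma}_{ij}=\boldsymbol\Sigma_{ij}/(\sigma_i\sigma_j)$; $\hat F_{Y^2}$ the empirical c.d.f. of $\tilde Y_1^2,\dots,\tilde Y_d^2$; $F$ the c.d.f. of $\chi^2_1$; $\hat\sigma_S^2(t)=t/F^{-1}(\hat F_{Y^2}(t))$ if $\hat F_{Y^2}(t)>0$, $+\infty$ otherwise; $\hat t=\min\{2^\ell:\ell\in\mathbb Z,\hat F_{Y^2}(2^\ell)\ge0.5\}$; $\hat\sigma_S^2=\hat\sigma_S^2(\hat t)$, $\hat\sigma_S=\sqrt{\hat\sigma_S^2}$; $\hat\varphi_d(u)=\frac1d\sum_i\cos(u\tilde Y_i)$; $\lambda=(1\vee\log(s/\|\tilde{\boldsymbol\Sigma}\|_F))/6$;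 $\tilde\sigma_D^2=-\frac{2\hat t}{\lambda}\log|\hat\varphi_d(\sqrt{\lambda/\hat t})|$; $\hat\sigma_D^2=\min\{\tilde\sigma_D^2,2\hat\sigma_S^2\}$. Norm estimator: $\tau=3\sqrt{\log(1+\|\boldsymbol\Sigma\|_F^2/s^2)}$, $\alpha_s=\mathbf E[Z^2\mathbb 1\{|Z|\ge\tau\}]$ with $Z\sim\mathcal N(0,1)$, \[ \hat Q^*=\begin{cases}\sum_{i=1}^dY_i^2\mathbb 1\{|Y_i|>\hat\sigma_S\sigma_i\tau\}-\hat\sigma_S^2\alpha_s\sum_{i=1}^d\sigma_i^2,& s\le\|\boldsymbol\Sigma\|_F,\\ \sum_{i=1}^d(Y_i^2-\hat\sigma_D^2\sigma_i^2),&\text{otherwise},\end{cases}\qquad\hat N^*=\sqrt{|\hat Q^*|}. \] Rate: $\psi^*(s,\boldsymbol\Sigma)=s\log(1+\|\boldsymbol\Sigma\|_F^2/s^2)$ if $s\le\|\boldsymbol\Sigma\|_F$ and $\psi^*(s,\boldsymbol\Sigma)=\frac{s}{1\vee\log(s/\|\boldsymbol\Sigma\|_F)}$ otherwise. *)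

theory Defs
  imports "HOL-Probability.Probability"
begin

(* Vectors in R^d are functions nat => real, only indices i < d matter.
   d x d matrices are functions nat => nat => real, only indices i,j < d matter. *)

definition std_gauss :: "real measure" where
  "std_gauss = density lborel std_normal_density"

(* Law of Y = theta + sigma * eps, eps = A z, z ~ N(0, I_d); then eps ~ N(0, A A^T). *)
definition obs_measure :: "nat \<Rightarrow> (nat \<Rightarrow> real) \<Rightarrow> real \<Rightarrow> (nat \<Rightarrow> nat \<Rightarrow> real)
    \<Rightarrow> (nat \<Rightarrow> real) measure" where
  "obs_measure d \<theta> \<sigma> A =
     distr (PiM {0..<d} (\<lambda>_. std_gauss)) (PiM {0..<d} (\<lambda>_. borel))
       (\<lambda>z. restrict (\<lambda>i. \<theta> i + \<sigma> * (\<Sum>k<d. A i k * z k)) {0..<d})"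

definition frob :: "nat \<Rightarrow> (nat \<Rightarrow> nat \<Rightarrow> real) \<Rightarrow> real" where
  "frob d S = sqrt (\<Sum>i<d. \<Sum>j<d. (S i j)\<^sup>2)"

definition l2norm :: "nat \<Rightarrow> (nat \<Rightarrow> real) \<Rightarrow> real" where
  "l2norm d x = sqrt (\<Sum>i<d. (x i)\<^sup>2)"

definition B0 :: "real \<Rightarrow> nat \<Rightarrow> (nat \<Rightarrow> real) set" where
  "B0 s d = {\<theta>. real (card {i\<in>{0..<d}. \<theta> i \<noteq> 0}) \<le> s}"

definition sd :: "(nat \<Rightarrow> nat \<Rightarrow> real) \<Rightarrow> nat \<Rightarrow> real" where
  "sd S i = sqrt (S i i)"

definition Ytil :: "(nat \<Rightarrow> nat \<Rightarrow> real) \<Rightarrow> (nat \<Rightarrow> real) \<Rightarrow> nat \<Rightarrow> real" where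
  "Ytil S Y i = Y i / sd S i"

definition Stil :: "(nat \<Rightarrow> nat \<Rightarrow> real) \<Rightarrow> nat \<Rightarrow> nat \<Rightarrow> real" where
  "Stil S i j = S i j / (sd S i * sd S j)"

definition Fhat :: "nat \<Rightarrow> (nat \<Rightarrow> nat \<Rightarrow> real) \<Rightarrow> (nat \<Rightarrow> real) \<Rightarrow> real \<Rightarrow> real" where
  "Fhat d S Y t = real (card {i\<in>{0..<d}. (Ytil S Y i)\<^sup>2 \<le> t}) / real d"

definition chi2_cdf :: "real \<Rightarrow> real" where
  "chi2_cdf x = measure std_gauss {z. z\<^sup>2 \<le> x}"

(* generalized inverse (quantile) of the chi^2_1 cdf, with value +infinity at p = 1 *)
definition chi2_quantile :: "real \<Rightarrow> ereal" where
  "chi2_quantile p = Inf {ereal x | x. 0 \<le> x \<and> p \<le> chi2_cdf x}"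

definition sigmaS2_fun :: "nat \<Rightarrow> (nat \<Rightarrow> nat \<Rightarrow> real) \<Rightarrow> (nat \<Rightarrow> real) \<Rightarrow> real \<Rightarrow> ereal" where
  "sigmaS2_fun d S Y t =
     (if Fhat d S Y t > 0 then ereal t / chi2_quantile (Fhat d S Y t) else \<infinity>)"

definition that :: "nat \<Rightarrow> (nat \<Rightarrow> nat \<Rightarrow> real) \<Rightarrow> (nat \<Rightarrow> real) \<Rightarrow> real" where
  "that d S Y = Inf {(2::real) powr (real_of_int l) | l. 1/2 \<le> Fhat d S Y (2 powr (real_of_int l))}"

definition sigmaS2 :: "nat \<Rightarrow> (nat \<Rightarrow> nat \<Rightarrow> real) \<Rightarrow> (nat \<Rightarrow> real) \<Rightarrow> real" where
  "sigmaS2 d S Y = real_of_ereal (sigmaS2_fun d S Y (that d S Y))"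

definition sigmaS :: "nat \<Rightarrow> (nat \<Rightarrow> nat \<Rightarrow> real) \<Rightarrow> (nat \<Rightarrow> real) \<Rightarrow> real" where
  "sigmaS d S Y = sqrt (sigmaS2 d S Y)"

definition phihat :: "nat \<Rightarrow> (nat \<Rightarrow> nat \<Rightarrow> real) \<Rightarrow> (nat \<Rightarrow> real) \<Rightarrow> real \<Rightarrow> real" where
  "phihat d S Y u = (\<Sum>i<d. cos (u * Ytil S Y i)) / real d"

definition lam :: "nat \<Rightarrow> real \<Rightarrow> (nat \<Rightarrow> nat \<Rightarrow> real) \<Rightarrow> real" where
  "lam d s S = max 1 (ln (s / frob d (Stil S))) / 6"

definition sigmaD2til :: "nat \<Rightarrow> real \<Rightarrow> (nat \<Rightarrow> nat \<Rightarrow> real) \<Rightarrow> (nat \<Rightarrow> real) \<Rightarrow> real" where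
  "sigmaD2til d s S Y =
     - (2 * that d S Y / lam d s S) *
       ln \<bar>phihat d S Y (sqrt (lam d s S / that d S Y))\<bar>"

definition sigmaD2 :: "nat \<Rightarrow> real \<Rightarrow> (nat \<Rightarrow> nat \<Rightarrow> real) \<Rightarrow> (nat \<Rightarrow> real) \<Rightarrow> real" where
  "sigmaD2 d s S Y = min (sigmaD2til d s S Y) (2 * sigmaS2 d S Y)"

definition tau :: "nat \<Rightarrow> real \<Rightarrow> (nat \<Rightarrow> nat \<Rightarrow> real) \<Rightarrow> real" where
  "tau d s S = 3 * sqrt (ln (1 + (frob d S)\<^sup>2 / s\<^sup>2))"

definition alpha_s :: "nat \<Rightarrow> real \<Rightarrow> (nat \<Rightarrow> nat \<Rightarrow> real) \<Rightarrow> real" where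
  "alpha_s d s S = (\<integral>z. z\<^sup>2 * indicator {z. tau d s S \<le> \<bar>z\<bar>} z \<partial>std_gauss)"

definition Qstar :: "nat \<Rightarrow> real \<Rightarrow> (nat \<Rightarrow> nat \<Rightarrow> real) \<Rightarrow> (nat \<Rightarrow> real) \<Rightarrow> real" where
  "Qstar d s S Y =
     (if s \<le> frob d S then
        (\<Sum>i<d. (Y i)\<^sup>2 * indicator {y. sigmaS d S Y * sd S i * tau d s S < \<bar>y\<bar>} (Y i))
        - sigmaS2 d S Y * alpha_s d s S * (\<Sum>i<d. (sd S i)\<^sup>2)
      else (\<Sum>i<d. (Y i)\<^sup>2 - sigmaD2 d s S Y * (sd S i)\<^sup>2))"

definition Nstar :: "nat \<Rightarrow> real \<Rightarrow> (nat \<Rightarrow> nat \<Rightarrow> real) \<Rightarrow> (nat \<Rightarrow> real) \<Rightarrow> real" where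
  "Nstar d s S Y = sqrt \<bar>Qstar d s S Y\<bar>"

definition psi_star :: "nat \<Rightarrow> real \<Rightarrow> (nat \<Rightarrow> nat \<Rightarrow> real) \<Rightarrow> real" where
  "psi_star d s S =
     (if s \<le> frob d S then s * ln (1 + (frob d S)\<^sup>2 / s\<^sup>2)
      else s / max 1 (ln (s / frob d S)))"

definition pos_def :: "nat \<Rightarrow> (nat \<Rightarrow> nat \<Rightarrow> real) \<Rightarrow> bool" where
  "pos_def d S \<longleftrightarrow> (\<forall>u. (\<exists>i<d. u i \<noteq> 0) \<longrightarrow> (\<Sum>i<d. \<Sum>j<d. u i * S i j * u j) > 0)"

definition mat_inv :: "nat \<Rightarrow> (nat \<Rightarrow> nat \<Rightarrow> real) \<Rightarrow> nat \<Rightarrow> nat \<Rightarrow> real" where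
  "mat_inv d S = (SOME B. \<forall>i<d. \<forall>j<d.
       (\<Sum>k<d. S i k * B k j) = (if i = j then 1 else 0) \<and>
       (\<Sum>k<d. B i k * S k j) = (if i = j then 1 else 0))"

definition is_eigenvalue :: "nat \<Rightarrow> (nat \<Rightarrow> nat \<Rightarrow> real) \<Rightarrow> real \<Rightarrow> bool" where
  "is_eigenvalue d M \<mu> \<longleftrightarrow>
     (\<exists>v. (\<exists>i<d. v i \<noteq> 0) \<and> (\<forall>i<d. (\<Sum>j<d. M i j * v j) = \<mu> * v i))"

definition lambda_max :: "nat \<Rightarrow> (nat \<Rightarrow> nat \<Rightarrow> real) \<Rightarrow> real" where
  "lambda_max d M = Max {\<mu>. is_eigenvalue d M \<mu>}"

end

theory Submission
  imports Defs "Jordan_Normal_Form.Spectral_Radius"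
begin

text \<open>
  All concentration statements come from one covariance bound. If \<open>X\<close>, \<open>Y\<close> are standard Gaussian
  with correlation \<open>\<rho>\<close>, then the covariance of \<open>g X\<close> and \<open>h Y\<close> is at most \<open>4 * \<bar>\<rho>\<bar>\<close> times the product
  of the \<open>L\<^sup>2\<close> norms, and at most \<open>4 * \<rho>\<^sup>2\<close> times it when \<open>h\<close> is even: the density of the pair
  relative to the product measure has explicit distance to one in \<open>L\<^sup>2\<close>, and for even functions
  it may be averaged over \<open>\<plusminus>\<rho>\<close>. Hence sums of even functions of the noise coordinates
  have variance of order \<open>K\<^sup>2\<close>, with \<open>K\<close> the Frobenius norm of the correlation matrix.

  The dyadic level \<open>that\<close> then takes one of five values up to an event of probability of order
  \<open>(K / d)\<^sup>2\<close>, and on the exceptional event its size is controlled by a geometric series. Off the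
  exceptional event \<open>sigmaS2\<close> has relative error of order \<open>s / d + K / d\<close>; the random threshold in
  the hard-thresholding regime is handled by peeling over dyadic sizes of this error. In the other
  regime the support biases the empirical characteristic function only multiplicatively, by
  \<open>1 + O(s / d)\<close>, so that taking logarithms and dividing by \<open>\<lambda>\<close> gives the rate.
\<close>


section \<open>Rotation invariance and the law of two linear forms\<close>

text \<open>Both regimes rest on one decomposition: \<open>Qstar\<close> is the squared norm of the
  signal plus \<open>2 * \<sigma> * lin\<close> plus \<open>\<sigma>\<^sup>2\<close> times a
  remainder. The linear term grows with the signal; dividing by the norm when passing to the square
  root turns it into \<open>linq\<close>, whose mean is bounded independently of the size of the
  signal. The constants in the estimators make the remainders fit the rate. The factor 3 in
  \<open>tau\<close> gives exp(-tau^2/18) = (1 + F^2/s^2)^(-1/2) <= s/F, so a fluctuation of order K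
  exp(-tau^2/18) is of order s. The divisor 6 in \<open>lam\<close> keeps the loss from dividing by
  the Gaussian characteristic function below the gain in variance. On the exceptional event errors
  are only known to be of order d; times a probability of order (K/d)^2 this leaves K^2/d. That is
  at most K, which suffices when s exceeds F; otherwise it is the second summand of the third claim,
  while in the second claim the event itself is charged to eta. Estimates come out in K, rates are
  stated in F; the two agree up to the factor c, and so the constants depend on the lower variance
  bound.\<close>

lemma prob_space_std_gauss [simp]: "prob_space std_gauss"
  unfolding std_gauss_def by (rule prob_space_normal_density) simp

lemma sets_std_gauss [simp, measurable_cong]: "sets std_gauss = sets borel"
  by (simp add: std_gauss_def)

lemma space_std_gauss [simp]: "space std_gauss = UNIV"
  by (simp add: std_gauss_def)

interpretation std_gauss: prob_space std_gauss
  by simp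

interpretation std_gauss2: pair_prob_space std_gauss std_gauss ..

interpretation std_gauss_prod: product_prob_space "\<lambda>_. std_gauss" UNIV
  by unfold_locales

lemma nn_integral_std_gauss:
  assumes "f \<in> borel_measurable borel"
  shows "(\<integral>\<^sup>+x. f x \<partial>std_gauss) = (\<integral>\<^sup>+x. ennreal (std_normal_density x) * f x \<partial>lborel)"
  unfolding std_gauss_def using assms by (subst nn_integral_density) auto

lemma std_normal_density_rotate:
  assumes "c\<^sup>2 + s\<^sup>2 = (1::real)"
  shows "std_normal_density (c * u + s * v) * std_normal_density (c * v - s * u)
       = std_normal_density u * std_normal_density v"
proof -
  have "(c * u + s * v)\<^sup>2 + (c * v - s * u)\<^sup>2 = (c\<^sup>2 + s\<^sup>2) * (u\<^sup>2 + v\<^sup>2)"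
    by (simp add: power2_eq_square algebra_simps)
  then have "- ((c * u + s * v)\<^sup>2) / 2 + - ((c * v - s * u)\<^sup>2) / 2 = - u\<^sup>2 / 2 + - v\<^sup>2 / 2"
    using assms by simp
  then show ?thesis
    unfolding std_normal_density_def
    by (simp add: exp_add[symmetric] field_simps)
qed

lemma nn_integral_std_gauss_pair:
  assumes [measurable]: "f \<in> borel_measurable (borel \<Otimes>\<^sub>M borel)"
  shows "(\<integral>\<^sup>+x. \<integral>\<^sup>+y. f (x, y) \<partial>std_gauss \<partial>std_gauss)
       = (\<integral>\<^sup>+x. \<integral>\<^sup>+y. ennreal (std_normal_density x * std_normal_density y) * f (x, y) \<partial>lborel \<partial>lborel)"
proof -
  have "(\<integral>\<^sup>+x. \<integral>\<^sup>+y. f (x, y) \<partial>std_gauss \<partial>std_gauss)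
      = (\<integral>\<^sup>+x. (\<integral>\<^sup>+y. ennreal (std_normal_density y) * f (x, y) \<partial>lborel) \<partial>std_gauss)"
    by (intro nn_integral_cong nn_integral_std_gauss) measurable
  also have "\<dots> = (\<integral>\<^sup>+x. ennreal (std_normal_density x) *
       (\<integral>\<^sup>+y. ennreal (std_normal_density y) * f (x, y) \<partial>lborel) \<partial>lborel)"
    by (intro nn_integral_std_gauss) measurable
  also have "\<dots> = (\<integral>\<^sup>+x. \<integral>\<^sup>+y. ennreal (std_normal_density x * std_normal_density y) * f (x, y) \<partial>lborel \<partial>lborel)"
    by (intro nn_integral_cong, subst nn_integral_cmult[symmetric])
       (auto simp: ennreal_mult mult.assoc)
  finally show ?thesis .
qed

text \<open>The rotation is factored into two affine substitutions in one variable each, so that the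
  one-dimensional change of variables and Fubini suffice; the Jacobians
  \<open>\<bar>1/c\<bar>\<close> and \<open>\<bar>c\<bar>\<close> cancel. The first substitution
  divides by \<open>c\<close>, hence the separate quarter turn \<open>c = 0\<close>.\<close>

lemma std_gauss_rotation:
  fixes f :: "real \<times> real \<Rightarrow> ennreal"
  assumes [measurable]: "f \<in> borel_measurable (borel \<Otimes>\<^sub>M borel)" and cs: "c\<^sup>2 + s\<^sup>2 = (1::real)"
  shows "(\<integral>\<^sup>+x. \<integral>\<^sup>+y. f (c * x - s * y, s * x + c * y) \<partial>std_gauss \<partial>std_gauss)
       = (\<integral>\<^sup>+x. \<integral>\<^sup>+y. f (x, y) \<partial>std_gauss \<partial>std_gauss)"
proof -
  define h where "h x y = ennreal (std_normal_density x * std_normal_density y) * f (c * x - s * y, s * x + c * y)" for x y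
  have [measurable]: "case_prod h \<in> borel_measurable (borel \<Otimes>\<^sub>M borel)"
    unfolding h_def by measurable
  have L: "(\<integral>\<^sup>+x. \<integral>\<^sup>+y. f (c * x - s * y, s * x + c * y) \<partial>std_gauss \<partial>std_gauss)
    = (\<integral>\<^sup>+x. \<integral>\<^sup>+y. h x y \<partial>lborel \<partial>lborel)"
    using nn_integral_std_gauss_pair[of "\<lambda>(x,y). f (c * x - s * y, s * x + c * y)"] by (simp add: h_def)
  have R: "(\<integral>\<^sup>+x. \<integral>\<^sup>+y. f (x, y) \<partial>std_gauss \<partial>std_gauss) =
    (\<integral>\<^sup>+x. \<integral>\<^sup>+y. ennreal (std_normal_density x * std_normal_density y) * f (x, y) \<partial>lborel \<partial>lborel)"
    by (rule nn_integral_std_gauss_pair) simp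
  have H: "h (c * u + s * v) (c * v - s * u)
      = ennreal (std_normal_density u * std_normal_density v) * f (u, v)" for u v
  proof -
    have "c * (c * u + s * v) - s * (c * v - s * u) = (c\<^sup>2 + s\<^sup>2) * u"
      "s * (c * u + s * v) + c * (c * v - s * u) = (c\<^sup>2 + s\<^sup>2) * v"
      by (simp_all add: power2_eq_square algebra_simps)
    then show ?thesis using cs by (simp add: h_def std_normal_density_rotate)
  qed
  have "(\<integral>\<^sup>+x. \<integral>\<^sup>+y. h x y \<partial>lborel \<partial>lborel) =
    (\<integral>\<^sup>+x. \<integral>\<^sup>+y. ennreal (std_normal_density x * std_normal_density y) * f (x, y) \<partial>lborel \<partial>lborel)"
  proof (cases "c = 0")
    case False
    \<comment> \<open>The coordinate u = c x - s y is introduced at fixed y, then v = s x + c y at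
      fixed u.\<close>
    have "(\<integral>\<^sup>+x. \<integral>\<^sup>+y. h x y \<partial>lborel \<partial>lborel) = (\<integral>\<^sup>+y. \<integral>\<^sup>+x. h x y \<partial>lborel \<partial>lborel)"
      by (rule lborel_pair.Fubini'[symmetric]) simp
    also have "\<dots> = (\<integral>\<^sup>+y. \<integral>\<^sup>+u. \<bar>1/c\<bar> * h (s * y / c + 1/c * u) y \<partial>lborel \<partial>lborel)"
    proof (rule nn_integral_cong)
      fix y :: real
      show "(\<integral>\<^sup>+x. h x y \<partial>lborel) = (\<integral>\<^sup>+u. \<bar>1/c\<bar> * h (s * y / c + 1/c * u) y \<partial>lborel)"
        using False nn_integral_real_affine[where c="1/c" and t="s * y / c" and f="\<lambda>x. h x y"]
        by (simp add: nn_integral_cmult)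
    qed
    also have "\<dots> = (\<integral>\<^sup>+u. \<integral>\<^sup>+y. \<bar>1/c\<bar> * h (s * y / c + 1/c * u) y \<partial>lborel \<partial>lborel)"
      by (rule lborel_pair.Fubini') measurable
    also have "\<dots> = (\<integral>\<^sup>+u. \<integral>\<^sup>+v. \<bar>c\<bar> * (\<bar>1/c\<bar> * h (s * (- s * u + c * v) / c + 1/c * u) (- s * u + c * v)) \<partial>lborel \<partial>lborel)"
    proof (rule nn_integral_cong)
      fix u :: real
      show "(\<integral>\<^sup>+y. \<bar>1/c\<bar> * h (s * y / c + 1/c * u) y \<partial>lborel) =
        (\<integral>\<^sup>+v. \<bar>c\<bar> * (\<bar>1/c\<bar> * h (s * (- s * u + c * v) / c + 1/c * u) (- s * u + c * v)) \<partial>lborel)"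
        using False
        by (subst nn_integral_real_affine[where c=c and t="- s * u"]) (simp_all add: nn_integral_cmult)
    qed
    also have "\<dots> = (\<integral>\<^sup>+u. \<integral>\<^sup>+v. ennreal (std_normal_density u * std_normal_density v) * f (u, v) \<partial>lborel \<partial>lborel)"
    proof (intro nn_integral_cong)
      fix u v :: real
      have "s * (- s * u + c * v) / c + 1/c * u = ((c\<^sup>2 + s\<^sup>2) * u - s\<^sup>2 * u + s * c * v) / c"
        using cs False by (simp add: field_simps power2_eq_square)
      also have "\<dots> = c * u + s * v" using False by (simp add: field_simps power2_eq_square)
      finally have e: "s * (- s * u + c * v) / c + 1/c * u = c * u + s * v" .
      have e2: "- s * u + c * v = c * v - s * u" by simp
      have "ennreal \<bar>c\<bar> * (ennreal \<bar>1/c\<bar> * X) = X" for X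
        using False by (simp add: mult.assoc[symmetric] ennreal_mult[symmetric] abs_mult[symmetric])
      then show "ennreal \<bar>c\<bar> * (ennreal \<bar>1/c\<bar> * h (s * (- s * u + c * v) / c + 1/c * u) (- s * u + c * v))
         = ennreal (std_normal_density u * std_normal_density v) * f (u, v)"
        unfolding e unfolding e2 H by simp
    qed
    finally show ?thesis .
  next
    case True
    then have s: "s\<^sup>2 = 1" "s \<noteq> 0" "\<bar>s\<bar> = 1" using cs by (auto simp: power2_eq_1_iff)
    have "(\<integral>\<^sup>+x. \<integral>\<^sup>+y. h x y \<partial>lborel \<partial>lborel) = (\<integral>\<^sup>+v. \<integral>\<^sup>+y. h (s * v) y \<partial>lborel \<partial>lborel)"
      using s by (subst nn_integral_real_affine[where c=s and t=0]) auto
    also have "\<dots> = (\<integral>\<^sup>+v. \<integral>\<^sup>+u. h (s * v) (- s * u) \<partial>lborel \<partial>lborel)"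
    proof (rule nn_integral_cong)
      fix v :: real
      show "(\<integral>\<^sup>+y. h (s * v) y \<partial>lborel) = (\<integral>\<^sup>+u. h (s * v) (- s * u) \<partial>lborel)"
        using s nn_integral_real_affine[where c="- s" and t=0 and f="\<lambda>y. h (s * v) y"] by simp
    qed
    also have "\<dots> = (\<integral>\<^sup>+u. \<integral>\<^sup>+v. h (s * v) (- s * u) \<partial>lborel \<partial>lborel)"
      by (rule lborel_pair.Fubini') measurable
    also have "\<dots> = (\<integral>\<^sup>+u. \<integral>\<^sup>+v. ennreal (std_normal_density u * std_normal_density v) * f (u, v) \<partial>lborel \<partial>lborel)"
      using H True by simp
    finally show ?thesis .
  qed
  then show ?thesis using L R by simp
qed

text \<open>The triple p, q, r is a Cholesky factor of the Gram matrix of \<open>a\<close> and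
  \<open>b\<close>. In the induction step the new coordinate is absorbed by two rotations: the
  first, with the \<open>x\<close> axis, removes it from the first form; the second, with the
  \<open>w\<close> axis, merges what is left of it in the second form into the residual.\<close>

lemma std_gauss_linear_pair:
  fixes a b :: "'i \<Rightarrow> real"
  assumes "finite I"
  shows "\<exists>p q r. 0 \<le> p \<and> p\<^sup>2 = (\<Sum>k\<in>I. (a k)\<^sup>2) \<and> p * q = (\<Sum>k\<in>I. a k * b k) \<and> q\<^sup>2 + r\<^sup>2 = (\<Sum>k\<in>I. (b k)\<^sup>2) \<and>
    (\<forall>f \<in> borel_measurable (borel \<Otimes>\<^sub>M borel).
      (\<integral>\<^sup>+z. f (\<Sum>k\<in>I. a k * z k, \<Sum>k\<in>I. b k * z k) \<partial>PiM I (\<lambda>_. std_gauss))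
       = (\<integral>\<^sup>+x. \<integral>\<^sup>+w. f (p * x, q * x + r * w) \<partial>std_gauss \<partial>std_gauss :: ennreal))"
  using assms
proof (induction I rule: finite_induct)
  case empty
  show ?case
    by (rule exI[of _ 0], rule exI[of _ 0], rule exI[of _ 0])
       (auto simp: prob_space.emeasure_space_1[OF prob_space_PiM] std_gauss.emeasure_space_1[simplified])
next
  case (insert i I)
  from insert.IH obtain p q r where pqr: "0 \<le> p" "p\<^sup>2 = (\<Sum>k\<in>I. (a k)\<^sup>2)" "p * q = (\<Sum>k\<in>I. a k * b k)"
    "q\<^sup>2 + r\<^sup>2 = (\<Sum>k\<in>I. (b k)\<^sup>2)" and
    IH: "\<And>f. f \<in> borel_measurable (borel \<Otimes>\<^sub>M borel) \<Longrightarrow>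
      (\<integral>\<^sup>+z. f (\<Sum>k\<in>I. a k * z k, \<Sum>k\<in>I. b k * z k) \<partial>PiM I (\<lambda>_. std_gauss))
       = (\<integral>\<^sup>+x. \<integral>\<^sup>+w. f (p * x, q * x + r * w) \<partial>std_gauss \<partial>std_gauss :: ennreal)"
    by auto
  define \<alpha> \<beta> where "\<alpha> = a i" and "\<beta> = b i"
  define p' where "p' = sqrt (p\<^sup>2 + \<alpha>\<^sup>2)"
  have p'2: "p'\<^sup>2 = p\<^sup>2 + \<alpha>\<^sup>2" by (simp add: p'_def)
  \<comment> \<open>The angle that turns the coefficient vector \<open>(p, \<alpha>)\<close> of the
    first form onto the first axis; if the vector vanishes, the identity is taken.\<close>
  obtain c s where cs: "c\<^sup>2 + s\<^sup>2 = 1" "p = p' * c" "\<alpha> = p' * s"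
  proof (cases "p' = 0")
    case True
    then have "p = 0" "\<alpha> = 0" using p'2 by (auto simp: sum_power2_eq_zero_iff)
    then show ?thesis using that[of 1 0] True by simp
  next
    case False
    have "(p/p')\<^sup>2 + (\<alpha>/p')\<^sup>2 = (p\<^sup>2 + \<alpha>\<^sup>2) / p'\<^sup>2"
      by (simp add: power_divide add_divide_distrib)
    also have "\<dots> = 1" using False unfolding p'2[symmetric] by simp
    finally have "(p/p')\<^sup>2 + (\<alpha>/p')\<^sup>2 = 1" .
    then show ?thesis using that[of "p/p'" "\<alpha>/p'"] False by simp
  qed
  \<comment> \<open>Coefficients of the second form along the rotated axes: \<open>q'\<close> along
    the axis carrying the first form, \<open>r1\<close> along the one orthogonal to it.\<close>
  define q' r1 where "q' = q * c + \<beta> * s" and "r1 = \<beta> * c - q * s"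
  define r' where "r' = sqrt (r\<^sup>2 + r1\<^sup>2)"
  have r'2: "r'\<^sup>2 = r\<^sup>2 + r1\<^sup>2" by (simp add: r'_def)
  obtain c2 s2 where cs2: "c2\<^sup>2 + s2\<^sup>2 = 1" "r = r' * c2" "r1 = r' * s2"
  proof (cases "r' = 0")
    case True
    then have "r = 0" "r1 = 0" using r'2 by (auto simp: sum_power2_eq_zero_iff)
    then show ?thesis using that[of 1 0] True by simp
  next
    case False
    have "(r/r')\<^sup>2 + (r1/r')\<^sup>2 = (r\<^sup>2 + r1\<^sup>2) / r'\<^sup>2"
      by (simp add: power_divide add_divide_distrib)
    also have "\<dots> = 1" using False unfolding r'2[symmetric] by simp
    finally have "(r/r')\<^sup>2 + (r1/r')\<^sup>2 = 1" .
    then show ?thesis using that[of "r/r'" "r1/r'"] False by simp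
  qed
  have main: "(\<integral>\<^sup>+z. f (\<Sum>k\<in>insert i I. a k * z k, \<Sum>k\<in>insert i I. b k * z k) \<partial>PiM (insert i I) (\<lambda>_. std_gauss))
       = (\<integral>\<^sup>+x. \<integral>\<^sup>+w. f (p' * x, q' * x + r' * w) \<partial>std_gauss \<partial>std_gauss)"
    if [measurable]: "f \<in> borel_measurable (borel \<Otimes>\<^sub>M borel)" for f :: "real \<times> real \<Rightarrow> ennreal"
  proof -
    have "(\<integral>\<^sup>+z. f (\<Sum>k\<in>insert i I. a k * z k, \<Sum>k\<in>insert i I. b k * z k) \<partial>PiM (insert i I) (\<lambda>_. std_gauss))
      = (\<integral>\<^sup>+z. \<integral>\<^sup>+y. f (\<Sum>k\<in>insert i I. a k * (z(i := y)) k, \<Sum>k\<in>insert i I. b k * (z(i := y)) k) \<partial>std_gauss \<partial>PiM I (\<lambda>_. std_gauss))"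
      using insert.hyps by (intro std_gauss_prod.product_nn_integral_insert) measurable
    also have "\<dots> = (\<integral>\<^sup>+z. \<integral>\<^sup>+y. f (\<alpha> * y + (\<Sum>k\<in>I. a k * z k), \<beta> * y + (\<Sum>k\<in>I. b k * z k)) \<partial>std_gauss \<partial>PiM I (\<lambda>_. std_gauss))"
    proof -
      have "(\<Sum>k\<in>insert i I. e k * (z(i := y)) k) = e i * y + (\<Sum>k\<in>I. e k * z k)" for e z and y :: real
      proof -
        have "(\<Sum>k\<in>I. e k * (z(i := y)) k) = (\<Sum>k\<in>I. e k * z k)"
          using insert.hyps by (intro sum.cong) auto
        then show ?thesis using insert.hyps by simp
      qed
      then show ?thesis by (simp add: \<alpha>_def \<beta>_def)
    qed
    also have "\<dots> = (\<integral>\<^sup>+x. \<integral>\<^sup>+w. \<integral>\<^sup>+y. f (\<alpha> * y + p * x, \<beta> * y + (q * x + r * w)) \<partial>std_gauss \<partial>std_gauss \<partial>std_gauss)"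
      by (subst IH[where f="\<lambda>(u,v). \<integral>\<^sup>+y. f (\<alpha> * y + u, \<beta> * y + v) \<partial>std_gauss", simplified]) simp_all
    also have "\<dots> = (\<integral>\<^sup>+w. \<integral>\<^sup>+x. \<integral>\<^sup>+y. f (\<alpha> * y + p * x, \<beta> * y + (q * x + r * w)) \<partial>std_gauss \<partial>std_gauss \<partial>std_gauss)"
      by (rule std_gauss2.Fubini'[symmetric]) measurable
    also have "\<dots> = (\<integral>\<^sup>+w. \<integral>\<^sup>+x. \<integral>\<^sup>+y. f (p' * x, (q' * x + r * w) + r1 * y) \<partial>std_gauss \<partial>std_gauss \<partial>std_gauss)"
    proof (rule nn_integral_cong)
      fix w :: real
      have "(\<integral>\<^sup>+x. \<integral>\<^sup>+y. f (p' * x, (q' * x + r * w) + r1 * y) \<partial>std_gauss \<partial>std_gauss) =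
        (\<integral>\<^sup>+x. \<integral>\<^sup>+y. f (p' * (c * x - (- s) * y), (q' * (c * x - (- s) * y) + r * w) + r1 * ((- s) * x + c * y)) \<partial>std_gauss \<partial>std_gauss)"
        using cs(1)
          std_gauss_rotation[where f="\<lambda>(x,y). f (p' * x, (q' * x + r * w) + r1 * y)" and c=c and s="- s"]
        by simp
      also have "\<dots> = (\<integral>\<^sup>+x. \<integral>\<^sup>+y. f (\<alpha> * y + p * x, \<beta> * y + (q * x + r * w)) \<partial>std_gauss \<partial>std_gauss)"
      proof (intro nn_integral_cong)
        fix x y :: real
        have "q' * (c * x - (- s) * y) + r1 * ((- s) * x + c * y) = (c\<^sup>2 + s\<^sup>2) * (q * x + \<beta> * y)"
          by (simp add: q'_def r1_def power2_eq_square algebra_simps)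
        then have e2: "(q' * (c * x - (- s) * y) + r * w) + r1 * ((- s) * x + c * y) = \<beta> * y + (q * x + r * w)"
          using cs(1) by simp
        have e1: "p' * (c * x - (- s) * y) = \<alpha> * y + p * x"
          by (simp add: cs algebra_simps)
        show "f (p' * (c * x - (- s) * y), (q' * (c * x - (- s) * y) + r * w) + r1 * ((- s) * x + c * y))
           = f (\<alpha> * y + p * x, \<beta> * y + (q * x + r * w))"
          unfolding e1 e2 ..
      qed
      finally show "(\<integral>\<^sup>+x. \<integral>\<^sup>+y. f (\<alpha> * y + p * x, \<beta> * y + (q * x + r * w)) \<partial>std_gauss \<partial>std_gauss)
        = (\<integral>\<^sup>+x. \<integral>\<^sup>+y. f (p' * x, (q' * x + r * w) + r1 * y) \<partial>std_gauss \<partial>std_gauss)" by simp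
    qed
    also have "\<dots> = (\<integral>\<^sup>+x. \<integral>\<^sup>+w. \<integral>\<^sup>+y. f (p' * x, (q' * x + r * w) + r1 * y) \<partial>std_gauss \<partial>std_gauss \<partial>std_gauss)"
      by (rule std_gauss2.Fubini') measurable
    also have "\<dots> = (\<integral>\<^sup>+x. \<integral>\<^sup>+w. \<integral>\<^sup>+y. f (p' * x, q' * x + r' * w) \<partial>std_gauss \<partial>std_gauss \<partial>std_gauss)"
    proof (rule nn_integral_cong)
      fix x :: real
      have "(\<integral>\<^sup>+w. \<integral>\<^sup>+y. f (p' * x, q' * x + r' * w) \<partial>std_gauss \<partial>std_gauss) =
        (\<integral>\<^sup>+w. \<integral>\<^sup>+y. f (p' * x, q' * x + r' * (c2 * w - (- s2) * y)) \<partial>std_gauss \<partial>std_gauss)"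
        using cs2(1)
          std_gauss_rotation[where f="\<lambda>(w,y). f (p' * x, q' * x + r' * w)" and c=c2 and s="- s2"]
        by simp
      also have "\<dots> = (\<integral>\<^sup>+w. \<integral>\<^sup>+y. f (p' * x, (q' * x + r * w) + r1 * y) \<partial>std_gauss \<partial>std_gauss)"
        by (intro nn_integral_cong arg_cong[where f=f]) (simp add: cs2 algebra_simps)
      finally show "(\<integral>\<^sup>+w. \<integral>\<^sup>+y. f (p' * x, (q' * x + r * w) + r1 * y) \<partial>std_gauss \<partial>std_gauss) =
        (\<integral>\<^sup>+w. \<integral>\<^sup>+y. f (p' * x, q' * x + r' * w) \<partial>std_gauss \<partial>std_gauss)" by simp
    qed
    also have "\<dots> = (\<integral>\<^sup>+x. \<integral>\<^sup>+w. f (p' * x, q' * x + r' * w) \<partial>std_gauss \<partial>std_gauss)"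
      by (simp add: std_gauss.emeasure_space_1[simplified])
    finally show ?thesis .
  qed
  show ?case
  proof (intro exI conjI ballI)
    show "0 \<le> p'" by (simp add: p'_def)
    show "p'\<^sup>2 = (\<Sum>k\<in>insert i I. (a k)\<^sup>2)" using insert.hyps pqr by (simp add: p'2 \<alpha>_def)
    have "p' * q' = p * q + \<alpha> * \<beta>" by (simp add: q'_def cs algebra_simps)
    then show "p' * q' = (\<Sum>k\<in>insert i I. a k * b k)" using insert.hyps pqr by (simp add: \<alpha>_def \<beta>_def)
    have "q'\<^sup>2 + r1\<^sup>2 = (c\<^sup>2 + s\<^sup>2) * (q\<^sup>2 + \<beta>\<^sup>2)" by (simp add: q'_def r1_def power2_eq_square algebra_simps)
    then show "q'\<^sup>2 + r'\<^sup>2 = (\<Sum>k\<in>insert i I. (b k)\<^sup>2)"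
      using insert.hyps pqr cs by (simp add: r'2 \<beta>_def)
  qed (use main in auto)
qed


section \<open>Covariances of functions of a Gaussian pair\<close>

lemma integrable_mult_of_squares:
  fixes u v :: "'a \<Rightarrow> real"
  assumes [measurable]: "u \<in> borel_measurable M" "v \<in> borel_measurable M"
    and "integrable M (\<lambda>x. (u x)\<^sup>2)" "integrable M (\<lambda>x. (v x)\<^sup>2)"
  shows "integrable M (\<lambda>x. u x * v x)"
proof (rule Bochner_Integration.integrable_bound)
  show "integrable M (\<lambda>x. (u x)\<^sup>2 + (v x)\<^sup>2)" using assms by simp
  have "\<bar>u x * v x\<bar> \<le> (u x)\<^sup>2 + (v x)\<^sup>2" for x
  proof -
    have "0 \<le> (\<bar>u x\<bar> - \<bar>v x\<bar>)\<^sup>2" by simp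
    then have "2 * \<bar>u x * v x\<bar> \<le> (u x)\<^sup>2 + (v x)\<^sup>2"
      by (simp add: power2_diff abs_mult)
    then show ?thesis using abs_ge_zero[of "u x * v x"] by linarith
  qed
  then show "AE x in M. norm (u x * v x) \<le> norm ((u x)\<^sup>2 + (v x)\<^sup>2)" by simp
qed simp

lemma integral_Cauchy_Schwarz:
  fixes u v :: "'a \<Rightarrow> real"
  assumes [measurable]: "u \<in> borel_measurable M" "v \<in> borel_measurable M"
    and iu: "integrable M (\<lambda>x. (u x)\<^sup>2)" and iv: "integrable M (\<lambda>x. (v x)\<^sup>2)"
  shows "\<bar>\<integral>x. u x * v x \<partial>M\<bar> \<le> sqrt (\<integral>x. (u x)\<^sup>2 \<partial>M) * sqrt (\<integral>x. (v x)\<^sup>2 \<partial>M)"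
proof -
  have iuv: "integrable M (\<lambda>x. u x * v x)"
    by (rule integrable_mult_of_squares) (use assms in auto)
  define I where "I = (\<integral>x. \<bar>u x * v x\<bar> \<partial>M)"
  have I0: "0 \<le> I" by (simp add: I_def)
  have "(\<integral>\<^sup>+x. ennreal \<bar>u x\<bar> * ennreal \<bar>v x\<bar> \<partial>M) = ennreal I"
    unfolding I_def
    by (subst nn_integral_eq_integral[symmetric]) (use integrable_abs[OF iuv] in \<open>auto simp: ennreal_mult[symmetric] abs_mult\<close>)
  moreover have "(\<integral>\<^sup>+x. ennreal \<bar>u x\<bar> ^ 2 \<partial>M) = ennreal (\<integral>x. (u x)\<^sup>2 \<partial>M)"
    by (subst nn_integral_eq_integral[symmetric]) (use iu in \<open>auto simp: ennreal_power\<close>)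
  moreover have "(\<integral>\<^sup>+x. ennreal \<bar>v x\<bar> ^ 2 \<partial>M) = ennreal (\<integral>x. (v x)\<^sup>2 \<partial>M)"
    by (subst nn_integral_eq_integral[symmetric]) (use iv in \<open>auto simp: ennreal_power\<close>)
  ultimately have "(ennreal I)\<^sup>2 \<le> ennreal (\<integral>x. (u x)\<^sup>2 \<partial>M) * ennreal (\<integral>x. (v x)\<^sup>2 \<partial>M)"
    using Cauchy_Schwarz_nn_integral[of "\<lambda>x. ennreal \<bar>u x\<bar>" M "\<lambda>x. ennreal \<bar>v x\<bar>"] by simp
  then have "I\<^sup>2 \<le> (\<integral>x. (u x)\<^sup>2 \<partial>M) * (\<integral>x. (v x)\<^sup>2 \<partial>M)"
    using I0 by (simp add: ennreal_power ennreal_mult[symmetric])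
  then have "I \<le> sqrt (\<integral>x. (u x)\<^sup>2 \<partial>M) * sqrt (\<integral>x. (v x)\<^sup>2 \<partial>M)"
    by (metis real_le_rsqrt real_sqrt_mult)
  then show ?thesis using integral_abs_bound[of M "\<lambda>x. u x * v x"] unfolding I_def by linarith
qed

text \<open>Density, with respect to the standard Gaussian product measure, of a centred Gaussian pair
  with unit variances and correlation \<open>\<rho>\<close>.\<close>

definition gauss_kernel :: "real \<Rightarrow> real \<times> real \<Rightarrow> real" where
  "gauss_kernel \<rho> = (\<lambda>(x, y). exp ((2 * \<rho> * x * y - \<rho>\<^sup>2 * x\<^sup>2 - \<rho>\<^sup>2 * y\<^sup>2) / (2 * (1 - \<rho>\<^sup>2))) / sqrt (1 - \<rho>\<^sup>2))"

lemma gauss_kernel_measurable [measurable]: "gauss_kernel \<rho> \<in> borel_measurable (borel \<Otimes>\<^sub>M borel)"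
  unfolding gauss_kernel_def by measurable

lemma gauss_kernel_nonneg: "\<rho>\<^sup>2 < 1 \<Longrightarrow> 0 \<le> gauss_kernel \<rho> p"
  by (auto simp: gauss_kernel_def split: prod.split)

text \<open>Completing the square: given \<open>x\<close>, the variable y = rho x + r w has density
  \<open>std_normal_density w / \<bar>r\<bar>\<close>, and the kernel is the quotient of this by the
  standard normal density of y.\<close>

lemma gauss_kernel_subst:
  assumes r: "\<rho>\<^sup>2 + r\<^sup>2 = 1" "r \<noteq> 0"
  shows "\<bar>r\<bar> * (std_normal_density (\<rho> * x + r * w) * gauss_kernel \<rho> (x, \<rho> * x + r * w)) = std_normal_density w"
proof -
  have r2: "1 - \<rho>\<^sup>2 = r\<^sup>2" using r by simp
  define y where "y = \<rho> * x + r * w"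
  have "(2 * \<rho> * x * y - \<rho>\<^sup>2 * x\<^sup>2 - \<rho>\<^sup>2 * y\<^sup>2) / (2 * r\<^sup>2) + - y\<^sup>2 / 2
     = (2 * \<rho> * x * y - \<rho>\<^sup>2 * x\<^sup>2 - (\<rho>\<^sup>2 + r\<^sup>2) * y\<^sup>2) / (2 * r\<^sup>2)"
    using r(2) by (simp add: field_simps)
  also have "\<dots> = - (r * w)\<^sup>2 / (2 * r\<^sup>2)"
    unfolding r(1) by (rule arg_cong2[where f="(/)"]) (simp_all add: y_def power2_eq_square algebra_simps)
  also have "\<dots> = - w\<^sup>2 / 2" using r(2) by (simp add: power_mult_distrib)
  finally have e: "(2 * \<rho> * x * y - \<rho>\<^sup>2 * x\<^sup>2 - \<rho>\<^sup>2 * y\<^sup>2) / (2 * r\<^sup>2) + - y\<^sup>2 / 2 = - w\<^sup>2 / 2" .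
  have "\<bar>r\<bar> * (std_normal_density y * gauss_kernel \<rho> (x, y)) =
    1 / sqrt (2 * pi) * exp ((2 * \<rho> * x * y - \<rho>\<^sup>2 * x\<^sup>2 - \<rho>\<^sup>2 * y\<^sup>2) / (2 * r\<^sup>2) + - y\<^sup>2 / 2)"
    unfolding exp_add using r(2) by (simp add: gauss_kernel_def std_normal_density_def r2)
  then show ?thesis unfolding e by (simp add: y_def std_normal_density_def)
qed

lemma nn_integral_std_gauss_corr:
  fixes f :: "real \<times> real \<Rightarrow> ennreal"
  assumes [measurable]: "f \<in> borel_measurable (borel \<Otimes>\<^sub>M borel)"
    and r: "\<rho>\<^sup>2 + r\<^sup>2 = 1" "r \<noteq> 0"
  shows "(\<integral>\<^sup>+x. \<integral>\<^sup>+w. f (x, \<rho> * x + r * w) \<partial>std_gauss \<partial>std_gauss)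
       = (\<integral>\<^sup>+p. ennreal (gauss_kernel \<rho> p) * f p \<partial>(std_gauss \<Otimes>\<^sub>M std_gauss))"
proof -
  have rho: "\<rho>\<^sup>2 < 1"
  proof -
    have "r\<^sup>2 > 0" using r by simp
    then show ?thesis using r by linarith
  qed
  have "(\<integral>\<^sup>+w. f (x, \<rho> * x + r * w) \<partial>std_gauss) = (\<integral>\<^sup>+y. ennreal (gauss_kernel \<rho> (x, y)) * f (x, y) \<partial>std_gauss)" for x
  proof -
    have "(\<integral>\<^sup>+y. ennreal (gauss_kernel \<rho> (x, y)) * f (x, y) \<partial>std_gauss)
      = (\<integral>\<^sup>+y. ennreal (std_normal_density y) * (ennreal (gauss_kernel \<rho> (x, y)) * f (x, y)) \<partial>lborel)"
      by (rule nn_integral_std_gauss) measurable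
    also have "\<dots> = ennreal \<bar>r\<bar> * (\<integral>\<^sup>+w. ennreal (std_normal_density (\<rho> * x + r * w)) *
        (ennreal (gauss_kernel \<rho> (x, \<rho> * x + r * w)) * f (x, \<rho> * x + r * w)) \<partial>lborel)"
      using r by (intro nn_integral_real_affine) auto
    also have "\<dots> = (\<integral>\<^sup>+w. ennreal \<bar>r\<bar> * (ennreal (std_normal_density (\<rho> * x + r * w)) *
        (ennreal (gauss_kernel \<rho> (x, \<rho> * x + r * w)) * f (x, \<rho> * x + r * w))) \<partial>lborel)"
      by (intro nn_integral_cmult[symmetric]) measurable
    also have "\<dots> = (\<integral>\<^sup>+w. ennreal (std_normal_density w) * f (x, \<rho> * x + r * w) \<partial>lborel)"
    proof (rule nn_integral_cong)
      fix w
      have "ennreal \<bar>r\<bar> * (ennreal (std_normal_density (\<rho> * x + r * w)) *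
        (ennreal (gauss_kernel \<rho> (x, \<rho> * x + r * w)) * f (x, \<rho> * x + r * w))) =
        ennreal (\<bar>r\<bar> * (std_normal_density (\<rho> * x + r * w) * gauss_kernel \<rho> (x, \<rho> * x + r * w))) * f (x, \<rho> * x + r * w)"
        using gauss_kernel_nonneg[OF rho] by (simp add: ennreal_mult mult.assoc)
      then show "ennreal \<bar>r\<bar> * (ennreal (std_normal_density (\<rho> * x + r * w)) *
        (ennreal (gauss_kernel \<rho> (x, \<rho> * x + r * w)) * f (x, \<rho> * x + r * w))) = ennreal (std_normal_density w) * f (x, \<rho> * x + r * w)"
        by (simp add: gauss_kernel_subst[OF r])
    qed
    also have "\<dots> = (\<integral>\<^sup>+w. f (x, \<rho> * x + r * w) \<partial>std_gauss)"
      by (rule nn_integral_std_gauss[symmetric]) measurable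
    finally show ?thesis by simp
  qed
  then show ?thesis
    using std_gauss.nn_integral_fst[of "\<lambda>p. ennreal (gauss_kernel \<rho> p) * f p" std_gauss] by simp
qed

lemma distr_std_gauss_corr:
  assumes r: "\<rho>\<^sup>2 + r\<^sup>2 = 1" "r \<noteq> 0"
  shows "distr (std_gauss \<Otimes>\<^sub>M std_gauss) (borel \<Otimes>\<^sub>M borel) (\<lambda>(x, w). (x, \<rho> * x + r * w))
       = density (std_gauss \<Otimes>\<^sub>M std_gauss) (gauss_kernel \<rho>)"
proof (rule measure_eqI)
  show "sets (distr (std_gauss \<Otimes>\<^sub>M std_gauss) (borel \<Otimes>\<^sub>M borel) (\<lambda>(x, w). (x, \<rho> * x + r * w)))
    = sets (density (std_gauss \<Otimes>\<^sub>M std_gauss) (gauss_kernel \<rho>))"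
    by (simp cong: sets_pair_measure_cong)
next
  fix A assume "A \<in> sets (distr (std_gauss \<Otimes>\<^sub>M std_gauss) (borel \<Otimes>\<^sub>M borel) (\<lambda>(x, w). (x, \<rho> * x + r * w)))"
  then have A [measurable]: "A \<in> sets (borel \<Otimes>\<^sub>M borel)" by simp
  have A' [measurable]: "A \<in> sets (std_gauss \<Otimes>\<^sub>M std_gauss)" using A by (simp cong: sets_pair_measure_cong)
  have "emeasure (distr (std_gauss \<Otimes>\<^sub>M std_gauss) (borel \<Otimes>\<^sub>M borel) (\<lambda>(x, w). (x, \<rho> * x + r * w))) A
    = (\<integral>\<^sup>+p. indicator A p \<partial>distr (std_gauss \<Otimes>\<^sub>M std_gauss) (borel \<Otimes>\<^sub>M borel) (\<lambda>(x, w). (x, \<rho> * x + r * w)))"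
    by simp
  also have "\<dots> = (\<integral>\<^sup>+p. indicator A (case p of (x, w) \<Rightarrow> (x, \<rho> * x + r * w)) \<partial>(std_gauss \<Otimes>\<^sub>M std_gauss))"
    by (rule nn_integral_distr) measurable
  also have "\<dots> = (\<integral>\<^sup>+x. \<integral>\<^sup>+w. indicator A (x, \<rho> * x + r * w) \<partial>std_gauss \<partial>std_gauss)"
    by (subst std_gauss.nn_integral_fst[symmetric]) (auto)
  also have "\<dots> = (\<integral>\<^sup>+p. ennreal (gauss_kernel \<rho> p) * indicator A p \<partial>(std_gauss \<Otimes>\<^sub>M std_gauss))"
    by (rule nn_integral_std_gauss_corr[OF _ r]) measurable
  also have "\<dots> = emeasure (density (std_gauss \<Otimes>\<^sub>M std_gauss) (gauss_kernel \<rho>)) A"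
    by (subst emeasure_density) (auto cong: measurable_cong_sets)
  finally show "emeasure (distr (std_gauss \<Otimes>\<^sub>M std_gauss) (borel \<Otimes>\<^sub>M borel) (\<lambda>(x, w). (x, \<rho> * x + r * w))) A
    = emeasure (density (std_gauss \<Otimes>\<^sub>M std_gauss) (gauss_kernel \<rho>)) A" .
qed

lemma nn_integral_normal_density:
  "0 < \<sigma> \<Longrightarrow> (\<integral>\<^sup>+x. ennreal (normal_density \<mu> \<sigma> x) \<partial>lborel) = 1"
  by (subst nn_integral_eq_integral) auto

text \<open>Weighted by the product density, the squared kernel is a multiple of another Gaussian
  density, written as a marginal in \<open>x\<close> times a conditional in \<open>y\<close>. The
  squared norm of the kernel can therefore be read off from the normalisation.\<close>

lemma gauss_kernel_square:
  assumes "\<rho>\<^sup>2 < 1"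
  shows "std_normal_density x * std_normal_density y * (gauss_kernel \<rho> (x, y))\<^sup>2
    = 1 / (1 - \<rho>\<^sup>2) * (normal_density 0 (sqrt ((1 + \<rho>\<^sup>2) / (1 - \<rho>\<^sup>2))) x *
       normal_density (2 * \<rho> * x / (1 + \<rho>\<^sup>2)) (sqrt ((1 - \<rho>\<^sup>2) / (1 + \<rho>\<^sup>2))) y)"
proof -
  define t where "t = \<rho>\<^sup>2"
  have t: "0 \<le> t" "t < 1" using assms by (auto simp: t_def)
  define E where "E = 2 * \<rho> * x * y - t * x\<^sup>2 - t * y\<^sup>2"
  have k2: "(gauss_kernel \<rho> (x, y))\<^sup>2 = exp (E / (1 - t)) / (1 - t)"
  proof -
    have "(exp (E / (2 * (1 - t))))\<^sup>2 = exp (E / (1 - t))"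
    proof -
      have "2 * (E / (2 * (1 - t))) = E / (1 - t)" using t by (simp add: divide_simps)
      then show ?thesis by (metis exp_double)
    qed
    then show ?thesis using t by (simp add: gauss_kernel_def E_def t_def power_divide)
  qed
  have n1: "normal_density 0 (sqrt ((1 + t) / (1 - t))) x =
      1 / sqrt (2 * pi * ((1 + t) / (1 - t))) * exp (- x\<^sup>2 * (1 - t) / (2 * (1 + t)))"
    using t by (simp add: normal_density_def)
  have n2: "normal_density (2 * \<rho> * x / (1 + t)) (sqrt ((1 - t) / (1 + t))) y =
      1 / sqrt (2 * pi * ((1 - t) / (1 + t))) * exp (- (y - 2 * \<rho> * x / (1 + t))\<^sup>2 * (1 + t) / (2 * (1 - t)))"
    using t by (simp add: normal_density_def)
  have s: "sqrt (2 * pi * ((1 + t) / (1 - t))) * sqrt (2 * pi * ((1 - t) / (1 + t))) = 2 * pi"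
    using t by (subst real_sqrt_mult[symmetric]) (simp add: real_sqrt_mult)
  have key: "(y - 2 * \<rho> * x / (1 + t))\<^sup>2 * (1 + t) = ((1+t)*y\<^sup>2 - 4 * \<rho> * x * y + 4 * t * x\<^sup>2 / (1 + t))"
    using t by (simp add: power2_diff power_divide power_mult_distrib t_def[symmetric] field_simps)
       (simp add: power2_eq_square algebra_simps)
  have "- x\<^sup>2 * (1 - t) / (2 * (1 + t)) + - (y - 2 * \<rho> * x / (1 + t))\<^sup>2 * (1 + t) / (2 * (1 - t))
     = - x\<^sup>2 * (1 - t) / (2 * (1 + t)) - ((1+t)*y\<^sup>2 - 4 * \<rho> * x * y + 4 * t * x\<^sup>2 / (1 + t)) / (2 * (1 - t))"
    unfolding key[symmetric] by simp
  also have "\<dots> = - x\<^sup>2 / 2 + - y\<^sup>2 / 2 + E / (1 - t)"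
  proof -
    have "- x\<^sup>2 * (1 - t) / (2 * (1 + t)) - 4 * t * x\<^sup>2 / (1 + t) / (2 * (1 - t)) =
       - x\<^sup>2 * ((1 - t)\<^sup>2 + 4 * t) / (2 * (1 + t) * (1 - t))"
    proof -
      have "- X * a / (2 * b) - 4 * t * X / b / (2 * a) = - X * (a\<^sup>2 + 4 * t) / (2 * b * a)"
        if "a \<noteq> 0" "b \<noteq> 0" for a b X :: real
        using that by (simp add: divide_simps) (simp add: power2_eq_square algebra_simps)
      from this[of "1 - t" "1 + t"] show ?thesis using t by simp
    qed
    also have "(1 - t)\<^sup>2 + 4 * t = (1 + t) * (1 + t)" by (simp add: power2_eq_square algebra_simps)
    also have "- x\<^sup>2 * ((1 + t) * (1 + t)) / (2 * (1 + t) * (1 - t)) = - x\<^sup>2 * (1 + t) / (2 * (1 - t))"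
    proof -
      have "X * (b * b) / (2 * b * a) = X * b / (2 * a)" if "a \<noteq> 0" "b \<noteq> 0" for a b X :: real
        using that by (simp add: divide_simps)
      moreover have "1 - t \<noteq> 0" "1 + t \<noteq> 0" using t by auto
      ultimately show ?thesis by blast
    qed
    finally have *: "- x\<^sup>2 * (1 - t) / (2 * (1 + t)) - 4 * t * x\<^sup>2 / (1 + t) / (2 * (1 - t)) =
      - x\<^sup>2 * (1 + t) / (2 * (1 - t))" .
    have "- x\<^sup>2 * (1 - t) / (2 * (1 + t)) - ((1+t)*y\<^sup>2 - 4 * \<rho> * x * y + 4 * t * x\<^sup>2 / (1 + t)) / (2 * (1 - t))
      = (- x\<^sup>2 * (1 - t) / (2 * (1 + t)) - 4 * t * x\<^sup>2 / (1 + t) / (2 * (1 - t))) - ((1+t)*y\<^sup>2 - 4 * \<rho> * x * y) / (2 * (1 - t))"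
      by (simp add: add_divide_distrib diff_divide_distrib)
    also have "\<dots> = - x\<^sup>2 / 2 + - y\<^sup>2 / 2 + E / (1 - t)"
    proof -
      \<comment> \<open>With a = 1 - t the quantity 1 + t becomes 2 - a, which leaves
        \<open>a\<close> as the only denominator.\<close>
      have "- X * (2 - a) / (2 * a) - ((2 - a) * Y - 4 * Z) / (2 * a) = - X / 2 + - Y / 2 + (2 * Z - (1 - a) * X - (1 - a) * Y) / a"
        if "a \<noteq> 0" for a X Y Z :: real
        using that by (simp add: divide_simps) (simp add: algebra_simps)
      from this[of "1 - t" "x\<^sup>2" "y\<^sup>2" "\<rho> * x * y"] show ?thesis
        unfolding * E_def using t by (simp add: mult.assoc)
    qed
    finally show ?thesis .
  qed
  finally have e: "- x\<^sup>2 / 2 + - y\<^sup>2 / 2 + E / (1 - t) =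
    - x\<^sup>2 * (1 - t) / (2 * (1 + t)) + - (y - 2 * \<rho> * x / (1 + t))\<^sup>2 * (1 + t) / (2 * (1 - t))" by simp
  have "std_normal_density x * std_normal_density y * (gauss_kernel \<rho> (x, y))\<^sup>2
     = 1 / (2 * pi) * exp (- x\<^sup>2 / 2 + - y\<^sup>2 / 2 + E / (1 - t)) / (1 - t)"
    unfolding k2 exp_add by (simp add: std_normal_density_def)
  also have "\<dots> = 1 / (1 - t) * (normal_density 0 (sqrt ((1 + t) / (1 - t))) x *
       normal_density (2 * \<rho> * x / (1 + t)) (sqrt ((1 - t) / (1 + t))) y)"
  proof -
    have "1 / (2 * pi) * (a * b) / (1 - t) = 1 / (1 - t) * (1 / A * a * (1 / B * b))" if "A * B = 2 * pi" for a b A B :: real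
      unfolding that[symmetric] by simp
    from this[OF s] show ?thesis unfolding n1 n2 e exp_add .
  qed
  finally show ?thesis by (simp add: t_def)
qed

lemma nn_integral_gauss_kernel_square:
  assumes "\<rho>\<^sup>2 < 1"
  shows "(\<integral>\<^sup>+p. ennreal ((gauss_kernel \<rho> p)\<^sup>2) \<partial>(std_gauss \<Otimes>\<^sub>M std_gauss)) = ennreal (1 / (1 - \<rho>\<^sup>2))"
proof -
  have pos: "0 < 1 + \<rho>\<^sup>2" by (simp add: add_pos_nonneg)
  have "(\<integral>\<^sup>+p. ennreal ((gauss_kernel \<rho> p)\<^sup>2) \<partial>(std_gauss \<Otimes>\<^sub>M std_gauss))
    = (\<integral>\<^sup>+x. \<integral>\<^sup>+y. ennreal ((gauss_kernel \<rho> (x, y))\<^sup>2) \<partial>std_gauss \<partial>std_gauss)"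
    by (rule std_gauss.nn_integral_fst[symmetric]) measurable
  also have "\<dots> = (\<integral>\<^sup>+x. \<integral>\<^sup>+y. ennreal (std_normal_density x * std_normal_density y) * ennreal ((gauss_kernel \<rho> (x, y))\<^sup>2) \<partial>lborel \<partial>lborel)"
    by (rule nn_integral_std_gauss_pair) measurable
  also have "\<dots> = (\<integral>\<^sup>+x. \<integral>\<^sup>+y. ennreal (1 / (1 - \<rho>\<^sup>2)) * (ennreal (normal_density 0 (sqrt ((1 + \<rho>\<^sup>2) / (1 - \<rho>\<^sup>2))) x) *
       ennreal (normal_density (2 * \<rho> * x / (1 + \<rho>\<^sup>2)) (sqrt ((1 - \<rho>\<^sup>2) / (1 + \<rho>\<^sup>2))) y)) \<partial>lborel \<partial>lborel)"
    using assms by (simp add: ennreal_mult[symmetric] gauss_kernel_square)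
  also have "\<dots> = ennreal (1 / (1 - \<rho>\<^sup>2))"
    using assms pos by (simp add: nn_integral_cmult nn_integral_normal_density)
  finally show ?thesis .
qed

text \<open>In the product of the kernels for \<open>\<rho>\<close> and \<open>- \<rho>\<close> the
  mixed terms cancel, so the weighted product splits into two centred Gaussians of variance (1 -
  t)/(1 + t). The value is the inner product entering the norm of the symmetrised kernel.\<close>

lemma nn_integral_gauss_kernel_cross:
  assumes "\<rho>\<^sup>2 < 1"
  shows "(\<integral>\<^sup>+p. ennreal (gauss_kernel \<rho> p * gauss_kernel (- \<rho>) p) \<partial>(std_gauss \<Otimes>\<^sub>M std_gauss)) = ennreal (1 / (1 + \<rho>\<^sup>2))"
proof -
  define t where "t = \<rho>\<^sup>2"
  have t: "0 \<le> t" "t < 1" using assms by (auto simp: t_def)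
  define u where "u = (1 - t) / (1 + t)"
  have u: "0 < u" using t by (simp add: u_def)
  have n: "normal_density 0 (sqrt u) x = 1 / sqrt (2 * pi * u) * exp (- x\<^sup>2 * (1 + t) / (2 * (1 - t)))" for x
    using t u by (simp add: normal_density_def) (simp add: u_def)
  have id: "std_normal_density x * std_normal_density y * (gauss_kernel \<rho> (x, y) * gauss_kernel (- \<rho>) (x, y))
    = 1 / (1 + t) * (normal_density 0 (sqrt u) x * normal_density 0 (sqrt u) y)" for x y
  proof -
    have "gauss_kernel \<rho> (x, y) * gauss_kernel (- \<rho>) (x, y)
      = exp ((2 * \<rho> * x * y - t * x\<^sup>2 - t * y\<^sup>2) / (2 * (1 - t)) + (- (2 * \<rho> * x * y) - t * x\<^sup>2 - t * y\<^sup>2) / (2 * (1 - t))) / (1 - t)"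
      using t by (simp add: gauss_kernel_def t_def[symmetric] exp_add)
    also have "(2 * \<rho> * x * y - t * x\<^sup>2 - t * y\<^sup>2) / (2 * (1 - t)) + (- (2 * \<rho> * x * y) - t * x\<^sup>2 - t * y\<^sup>2) / (2 * (1 - t))
      = - t * x\<^sup>2 / (1 - t) + - t * y\<^sup>2 / (1 - t)"
    proof -
      have "(a - b - c) / (2 * D) + (- a - b - c) / (2 * D) = - b / D + - c / D" if "D \<noteq> 0" for a b c D :: real
        using that by (simp add: add_divide_distrib diff_divide_distrib)
      from this[of "1 - t"] show ?thesis using t by simp
    qed
    finally have kk: "gauss_kernel \<rho> (x, y) * gauss_kernel (- \<rho>) (x, y) = exp (- t * x\<^sup>2 / (1 - t)) * exp (- t * y\<^sup>2 / (1 - t)) / (1 - t)"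
      unfolding exp_add .
    have e: "exp (- x\<^sup>2 * (1 + t) / (2 * (1 - t))) = exp (- x\<^sup>2 / 2) * exp (- t * x\<^sup>2 / (1 - t))" for x :: real
    proof -
      have "- x\<^sup>2 * (1 + t) / (2 * (1 - t)) = - x\<^sup>2 / 2 + - t * x\<^sup>2 / (1 - t)"
        using t by (simp add: field_simps)
      then show ?thesis by (metis exp_add)
    qed
    have "1 / (1 + t) * (1 / sqrt (2 * pi * u) * (1 / sqrt (2 * pi * u))) = 1 / (2 * pi) / (1 - t)"
      using t u by (simp add: u_def)
    then have c: "1 / (1 + t) * (1 / sqrt (2 * pi * u) * a * (1 / sqrt (2 * pi * u) * b)) = 1 / (2 * pi) / (1 - t) * (a * b)" for a b
      by (metis (no_types, opaque_lifting) mult.assoc mult.left_commute)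
    show ?thesis
      unfolding n c unfolding e kk by (simp add: std_normal_density_def)
  qed
  have "(\<integral>\<^sup>+p. ennreal (gauss_kernel \<rho> p * gauss_kernel (- \<rho>) p) \<partial>(std_gauss \<Otimes>\<^sub>M std_gauss))
    = (\<integral>\<^sup>+x. \<integral>\<^sup>+y. ennreal (gauss_kernel \<rho> (x, y) * gauss_kernel (- \<rho>) (x, y)) \<partial>std_gauss \<partial>std_gauss)"
    by (rule std_gauss.nn_integral_fst[symmetric]) measurable
  also have "\<dots> = (\<integral>\<^sup>+x. \<integral>\<^sup>+y. ennreal (std_normal_density x * std_normal_density y) * ennreal (gauss_kernel \<rho> (x, y) * gauss_kernel (- \<rho>) (x, y)) \<partial>lborel \<partial>lborel)"
    by (rule nn_integral_std_gauss_pair) measurable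
  also have "\<dots> = (\<integral>\<^sup>+x. \<integral>\<^sup>+y. ennreal (1 / (1 + t)) * (ennreal (normal_density 0 (sqrt u) x) *
       ennreal (normal_density 0 (sqrt u) y)) \<partial>lborel \<partial>lborel)"
    using t by (simp add: ennreal_mult[symmetric] id gauss_kernel_nonneg assms)
  also have "\<dots> = ennreal (1 / (1 + \<rho>\<^sup>2))"
    using u by (simp add: nn_integral_cmult nn_integral_normal_density t_def)
  finally show ?thesis .
qed


lemma integrable_std_gauss_times:
  fixes g h :: "real \<Rightarrow> real"
  assumes g: "integrable std_gauss g" and h: "integrable std_gauss h"
  shows "integrable (std_gauss \<Otimes>\<^sub>M std_gauss) (\<lambda>(x, y). g x * h y)"
    and "(\<integral>(x, y). g x * h y \<partial>(std_gauss \<Otimes>\<^sub>M std_gauss)) = (\<integral>x. g x \<partial>std_gauss) * (\<integral>x. h x \<partial>std_gauss)"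
proof -
  have [measurable]: "g \<in> borel_measurable borel" "h \<in> borel_measurable borel"
    using g h by (auto dest!: borel_measurable_integrable)
  show i: "integrable (std_gauss \<Otimes>\<^sub>M std_gauss) (\<lambda>(x, y). g x * h y)"
    by (rule std_gauss2.Fubini_integrable) (use g h in \<open>auto simp: abs_mult\<close>)
  show "(\<integral>(x, y). g x * h y \<partial>(std_gauss \<Otimes>\<^sub>M std_gauss)) = (\<integral>x. g x \<partial>std_gauss) * (\<integral>x. h x \<partial>std_gauss)"
    using std_gauss2.integral_fst[OF i] by simp
qed

lemma gauss_kernel_integral:
  fixes f :: "real \<times> real \<Rightarrow> real"
  assumes r: "\<rho>\<^sup>2 + r\<^sup>2 = 1" "r \<noteq> 0" and [measurable]: "f \<in> borel_measurable (borel \<Otimes>\<^sub>M borel)"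
  shows "(\<integral>(x, w). f (x, \<rho> * x + r * w) \<partial>(std_gauss \<Otimes>\<^sub>M std_gauss))
     = (\<integral>p. gauss_kernel \<rho> p * f p \<partial>(std_gauss \<Otimes>\<^sub>M std_gauss))"
proof -
  have rho: "\<rho>\<^sup>2 < 1"
  proof -
    have "r\<^sup>2 > 0" using r by simp
    then show ?thesis using r by linarith
  qed
  have "(\<integral>p. f p \<partial>distr (std_gauss \<Otimes>\<^sub>M std_gauss) (borel \<Otimes>\<^sub>M borel) (\<lambda>(x, w). (x, \<rho> * x + r * w)))
    = (\<integral>p. f (case p of (x, w) \<Rightarrow> (x, \<rho> * x + r * w)) \<partial>(std_gauss \<Otimes>\<^sub>M std_gauss))"
    by (rule integral_distr) measurable
  moreover have "(\<integral>p. f p \<partial>density (std_gauss \<Otimes>\<^sub>M std_gauss) (gauss_kernel \<rho>)) = (\<integral>p. gauss_kernel \<rho> p *\<^sub>R f p \<partial>(std_gauss \<Otimes>\<^sub>M std_gauss))"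
    by (rule integral_density) (use gauss_kernel_nonneg[OF rho] in \<open>auto cong: measurable_cong_sets\<close>)
  ultimately show ?thesis unfolding distr_std_gauss_corr[OF r] by (simp add: case_prod_unfold)
qed

lemma integrable_gauss_kernel_square:
  assumes "\<rho>\<^sup>2 < 1"
  shows "integrable (std_gauss \<Otimes>\<^sub>M std_gauss) (\<lambda>p. (gauss_kernel \<rho> p)\<^sup>2)"
    and "(\<integral>p. (gauss_kernel \<rho> p)\<^sup>2 \<partial>(std_gauss \<Otimes>\<^sub>M std_gauss)) = 1 / (1 - \<rho>\<^sup>2)"
proof -
  have "has_bochner_integral (std_gauss \<Otimes>\<^sub>M std_gauss) (\<lambda>p. (gauss_kernel \<rho> p)\<^sup>2) (1 / (1 - \<rho>\<^sup>2))"
    by (rule has_bochner_integral_nn_integral)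
       (use nn_integral_gauss_kernel_square[OF assms] assms in \<open>auto cong: measurable_cong_sets\<close>)
  then show "integrable (std_gauss \<Otimes>\<^sub>M std_gauss) (\<lambda>p. (gauss_kernel \<rho> p)\<^sup>2)"
    and "(\<integral>p. (gauss_kernel \<rho> p)\<^sup>2 \<partial>(std_gauss \<Otimes>\<^sub>M std_gauss)) = 1 / (1 - \<rho>\<^sup>2)"
    by (auto simp: has_bochner_integral_iff)
qed

lemma gauss_kernel_cross:
  assumes "\<rho>\<^sup>2 < 1"
  shows "integrable (std_gauss \<Otimes>\<^sub>M std_gauss) (\<lambda>p. gauss_kernel \<rho> p * gauss_kernel (- \<rho>) p)"
    and "(\<integral>p. gauss_kernel \<rho> p * gauss_kernel (- \<rho>) p \<partial>(std_gauss \<Otimes>\<^sub>M std_gauss)) = 1 / (1 + \<rho>\<^sup>2)"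
proof -
  have nn: "0 \<le> gauss_kernel \<rho> p * gauss_kernel (- \<rho>) p" for p
    using gauss_kernel_nonneg[of \<rho> p] gauss_kernel_nonneg[of "- \<rho>" p] assms by simp
  have "0 \<le> 1 / (1 + \<rho>\<^sup>2)" by (simp add: add_nonneg_nonneg)
  then have "has_bochner_integral (std_gauss \<Otimes>\<^sub>M std_gauss) (\<lambda>p. gauss_kernel \<rho> p * gauss_kernel (- \<rho>) p) (1 / (1 + \<rho>\<^sup>2))"
    by (intro has_bochner_integral_nn_integral)
       (use nn_integral_gauss_kernel_cross[OF assms] nn in \<open>auto cong: measurable_cong_sets\<close>)
  then show "integrable (std_gauss \<Otimes>\<^sub>M std_gauss) (\<lambda>p. gauss_kernel \<rho> p * gauss_kernel (- \<rho>) p)"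
    and "(\<integral>p. gauss_kernel \<rho> p * gauss_kernel (- \<rho>) p \<partial>(std_gauss \<Otimes>\<^sub>M std_gauss)) = 1 / (1 + \<rho>\<^sup>2)"
    by (auto simp: has_bochner_integral_iff)
qed

lemma gauss_kernel_integral_one:
  assumes "\<rho>\<^sup>2 < 1"
  shows "integrable (std_gauss \<Otimes>\<^sub>M std_gauss) (gauss_kernel \<rho>)"
    and "(\<integral>p. gauss_kernel \<rho> p \<partial>(std_gauss \<Otimes>\<^sub>M std_gauss)) = 1"
proof -
  show "integrable (std_gauss \<Otimes>\<^sub>M std_gauss) (gauss_kernel \<rho>)"
    by (rule std_gauss2.square_integrable_imp_integrable)
       (use integrable_gauss_kernel_square[OF assms] in \<open>auto cong: measurable_cong_sets\<close>)
  show "(\<integral>p. gauss_kernel \<rho> p \<partial>(std_gauss \<Otimes>\<^sub>M std_gauss)) = 1"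
    using gauss_kernel_integral[of \<rho> "sqrt (1 - \<rho>\<^sup>2)" "\<lambda>_. 1"] assms
    by (simp add: case_prod_unfold std_gauss2.prob_space)
qed

text \<open>As the kernel has mean one, its squared distance to one is its second moment minus
  one.\<close>

lemma gauss_kernel_dist_sq:
  assumes "\<rho>\<^sup>2 < 1"
  shows "integrable (std_gauss \<Otimes>\<^sub>M std_gauss) (\<lambda>p. (gauss_kernel \<rho> p - 1)\<^sup>2)"
    and "(\<integral>p. (gauss_kernel \<rho> p - 1)\<^sup>2 \<partial>(std_gauss \<Otimes>\<^sub>M std_gauss)) = \<rho>\<^sup>2 / (1 - \<rho>\<^sup>2)"
proof -
  note i = integrable_gauss_kernel_square[OF assms] gauss_kernel_integral_one[OF assms]
  have e: "(\<lambda>p. (gauss_kernel \<rho> p - 1)\<^sup>2) = (\<lambda>p. (gauss_kernel \<rho> p)\<^sup>2 - 2 * gauss_kernel \<rho> p + 1)"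
    by (auto simp: power2_eq_square algebra_simps)
  show "integrable (std_gauss \<Otimes>\<^sub>M std_gauss) (\<lambda>p. (gauss_kernel \<rho> p - 1)\<^sup>2)"
    unfolding e using i by auto
  show "(\<integral>p. (gauss_kernel \<rho> p - 1)\<^sup>2 \<partial>(std_gauss \<Otimes>\<^sub>M std_gauss)) = \<rho>\<^sup>2 / (1 - \<rho>\<^sup>2)"
    unfolding e using i assms by (simp add: std_gauss2.prob_space) (simp add: field_simps)
qed

text \<open>Averaging the kernel over \<open>\<plusminus>\<rho>\<close> removes the first chaos, so that even functions see a
  kernel that is \<open>\<rho>\<^sup>2\<close>-close to one.\<close>

lemma gauss_kernel_even_dist_sq:
  assumes "\<rho>\<^sup>2 < 1"
  shows "integrable (std_gauss \<Otimes>\<^sub>M std_gauss) (\<lambda>p. ((gauss_kernel \<rho> p + gauss_kernel (- \<rho>) p) / 2 - 1)\<^sup>2)"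
    and "(\<integral>p. ((gauss_kernel \<rho> p + gauss_kernel (- \<rho>) p) / 2 - 1)\<^sup>2 \<partial>(std_gauss \<Otimes>\<^sub>M std_gauss)) = \<rho>^4 / (1 - \<rho>^4)"
proof -
  have assms': "(- \<rho>)\<^sup>2 < 1" using assms by simp
  note i = integrable_gauss_kernel_square[OF assms] gauss_kernel_integral_one[OF assms] gauss_kernel_cross[OF assms]
    integrable_gauss_kernel_square[OF assms'] gauss_kernel_integral_one[OF assms']
  have e: "(\<lambda>p. ((gauss_kernel \<rho> p + gauss_kernel (- \<rho>) p) / 2 - 1)\<^sup>2) =
    (\<lambda>p. (gauss_kernel \<rho> p)\<^sup>2 / 4 + (gauss_kernel (- \<rho>) p)\<^sup>2 / 4 + gauss_kernel \<rho> p * gauss_kernel (- \<rho>) p / 2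
      - gauss_kernel \<rho> p - gauss_kernel (- \<rho>) p + 1)"
    by (auto simp: power2_eq_square algebra_simps add_divide_distrib)
  show "integrable (std_gauss \<Otimes>\<^sub>M std_gauss) (\<lambda>p. ((gauss_kernel \<rho> p + gauss_kernel (- \<rho>) p) / 2 - 1)\<^sup>2)"
    unfolding e using i by auto
  define t where "t = \<rho>\<^sup>2"
  have t: "0 \<le> t" "t < 1" using assms by (auto simp: t_def)
  have tt: "1 - t * t \<noteq> 0" using t mult_strict_mono[of t 1 t 1] by auto
  have "(\<integral>p. ((gauss_kernel \<rho> p + gauss_kernel (- \<rho>) p) / 2 - 1)\<^sup>2 \<partial>(std_gauss \<Otimes>\<^sub>M std_gauss)) =
     1 / (1 - t) / 4 + 1 / (1 - t) / 4 + 1 / (1 + t) / 2 - 1"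
    unfolding e using i by (simp add: std_gauss2.prob_space t_def)
  also have "\<dots> = (1 + t + (1 - t)) / (2 * ((1 - t) * (1 + t))) - 1"
    using t by (simp add: divide_simps) (simp add: algebra_simps)
  also have "(1 - t) * (1 + t) = 1 - t * t" by (simp add: algebra_simps)
  also have "(1 + t + (1 - t)) / (2 * (1 - t * t)) - 1 = t * t / (1 - t * t)"
    using tt by (simp add: field_simps)
  finally show "(\<integral>p. ((gauss_kernel \<rho> p + gauss_kernel (- \<rho>) p) / 2 - 1)\<^sup>2 \<partial>(std_gauss \<Otimes>\<^sub>M std_gauss)) = \<rho>^4 / (1 - \<rho>^4)"
    by (simp add: t_def power2_eq_square power4_eq_xxxx mult.assoc)
qed


section \<open>Laws of normalised linear forms, and covariances of functions of them\<close>

lemma std_gauss_linear: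
  fixes a :: "'i \<Rightarrow> real"
  assumes I: "finite I" and a: "(\<Sum>k\<in>I. (a k)\<^sup>2) = 1"
  shows "distr (PiM I (\<lambda>_. std_gauss)) borel (\<lambda>z. \<Sum>k\<in>I. a k * z k) = std_gauss"
proof (rule measure_eqI)
  fix A assume "A \<in> sets (distr (PiM I (\<lambda>_. std_gauss)) borel (\<lambda>z. \<Sum>k\<in>I. a k * z k))"
  then have A [measurable]: "A \<in> sets borel" by simp
  obtain p q r where p: "0 \<le> p" "p\<^sup>2 = (\<Sum>k\<in>I. (a k)\<^sup>2)" and
    law: "\<And>f. f \<in> borel_measurable (borel \<Otimes>\<^sub>M borel) \<Longrightarrow>
      (\<integral>\<^sup>+z. f (\<Sum>k\<in>I. a k * z k, \<Sum>k\<in>I. a k * z k) \<partial>PiM I (\<lambda>_. std_gauss))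
       = (\<integral>\<^sup>+x. \<integral>\<^sup>+w. f (p * x, q * x + r * w) \<partial>std_gauss \<partial>std_gauss :: ennreal)"
    using std_gauss_linear_pair[OF I, of a a] by auto
  have "p = 1" using p a by (simp add: power2_eq_1_iff)
  have "emeasure (distr (PiM I (\<lambda>_. std_gauss)) borel (\<lambda>z. \<Sum>k\<in>I. a k * z k)) A
    = (\<integral>\<^sup>+x. indicator A x \<partial>distr (PiM I (\<lambda>_. std_gauss)) borel (\<lambda>z. \<Sum>k\<in>I. a k * z k))" by simp
  also have "\<dots> = (\<integral>\<^sup>+z. indicator A (\<Sum>k\<in>I. a k * z k) \<partial>PiM I (\<lambda>_. std_gauss))"
    by (rule nn_integral_distr) measurable
  also have "\<dots> = (\<integral>\<^sup>+x. \<integral>\<^sup>+w. indicator A (p * x) \<partial>std_gauss \<partial>std_gauss)"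
    using law[of "\<lambda>(x, y). indicator A x"] by simp
  also have "\<dots> = emeasure std_gauss A"
    by (simp add: \<open>p = 1\<close> std_gauss.emeasure_space_1[simplified])
  finally show "emeasure (distr (PiM I (\<lambda>_. std_gauss)) borel (\<lambda>z. \<Sum>k\<in>I. a k * z k)) A = emeasure std_gauss A" .
qed simp

lemma std_gauss_linear_pair_distr:
  fixes a b :: "'i \<Rightarrow> real"
  assumes I: "finite I" and a: "(\<Sum>k\<in>I. (a k)\<^sup>2) = 1" and b: "(\<Sum>k\<in>I. (b k)\<^sup>2) = 1"
    and rho: "\<rho> = (\<Sum>k\<in>I. a k * b k)"
  obtains r where "\<rho>\<^sup>2 + r\<^sup>2 = 1"
    "distr (PiM I (\<lambda>_. std_gauss)) (borel \<Otimes>\<^sub>M borel) (\<lambda>z. (\<Sum>k\<in>I. a k * z k, \<Sum>k\<in>I. b k * z k))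
     = distr (std_gauss \<Otimes>\<^sub>M std_gauss) (borel \<Otimes>\<^sub>M borel) (\<lambda>(x, w). (x, \<rho> * x + r * w))"
proof -
  obtain p q r where p: "0 \<le> p" "p\<^sup>2 = (\<Sum>k\<in>I. (a k)\<^sup>2)" "p * q = (\<Sum>k\<in>I. a k * b k)" "q\<^sup>2 + r\<^sup>2 = (\<Sum>k\<in>I. (b k)\<^sup>2)" and
    law: "\<And>f. f \<in> borel_measurable (borel \<Otimes>\<^sub>M borel) \<Longrightarrow>
      (\<integral>\<^sup>+z. f (\<Sum>k\<in>I. a k * z k, \<Sum>k\<in>I. b k * z k) \<partial>PiM I (\<lambda>_. std_gauss))
       = (\<integral>\<^sup>+x. \<integral>\<^sup>+w. f (p * x, q * x + r * w) \<partial>std_gauss \<partial>std_gauss :: ennreal)"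
    using std_gauss_linear_pair[OF I, of a b] by blast
  have p1: "p = 1" using p a by (simp add: power2_eq_1_iff)
  then have q: "q = \<rho>" using p rho by simp
  show ?thesis
  proof (rule that)
    show "\<rho>\<^sup>2 + r\<^sup>2 = 1" using p b q by simp
    show "distr (PiM I (\<lambda>_. std_gauss)) (borel \<Otimes>\<^sub>M borel) (\<lambda>z. (\<Sum>k\<in>I. a k * z k, \<Sum>k\<in>I. b k * z k))
     = distr (std_gauss \<Otimes>\<^sub>M std_gauss) (borel \<Otimes>\<^sub>M borel) (\<lambda>(x, w). (x, \<rho> * x + r * w))" (is "?L = ?R")
    proof (rule measure_eqI)
      fix A assume "A \<in> sets ?L"
      then have [measurable]: "A \<in> sets (borel \<Otimes>\<^sub>M borel)" by simp
      have "emeasure ?L A = (\<integral>\<^sup>+x. indicator A x \<partial>?L)" by simp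
      also have "\<dots> = (\<integral>\<^sup>+z. indicator A (\<Sum>k\<in>I. a k * z k, \<Sum>k\<in>I. b k * z k) \<partial>PiM I (\<lambda>_. std_gauss))"
        by (rule nn_integral_distr) measurable
      also have "\<dots> = (\<integral>\<^sup>+x. \<integral>\<^sup>+w. indicator A (x, \<rho> * x + r * w) \<partial>std_gauss \<partial>std_gauss)"
        by (subst law) (simp_all add: p1 q)
      also have "\<dots> = (\<integral>\<^sup>+p. indicator A (case p of (x, w) \<Rightarrow> (x, \<rho> * x + r * w)) \<partial>(std_gauss \<Otimes>\<^sub>M std_gauss))"
        by (subst std_gauss.nn_integral_fst[symmetric]) auto
      also have "\<dots> = (\<integral>\<^sup>+x. indicator A x \<partial>?R)"
        by (rule nn_integral_distr[symmetric]) measurable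
      also have "\<dots> = emeasure ?R A" by simp
      finally show "emeasure ?L A = emeasure ?R A" .
    qed simp
  qed
qed

lemma std_gauss_square_integrable_imp_integrable:
  fixes g :: "real \<Rightarrow> real"
  assumes [measurable]: "g \<in> borel_measurable borel" and "integrable std_gauss (\<lambda>x. (g x)\<^sup>2)"
  shows "integrable std_gauss g"
  by (rule std_gauss.square_integrable_imp_integrable) (use assms in auto)

lemma std_gauss_abs_mean_le:
  fixes g :: "real \<Rightarrow> real"
  assumes [measurable]: "g \<in> borel_measurable borel" and "integrable std_gauss (\<lambda>x. (g x)\<^sup>2)"
  shows "\<bar>\<integral>x. g x \<partial>std_gauss\<bar> \<le> sqrt (\<integral>x. (g x)\<^sup>2 \<partial>std_gauss)"
  using integral_Cauchy_Schwarz[of g std_gauss "\<lambda>_. 1"] assms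
  by (simp add: std_gauss.prob_space[simplified])

text \<open>Cauchy-Schwarz on the product space, where the norm of the tensor product of
  \<open>g\<close> and \<open>h\<close> factorises.\<close>

lemma std_gauss_times_kernel_bound:
  fixes g h :: "real \<Rightarrow> real" and W :: "real \<times> real \<Rightarrow> real"
  assumes [measurable]: "g \<in> borel_measurable borel" "h \<in> borel_measurable borel" "W \<in> borel_measurable (borel \<Otimes>\<^sub>M borel)"
    and g: "integrable std_gauss (\<lambda>x. (g x)\<^sup>2)" and h: "integrable std_gauss (\<lambda>x. (h x)\<^sup>2)"
    and W: "integrable (std_gauss \<Otimes>\<^sub>M std_gauss) (\<lambda>p. (W p)\<^sup>2)"
  shows "integrable (std_gauss \<Otimes>\<^sub>M std_gauss) (\<lambda>p. (case p of (x, y) \<Rightarrow> g x * h y) * W p)"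
   "\<bar>\<integral>p. (case p of (x, y) \<Rightarrow> g x * h y) * W p \<partial>(std_gauss \<Otimes>\<^sub>M std_gauss)\<bar> \<le>
     sqrt (\<integral>x. (g x)\<^sup>2 \<partial>std_gauss) * sqrt (\<integral>x. (h x)\<^sup>2 \<partial>std_gauss) * sqrt (\<integral>p. (W p)\<^sup>2 \<partial>(std_gauss \<Otimes>\<^sub>M std_gauss))"
proof -
  have e: "(\<lambda>p. (case p of (x, y) \<Rightarrow> g x * h y)\<^sup>2) = (\<lambda>(x, y). (g x)\<^sup>2 * (h y)\<^sup>2)"
    by (auto simp: power_mult_distrib)
  note i = integrable_std_gauss_times[OF g h]
  have i1: "integrable (std_gauss \<Otimes>\<^sub>M std_gauss) (\<lambda>p. (case p of (x, y) \<Rightarrow> g x * h y)\<^sup>2)"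
    unfolding e by (rule i)
  have [measurable]: "W \<in> borel_measurable (std_gauss \<Otimes>\<^sub>M std_gauss)" by (simp cong: measurable_cong_sets)
  show "integrable (std_gauss \<Otimes>\<^sub>M std_gauss) (\<lambda>p. (case p of (x, y) \<Rightarrow> g x * h y) * W p)"
    by (rule integrable_mult_of_squares[OF _ _ i1 W]) measurable
  show "\<bar>\<integral>p. (case p of (x, y) \<Rightarrow> g x * h y) * W p \<partial>(std_gauss \<Otimes>\<^sub>M std_gauss)\<bar> \<le>
     sqrt (\<integral>x. (g x)\<^sup>2 \<partial>std_gauss) * sqrt (\<integral>x. (h x)\<^sup>2 \<partial>std_gauss) * sqrt (\<integral>p. (W p)\<^sup>2 \<partial>(std_gauss \<Otimes>\<^sub>M std_gauss))"
    using integral_Cauchy_Schwarz[OF _ _ i1 W] i(2) unfolding e by (simp add: real_sqrt_mult)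
qed

text \<open>The covariance is the integral of the tensor product of \<open>g\<close> and
  \<open>h\<close> against the kernel minus one, so the distance of the kernel from one bounds it.
  The restriction \<open>\<rho>\<^sup>2 \<le> 1/2\<close> keeps \<open>1 - \<rho>\<^sup>2\<close>
  away from zero; stronger correlations are treated without a kernel in
  \<open>gauss_noise_linear\<close>.\<close>

lemma std_gauss_corr_cov:
  fixes g h :: "real \<Rightarrow> real"
  assumes [measurable]: "g \<in> borel_measurable borel" "h \<in> borel_measurable borel"
    and g: "integrable std_gauss (\<lambda>x. (g x)\<^sup>2)" and h: "integrable std_gauss (\<lambda>x. (h x)\<^sup>2)"
    and r: "\<rho>\<^sup>2 + r\<^sup>2 = 1" and rho: "\<rho>\<^sup>2 \<le> 1/2"
  shows "\<bar>(\<integral>(x, w). g x * h (\<rho> * x + r * w) \<partial>(std_gauss \<Otimes>\<^sub>M std_gauss)) - (\<integral>x. g x \<partial>std_gauss) * (\<integral>x. h x \<partial>std_gauss)\<bar>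
      \<le> 4 * \<bar>\<rho>\<bar> * (sqrt (\<integral>x. (g x)\<^sup>2 \<partial>std_gauss) * sqrt (\<integral>x. (h x)\<^sup>2 \<partial>std_gauss))"
    and "(\<And>x. h (- x) = h x) \<Longrightarrow>
      \<bar>(\<integral>(x, w). g x * h (\<rho> * x + r * w) \<partial>(std_gauss \<Otimes>\<^sub>M std_gauss)) - (\<integral>x. g x \<partial>std_gauss) * (\<integral>x. h x \<partial>std_gauss)\<bar>
      \<le> 4 * \<rho>\<^sup>2 * (sqrt (\<integral>x. (g x)\<^sup>2 \<partial>std_gauss) * sqrt (\<integral>x. (h x)\<^sup>2 \<partial>std_gauss))"
proof -
  let ?N = "sqrt (\<integral>x. (g x)\<^sup>2 \<partial>std_gauss) * sqrt (\<integral>x. (h x)\<^sup>2 \<partial>std_gauss)"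
  let ?G = "std_gauss \<Otimes>\<^sub>M std_gauss"
  have N0: "0 \<le> ?N" by simp
  have rho1: "\<rho>\<^sup>2 < 1" using rho by simp
  have r0: "r \<noteq> 0" using r rho by auto
  have ig: "integrable std_gauss g" "integrable std_gauss h"
    using g h by (auto intro: std_gauss_square_integrable_imp_integrable)
  have gh: "integrable ?G (\<lambda>p. case p of (x, y) \<Rightarrow> g x * h y)"
    "(\<integral>p. (case p of (x, y) \<Rightarrow> g x * h y) \<partial>?G) = (\<integral>x. g x \<partial>std_gauss) * (\<integral>x. h x \<partial>std_gauss)"
    using integrable_std_gauss_times[OF ig] by auto
  have K: "(\<integral>(x, w). g x * h (\<rho>' * x + r' * w) \<partial>?G) = (\<integral>p. (case p of (x, y) \<Rightarrow> g x * h y) * gauss_kernel \<rho>' p \<partial>?G)"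
    if "\<rho>'\<^sup>2 + r'\<^sup>2 = 1" "r' \<noteq> 0" for \<rho>' r'
    using gauss_kernel_integral[OF that, of "\<lambda>(x, y). g x * h y"] by (simp add: mult.commute)
  have iK: "integrable ?G (\<lambda>p. (case p of (x, y) \<Rightarrow> g x * h y) * gauss_kernel \<rho>' p)" if "\<rho>'\<^sup>2 < 1" for \<rho>'
    by (rule std_gauss_times_kernel_bound[OF _ _ _ g h]) (use integrable_gauss_kernel_square[OF that] in auto)
  have "(\<integral>(x, w). g x * h (\<rho> * x + r * w) \<partial>?G) - (\<integral>x. g x \<partial>std_gauss) * (\<integral>x. h x \<partial>std_gauss)
    = (\<integral>p. (case p of (x, y) \<Rightarrow> g x * h y) * (gauss_kernel \<rho> p - 1) \<partial>?G)"
    unfolding K[OF r r0] gh(2)[symmetric] using iK[OF rho1] gh(1)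
    by (subst Bochner_Integration.integral_diff[symmetric]) (auto simp: algebra_simps)
  also have "\<bar>\<dots>\<bar> \<le> ?N * sqrt (\<integral>p. (gauss_kernel \<rho> p - 1)\<^sup>2 \<partial>?G)"
    by (rule std_gauss_times_kernel_bound) (use g h gauss_kernel_dist_sq[OF rho1] in auto)
  also have "\<dots> \<le> ?N * (4 * \<bar>\<rho>\<bar>)"
  proof (intro mult_left_mono N0)
    \<comment> \<open>The denominator is at least 1/2; the smaller 1/16 is chosen because its
      reciprocal is a perfect square.\<close>
    have "\<rho>\<^sup>2 / (1 - \<rho>\<^sup>2) \<le> \<rho>\<^sup>2 / (1/16)"
      using rho by (intro divide_left_mono) auto
    also have "\<dots> = (4 * \<bar>\<rho>\<bar>)\<^sup>2" by (simp add: power_mult_distrib)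
    finally show "sqrt (\<integral>p. (gauss_kernel \<rho> p - 1)\<^sup>2 \<partial>?G) \<le> 4 * \<bar>\<rho>\<bar>"
      unfolding gauss_kernel_dist_sq[OF rho1] by (intro real_le_lsqrt) auto
  qed
  finally show "\<bar>(\<integral>(x, w). g x * h (\<rho> * x + r * w) \<partial>?G) - (\<integral>x. g x \<partial>std_gauss) * (\<integral>x. h x \<partial>std_gauss)\<bar>
      \<le> 4 * \<bar>\<rho>\<bar> * ?N" by (simp add: mult.commute)
  assume even: "\<And>x. h (- x) = h x"
  \<comment> \<open>Evenness allows the sign of the argument of \<open>h\<close> to be changed, so
    the same expectation is also an integral against the kernel with correlation
    \<open>- \<rho>\<close>, and the two representations can be averaged.\<close>
  have K2: "(\<integral>(x, w). g x * h (\<rho> * x + r * w) \<partial>?G) = (\<integral>p. (case p of (x, y) \<Rightarrow> g x * h y) * gauss_kernel (- \<rho>) p \<partial>?G)"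
  proof -
    have "h (\<rho> * x + r * w) = h (- \<rho> * x + - r * w)" for x w
      using even[of "\<rho> * x + r * w"] by simp
    then show ?thesis using K[of "- \<rho>" "- r"] r r0 by simp
  qed
  have "(\<integral>(x, w). g x * h (\<rho> * x + r * w) \<partial>?G) - (\<integral>x. g x \<partial>std_gauss) * (\<integral>x. h x \<partial>std_gauss)
    = ((\<integral>p. (case p of (x, y) \<Rightarrow> g x * h y) * gauss_kernel \<rho> p \<partial>?G) +
       (\<integral>p. (case p of (x, y) \<Rightarrow> g x * h y) * gauss_kernel (- \<rho>) p \<partial>?G)) / 2 - (\<integral>p. (case p of (x, y) \<Rightarrow> g x * h y) \<partial>?G)"
    using K[OF r r0] K2 gh(2) by simp
  also have "\<dots> = (\<integral>p. ((case p of (x, y) \<Rightarrow> g x * h y) * gauss_kernel \<rho> p +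
       (case p of (x, y) \<Rightarrow> g x * h y) * gauss_kernel (- \<rho>) p) / 2 - (case p of (x, y) \<Rightarrow> g x * h y) \<partial>?G)"
    using iK[of \<rho>] iK[of "- \<rho>"] gh(1) rho1 by simp
  also have "\<dots> = (\<integral>p. (case p of (x, y) \<Rightarrow> g x * h y) * ((gauss_kernel \<rho> p + gauss_kernel (- \<rho>) p) / 2 - 1) \<partial>?G)"
    by (simp add: algebra_simps add_divide_distrib)
  also have "\<bar>\<dots>\<bar> \<le> ?N * sqrt (\<integral>p. ((gauss_kernel \<rho> p + gauss_kernel (- \<rho>) p) / 2 - 1)\<^sup>2 \<partial>?G)"
    by (rule std_gauss_times_kernel_bound) (use g h gauss_kernel_even_dist_sq[OF rho1] in auto)
  also have "\<dots> \<le> ?N * (4 * \<rho>\<^sup>2)"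
  proof (intro mult_left_mono N0)
    have "\<rho>^4 \<le> 1/4" using mult_mono[OF rho rho] by (simp add: power2_eq_square power4_eq_xxxx mult.assoc)
    then have "\<rho>^4 / (1 - \<rho>^4) \<le> \<rho>^4 / (1/16)"
      by (intro divide_left_mono) auto
    also have "\<dots> = (4 * \<rho>\<^sup>2)\<^sup>2" by (simp add: power_mult_distrib)
    finally show "sqrt (\<integral>p. ((gauss_kernel \<rho> p + gauss_kernel (- \<rho>) p) / 2 - 1)\<^sup>2 \<partial>?G) \<le> 4 * \<rho>\<^sup>2"
      unfolding gauss_kernel_even_dist_sq[OF rho1] by (intro real_le_lsqrt) auto
  qed
  finally show "\<bar>(\<integral>(x, w). g x * h (\<rho> * x + r * w) \<partial>?G) - (\<integral>x. g x \<partial>std_gauss) * (\<integral>x. h x \<partial>std_gauss)\<bar>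
      \<le> 4 * \<rho>\<^sup>2 * ?N" by (simp add: mult.commute)
qed


section \<open>Correlated standard Gaussian families\<close>

lemma mult3_le_abs: "(a::real) * b * c \<le> \<bar>a\<bar> * \<bar>b\<bar> * \<bar>c\<bar>"
  by (metis abs_ge_self abs_mult)

lemma sum_abs_triple_le:
  fixes c :: "nat \<Rightarrow> real"
  assumes "\<And>i. i < d \<Longrightarrow> \<bar>c i\<bar> \<le> 1" "0 \<le> N" "\<And>i j. i < d \<Longrightarrow> j < d \<Longrightarrow> \<bar>C i j\<bar> \<le> 4 * (R i j)\<^sup>2 * N"
  shows "(\<Sum>i<d. \<Sum>j<d. c i * c j * C i j) \<le> 4 * (\<Sum>i<d. \<Sum>j<d. (R i j)\<^sup>2) * (N::real)"
proof -
  have "c i * c j * C i j \<le> 4 * (R i j)\<^sup>2 * N" if "i < d" "j < d" for i j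
  proof -
    have "c i * c j * C i j \<le> \<bar>c i\<bar> * \<bar>c j\<bar> * \<bar>C i j\<bar>" by (rule mult3_le_abs)
    also have "\<dots> \<le> 1 * 1 * (4 * (R i j)\<^sup>2 * N)" using assms that by (intro mult_mono) auto
    finally show ?thesis by simp
  qed
  then have "(\<Sum>i<d. \<Sum>j<d. c i * c j * C i j) \<le> (\<Sum>i<d. \<Sum>j<d. 4 * (R i j)\<^sup>2 * N)"
    by (intro sum_mono) auto
  also have "\<dots> = 4 * (\<Sum>i<d. \<Sum>j<d. (R i j)\<^sup>2) * N"
    by (simp add: sum_distrib_left sum_distrib_right)
  finally show ?thesis .
qed

text \<open>Keeps from the joint Gaussian law what second-moment arguments consume: standard
  marginals, and pairwise covariances that are linear in the correlation in general and quadratic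
  when one of the functions is even.\<close>

locale gauss_noise = prob_space M for M :: "'a measure" +
  fixes d :: nat and \<xi> :: "nat \<Rightarrow> 'a \<Rightarrow> real" and R :: "nat \<Rightarrow> nat \<Rightarrow> real"
  assumes xi_measurable: "i < d \<Longrightarrow> \<xi> i \<in> borel_measurable M"
    and xi_law: "i < d \<Longrightarrow> distr M borel (\<xi> i) = std_gauss"
    and cov_general: "i < d \<Longrightarrow> j < d \<Longrightarrow> g \<in> borel_measurable borel \<Longrightarrow> h \<in> borel_measurable borel \<Longrightarrow>
      integrable std_gauss (\<lambda>x. (g x)\<^sup>2) \<Longrightarrow> integrable std_gauss (\<lambda>x. (h x)\<^sup>2) \<Longrightarrow>
      \<bar>(\<integral>\<omega>. g (\<xi> i \<omega>) * h (\<xi> j \<omega>) \<partial>M) - (\<integral>x. g x \<partial>std_gauss) * (\<integral>x. h x \<partial>std_gauss)\<bar>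
        \<le> 4 * \<bar>R i j\<bar> * (sqrt (\<integral>x. (g x)\<^sup>2 \<partial>std_gauss) * sqrt (\<integral>x. (h x)\<^sup>2 \<partial>std_gauss))"
    and cov_even: "i < d \<Longrightarrow> j < d \<Longrightarrow> g \<in> borel_measurable borel \<Longrightarrow> h \<in> borel_measurable borel \<Longrightarrow>
      integrable std_gauss (\<lambda>x. (g x)\<^sup>2) \<Longrightarrow> integrable std_gauss (\<lambda>x. (h x)\<^sup>2) \<Longrightarrow> (\<And>x. h (- x) = h x) \<Longrightarrow>
      \<bar>(\<integral>\<omega>. g (\<xi> i \<omega>) * h (\<xi> j \<omega>) \<partial>M) - (\<integral>x. g x \<partial>std_gauss) * (\<integral>x. h x \<partial>std_gauss)\<bar>
        \<le> 4 * (R i j)\<^sup>2 * (sqrt (\<integral>x. (g x)\<^sup>2 \<partial>std_gauss) * sqrt (\<integral>x. (h x)\<^sup>2 \<partial>std_gauss))"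

lemma gauss_noise_linear:
  fixes a :: "nat \<Rightarrow> nat \<Rightarrow> real"
  assumes a: "\<And>i. i < d \<Longrightarrow> (\<Sum>k<d. (a i k)\<^sup>2) = 1"
    and R: "\<And>i j. i < d \<Longrightarrow> j < d \<Longrightarrow> R i j = (\<Sum>k<d. a i k * a j k)"
  shows "gauss_noise (PiM {0..<d} (\<lambda>_. std_gauss)) d (\<lambda>i z. \<Sum>k<d. a i k * z k) R"
proof -
  let ?M = "PiM {0..<d} (\<lambda>_. std_gauss)"
  interpret P: prob_space ?M by (rule prob_space_PiM) simp
  have m [measurable]: "(\<lambda>z. \<Sum>k<d. a i k * z k) \<in> borel_measurable ?M" for i
    by (rule borel_measurable_sum) auto
  have law: "distr ?M borel (\<lambda>z. \<Sum>k<d. a i k * z k) = std_gauss" if "i < d" for i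
    using std_gauss_linear[of "{0..<d}" "a i"] a[OF that] unfolding lessThan_atLeast0 by blast
  have cov: "\<bar>(\<integral>z. g (\<Sum>k<d. a i k * z k) * h (\<Sum>k<d. a j k * z k) \<partial>?M) - (\<integral>x. g x \<partial>std_gauss) * (\<integral>x. h x \<partial>std_gauss)\<bar>
        \<le> 4 * \<bar>R i j\<bar> * (sqrt (\<integral>x. (g x)\<^sup>2 \<partial>std_gauss) * sqrt (\<integral>x. (h x)\<^sup>2 \<partial>std_gauss)) \<and>
     ((\<forall>x. h (- x) = h x) \<longrightarrow>
      \<bar>(\<integral>z. g (\<Sum>k<d. a i k * z k) * h (\<Sum>k<d. a j k * z k) \<partial>?M) - (\<integral>x. g x \<partial>std_gauss) * (\<integral>x. h x \<partial>std_gauss)\<bar>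
        \<le> 4 * (R i j)\<^sup>2 * (sqrt (\<integral>x. (g x)\<^sup>2 \<partial>std_gauss) * sqrt (\<integral>x. (h x)\<^sup>2 \<partial>std_gauss)))"
    if ij: "i < d" "j < d" and [measurable]: "g \<in> borel_measurable borel" "h \<in> borel_measurable borel"
      and g: "integrable std_gauss (\<lambda>x. (g x)\<^sup>2)" and h: "integrable std_gauss (\<lambda>x. (h x)\<^sup>2)" for i j g h
  proof -
    obtain r where r: "(R i j)\<^sup>2 + r\<^sup>2 = 1" and
      law2: "distr ?M (borel \<Otimes>\<^sub>M borel) (\<lambda>z. (\<Sum>k<d. a i k * z k, \<Sum>k<d. a j k * z k))
       = distr (std_gauss \<Otimes>\<^sub>M std_gauss) (borel \<Otimes>\<^sub>M borel) (\<lambda>(x, w). (x, R i j * x + r * w))"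
      using std_gauss_linear_pair_distr[of "{0..<d}" "a i" "a j" "R i j"] a[OF ij(1)] a[OF ij(2)] R[OF ij]
      unfolding lessThan_atLeast0 by blast
    let ?N = "sqrt (\<integral>x. (g x)\<^sup>2 \<partial>std_gauss) * sqrt (\<integral>x. (h x)\<^sup>2 \<partial>std_gauss)"
    have N0: "0 \<le> ?N" by simp
    show ?thesis
    proof (cases "(R i j)\<^sup>2 \<le> 1/2")
      case True
      have "(\<integral>z. g (\<Sum>k<d. a i k * z k) * h (\<Sum>k<d. a j k * z k) \<partial>?M)
        = (\<integral>p. (\<lambda>(x, y). g x * h y) p \<partial>distr ?M (borel \<Otimes>\<^sub>M borel) (\<lambda>z. (\<Sum>k<d. a i k * z k, \<Sum>k<d. a j k * z k)))"
        by (subst integral_distr) auto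
      also have "\<dots> = (\<integral>p. (\<lambda>(x, y). g x * h y) (case p of (x, w) \<Rightarrow> (x, R i j * x + r * w)) \<partial>(std_gauss \<Otimes>\<^sub>M std_gauss))"
        unfolding law2 by (rule integral_distr) measurable
      also have "\<dots> = (\<integral>(x, w). g x * h (R i j * x + r * w) \<partial>(std_gauss \<Otimes>\<^sub>M std_gauss))"
        by (simp add: case_prod_unfold)
      finally have e: "(\<integral>z. g (\<Sum>k<d. a i k * z k) * h (\<Sum>k<d. a j k * z k) \<partial>?M) = \<dots>" .
      show ?thesis unfolding e
        by (intro conjI impI std_gauss_corr_cov[OF _ _ g h r True]) (simp_all)
    next
      \<comment> \<open>The mixed moment and the product of the means are each at most the product
        \<open>?N\<close> of the norms, so the covariance is at most \<open>2 * ?N\<close>, and a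
        squared correlation above 1/2 puts this below both claimed bounds. This also covers fully
        correlated pairs, such as \<open>i = j\<close>, which have no joint density.\<close>
      case False
      have g': "(\<integral>z. (g (\<Sum>k<d. a i k * z k))\<^sup>2 \<partial>?M) = (\<integral>x. (g x)\<^sup>2 \<partial>std_gauss)"
        "integrable ?M (\<lambda>z. (g (\<Sum>k<d. a i k * z k))\<^sup>2)"
        using integral_distr[of "\<lambda>z. \<Sum>k<d. a i k * z k" ?M borel "\<lambda>x. (g x)\<^sup>2"]
          integrable_distr_eq[of "\<lambda>z. \<Sum>k<d. a i k * z k" ?M borel "\<lambda>x. (g x)\<^sup>2"] g
        unfolding law[OF ij(1)] by simp_all
      have h': "(\<integral>z. (h (\<Sum>k<d. a j k * z k))\<^sup>2 \<partial>?M) = (\<integral>x. (h x)\<^sup>2 \<partial>std_gauss)"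
        "integrable ?M (\<lambda>z. (h (\<Sum>k<d. a j k * z k))\<^sup>2)"
        using integral_distr[of "\<lambda>z. \<Sum>k<d. a j k * z k" ?M borel "\<lambda>x. (h x)\<^sup>2"]
          integrable_distr_eq[of "\<lambda>z. \<Sum>k<d. a j k * z k" ?M borel "\<lambda>x. (h x)\<^sup>2"] h
        unfolding law[OF ij(2)] by simp_all
      have 1: "\<bar>\<integral>z. g (\<Sum>k<d. a i k * z k) * h (\<Sum>k<d. a j k * z k) \<partial>?M\<bar> \<le> ?N"
        using integral_Cauchy_Schwarz[OF _ _ g'(2) h'(2)] unfolding g' h' by simp
      have 2: "\<bar>(\<integral>x. g x \<partial>std_gauss) * (\<integral>x. h x \<partial>std_gauss)\<bar> \<le> ?N"
        unfolding abs_mult using std_gauss_abs_mean_le[of g] std_gauss_abs_mean_le[of h] g h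
        by (intro mult_mono) auto
      have "2 * ?N \<le> 4 * (R i j)\<^sup>2 * ?N" using False by (intro mult_right_mono[OF _ N0]) simp
      moreover have "2 * ?N \<le> 4 * \<bar>R i j\<bar> * ?N"
      proof (intro mult_right_mono N0)
        have "1/2 < \<bar>R i j\<bar>\<^sup>2" using False by simp
        moreover have "\<bar>R i j\<bar>\<^sup>2 \<le> 1" using r zero_le_power2[of r] unfolding power2_abs by linarith
        then have "\<bar>R i j\<bar> \<le> 1" by (simp add: abs_square_le_1)
        then have "\<bar>R i j\<bar>\<^sup>2 \<le> \<bar>R i j\<bar>" using mult_left_mono[of "\<bar>R i j\<bar>" 1 "\<bar>R i j\<bar>"] by (simp add: power2_eq_square)
        ultimately show "2 \<le> 4 * \<bar>R i j\<bar>" by linarith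
      qed
      ultimately show ?thesis using 1 2 by linarith
    qed
  qed
  show ?thesis
  proof
    fix i j and g h :: "real \<Rightarrow> real"
    assume *: "i < d" "j < d" "g \<in> borel_measurable borel" "h \<in> borel_measurable borel"
      "integrable std_gauss (\<lambda>x. (g x)\<^sup>2)" "integrable std_gauss (\<lambda>x. (h x)\<^sup>2)"
    show "\<bar>(\<integral>z. g (\<Sum>k<d. a i k * z k) * h (\<Sum>k<d. a j k * z k) \<partial>?M) - (\<integral>x. g x \<partial>std_gauss) * (\<integral>x. h x \<partial>std_gauss)\<bar>
        \<le> 4 * \<bar>R i j\<bar> * (sqrt (\<integral>x. (g x)\<^sup>2 \<partial>std_gauss) * sqrt (\<integral>x. (h x)\<^sup>2 \<partial>std_gauss))"
      by (rule conjunct1[OF cov[OF *]])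
    assume "\<And>x. h (- x) = h x"
    then show "\<bar>(\<integral>z. g (\<Sum>k<d. a i k * z k) * h (\<Sum>k<d. a j k * z k) \<partial>?M) - (\<integral>x. g x \<partial>std_gauss) * (\<integral>x. h x \<partial>std_gauss)\<bar>
        \<le> 4 * (R i j)\<^sup>2 * (sqrt (\<integral>x. (g x)\<^sup>2 \<partial>std_gauss) * sqrt (\<integral>x. (h x)\<^sup>2 \<partial>std_gauss))"
      by (intro conjunct2[OF cov[OF *], rule_format])
  qed (use law in simp_all)
qed

section \<open>Chebyshev and Cauchy-Schwarz bounds from second moments\<close>

context prob_space
begin

text \<open>Cauchy-Schwarz against an indicator: on a rare event the integral of a statistic with
  controlled second moment gains the square root of the probability.\<close>

lemma nn_integral_abs_le_sqrt:
  fixes Z :: "'a \<Rightarrow> real"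
  assumes [measurable]: "Z \<in> borel_measurable M" "B \<in> sets M"
    and V: "(\<integral>\<^sup>+\<omega>. ennreal ((Z \<omega>)\<^sup>2) \<partial>M) \<le> ennreal V" and p: "emeasure M B \<le> ennreal p" and "0 \<le> V" "0 \<le> p"
  shows "(\<integral>\<^sup>+\<omega>. ennreal \<bar>Z \<omega>\<bar> * indicator B \<omega> \<partial>M) \<le> ennreal (sqrt V * sqrt p)"
proof -
  let ?I = "\<integral>\<^sup>+\<omega>. ennreal \<bar>Z \<omega>\<bar> * indicator B \<omega> \<partial>M"
  have "?I\<^sup>2 \<le> (\<integral>\<^sup>+\<omega>. (ennreal \<bar>Z \<omega>\<bar>)\<^sup>2 \<partial>M) * (\<integral>\<^sup>+\<omega>. (indicator B \<omega>)\<^sup>2 \<partial>M)"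
    by (rule Cauchy_Schwarz_nn_integral) measurable
  also have "(\<integral>\<^sup>+\<omega>. (ennreal \<bar>Z \<omega>\<bar>)\<^sup>2 \<partial>M) = (\<integral>\<^sup>+\<omega>. ennreal ((Z \<omega>)\<^sup>2) \<partial>M)"
    by (simp add: ennreal_power)
  also have "(\<integral>\<^sup>+\<omega>. (indicator B \<omega> :: ennreal)\<^sup>2 \<partial>M) = emeasure M B"
  proof -
    have "(indicator B \<omega> :: ennreal)\<^sup>2 = indicator B \<omega>" for \<omega> by (simp split: split_indicator)
    then show ?thesis by simp
  qed
  also have "(\<integral>\<^sup>+\<omega>. ennreal ((Z \<omega>)\<^sup>2) \<partial>M) * emeasure M B \<le> ennreal V * ennreal p"
    using V p by (intro mult_mono) auto
  also have "\<dots> = (ennreal (sqrt V * sqrt p))\<^sup>2"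
    using assms by (simp add: ennreal_power ennreal_mult[symmetric] power_mult_distrib)
  finally have sq: "?I\<^sup>2 \<le> (ennreal (sqrt V * sqrt p))\<^sup>2" .
  have "x \<le> y" if "x\<^sup>2 \<le> (ennreal y)\<^sup>2" "0 \<le> y" for x :: ennreal and y
  proof (cases x)
    case (real r)
    then have "r\<^sup>2 \<le> y\<^sup>2" using that by (simp add: ennreal_power)
    then have "r \<le> y" using power2_le_imp_le[OF _ that(2)] by blast
    then show ?thesis using real by (simp add: ennreal_leI)
  next
    case top
    then show ?thesis using that by (simp add: ennreal_power top_unique)
  qed
  from this[OF sq] show ?thesis using \<open>0 \<le> V\<close> \<open>0 \<le> p\<close> by simp
qed

lemma nn_integral_abs_le_sqrt':
  fixes Z :: "'a \<Rightarrow> real"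
  assumes [measurable]: "Z \<in> borel_measurable M"
    and V: "(\<integral>\<^sup>+\<omega>. ennreal ((Z \<omega>)\<^sup>2) \<partial>M) \<le> ennreal V" and "0 \<le> V"
  shows "(\<integral>\<^sup>+\<omega>. ennreal \<bar>Z \<omega>\<bar> \<partial>M) \<le> ennreal (sqrt V)"
proof -
  have "(\<integral>\<^sup>+\<omega>. ennreal \<bar>Z \<omega>\<bar> * indicator (space M) \<omega> \<partial>M) \<le> ennreal (sqrt V * sqrt 1)"
    by (rule nn_integral_abs_le_sqrt) (use assms in \<open>auto simp: emeasure_space_1\<close>)
  then show ?thesis by (simp cong: nn_integral_cong)
qed

text \<open>Chebyshev's inequality, with an upper bound \<open>V\<close> in place of the second
  moment itself.\<close>

lemma emeasure_abs_ge_le: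
  fixes Z :: "'a \<Rightarrow> real"
  assumes [measurable]: "Z \<in> borel_measurable M"
    and V: "(\<integral>\<^sup>+\<omega>. ennreal ((Z \<omega>)\<^sup>2) \<partial>M) \<le> ennreal V" and "0 < a" "0 \<le> V"
  shows "emeasure M {\<omega> \<in> space M. a \<le> \<bar>Z \<omega>\<bar>} \<le> ennreal (V / a\<^sup>2)"
proof -
  have "emeasure M {\<omega> \<in> space M. a \<le> \<bar>Z \<omega>\<bar>} = (\<integral>\<^sup>+\<omega>. indicator {\<omega> \<in> space M. a \<le> \<bar>Z \<omega>\<bar>} \<omega> \<partial>M)"
    by simp
  also have "\<dots> \<le> (\<integral>\<^sup>+\<omega>. ennreal (1 / a\<^sup>2) * ennreal ((Z \<omega>)\<^sup>2) \<partial>M)"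
  proof (rule nn_integral_mono)
    fix \<omega>
    show "indicator {\<omega> \<in> space M. a \<le> \<bar>Z \<omega>\<bar>} \<omega> \<le> ennreal (1 / a\<^sup>2) * ennreal ((Z \<omega>)\<^sup>2)"
    proof (cases "a \<le> \<bar>Z \<omega>\<bar>")
      case True
      then have "a\<^sup>2 \<le> (Z \<omega>)\<^sup>2" using \<open>0 < a\<close> by (metis abs_le_square_iff abs_of_pos)
      then have "1 \<le> 1 / a\<^sup>2 * (Z \<omega>)\<^sup>2" using \<open>0 < a\<close> by (simp add: field_simps)
      then have "1 \<le> ennreal (1 / a\<^sup>2) * ennreal ((Z \<omega>)\<^sup>2)"
        by (simp add: ennreal_mult[symmetric])
      then show ?thesis by (auto simp: indicator_def)
    qed (simp add: indicator_def)
  qed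
  also have "\<dots> = ennreal (1 / a\<^sup>2) * (\<integral>\<^sup>+\<omega>. ennreal ((Z \<omega>)\<^sup>2) \<partial>M)"
    by (rule nn_integral_cmult) measurable
  also have "\<dots> \<le> ennreal (1 / a\<^sup>2) * ennreal V" by (intro mult_left_mono V) simp
  also have "\<dots> = ennreal (V / a\<^sup>2)" using assms by (simp add: ennreal_mult[symmetric])
  finally show ?thesis .
qed

end

context gauss_noise
begin

declare xi_measurable [measurable (raw)]

lemma integral_xi:
  assumes "i < d" and [measurable]: "g \<in> borel_measurable borel"
  shows "(\<integral>\<omega>. g (\<xi> i \<omega>) \<partial>M) = (\<integral>x. g x \<partial>std_gauss :: real)"
  using integral_distr[of "\<xi> i" M borel g] assms xi_measurable[OF assms(1)] unfolding xi_law[OF assms(1)] by simp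

lemma integrable_xi:
  fixes g :: "real \<Rightarrow> real"
  assumes "i < d" and [measurable]: "g \<in> borel_measurable borel" and "integrable std_gauss g"
  shows "integrable M (\<lambda>\<omega>. g (\<xi> i \<omega>))"
  using integrable_distr_eq[of "\<xi> i" M borel g] assms xi_measurable[OF assms(1)] unfolding xi_law[OF assms(1)] by simp

lemma second_moment_sum:
  fixes g :: "nat \<Rightarrow> real \<Rightarrow> real" and c :: "nat \<Rightarrow> real"
  assumes S: "S \<subseteq> {..<d}" and gm: "\<And>i. i \<in> S \<Longrightarrow> g i \<in> borel_measurable borel"
    and g2: "\<And>i. i \<in> S \<Longrightarrow> integrable std_gauss (\<lambda>x. (g i x)\<^sup>2)"
  shows "integrable M (\<lambda>\<omega>. (\<Sum>i\<in>S. c i * (g i (\<xi> i \<omega>) - (\<integral>x. g i x \<partial>std_gauss)))\<^sup>2)"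
    and "(\<integral>\<omega>. (\<Sum>i\<in>S. c i * (g i (\<xi> i \<omega>) - (\<integral>x. g i x \<partial>std_gauss)))\<^sup>2 \<partial>M) =
     (\<Sum>i\<in>S. \<Sum>j\<in>S. c i * c j * ((\<integral>\<omega>. g i (\<xi> i \<omega>) * g j (\<xi> j \<omega>) \<partial>M) - (\<integral>x. g i x \<partial>std_gauss) * (\<integral>x. g j x \<partial>std_gauss)))"
proof -
  define m where "m i = (\<integral>x. g i x \<partial>std_gauss)" for i
  have lt: "i < d" if "i \<in> S" for i using S that by auto
  have i1: "integrable M (\<lambda>\<omega>. g i (\<xi> i \<omega>))" if "i \<in> S" for i
    by (rule integrable_xi[OF lt[OF that] gm[OF that]])
       (rule std_gauss_square_integrable_imp_integrable[OF gm[OF that] g2[OF that]])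
  have meas: "(\<lambda>\<omega>. g i (\<xi> i \<omega>)) \<in> borel_measurable M" if "i \<in> S" for i
    using i1[OF that] by (rule borel_measurable_integrable)
  have i2: "integrable M (\<lambda>\<omega>. g i (\<xi> i \<omega>) * g j (\<xi> j \<omega>))" if "i \<in> S" "j \<in> S" for i j
  proof (rule integrable_mult_of_squares)
    show "integrable M (\<lambda>x. (g i (\<xi> i x))\<^sup>2)" using integrable_xi[OF lt[OF that(1)], of "\<lambda>x. (g i x)\<^sup>2"] gm g2 that by auto
    show "integrable M (\<lambda>x. (g j (\<xi> j x))\<^sup>2)" using integrable_xi[OF lt[OF that(2)], of "\<lambda>x. (g j x)\<^sup>2"] gm g2 that by auto
  qed (use meas that in auto)
  have m: "(\<integral>\<omega>. g i (\<xi> i \<omega>) \<partial>M) = m i" if "i \<in> S" for i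
    unfolding m_def by (rule integral_xi[OF lt[OF that] gm[OF that]])
  have e: "(\<lambda>\<omega>. (\<Sum>i\<in>S. c i * (g i (\<xi> i \<omega>) - m i))\<^sup>2) =
    (\<lambda>\<omega>. \<Sum>i\<in>S. \<Sum>j\<in>S. c i * c j * (g i (\<xi> i \<omega>) * g j (\<xi> j \<omega>) - m j * g i (\<xi> i \<omega>) - m i * g j (\<xi> j \<omega>) + m i * m j))"
    unfolding power2_eq_square sum_product by (intro ext sum.cong refl) (simp add: algebra_simps)
  have I: "integrable M (\<lambda>\<omega>. c i * c j * (g i (\<xi> i \<omega>) * g j (\<xi> j \<omega>) - m j * g i (\<xi> i \<omega>) - m i * g j (\<xi> j \<omega>) + m i * m j))"
    if "i \<in> S" "j \<in> S" for i j
    using i1 i2 that by (intro integrable_mult_right Bochner_Integration.integrable_add Bochner_Integration.integrable_diff) auto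
  show "integrable M (\<lambda>\<omega>. (\<Sum>i\<in>S. c i * (g i (\<xi> i \<omega>) - (\<integral>x. g i x \<partial>std_gauss)))\<^sup>2)"
    unfolding m_def[symmetric] e using I by (intro Bochner_Integration.integrable_sum) auto
  have E: "(\<integral>\<omega>. c i * c j * (g i (\<xi> i \<omega>) * g j (\<xi> j \<omega>) - m j * g i (\<xi> i \<omega>) - m i * g j (\<xi> j \<omega>) + m i * m j) \<partial>M)
    = c i * c j * ((\<integral>\<omega>. g i (\<xi> i \<omega>) * g j (\<xi> j \<omega>) \<partial>M) - m i * m j)" if "i \<in> S" "j \<in> S" for i j
    using i1 i2 m that by (simp add: prob_space)
  have "(\<integral>\<omega>. (\<Sum>i\<in>S. \<Sum>j\<in>S. c i * c j * (g i (\<xi> i \<omega>) * g j (\<xi> j \<omega>) - m j * g i (\<xi> i \<omega>) - m i * g j (\<xi> j \<omega>) + m i * m j)) \<partial>M)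
    = (\<Sum>i\<in>S. \<integral>\<omega>. (\<Sum>j\<in>S. c i * c j * (g i (\<xi> i \<omega>) * g j (\<xi> j \<omega>) - m j * g i (\<xi> i \<omega>) - m i * g j (\<xi> j \<omega>) + m i * m j)) \<partial>M)"
    using I by (intro Bochner_Integration.integral_sum Bochner_Integration.integrable_sum)
  also have "\<dots> = (\<Sum>i\<in>S. \<Sum>j\<in>S. \<integral>\<omega>. c i * c j * (g i (\<xi> i \<omega>) * g j (\<xi> j \<omega>) - m j * g i (\<xi> i \<omega>) - m i * g j (\<xi> j \<omega>) + m i * m j) \<partial>M)"
    using I by (intro sum.cong refl Bochner_Integration.integral_sum)
  also have "\<dots> = (\<Sum>i\<in>S. \<Sum>j\<in>S. c i * c j * ((\<integral>\<omega>. g i (\<xi> i \<omega>) * g j (\<xi> j \<omega>) \<partial>M) - m i * m j))"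
    by (intro sum.cong refl E)
  finally show "(\<integral>\<omega>. (\<Sum>i\<in>S. c i * (g i (\<xi> i \<omega>) - (\<integral>x. g i x \<partial>std_gauss)))\<^sup>2 \<partial>M) =
     (\<Sum>i\<in>S. \<Sum>j\<in>S. c i * c j * ((\<integral>\<omega>. g i (\<xi> i \<omega>) * g j (\<xi> j \<omega>) \<partial>M) - (\<integral>x. g i x \<partial>std_gauss) * (\<integral>x. g j x \<partial>std_gauss)))"
    unfolding m_def[symmetric] e .
qed

definition K :: real where "K = sqrt (\<Sum>i<d. \<Sum>j<d. (R i j)\<^sup>2)"

lemma K_nonneg: "0 \<le> K"
  by (simp add: K_def sum_nonneg)

lemma K_sq: "K\<^sup>2 = (\<Sum>i<d. \<Sum>j<d. (R i j)\<^sup>2)"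
  by (simp add: K_def sum_nonneg)

text \<open>Evenness makes each covariance quadratic in \<open>R i j\<close>, so the double sum
  closes up to \<open>K\<^sup>2\<close> with no loss from the number of coordinates. The function
  \<open>g\<close> is common to all coordinates; the weights \<open>c\<close> carry the variances
  and also serve to switch coordinates off.\<close>

lemma nn_second_moment_even:
  fixes g :: "real \<Rightarrow> real" and c :: "nat \<Rightarrow> real"
  assumes c: "\<And>i. i < d \<Longrightarrow> \<bar>c i\<bar> \<le> 1" and gm: "g \<in> borel_measurable borel"
    and g2: "integrable std_gauss (\<lambda>x. (g x)\<^sup>2)" and ev: "\<And>x. g (- x) = g x"
  shows "(\<integral>\<^sup>+\<omega>. ennreal ((\<Sum>i<d. c i * (g (\<xi> i \<omega>) - (\<integral>x. g x \<partial>std_gauss)))\<^sup>2) \<partial>M) \<le> ennreal (4 * K\<^sup>2 * (\<integral>x. (g x)\<^sup>2 \<partial>std_gauss))"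
proof -
  note s = second_moment_sum[of "{..<d}" "\<lambda>_. g" c, OF _ gm g2]
  have "(\<integral>\<^sup>+\<omega>. ennreal ((\<Sum>i<d. c i * (g (\<xi> i \<omega>) - (\<integral>x. g x \<partial>std_gauss)))\<^sup>2) \<partial>M)
    = ennreal (\<Sum>i<d. \<Sum>j<d. c i * c j * ((\<integral>\<omega>. g (\<xi> i \<omega>) * g (\<xi> j \<omega>) \<partial>M) - (\<integral>x. g x \<partial>std_gauss) * (\<integral>x. g x \<partial>std_gauss)))"
    using s by (subst nn_integral_eq_integral) auto
  also have "\<dots> \<le> ennreal (4 * K\<^sup>2 * (\<integral>x. (g x)\<^sup>2 \<partial>std_gauss))"
    unfolding K_sq
    by (intro ennreal_leI sum_abs_triple_le) (use c cov_even[OF _ _ gm gm g2 g2 ev] in auto)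
  finally show ?thesis .
qed

text \<open>On the support of the signal the functions are shifted and need not be even, so the
  covariances are only linear in \<open>\<bar>R i j\<bar>\<close>. The double sum is left open
  because it is estimated in different ways for different weights.\<close>

lemma nn_second_moment_general:
  fixes g :: "nat \<Rightarrow> real \<Rightarrow> real" and c :: "nat \<Rightarrow> real"
  assumes S: "S \<subseteq> {..<d}" and gm: "\<And>i. i \<in> S \<Longrightarrow> g i \<in> borel_measurable borel"
    and g2: "\<And>i. i \<in> S \<Longrightarrow> integrable std_gauss (\<lambda>x. (g i x)\<^sup>2)"
  shows "(\<integral>\<^sup>+\<omega>. ennreal ((\<Sum>i\<in>S. c i * (g i (\<xi> i \<omega>) - (\<integral>x. g i x \<partial>std_gauss)))\<^sup>2) \<partial>M)
     \<le> ennreal (\<Sum>i\<in>S. \<Sum>j\<in>S. \<bar>c i\<bar> * \<bar>c j\<bar> * (4 * \<bar>R i j\<bar> * (sqrt (\<integral>x. (g i x)\<^sup>2 \<partial>std_gauss) * sqrt (\<integral>x. (g j x)\<^sup>2 \<partial>std_gauss))))"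
proof -
  have lt: "i < d" if "i \<in> S" for i using S that by auto
  have "(\<integral>\<^sup>+\<omega>. ennreal ((\<Sum>i\<in>S. c i * (g i (\<xi> i \<omega>) - (\<integral>x. g i x \<partial>std_gauss)))\<^sup>2) \<partial>M)
    = ennreal (\<Sum>i\<in>S. \<Sum>j\<in>S. c i * c j * ((\<integral>\<omega>. g i (\<xi> i \<omega>) * g j (\<xi> j \<omega>) \<partial>M) - (\<integral>x. g i x \<partial>std_gauss) * (\<integral>x. g j x \<partial>std_gauss)))"
  proof (subst nn_integral_eq_integral)
    show "integrable M (\<lambda>\<omega>. (\<Sum>i\<in>S. c i * (g i (\<xi> i \<omega>) - (\<integral>x. g i x \<partial>std_gauss)))\<^sup>2)"
      by (rule second_moment_sum(1)[OF S]) (use gm g2 in auto)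
    show "ennreal (\<integral>\<omega>. (\<Sum>i\<in>S. c i * (g i (\<xi> i \<omega>) - (\<integral>x. g i x \<partial>std_gauss)))\<^sup>2 \<partial>M) =
      ennreal (\<Sum>i\<in>S. \<Sum>j\<in>S. c i * c j * ((\<integral>\<omega>. g i (\<xi> i \<omega>) * g j (\<xi> j \<omega>) \<partial>M) - (\<integral>x. g i x \<partial>std_gauss) * (\<integral>x. g j x \<partial>std_gauss)))"
      by (rule arg_cong[where f=ennreal], rule second_moment_sum(2)[OF S]) (use gm g2 in auto)
  qed simp
  also have "\<dots> \<le> ennreal (\<Sum>i\<in>S. \<Sum>j\<in>S. \<bar>c i\<bar> * \<bar>c j\<bar> * (4 * \<bar>R i j\<bar> * (sqrt (\<integral>x. (g i x)\<^sup>2 \<partial>std_gauss) * sqrt (\<integral>x. (g j x)\<^sup>2 \<partial>std_gauss))))"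
  proof (intro ennreal_leI sum_mono)
    fix i j assume ij: "i \<in> S" "j \<in> S"
    let ?C = "(\<integral>\<omega>. g i (\<xi> i \<omega>) * g j (\<xi> j \<omega>) \<partial>M) - (\<integral>x. g i x \<partial>std_gauss) * (\<integral>x. g j x \<partial>std_gauss)"
    have "c i * c j * ?C \<le> \<bar>c i\<bar> * \<bar>c j\<bar> * \<bar>?C\<bar>" by (rule mult3_le_abs)
    also have "\<dots> \<le> \<bar>c i\<bar> * \<bar>c j\<bar> * (4 * \<bar>R i j\<bar> * (sqrt (\<integral>x. (g i x)\<^sup>2 \<partial>std_gauss) * sqrt (\<integral>x. (g j x)\<^sup>2 \<partial>std_gauss)))"
      using cov_general[OF lt[OF ij(1)] lt[OF ij(2)] gm[OF ij(1)] gm[OF ij(2)] g2[OF ij(1)] g2[OF ij(2)]]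
      by (rule mult_left_mono) simp
    finally show "c i * c j * ?C \<le> \<bar>c i\<bar> * \<bar>c j\<bar> * (4 * \<bar>R i j\<bar> * (sqrt (\<integral>x. (g i x)\<^sup>2 \<partial>std_gauss) * sqrt (\<integral>x. (g j x)\<^sup>2 \<partial>std_gauss)))" .
  qed
  finally show ?thesis .
qed

end


section \<open>One-dimensional Gaussian estimates\<close>

lemma std_gauss_power: "integrable std_gauss (\<lambda>x. x ^ k)"
  unfolding std_gauss_def by (rule integrable_std_normal_distribution_moment)

lemma std_gauss_moment2: "(\<integral>x. x\<^sup>2 \<partial>std_gauss) = 1"
  using std_normal_distribution_even_moments(1)[of 1] by (simp add: std_gauss_def)

lemma std_gauss_moment4: "(\<integral>x. x ^ 4 \<partial>std_gauss) = 3"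
  using std_normal_distribution_even_moments(1)[of 2] by (simp add: std_gauss_def fact_numeral)

lemma std_gauss_mean: "(\<integral>x. x \<partial>std_gauss) = 0"
  using integral_std_normal_distribution_moment_odd[of 1] by (simp add: std_gauss_def)

lemma std_gauss_char: "(\<integral>x. exp (\<i> * complex_of_real (t * x)) \<partial>std_gauss) = complex_of_real (exp (- (t\<^sup>2) / 2))"
  using fun_cong[OF char_std_normal_distribution, of t] unfolding char_def std_gauss_def by simp

lemma std_gauss_bounded_integrable:
  fixes g :: "real \<Rightarrow> 'b::{banach, second_countable_topology}"
  assumes "g \<in> borel_measurable borel" "\<And>x. norm (g x) \<le> B"
  shows "integrable std_gauss g"
  by (rule std_gauss.integrable_const_bound[of _ B]) (use assms in auto)

lemma std_gauss_cos_sin: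
  "(\<integral>x. cos (t * x) \<partial>std_gauss) = exp (- (t\<^sup>2) / 2)" "(\<integral>x. sin (t * x) \<partial>std_gauss) = 0"
proof -
  have i: "integrable std_gauss (\<lambda>x. exp (\<i> * complex_of_real (t * x)))"
    by (rule std_gauss_bounded_integrable[of _ 1]) auto
  have "(\<integral>x. cos (t * x) \<partial>std_gauss) = (\<integral>x. Re (exp (\<i> * complex_of_real (t * x))) \<partial>std_gauss)"
    by (simp add: Re_exp)
  also have "\<dots> = Re (\<integral>x. exp (\<i> * complex_of_real (t * x)) \<partial>std_gauss)"
    using i by (rule integral_Re)
  finally show "(\<integral>x. cos (t * x) \<partial>std_gauss) = exp (- (t\<^sup>2) / 2)" unfolding std_gauss_char by simp
  have "(\<integral>x. sin (t * x) \<partial>std_gauss) = (\<integral>x. Im (exp (\<i> * complex_of_real (t * x))) \<partial>std_gauss)"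
    by (simp add: Im_exp)
  also have "\<dots> = Im (\<integral>x. exp (\<i> * complex_of_real (t * x)) \<partial>std_gauss)"
    using i by (rule integral_Im)
  finally show "(\<integral>x. sin (t * x) \<partial>std_gauss) = 0" unfolding std_gauss_char by simp
qed

lemma std_gauss_cos_shift:
  "(\<integral>x. cos (t * (m + x)) \<partial>std_gauss) = cos (t * m) * exp (- (t\<^sup>2) / 2)"
proof -
  have "integrable std_gauss (\<lambda>x. cos (t * x))" "integrable std_gauss (\<lambda>x. sin (t * x))"
    by (rule std_gauss_bounded_integrable[of _ 1]; simp)+
  then have "(\<integral>x. cos (t * m) * cos (t * x) - sin (t * m) * sin (t * x) \<partial>std_gauss) = cos (t * m) * exp (- (t\<^sup>2) / 2)"
    by (simp add: std_gauss_cos_sin)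
  then show ?thesis by (simp add: distrib_left cos_add)
qed

lemma std_gauss_integral_leI:
  fixes f :: "real \<Rightarrow> real"
  assumes "f \<in> borel_measurable borel" "\<And>x. 0 \<le> f x"
    "(\<integral>\<^sup>+x. ennreal (std_normal_density x * f x) \<partial>lborel) \<le> ennreal C" "0 \<le> C"
  shows "(\<integral>x. f x \<partial>std_gauss) \<le> C"
proof -
  have "(\<integral>\<^sup>+x. ennreal (f x) \<partial>std_gauss) \<le> ennreal C"
    using assms(3) nn_integral_std_gauss[of "\<lambda>x. ennreal (f x)"] assms(1,2) by (simp add: ennreal_mult)
  then show ?thesis
    using assms by (subst integral_eq_nn_integral) (auto simp: enn2real_leI)
qed

lemma power4_times_density_le: "std_normal_density x * x ^ 4 \<le> 32 * exp (- x\<^sup>2 / 4)"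
proof -
  \<comment> \<open>From exp y >= y^2/2 at y = x^2/4: half of the Gaussian exponent is spent on the
    fourth power.\<close>
  have "(x\<^sup>2/4)\<^sup>2 / 2 \<le> exp (x\<^sup>2/4)"
    using exp_lower_Taylor_quadratic[of "x\<^sup>2/4"] by (smt (verit) divide_nonneg_pos zero_le_power2)
  then have x4: "x ^ 4 \<le> 32 * exp (x\<^sup>2/4)" by (simp add: power_divide)
  have "1 \<le> sqrt (2 * pi)" using pi_gt3 by simp
  then have "std_normal_density x \<le> exp (- x\<^sup>2 / 2)"
    by (simp add: std_normal_density_def divide_le_eq mult_le_cancel_left1)
  then have "std_normal_density x * x ^ 4 \<le> exp (- x\<^sup>2 / 2) * (32 * exp (x\<^sup>2/4))"
    using x4 by (intro mult_mono) auto
  also have "\<dots> = 32 * exp (- x\<^sup>2 / 2 + x\<^sup>2/4)" by (simp only: exp_add)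
  also have "- x\<^sup>2 / 2 + x\<^sup>2/4 = - x\<^sup>2 / 4" by simp
  finally show ?thesis .
qed

text \<open>Of the exponent x^2/4 that remains after absorbing the fourth power, one half is
  integrated as a normal density of variance 4, and the other half, at least tau^2/9 on the tail, is
  taken out. With the later choice of \<open>tau\<close> the factor exp(-tau^2/9) equals 1/(1 +
  F^2/s^2).\<close>

lemma std_gauss_tail4:
  assumes "0 \<le> \<tau>"
  shows "(\<integral>x. x ^ 4 * indicator {x. \<tau> \<le> \<bar>x\<bar>} x \<partial>std_gauss) \<le> 192 * exp (- \<tau>\<^sup>2 / 9)"
proof (rule std_gauss_integral_leI)
  have pt: "std_normal_density x * (x ^ 4 * indicator {x. \<tau> \<le> \<bar>x\<bar>} x) \<le> 192 * exp (- \<tau>\<^sup>2 / 9) * normal_density 0 2 x" for x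
  proof (cases "\<tau> \<le> \<bar>x\<bar>")
    case True
    then have t2: "\<tau>\<^sup>2 \<le> x\<^sup>2" using assms by (metis abs_le_square_iff abs_of_nonneg)
    have "exp (- x\<^sup>2 / 4) \<le> exp (- \<tau>\<^sup>2 / 9 + - x\<^sup>2 / 8)"
    proof (subst exp_le_cancel_iff)
      show "- x\<^sup>2 / 4 \<le> - \<tau>\<^sup>2 / 9 + - x\<^sup>2 / 8" using t2 zero_le_power2[of x] by linarith
    qed
    also have "\<dots> = exp (- \<tau>\<^sup>2 / 9) * exp (- x\<^sup>2 / 8)" by (rule exp_add)
    finally have 1: "exp (- x\<^sup>2 / 4) \<le> exp (- \<tau>\<^sup>2 / 9) * exp (- x\<^sup>2 / 8)" .
    have 2: "exp (- x\<^sup>2 / 8) \<le> 6 * normal_density 0 2 x"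
    proof -
      have "sqrt (8 * pi) \<le> 6" using pi_less_4 by (intro real_le_lsqrt) auto
      then show ?thesis by (simp add: normal_density_def divide_simps)
    qed
    have "std_normal_density x * x ^ 4 \<le> 32 * exp (- x\<^sup>2 / 4)" by (rule power4_times_density_le)
    also have "\<dots> \<le> 32 * (exp (- \<tau>\<^sup>2 / 9) * exp (- x\<^sup>2 / 8))" using 1 by simp
    also have "\<dots> \<le> 32 * (exp (- \<tau>\<^sup>2 / 9) * (6 * normal_density 0 2 x))" using 2 by simp
    finally show ?thesis using True by simp
  qed simp
  have "(\<integral>\<^sup>+x. ennreal (std_normal_density x * (x ^ 4 * indicator {x. \<tau> \<le> \<bar>x\<bar>} x)) \<partial>lborel)
    \<le> (\<integral>\<^sup>+x. ennreal (192 * exp (- \<tau>\<^sup>2 / 9)) * ennreal (normal_density 0 2 x) \<partial>lborel)"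
    using pt by (intro nn_integral_mono) (auto simp: ennreal_mult[symmetric] intro!: ennreal_leI)
  also have "\<dots> = ennreal (192 * exp (- \<tau>\<^sup>2 / 9))"
    by (simp add: nn_integral_cmult nn_integral_normal_density)
  finally show "(\<integral>\<^sup>+x. ennreal (std_normal_density x * (x ^ 4 * indicator {x. \<tau> \<le> \<bar>x\<bar>} x)) \<partial>lborel) \<le> ennreal (192 * exp (- \<tau>\<^sup>2 / 9))" .
qed auto

text \<open>Linearity in the width \<open>v\<close> is the point, as \<open>v\<close> will stand for
  the relative error of the noise estimate. The set lies in two intervals of total length
  \<open>4 * \<tau> * v\<close>, on which |x| >= 3 tau/4; the gap between the exponents 9/64 and 1/9
  absorbs the factor tau.\<close>

lemma std_gauss_box4:
  assumes "0 \<le> \<tau>" "0 \<le> v" "v \<le> 1/4"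
  shows "(\<integral>x. x ^ 4 * indicator {x. \<bar>\<bar>x\<bar> - \<tau>\<bar> \<le> \<tau> * v} x \<partial>std_gauss) \<le> 768 * v * exp (- \<tau>\<^sup>2 / 9)"
proof (rule std_gauss_integral_leI)
  let ?B = "{x. \<bar>\<bar>x\<bar> - \<tau>\<bar> \<le> \<tau> * v}"
  have pt: "std_normal_density x * (x ^ 4 * indicator ?B x) \<le> 32 * exp (- 9 * \<tau>\<^sup>2 / 64) * indicator ?B x" for x
  proof (cases "x \<in> ?B")
    case True
    have "\<tau> * v \<le> \<tau> * (1/4)" using assms by (intro mult_left_mono)
    then have "3/4 * \<tau> \<le> \<bar>x\<bar>" using True by auto
    then have "(3/4 * \<tau>)\<^sup>2 \<le> \<bar>x\<bar>\<^sup>2" using assms by (intro power_mono) auto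
    then have "exp (- x\<^sup>2 / 4) \<le> exp (- 9 * \<tau>\<^sup>2 / 64)" by (simp add: power_mult_distrib power_divide)
    then have "std_normal_density x * x ^ 4 \<le> 32 * exp (- 9 * \<tau>\<^sup>2 / 64)"
      using power4_times_density_le[of x] by linarith
    then show ?thesis using True by simp
  qed simp
  have sub: "?B \<subseteq> {\<tau> - \<tau> * v..\<tau> + \<tau> * v} \<union> {- \<tau> - \<tau> * v..- \<tau> + \<tau> * v}" by auto
  have tv: "0 \<le> \<tau> * v" using assms by simp
  have "emeasure lborel ?B \<le> emeasure lborel ({\<tau> - \<tau> * v..\<tau> + \<tau> * v} \<union> {- \<tau> - \<tau> * v..- \<tau> + \<tau> * v})"
    by (intro emeasure_mono sub) simp
  also have "\<dots> \<le> emeasure lborel {\<tau> - \<tau> * v..\<tau> + \<tau> * v} + emeasure lborel {- \<tau> - \<tau> * v..- \<tau> + \<tau> * v}"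
    by (rule emeasure_subadditive) auto
  also have "\<dots> = ennreal (4 * \<tau> * v)" using tv by (simp add: ennreal_plus[symmetric] del: ennreal_plus)
  finally have B: "emeasure lborel ?B \<le> ennreal (4 * \<tau> * v)" .
  have [measurable]: "?B \<in> sets borel" by measurable
  have "(\<integral>\<^sup>+x. ennreal (std_normal_density x * (x ^ 4 * indicator ?B x)) \<partial>lborel)
    \<le> (\<integral>\<^sup>+x. ennreal (32 * exp (- 9 * \<tau>\<^sup>2 / 64)) * indicator ?B x \<partial>lborel)"
    using pt by (intro nn_integral_mono) (auto simp: ennreal_indicator[symmetric] ennreal_mult[symmetric] simp del: ennreal_indicator intro!: ennreal_leI)
  also have "\<dots> = ennreal (32 * exp (- 9 * \<tau>\<^sup>2 / 64)) * emeasure lborel ?B"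
    by (simp add: nn_integral_cmult_indicator)
  also have "\<dots> \<le> ennreal (32 * exp (- 9 * \<tau>\<^sup>2 / 64)) * ennreal (4 * \<tau> * v)"
    by (intro mult_left_mono B) simp
  also have "\<dots> = ennreal (32 * exp (- 9 * \<tau>\<^sup>2 / 64) * (4 * \<tau> * v))"
    using tv by (simp add: ennreal_mult[symmetric])
  also have "\<dots> \<le> ennreal (768 * v * exp (- \<tau>\<^sup>2 / 9))"
  proof (rule ennreal_leI)
    have "\<tau> / 6 \<le> 1 + (\<tau> / 6)\<^sup>2"
      using zero_le_power2[of "\<tau> / 6 - 1/2"] by (simp add: power2_eq_square algebra_simps)
    also have "\<dots> \<le> exp ((\<tau> / 6)\<^sup>2)" by (rule exp_ge_add_one_self)
    finally have "\<tau> \<le> 6 * exp (\<tau>\<^sup>2 / 36)" by (simp add: power_divide)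
    then have "exp (- 9 * \<tau>\<^sup>2 / 64) * \<tau> \<le> exp (- 9 * \<tau>\<^sup>2 / 64) * (6 * exp (\<tau>\<^sup>2 / 36))"
      by (intro mult_left_mono) auto
    also have "\<dots> = 6 * exp (- 9 * \<tau>\<^sup>2 / 64 + \<tau>\<^sup>2 / 36)" by (simp only: exp_add)
    also have "\<dots> \<le> 6 * exp (- \<tau>\<^sup>2 / 9)" using zero_le_power2[of \<tau>] by (simp add: field_simps)
    finally have "exp (- 9 * \<tau>\<^sup>2 / 64) * \<tau> * (128 * v) \<le> 6 * exp (- \<tau>\<^sup>2 / 9) * (128 * v)"
      using assms by (intro mult_right_mono) auto
    then show "32 * exp (- 9 * \<tau>\<^sup>2 / 64) * (4 * \<tau> * v) \<le> 768 * v * exp (- \<tau>\<^sup>2 / 9)"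
      by (simp add: algebra_simps)
  qed
  finally show "(\<integral>\<^sup>+x. ennreal (std_normal_density x * (x ^ 4 * indicator ?B x)) \<partial>lborel) \<le> ennreal (768 * v * exp (- \<tau>\<^sup>2 / 9))" .
  show "0 \<le> 768 * v * exp (- \<tau>\<^sup>2 / 9)" using assms by simp
qed auto

section \<open>The chi-square distribution function and its quantiles\<close>

lemma chi2_cdf_mono: "x \<le> y \<Longrightarrow> chi2_cdf x \<le> chi2_cdf y"
  unfolding chi2_cdf_def by (rule std_gauss.finite_measure_mono) auto

lemma chi2_cdf_eq_integral: "chi2_cdf x = (\<integral>z. indicator {z. z\<^sup>2 \<le> x} z \<partial>std_gauss)"
  unfolding chi2_cdf_def by simp

text \<open>The density is at most 9/20 on an interval of length one. The margin below 1/2 makes the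
  median test fail at the start of the dyadic grid even after small deviations.\<close>

lemma chi2_cdf_quarter: "chi2_cdf (1/4) \<le> 9/20"
  unfolding chi2_cdf_eq_integral
proof (rule std_gauss_integral_leI)
  have s: "(1::real) / sqrt (2 * pi) \<le> 9/20"
  proof -
    have "20/9 \<le> sqrt (2 * pi)" using pi_gt3 by (intro real_le_rsqrt) (auto simp: power2_eq_square)
    then show ?thesis by (simp add: field_simps)
  qed
  have e: "{z::real. z\<^sup>2 \<le> 1/4} = {-1/2..1/2}"
  proof -
    have "z\<^sup>2 \<le> 1/4 \<longleftrightarrow> \<bar>z\<bar> \<le> 1/2" for z :: real
      using abs_le_square_iff[of z "1/2"] by (simp add: power2_eq_square)
    then show ?thesis unfolding set_eq_iff mem_Collect_eq atLeastAtMost_iff abs_le_iff by (smt (verit) divide_minus_left)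
  qed
  have "std_normal_density x \<le> 9/20" for x
  proof -
    have "std_normal_density x \<le> 1 / sqrt (2 * pi) * 1"
      unfolding std_normal_density_def by (intro mult_left_mono) auto
    then show ?thesis using s by simp
  qed
  then have "(\<integral>\<^sup>+x. ennreal (std_normal_density x * indicator {z. z\<^sup>2 \<le> 1/4} x) \<partial>lborel) \<le> (\<integral>\<^sup>+x. ennreal (9/20) * indicator {-1/2..1/2::real} x \<partial>lborel)"
    unfolding e by (intro nn_integral_mono) (auto split: split_indicator intro!: ennreal_leI)
  also have "\<dots> = ennreal (9/20)" by (simp add: nn_integral_cmult_indicator)
  finally show "(\<integral>\<^sup>+x. ennreal (std_normal_density x * indicator {z. z\<^sup>2 \<le> 1/4} x) \<partial>lborel) \<le> ennreal (9/20)" .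
qed auto

lemma chi2_cdf_compl: "(\<integral>z. indicator {z. x < z\<^sup>2} z \<partial>std_gauss) = 1 - chi2_cdf x"
proof -
  have "measure std_gauss (space std_gauss - {z. z\<^sup>2 \<le> x}) = 1 - chi2_cdf x"
    unfolding chi2_cdf_def by (rule std_gauss.prob_compl) auto
  moreover have "space std_gauss - {z. z\<^sup>2 \<le> x} = {z. x < z\<^sup>2}" by auto
  ultimately show ?thesis by simp
qed

text \<open>Markov's inequality for the fourth moment. Decay of second order makes level times tail
  probability summable over dyadic levels.\<close>

lemma chi2_cdf_tail:
  assumes "0 < x"
  shows "1 - chi2_cdf x \<le> 3 / x\<^sup>2"
proof -
  have "(\<integral>z. indicator {z. x < z\<^sup>2} z \<partial>std_gauss) \<le> (\<integral>z. z ^ 4 / x\<^sup>2 \<partial>std_gauss)"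
  proof (rule integral_mono)
    show "integrable std_gauss (indicator {z. x < z\<^sup>2} :: real \<Rightarrow> real)"
      by (rule std_gauss_bounded_integrable[of _ 1]) (auto split: split_indicator)
    show "integrable std_gauss (\<lambda>z. z ^ 4 / x\<^sup>2)" using std_gauss_power[of 4] by simp
    fix z :: real
    show "indicator {z. x < z\<^sup>2} z \<le> z ^ 4 / x\<^sup>2"
    proof (cases "x < z\<^sup>2")
      case True
      then have "x\<^sup>2 \<le> (z\<^sup>2)\<^sup>2" using assms by (intro power_mono) auto
      then show ?thesis using True assms by simp
    qed simp
  qed
  then show ?thesis using chi2_cdf_compl[of x] std_gauss_moment4 by simp
qed

text \<open>A lower bound for the slope of \<open>chi2_cdf\<close> on the interval from 0 to 16: the
  normal density is at least its value at 4 on [0, 4], and the square root has slope at least 1/8 up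
  to 16.\<close>

definition ell :: real where "ell = std_normal_density 4 / 8"

lemma ell_pos: "0 < ell"
  by (simp add: ell_def normal_density_pos)

lemma ell_le: "ell \<le> 1/8"
proof -
  have "1 \<le> sqrt (2 * pi)" using pi_gt3 by simp
  then have "1 / sqrt (2 * pi) \<le> 1" by simp
  then have "1 / sqrt (2 * pi) * exp (- 4\<^sup>2 / 2) \<le> 1 * (1::real)" by (intro mult_mono) auto
  then show ?thesis unfolding ell_def std_normal_density_def by simp
qed

lemma chi2_cdf_diff:
  assumes "0 \<le> x" "x \<le> y" "y \<le> 16"
  shows "ell * (y - x) \<le> chi2_cdf y - chi2_cdf x"
proof -
  have sq: "0 \<le> sqrt x" "sqrt x \<le> sqrt y" "sqrt y \<le> 4" using assms by (auto intro: real_le_lsqrt)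
  have D: "std_normal_density 4 \<le> std_normal_density z" if "z \<in> {sqrt x<..sqrt y}" for z
  proof -
    have "sqrt x < z" "z \<le> sqrt y" using that by auto
    then have "0 \<le> z" "z \<le> 4" using sq by linarith+
    then have "z\<^sup>2 \<le> 4\<^sup>2" by (intro power_mono)
    then show ?thesis unfolding std_normal_density_def by (intro mult_left_mono) auto
  qed
  have "ennreal (std_normal_density 4 * (sqrt y - sqrt x)) = (\<integral>\<^sup>+z. ennreal (std_normal_density 4) * indicator {sqrt x<..sqrt y} z \<partial>lborel)"
    using sq by (simp add: nn_integral_cmult_indicator ennreal_mult)
  also have "\<dots> \<le> (\<integral>\<^sup>+z. ennreal (std_normal_density z) * indicator {sqrt x<..sqrt y} z \<partial>lborel)"
    using D by (intro nn_integral_mono) (auto split: split_indicator intro!: ennreal_leI)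
  also have "\<dots> = emeasure std_gauss {sqrt x<..sqrt y}"
    unfolding std_gauss_def by (subst emeasure_density) auto
  finally have 1: "std_normal_density 4 * (sqrt y - sqrt x) \<le> measure std_gauss {sqrt x<..sqrt y}"
    by (simp add: std_gauss.emeasure_eq_measure)
  have "(sqrt y - sqrt x) * (sqrt y + sqrt x) = y - x"
    using assms by (simp add: algebra_simps)
  moreover have "(sqrt y - sqrt x) * (sqrt y + sqrt x) \<le> (sqrt y - sqrt x) * 8"
    using sq by (intro mult_left_mono; linarith)
  ultimately have "(y - x) / 8 \<le> sqrt y - sqrt x" by simp
  then have "std_normal_density 4 * ((y - x) / 8) \<le> std_normal_density 4 * (sqrt y - sqrt x)"
    by (intro mult_left_mono) auto
  then have 2: "ell * (y - x) \<le> measure std_gauss {sqrt x<..sqrt y}" using 1 by (simp add: ell_def)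
  have "{sqrt x<..sqrt y} \<subseteq> {z. z\<^sup>2 \<le> y} - {z. z\<^sup>2 \<le> x}"
  proof
    fix z assume z: "z \<in> {sqrt x<..sqrt y}"
    then have "sqrt x < z" by simp
    then have z0: "0 \<le> z" using sq(1) by linarith
    have "z\<^sup>2 \<le> (sqrt y)\<^sup>2" using z z0 by (intro power_mono) auto
    moreover have "(sqrt x)\<^sup>2 < z\<^sup>2" using \<open>sqrt x < z\<close> sq(1) by (rule power_strict_mono) simp
    ultimately show "z \<in> {z. z\<^sup>2 \<le> y} - {z. z\<^sup>2 \<le> x}" using assms by auto
  qed
  then have "measure std_gauss {sqrt x<..sqrt y} \<le> measure std_gauss ({z. z\<^sup>2 \<le> y} - {z. z\<^sup>2 \<le> x})"
    by (intro std_gauss.finite_measure_mono) auto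
  also have "\<dots> = chi2_cdf y - chi2_cdf x"
    unfolding chi2_cdf_def by (rule std_gauss.finite_measure_Diff) (use assms in auto)
  finally show ?thesis using 2 by simp
qed

text \<open>Keeps the divisor in \<open>sigmaS2\<close> away from zero at every level that passes
  the median test.\<close>

lemma chi2_quantile_ge:
  assumes "1/2 \<le> p"
  shows "ereal (1/4) \<le> chi2_quantile p"
  unfolding chi2_quantile_def
proof (rule Inf_greatest)
  fix q assume "q \<in> {ereal x | x. 0 \<le> x \<and> p \<le> chi2_cdf x}"
  then obtain x where x: "q = ereal x" "p \<le> chi2_cdf x" by auto
  have "\<not> x < 1/4"
    using chi2_cdf_mono[of x "1/4"] chi2_cdf_quarter x assms by auto
  then show "ereal (1/4) \<le> q" using x by simp
qed

text \<open>The inverse of \<open>chi2_cdf_diff\<close>: where the distribution function has slope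
  at least \<open>ell\<close>, an error \<open>e\<close> in the probability moves the quantile by at
  most \<open>e / ell\<close>. The bound 16 is the end of the interval on which the slope is
  controlled.\<close>

lemma chi2_quantile_near:
  assumes T: "0 \<le> T" and e: "T + e / ell \<le> 16" "0 \<le> e" and p: "\<bar>p - chi2_cdf T\<bar> \<le> e"
  obtains r where "chi2_quantile p = ereal r" "\<bar>r - T\<bar> \<le> e / ell"
proof -
  have ee: "0 \<le> e / ell" using e ell_pos by simp
  have "ell * (e / ell) \<le> chi2_cdf (T + e / ell) - chi2_cdf T"
    using chi2_cdf_diff[of T "T + e / ell"] T e ee by simp
  then have "e \<le> chi2_cdf (T + e / ell) - chi2_cdf T" using ell_pos by simp
  then have "p \<le> chi2_cdf (T + e / ell)" using p by linarith
  then have up: "chi2_quantile p \<le> ereal (T + e / ell)"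
    unfolding chi2_quantile_def using T ee by (intro Inf_lower) auto
  have lo: "ereal (T - e / ell) \<le> chi2_quantile p"
    unfolding chi2_quantile_def
  proof (rule Inf_greatest)
    fix q assume "q \<in> {ereal x | x. 0 \<le> x \<and> p \<le> chi2_cdf x}"
    then obtain x where x: "q = ereal x" "0 \<le> x" "p \<le> chi2_cdf x" by auto
    have "\<not> x < T - e / ell"
    proof
      assume *: "x < T - e / ell"
      then have "ell * (e / ell) < ell * (T - x)" using ell_pos by (intro mult_strict_left_mono) auto
      then have "e < ell * (T - x)" using ell_pos by simp
      also have "\<dots> \<le> chi2_cdf T - chi2_cdf x" using chi2_cdf_diff[of x T] x * e ee by simp
      finally show False using x p by linarith
    qed
    then show "ereal (T - e / ell) \<le> q" using x by simp
  qed
  show ?thesis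
  proof (cases "chi2_quantile p")
    case (real r)
    then show ?thesis using that[of r] up lo by simp
  qed (use up lo in auto)
qed


section \<open>Deterministic properties of the noise estimators\<close>

text \<open>The empirical distribution function of squares in noise units, with the unknown scale
  removed.\<close>

definition ecdf :: "nat \<Rightarrow> (nat \<Rightarrow> real) \<Rightarrow> real \<Rightarrow> real" where
  "ecdf d V x = real (card {i\<in>{0..<d}. (V i)\<^sup>2 \<le> x}) / real d"

lemma Fhat_eq_ecdf:
  assumes "0 < \<sigma>" "\<And>i. i < d \<Longrightarrow> Ytil S Y i = \<sigma> * V i"
  shows "Fhat d S Y t = ecdf d V (t / \<sigma>\<^sup>2)"
proof -
  have "{i\<in>{0..<d}. (Ytil S Y i)\<^sup>2 \<le> t} = {i\<in>{0..<d}. (V i)\<^sup>2 \<le> t / \<sigma>\<^sup>2}"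
    using assms by (auto simp: power_mult_distrib field_simps)
  then show ?thesis by (simp add: Fhat_def ecdf_def)
qed

lemma ecdf_perturb:
  assumes "d \<ge> 1" "finite S" "\<And>i. i < d \<Longrightarrow> i \<notin> S \<Longrightarrow> V i = W i"
  shows "\<bar>ecdf d V x - ecdf d W x\<bar> \<le> real (card S) / real d"
proof -
  have *: "card {i\<in>{0..<d}. (V i)\<^sup>2 \<le> x} \<le> card {i\<in>{0..<d}. (W i)\<^sup>2 \<le> x} + card S"
    if "\<And>i. i < d \<Longrightarrow> i \<notin> S \<Longrightarrow> V i = W i" for V W :: "nat \<Rightarrow> real"
  proof -
    have "card {i\<in>{0..<d}. (V i)\<^sup>2 \<le> x} \<le> card ({i\<in>{0..<d}. (W i)\<^sup>2 \<le> x} \<union> S)"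
      using that assms(2) by (intro card_mono) auto
    also have "\<dots> \<le> card {i\<in>{0..<d}. (W i)\<^sup>2 \<le> x} + card S" by (rule card_Un_le)
    finally show ?thesis .
  qed
  let ?v = "card {i\<in>{0..<d}. (V i)\<^sup>2 \<le> x}" and ?w = "card {i\<in>{0..<d}. (W i)\<^sup>2 \<le> x}"
  have "?v \<le> ?w + card S" using *[of V W] assms(3) by blast
  moreover have "?w \<le> ?v + card S" using *[of W V] assms(3) by (metis (no_types, lifting))
  ultimately have "\<bar>real ?v - real ?w\<bar> \<le> real (card S)" by linarith
  then have "\<bar>real ?v - real ?w\<bar> / real d \<le> real (card S) / real d" by (intro divide_right_mono) auto
  then show ?thesis by (simp add: ecdf_def diff_divide_distrib[symmetric] abs_divide)
qed

lemma Fhat_mono: "t \<le> u \<Longrightarrow> Fhat d S Y t \<le> Fhat d S Y u"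
  unfolding Fhat_def by (intro divide_right_mono of_nat_mono card_mono) auto

lemma powr_int_mono: "(2::real) powr real_of_int a \<le> 2 powr real_of_int b \<longleftrightarrow> a \<le> b"
  by simp

lemma Fhat_eventually:
  assumes "1 \<le> d"
  shows "\<exists>n::nat. \<forall>l::int. int n \<le> l \<longrightarrow> Fhat d S Y (2 powr real_of_int l) = 1"
proof -
  define B where "B = (\<Sum>i<d. (Ytil S Y i)\<^sup>2)"
  obtain n where n: "B < real n" using reals_Archimedean2 by blast
  have "Fhat d S Y (2 powr real_of_int l) = 1" if "int n \<le> l" for l :: int
  proof -
    have "real n \<le> 2 ^ n" using of_nat_less_two_power[of n] by (metis less_imp_le)
    also have "\<dots> = 2 powr real n" by (simp add: powr_realpow)
    also have "\<dots> \<le> 2 powr real_of_int l" using that by (intro powr_mono) auto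
    finally have "B \<le> 2 powr real_of_int l" using n by simp
    moreover have "(Ytil S Y i)\<^sup>2 \<le> B" if "i < d" for i
      unfolding B_def using that by (intro member_le_sum) auto
    ultimately have "{i\<in>{0..<d}. (Ytil S Y i)\<^sup>2 \<le> 2 powr real_of_int l} = {0..<d}" by force
    then show ?thesis using assms by (simp add: Fhat_def)
  qed
  then show ?thesis by blast
qed

lemma that_set_nonempty:
  assumes "1 \<le> d"
  shows "{(2::real) powr (real_of_int l) | l. 1/2 \<le> Fhat d S Y (2 powr (real_of_int l))} \<noteq> {}"
proof -
  obtain n where "Fhat d S Y (2 powr real_of_int (int n)) = 1" using Fhat_eventually[OF assms, of S Y] by blast
  then have "1/2 \<le> Fhat d S Y (2 powr real_of_int (int n))" by simp
  then show ?thesis by blast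
qed

lemma that_set_bdd: "bdd_below {(2::real) powr (real_of_int l) | l. 1/2 \<le> Fhat d S Y (2 powr (real_of_int l))}"
  by (rule bdd_belowI[of _ 0]) auto

lemma that_nonneg:
  assumes "1 \<le> d" shows "0 \<le> that d S Y"
  unfolding that_def by (rule cInf_greatest[OF that_set_nonempty[OF assms]]) auto

text \<open>The infimum over all integers need not be attained: it is zero when at least half of the
  observations vanish. One failing level \<open>m\<close> turns the search into that of a least
  natural number.\<close>

lemma that_attained:
  assumes "1 \<le> d" and m: "Fhat d S Y (2 powr real_of_int m) < 1/2"
  obtains l where "that d S Y = 2 powr real_of_int l" "1/2 \<le> Fhat d S Y (2 powr real_of_int l)"
    "Fhat d S Y (2 powr real_of_int (l - 1)) < 1/2" "m < l"
proof -
  let ?P = "\<lambda>n. 1/2 \<le> Fhat d S Y (2 powr real_of_int (m + int n))"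
  obtain n where n: "\<forall>l::int. int n \<le> l \<longrightarrow> Fhat d S Y (2 powr real_of_int l) = 1"
    using Fhat_eventually[OF assms(1), of S Y] by blast
  have "?P (n + nat \<bar>m\<bar>)" using n[rule_format, of "m + int (n + nat \<bar>m\<bar>)"] by simp
  define k where "k = (LEAST n. ?P n)"
  have k: "?P k" unfolding k_def by (rule LeastI) fact
  have kmin: "\<not> ?P j" if "j < k" for j using not_less_Least[of j ?P] that k_def by blast
  have "k \<noteq> 0"
  proof
    assume "k = 0" then show False using k m by simp
  qed
  define l where "l = m + int k"
  have below: "Fhat d S Y (2 powr real_of_int (l - 1)) < 1/2"
  proof -
    have "l - 1 = m + int (k - 1)" using \<open>k \<noteq> 0\<close> by (simp add: l_def of_nat_diff)
    moreover have "\<not> ?P (k - 1)" using kmin[of "k - 1"] \<open>k \<noteq> 0\<close> by auto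
    ultimately show ?thesis by (simp only: not_le)
  qed
  have "that d S Y = 2 powr real_of_int l"
    unfolding that_def
  proof (rule cInf_eq_minimum)
    show "2 powr real_of_int l \<in> {(2::real) powr (real_of_int l) | l. 1/2 \<le> Fhat d S Y (2 powr (real_of_int l))}"
      using k unfolding l_def by blast
    fix x assume "x \<in> {(2::real) powr (real_of_int l) | l. 1/2 \<le> Fhat d S Y (2 powr (real_of_int l))}"
    then obtain l' where l': "x = 2 powr real_of_int l'" "1/2 \<le> Fhat d S Y (2 powr real_of_int l')" by blast
    have "\<not> l' \<le> l - 1"
      using below l' Fhat_mono[of "2 powr real_of_int l'" "2 powr real_of_int (l - 1)" d S Y]
      by (auto simp: powr_int_mono simp del: of_int_diff)
    then show "2 powr real_of_int l \<le> x" using l' by simp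
  qed
  moreover have "m < l" using \<open>k \<noteq> 0\<close> by (simp add: l_def)
  ultimately show ?thesis using that[of l] below k[folded l_def] by blast
qed

text \<open>If every level passed the median test, the negative powers of two would all be in the
  set and the infimum would be zero.\<close>

lemma that_pos_imp:
  assumes "1 \<le> d" and pos: "0 < that d S Y"
  obtains m :: int where "Fhat d S Y (2 powr real_of_int m) < 1/2"
proof -
  have "\<exists>m::int. Fhat d S Y (2 powr real_of_int m) < 1/2"
  proof (rule ccontr)
    assume "\<nexists>m::int. Fhat d S Y (2 powr real_of_int m) < 1/2"
    then have all: "1/2 \<le> Fhat d S Y (2 powr real_of_int m)" for m :: int by (meson not_le)
    obtain n where n: "inverse (that d S Y) < real n" using reals_Archimedean2 by blast
    have "that d S Y \<le> 2 powr real_of_int (- int n)"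
      unfolding that_def using all by (intro cInf_lower that_set_bdd) blast
    also have "\<dots> = inverse (2 ^ n)" by (simp add: powr_minus powr_realpow)
    also have "\<dots> \<le> inverse (real n)"
    proof (rule le_imp_inverse_le)
      show "real n \<le> 2 ^ n" using of_nat_less_two_power[of n] by (metis less_imp_le)
      show "0 < real n" using n pos by (meson inverse_positive_iff_positive order.strict_trans)
    qed
    also have "\<dots> < that d S Y"
      using n pos by (metis inverse_inverse_eq inverse_less_iff_less inverse_positive_iff_positive order.strict_trans)
    finally show False by simp
  qed
  then show ?thesis using that by blast
qed

lemma sigmaS2_eq:
  assumes "0 < Fhat d S Y (that d S Y)" "chi2_quantile (Fhat d S Y (that d S Y)) = ereal r" "r \<noteq> 0"
  shows "sigmaS2 d S Y = that d S Y / r"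
  using assms by (simp add: sigmaS2_def sigmaS2_fun_def)

lemma sigmaS2_bounds:
  assumes "1 \<le> d"
  shows "0 \<le> sigmaS2 d S Y" "sigmaS2 d S Y \<le> 4 * that d S Y"
proof -
  have "0 \<le> sigmaS2 d S Y \<and> sigmaS2 d S Y \<le> 4 * that d S Y"
  proof (cases "that d S Y = 0")
    \<comment> \<open>The value is zero divided by the quantile, or infinity if \<open>Fhat\<close>
      vanishes; \<open>real_of_ereal\<close> yields zero in both cases.\<close>
    case True
    then show ?thesis
      by (cases "chi2_quantile (Fhat d S Y 0)") (auto simp: sigmaS2_def sigmaS2_fun_def)
  next
    case False
    then have pos: "0 < that d S Y" using that_nonneg[OF assms, of S Y] by simp
    obtain m where "Fhat d S Y (2 powr real_of_int m) < 1/2" using that_pos_imp[OF assms pos] .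
    then obtain l where l: "that d S Y = 2 powr real_of_int l" "1/2 \<le> Fhat d S Y (2 powr real_of_int l)"
      using that_attained[OF assms] by metis
    then have half: "1/2 \<le> Fhat d S Y (that d S Y)" by simp
    have q: "ereal (1/4) \<le> chi2_quantile (Fhat d S Y (that d S Y))" by (rule chi2_quantile_ge[OF half])
    show ?thesis
    proof (cases "chi2_quantile (Fhat d S Y (that d S Y))")
      case (real r)
      then have r: "1/4 \<le> r" using q by simp
      then have "sigmaS2 d S Y = that d S Y / r" using real half by (intro sigmaS2_eq) auto
      moreover have "that d S Y / r \<le> that d S Y / (1/4)" using r pos by (intro divide_left_mono) auto
      ultimately show ?thesis using r pos by simp
    next
      \<comment> \<open>This occurs when all observations lie below the level: the quantile of 1 is
        an infimum over the empty set, and the quotient is zero.\<close>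
      case PInf
      then show ?thesis using pos half by (simp add: sigmaS2_def sigmaS2_fun_def)
    next
      case MInf
      then show ?thesis using q by simp
    qed
  qed
  then show "0 \<le> sigmaS2 d S Y" "sigmaS2 d S Y \<le> 4 * that d S Y" by auto
qed

text \<open>Anchors the dyadic grid to the unknown variance. Up to 1/4 the distribution function is
  at most 9/20; starting above 1/8, five doublings lead past 4, where it is at least 13/16. Hence
  the search crosses 1/2 within five steps unless there is a large deviation.\<close>

lemma dyadic_base:
  assumes "0 < (\<sigma>::real)"
  obtains l :: int where "1/8 < 2 powr real_of_int l / \<sigma>\<^sup>2" "2 powr real_of_int l / \<sigma>\<^sup>2 \<le> 1/4"
proof -
  define l where "l = \<lfloor>log 2 (\<sigma>\<^sup>2 / 4)\<rfloor>"
  have p: "2 powr log 2 (\<sigma>\<^sup>2 / 4) = \<sigma>\<^sup>2 / 4" using assms by simp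
  have "2 powr real_of_int l \<le> 2 powr log 2 (\<sigma>\<^sup>2 / 4)" unfolding l_def by (intro powr_mono) auto
  then have 1: "2 powr real_of_int l \<le> \<sigma>\<^sup>2 / 4" using p by simp
  have "2 powr log 2 (\<sigma>\<^sup>2 / 4) < 2 powr (real_of_int l + 1)" unfolding l_def by (intro powr_less_mono) auto
  then have 2: "\<sigma>\<^sup>2 / 4 < 2 * 2 powr real_of_int l" using p by (simp add: powr_add)
  show ?thesis using that[of l] 1 2 assms by (simp add: field_simps)
qed

lemma powr_int_add_nat: "(2::real) powr real_of_int (l + int j) = 2 powr real_of_int l * 2 ^ j"
  by (simp add: powr_add powr_realpow)

text \<open>Closeness is required at six points only, from the start of the grid, where the median
  test must fail, to the fifth doubling, where it must succeed. At the level found, the quantile is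
  close to the level in noise units, and \<open>w\<close> is the ratio of the two.\<close>

lemma estimator_good:
  fixes \<sigma> e :: real and l0 :: int
  assumes d: "1 \<le> d" and \<sigma>: "0 < \<sigma>" and F: "\<And>t. Fhat d S Y t = ecdf d V (t / \<sigma>\<^sup>2)"
    and x0: "x0 = 2 powr real_of_int l0 / \<sigma>\<^sup>2" "1/8 < x0" "x0 \<le> 1/4"
    and e: "0 \<le> e" "e \<le> ell / 64" "\<And>j. j < 6 \<Longrightarrow> \<bar>ecdf d V (x0 * 2 ^ j) - chi2_cdf (x0 * 2 ^ j)\<bar> \<le> e"
  obtains j w where "1 \<le> j" "j < 6" "that d S Y = \<sigma>\<^sup>2 * (x0 * 2 ^ j)" "sigmaS2 d S Y = \<sigma>\<^sup>2 / w" "\<bar>w - 1\<bar> \<le> 4 * e / ell"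
proof -
  have e512: "e \<le> 1/512" using e ell_le by simp
  have x0e: "2 powr real_of_int l0 = \<sigma>\<^sup>2 * x0" using x0 \<sigma> by simp
  have xj: "2 powr real_of_int (l0 + int j) / \<sigma>\<^sup>2 = x0 * 2 ^ j" for j
    unfolding powr_int_add_nat x0e using \<sigma> by simp
  have "ecdf d V (x0 * 2 ^ 0) < 1/2"
    using e(3)[of 0] chi2_cdf_mono[of x0 "1/4"] chi2_cdf_quarter x0 e512 by simp
  then have low: "Fhat d S Y (2 powr real_of_int l0) < 1/2" unfolding F using xj[of 0] by simp
  then obtain l where l: "that d S Y = 2 powr real_of_int l" "1/2 \<le> Fhat d S Y (2 powr real_of_int l)"
    "Fhat d S Y (2 powr real_of_int (l - 1)) < 1/2" "l0 < l"
    using that_attained[OF d] by metis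
  have "l \<le> l0 + 5"
  proof (rule ccontr)
    assume "\<not> l \<le> l0 + 5"
    then have "Fhat d S Y (2 powr real_of_int (l0 + int 5)) < 1/2"
      using Fhat_mono[of "2 powr real_of_int (l0 + int 5)" "2 powr real_of_int (l - 1)" d S Y] l(3)
      by (auto simp: powr_int_mono simp del: of_int_diff of_int_add)
    then have lt: "ecdf d V (x0 * 2 ^ 5) < 1/2" unfolding F xj .
    have "1 - chi2_cdf (x0 * 2 ^ 5) \<le> 3 / (x0 * 2 ^ 5)\<^sup>2" using x0 by (intro chi2_cdf_tail) auto
    also have "\<dots> \<le> 3 / 4\<^sup>2" using x0 by (intro divide_left_mono power_mono) auto
    finally have "13/16 \<le> chi2_cdf (x0 * 2 ^ 5)" by simp
    then show False using e(3)[of 5] lt e512 by auto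
  qed
  define j where "j = nat (l - l0)"
  have j: "1 \<le> j" "j < 6" "l = l0 + int j" using l(4) \<open>l \<le> l0 + 5\<close> by (auto simp: j_def)
  define T where "T = x0 * 2 ^ j"
  have that_T: "that d S Y = \<sigma>\<^sup>2 * T" unfolding l(1) j(3) powr_int_add_nat x0e T_def by simp
  have T: "1/4 < T" "T \<le> 8"
  proof -
    have "(2::real) ^ 1 \<le> 2 ^ j" using j by (intro power_increasing) auto
    moreover have "1/8 * 2 ^ j < x0 * 2 ^ j" using x0(2) by (intro mult_strict_right_mono) auto
    ultimately show "1/4 < T" unfolding T_def power_one_right by linarith
    have "(2::real) ^ j \<le> 2 ^ 5" using j by (intro power_increasing) auto
    then show "T \<le> 8" unfolding T_def using mult_mono[OF x0(3), of "2 ^ j" 32] by simp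
  qed
  let ?p = "Fhat d S Y (that d S Y)"
  have p: "?p = ecdf d V T" unfolding F that_T using \<sigma> by simp
  have half: "1/2 \<le> ?p" using l by simp
  \<comment> \<open>Together with \<open>T > 1/4\<close> this keeps \<open>r\<close> positive; the
    same lower bound on \<open>T\<close> costs the factor 4 in passing from absolute to relative
    error.\<close>
  have el: "e / ell \<le> 1/64" using e ell_pos by (simp add: field_simps)
  obtain r where r: "chi2_quantile ?p = ereal r" "\<bar>r - T\<bar> \<le> e / ell"
  proof (rule chi2_quantile_near[of T e ?p])
    show "\<bar>?p - chi2_cdf T\<bar> \<le> e" using e(3)[OF j(2)] by (simp add: p T_def)
    show "0 \<le> T" "T + e / ell \<le> 16" using T el by linarith+
  qed (use e in auto)
  have r0: "0 < r" using r T el by linarith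
  have s: "sigmaS2 d S Y = that d S Y / r" by (rule sigmaS2_eq) (use half r r0 in auto)
  show ?thesis
  proof (rule that[OF j(1,2)])
    show "that d S Y = \<sigma>\<^sup>2 * (x0 * 2 ^ j)" using that_T by (simp add: T_def)
    show "sigmaS2 d S Y = \<sigma>\<^sup>2 / (r / T)" unfolding s that_T using T r0 by simp
    have "\<bar>r / T - 1\<bar> = \<bar>r - T\<bar> / T" using T by (simp add: field_simps abs_divide[symmetric])
    also have "\<dots> \<le> \<bar>r - T\<bar> / (1/4)" using T by (intro divide_left_mono) auto
    also have "\<dots> \<le> 4 * (e / ell)" using r by simp
    finally show "\<bar>r / T - 1\<bar> \<le> 4 * e / ell" by simp
  qed
qed

text \<open>The level just before the selected one fails the median test. Since
  \<open>x0 * 2 ^ 5\<close> is at most 8, a selected level above 8 in noise units puts its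
  predecessor at or beyond the fifth doubling. Large values of \<open>that\<close> are thus indexed
  by a natural number.\<close>

lemma that_large:
  fixes \<sigma> :: real and l0 :: int
  assumes d: "1 \<le> d" and \<sigma>: "0 < \<sigma>" and F: "\<And>t. Fhat d S Y t = ecdf d V (t / \<sigma>\<^sup>2)"
    and x0: "x0 = 2 powr real_of_int l0 / \<sigma>\<^sup>2" "1/8 < x0" "x0 \<le> 1/4"
    and big: "8 * \<sigma>\<^sup>2 < that d S Y"
  obtains n where "that d S Y = \<sigma>\<^sup>2 * (2 * (x0 * 2 ^ (5 + n)))" "ecdf d V (x0 * 2 ^ (5 + n)) < 1/2"
proof -
  have x0e: "2 powr real_of_int l0 = \<sigma>\<^sup>2 * x0" using x0 \<sigma> by simp
  have xj: "2 powr real_of_int (l0 + int j) / \<sigma>\<^sup>2 = x0 * 2 ^ j" for j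
    unfolding powr_int_add_nat x0e using \<sigma> by simp
  have "0 < that d S Y" using big \<sigma> by (smt (verit) zero_le_power2)
  then obtain m where "Fhat d S Y (2 powr real_of_int m) < 1/2" using that_pos_imp[OF d] by metis
  then obtain l where l: "that d S Y = 2 powr real_of_int l" "Fhat d S Y (2 powr real_of_int (l - 1)) < 1/2"
    using that_attained[OF d] by metis
  have "2 powr real_of_int (l0 + int 5) < 2 powr real_of_int l"
  proof -
    have "2 powr real_of_int (l0 + int 5) = \<sigma>\<^sup>2 * (x0 * 32)" unfolding powr_int_add_nat x0e by simp
    also have "\<dots> \<le> \<sigma>\<^sup>2 * 8" using x0 by (intro mult_left_mono) auto
    finally show ?thesis using big unfolding l(1) by linarith
  qed
  then have "l0 + 5 < l" by (simp add: powr_less_cancel_iff)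
  define n where "n = nat (l - 1 - l0 - 5)"
  have n: "l - 1 = l0 + int (5 + n)" using \<open>l0 + 5 < l\<close> by (simp add: n_def)
  have l2: "l = l0 + int (Suc (5 + n))" using n by simp
  show ?thesis
  proof (rule that)
    show "that d S Y = \<sigma>\<^sup>2 * (2 * (x0 * 2 ^ (5 + n)))"
      unfolding l(1) l2 powr_int_add_nat x0e power_Suc by simp
    show "ecdf d V (x0 * 2 ^ (5 + n)) < 1/2" using l(2) unfolding n F xj .
  qed
qed

lemma abs_phihat_le: "\<bar>phihat d S Y u\<bar> \<le> 1"
proof -
  have "\<bar>\<Sum>i<d. cos (u * Ytil S Y i)\<bar> \<le> (\<Sum>i<d. 1)"
    by (intro order_trans[OF sum_abs] sum_mono) simp
  then show ?thesis by (auto simp: phihat_def abs_divide divide_le_eq_1)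
qed

lemma lam_pos: "0 < lam d s S"
  by (simp add: lam_def)

lemma sigmaD2_bounds:
  assumes "1 \<le> d"
  shows "0 \<le> sigmaD2 d s S Y" "sigmaD2 d s S Y \<le> 8 * that d S Y"
proof -
  \<comment> \<open>At a zero of the empirical characteristic function the convention
    \<open>ln 0 = 0\<close> applies.\<close>
  have "ln \<bar>phihat d S Y u\<bar> \<le> 0" for u
    using abs_phihat_le[of d S Y u] by (cases "phihat d S Y u = 0") auto
  then have "0 \<le> sigmaD2til d s S Y"
    unfolding sigmaD2til_def using that_nonneg[OF assms, of S Y] lam_pos[of d s S]
    by (intro mult_nonpos_nonpos) auto
  then show "0 \<le> sigmaD2 d s S Y" using sigmaS2_bounds[OF assms, of S Y] by (simp add: sigmaD2_def)
  show "sigmaD2 d s S Y \<le> 8 * that d S Y" using sigmaS2_bounds[OF assms, of S Y] by (simp add: sigmaD2_def)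
qed


section \<open>Fluctuations of the empirical distribution function\<close>

lemma ennreal_le_add: "a \<le> b + c \<Longrightarrow> 0 \<le> b \<Longrightarrow> 0 \<le> c \<Longrightarrow> ennreal a \<le> ennreal b + ennreal c"
  by (metis ennreal_leI ennreal_plus)

context gauss_noise
begin

definition dev :: "real \<Rightarrow> 'a \<Rightarrow> real" where
  "dev x \<omega> = ecdf d (\<lambda>i. \<xi> i \<omega>) x - chi2_cdf x"

text \<open>Counting exceedances instead of non-exceedances gives a second moment proportional to
  the tail probability \<open>1 - chi2_cdf x\<close>; with the complementary indicator this
  smallness at large \<open>x\<close> would be lost.\<close>

lemma dev_eq:
  assumes "1 \<le> d"
  shows "dev x \<omega> = - ((\<Sum>i<d. 1 * (indicator {z. x < z\<^sup>2} (\<xi> i \<omega>) - (\<integral>z. indicator {z. x < z\<^sup>2} z \<partial>std_gauss))) / real d)"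
proof -
  have "real (card {i\<in>{0..<d}. (\<xi> i \<omega>)\<^sup>2 \<le> x}) = (\<Sum>i\<in>{0..<d}. indicator {z. z\<^sup>2 \<le> x} (\<xi> i \<omega>))"
    by (simp add: indicator_def sum.If_cases Int_def)
  also have "\<dots> = (\<Sum>i<d. 1 - indicator {z. x < z\<^sup>2} (\<xi> i \<omega>))"
    by (intro sum.cong) (auto simp: indicator_def)
  finally have "real (card {i\<in>{0..<d}. (\<xi> i \<omega>)\<^sup>2 \<le> x}) = real d - (\<Sum>i<d. indicator {z. x < z\<^sup>2} (\<xi> i \<omega>))"
    by (simp add: sum_subtractf)
  then have "ecdf d (\<lambda>i. \<xi> i \<omega>) x = 1 - (\<Sum>i<d. indicator {z. x < z\<^sup>2} (\<xi> i \<omega>)) / real d"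
    using assms by (simp add: ecdf_def diff_divide_distrib)
  moreover have "(\<Sum>i<d. 1 * (indicator {z. x < z\<^sup>2} (\<xi> i \<omega>) - (\<integral>z. indicator {z. x < z\<^sup>2} z \<partial>std_gauss))) / real d
    = (\<Sum>i<d. indicator {z. x < z\<^sup>2} (\<xi> i \<omega>)) / real d - (1 - chi2_cdf x)"
    unfolding chi2_cdf_compl using assms by (simp add: sum_subtractf diff_divide_distrib)
  ultimately show ?thesis by (simp only: dev_def)
qed

lemma sum_xi_measurable:
  assumes "g \<in> borel_measurable borel"
  shows "(\<lambda>\<omega>. \<Sum>i<d. c i * (g (\<xi> i \<omega>) - m) :: real) \<in> borel_measurable M"
  by (intro borel_measurable_sum borel_measurable_times borel_measurable_diff borel_measurable_const
       measurable_compose[OF xi_measurable assms]) auto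

lemma dev_measurable [measurable]:
  assumes "1 \<le> d" shows "dev x \<in> borel_measurable M"
proof -
  have "dev x = (\<lambda>\<omega>. - ((\<Sum>i<d. 1 * (indicator {z. x < z\<^sup>2} (\<xi> i \<omega>) - (\<integral>z. indicator {z. x < z\<^sup>2} z \<partial>std_gauss))) / real d))"
    by (intro ext dev_eq[OF assms])
  also have "\<dots> \<in> borel_measurable M"
    by (intro borel_measurable_uminus borel_measurable_divide sum_xi_measurable borel_measurable_const) auto
  finally show ?thesis .
qed

lemma nn_second_moment_scaled:
  assumes [measurable]: "Z \<in> borel_measurable M"
    and "(\<integral>\<^sup>+\<omega>. ennreal ((Z \<omega>)\<^sup>2) \<partial>M) \<le> ennreal V" "0 \<le> V"
  shows "(\<integral>\<^sup>+\<omega>. ennreal ((a * Z \<omega>)\<^sup>2) \<partial>M) \<le> ennreal (a\<^sup>2 * V)"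
proof -
  have "(\<integral>\<^sup>+\<omega>. ennreal ((a * Z \<omega>)\<^sup>2) \<partial>M) = ennreal (a\<^sup>2) * (\<integral>\<^sup>+\<omega>. ennreal ((Z \<omega>)\<^sup>2) \<partial>M)"
    by (subst nn_integral_cmult[symmetric]) (auto simp: ennreal_mult power_mult_distrib)
  also have "\<dots> \<le> ennreal (a\<^sup>2) * ennreal V" by (intro mult_left_mono assms) simp
  also have "\<dots> = ennreal (a\<^sup>2 * V)" using assms by (simp add: ennreal_mult)
  finally show ?thesis .
qed

lemma dev_second_moment:
  assumes "1 \<le> d"
  shows "(\<integral>\<^sup>+\<omega>. ennreal ((dev x \<omega>)\<^sup>2) \<partial>M) \<le> ennreal (4 * (K / real d)\<^sup>2 * (1 - chi2_cdf x))"
proof -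
  let ?g = "indicator {z. x < z\<^sup>2} :: real \<Rightarrow> real"
  have g2: "(?g z)\<^sup>2 = ?g z" for z by (simp split: split_indicator)
  have i: "integrable std_gauss (\<lambda>z. (?g z)\<^sup>2)"
    unfolding g2 by (rule std_gauss_bounded_integrable[of _ 1]) (auto split: split_indicator)
  let ?Z = "\<lambda>\<omega>. \<Sum>i<d. 1 * (?g (\<xi> i \<omega>) - (\<integral>z. ?g z \<partial>std_gauss))"
  have p: "0 \<le> 1 - chi2_cdf x" unfolding chi2_cdf_def by simp
  have "(\<integral>\<^sup>+\<omega>. ennreal ((?Z \<omega>)\<^sup>2) \<partial>M) \<le> ennreal (4 * K\<^sup>2 * (\<integral>z. (?g z)\<^sup>2 \<partial>std_gauss))"
    by (rule nn_second_moment_even) (use i in \<open>auto split: split_indicator\<close>)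
  also have "(\<integral>z. (?g z)\<^sup>2 \<partial>std_gauss) = 1 - chi2_cdf x" unfolding g2 by (rule chi2_cdf_compl)
  finally have "(\<integral>\<^sup>+\<omega>. ennreal ((- (1 / real d) * ?Z \<omega>)\<^sup>2) \<partial>M) \<le> ennreal ((- (1 / real d))\<^sup>2 * (4 * K\<^sup>2 * (1 - chi2_cdf x)))"
    using p by (intro nn_second_moment_scaled sum_xi_measurable) auto
  moreover have "(- (1 / real d))\<^sup>2 * (4 * K\<^sup>2 * (1 - chi2_cdf x)) = 4 * (K / real d)\<^sup>2 * (1 - chi2_cdf x)"
    by (simp add: power_divide)
  moreover have "dev x = (\<lambda>\<omega>. - (1 / real d) * ?Z \<omega>)" by (rule ext, subst dev_eq[OF assms]) simp
  ultimately show ?thesis by (simp only:)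
qed

lemma dev_second_moment':
  assumes "1 \<le> d"
  shows "(\<integral>\<^sup>+\<omega>. ennreal ((dev x \<omega>)\<^sup>2) \<partial>M) \<le> ennreal (4 * (K / real d)\<^sup>2)"
proof -
  have "4 * (K / real d)\<^sup>2 * (1 - chi2_cdf x) \<le> 4 * (K / real d)\<^sup>2 * 1"
    by (intro mult_left_mono) (auto simp: chi2_cdf_def)
  then show ?thesis using order_trans[OF dev_second_moment[OF assms] ennreal_leI] by simp
qed

text \<open>One statistic dominating the deviations at all six levels examined in
  \<open>estimator_good\<close>. Its size decides between the good and the exceptional event and
  also sets the scale for peeling.\<close>

definition devsum :: "real \<Rightarrow> 'a \<Rightarrow> real" where
  "devsum x0 \<omega> = (\<Sum>j<6. \<bar>dev (x0 * 2 ^ j) \<omega>\<bar>)"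

lemma devsum_measurable [measurable]: "1 \<le> d \<Longrightarrow> devsum x0 \<in> borel_measurable M"
  unfolding devsum_def[abs_def] by measurable

lemma devsum_nonneg: "0 \<le> devsum x0 \<omega>"
  by (simp add: devsum_def sum_nonneg)

lemma dev_le_devsum: "j < 6 \<Longrightarrow> \<bar>dev (x0 * 2 ^ j) \<omega>\<bar> \<le> devsum x0 \<omega>"
  unfolding devsum_def by (rule member_le_sum) auto

lemma devsum_second_moment:
  assumes "1 \<le> d"
  shows "(\<integral>\<^sup>+\<omega>. ennreal ((devsum x0 \<omega>)\<^sup>2) \<partial>M) \<le> ennreal (144 * (K / real d)\<^sup>2)"
proof -
  have "(devsum x0 \<omega>)\<^sup>2 \<le> 6 * (\<Sum>j<6. (dev (x0 * 2 ^ j) \<omega>)\<^sup>2)" for \<omega>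
    using Cauchy_Schwarz_ineq_sum[of "\<lambda>_. 1" "\<lambda>j. \<bar>dev (x0 * 2 ^ j) \<omega>\<bar>" "{..<6::nat}"]
    by (simp add: devsum_def)
  then have "(\<integral>\<^sup>+\<omega>. ennreal ((devsum x0 \<omega>)\<^sup>2) \<partial>M) \<le> (\<integral>\<^sup>+\<omega>. ennreal (6 * (\<Sum>j<6. (dev (x0 * 2 ^ j) \<omega>)\<^sup>2)) \<partial>M)"
    by (intro nn_integral_mono ennreal_leI)
  also have "\<dots> = (\<integral>\<^sup>+\<omega>. 6 * (\<Sum>j<6. ennreal ((dev (x0 * 2 ^ j) \<omega>)\<^sup>2)) \<partial>M)"
    by (simp add: ennreal_mult sum_nonneg sum_ennreal)
  also have "\<dots> = 6 * (\<Sum>j<6. \<integral>\<^sup>+\<omega>. ennreal ((dev (x0 * 2 ^ j) \<omega>)\<^sup>2) \<partial>M)"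
    using assms by (simp add: nn_integral_cmult nn_integral_sum del: sum_ennreal)
  also have "\<dots> \<le> 6 * (\<Sum>j<6::nat. ennreal (4 * (K / real d)\<^sup>2))"
    by (intro mult_left_mono sum_mono dev_second_moment'[OF assms]) simp
  also have "\<dots> = ennreal (144 * (K / real d)\<^sup>2)"
  proof -
    have "(\<Sum>j<6::nat. ennreal (4 * (K / real d)\<^sup>2)) = ennreal (24 * (K / real d)\<^sup>2)"
      by (subst sum_ennreal) auto
    moreover have "6 * ennreal y = ennreal (6 * y)" if "0 \<le> y" for y using that by (simp add: ennreal_mult)
    ultimately show ?thesis by simp
  qed
  finally show ?thesis .
qed

text \<open>Dominates \<open>that\<close>, in units of the variance, beyond the value 8: if the
  search stops right after the level \<open>x0 * 2 ^ (5 + n)\<close>, that level shows a deviation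
  of at least 3/10 and \<open>that\<close> is its double, which is the weight of the
  summand.\<close>

definition tailT :: "real \<Rightarrow> 'a \<Rightarrow> ennreal" where
  "tailT x0 \<omega> = (\<Sum>n. ennreal (2 * (x0 * 2 ^ (5 + n))) * indicator {\<omega> \<in> space M. 3/10 \<le> \<bar>dev (x0 * 2 ^ (5 + n)) \<omega>\<bar>} \<omega>)"

lemma tailT_measurable [measurable]: "1 \<le> d \<Longrightarrow> tailT x0 \<in> borel_measurable M"
  unfolding tailT_def[abs_def] by measurable

text \<open>Chebyshev with a variance proportional to the tail probability, at most
  \<open>3 / x\<^sup>2\<close>: level times probability is of order 1/x, and x > 4 * 2^n makes the
  series geometric.\<close>

lemma tailT_integral:
  assumes "1 \<le> d" and x0: "1/8 < x0"
  shows "(\<integral>\<^sup>+\<omega>. tailT x0 \<omega> \<partial>M) \<le> ennreal (200 * (K / real d)\<^sup>2)"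
proof -
  define \<kappa> where "\<kappa> = (K / real d)\<^sup>2"
  have k0: "0 \<le> \<kappa>" by (simp add: \<kappa>_def)
  have summand: "ennreal (2 * (x0 * 2 ^ (5 + n))) * emeasure M {\<omega> \<in> space M. 3/10 \<le> \<bar>dev (x0 * 2 ^ (5 + n)) \<omega>\<bar>} \<le> ennreal (100 * \<kappa> * (1/2) ^ n)" for n
  proof -
    define x where "x = x0 * 2 ^ (5 + n)"
    have x: "4 * 2 ^ n < x"
    proof -
      have "1/8 * (2 ^ (5 + n)) < x" unfolding x_def using x0 by (intro mult_strict_right_mono) auto
      then show ?thesis by (simp add: power_add)
    qed
    then have xp: "0 < x" by (smt (verit) zero_less_power)
    have "emeasure M {\<omega> \<in> space M. 3/10 \<le> \<bar>dev x \<omega>\<bar>} \<le> ennreal (4 * \<kappa> * (1 - chi2_cdf x) / (3/10)\<^sup>2)"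
      unfolding \<kappa>_def using assms by (intro emeasure_abs_ge_le dev_second_moment) (auto simp: chi2_cdf_def)
    also have "\<dots> \<le> ennreal (4 * \<kappa> * (3 / x\<^sup>2) / (3/10)\<^sup>2)"
      using k0 by (intro ennreal_leI divide_right_mono mult_left_mono chi2_cdf_tail xp) auto
    finally have "ennreal (2 * x) * emeasure M {\<omega> \<in> space M. 3/10 \<le> \<bar>dev x \<omega>\<bar>} \<le> ennreal (2 * x) * ennreal (4 * \<kappa> * (3 / x\<^sup>2) / (3/10)\<^sup>2)"
      by (intro mult_left_mono) auto
    also have "\<dots> = ennreal (2 * x * (4 * \<kappa> * (3 / x\<^sup>2) / (3/10)\<^sup>2))"
      using xp k0 by (simp add: ennreal_mult[symmetric])
    also have "\<dots> \<le> ennreal (100 * \<kappa> * (1/2) ^ n)"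
    proof (rule ennreal_leI)
      have "2 * x * (4 * \<kappa> * (3 / x\<^sup>2) / (3/10)\<^sup>2) = (800/3) * \<kappa> * (1 / x)"
        using xp by (simp add: power2_eq_square field_simps)
      also have "\<dots> \<le> (800/3) * \<kappa> * (1 / (4 * 2 ^ n))"
        using x k0 xp by (intro mult_left_mono divide_left_mono) auto
      also have "\<dots> \<le> 100 * \<kappa> * (1/2) ^ n" using k0 by (simp add: power_divide field_simps)
      finally show "2 * x * (4 * \<kappa> * (3 / x\<^sup>2) / (3/10)\<^sup>2) \<le> 100 * \<kappa> * (1/2) ^ n" .
    qed
    finally show ?thesis by (simp only: x_def)
  qed
  have "(\<integral>\<^sup>+\<omega>. tailT x0 \<omega> \<partial>M) = (\<Sum>n. \<integral>\<^sup>+\<omega>. ennreal (2 * (x0 * 2 ^ (5 + n))) * indicator {\<omega> \<in> space M. 3/10 \<le> \<bar>dev (x0 * 2 ^ (5 + n)) \<omega>\<bar>} \<omega> \<partial>M)"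
    unfolding tailT_def using assms(1) by (intro nn_integral_suminf) measurable
  also have "\<dots> = (\<Sum>n. ennreal (2 * (x0 * 2 ^ (5 + n))) * emeasure M {\<omega> \<in> space M. 3/10 \<le> \<bar>dev (x0 * 2 ^ (5 + n)) \<omega>\<bar>})"
    using assms(1) by (intro suminf_cong nn_integral_cmult_indicator) measurable
  also have "\<dots> \<le> (\<Sum>n. ennreal (100 * \<kappa> * (1/2) ^ n))"
    by (intro suminf_le summand) auto
  also have "\<dots> = ennreal (\<Sum>n. 100 * \<kappa> * (1/2) ^ n)"
    using k0 by (intro suminf_ennreal2) (auto intro!: summable_mult summable_geometric)
  also have "(\<Sum>n. 100 * \<kappa> * (1/2) ^ n) = 200 * \<kappa>"
    by (subst suminf_mult) (auto simp: suminf_geometric intro!: summable_geometric)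
  finally show ?thesis by (simp add: \<kappa>_def)
qed

lemma that_le_tailT:
  fixes \<sigma> :: real and l0 :: int
  assumes d: "1 \<le> d" and \<sigma>: "0 < \<sigma>" and F: "\<And>t. Fhat d S Y t = ecdf d V (t / \<sigma>\<^sup>2)"
    and x0: "x0 = 2 powr real_of_int l0 / \<sigma>\<^sup>2" "1/8 < x0" "x0 \<le> 1/4"
    and \<omega>: "\<omega> \<in> space M" and V: "\<And>x. \<bar>ecdf d V x - ecdf d (\<lambda>i. \<xi> i \<omega>) x\<bar> \<le> 1/100"
  shows "ennreal (that d S Y / \<sigma>\<^sup>2) \<le> 8 + tailT x0 \<omega>"
proof (cases "8 * \<sigma>\<^sup>2 < that d S Y")
  case False
  then have "that d S Y / \<sigma>\<^sup>2 \<le> 8" using \<sigma> by (simp add: field_simps)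
  then have "ennreal (that d S Y / \<sigma>\<^sup>2) \<le> ennreal 8" by (rule ennreal_leI)
  also have "\<dots> \<le> 8 + tailT x0 \<omega>" by simp
  finally show ?thesis .
next
  case True
  obtain n where n: "that d S Y = \<sigma>\<^sup>2 * (2 * (x0 * 2 ^ (5 + n)))" "ecdf d V (x0 * 2 ^ (5 + n)) < 1/2"
    using that_large[OF d \<sigma> F x0 True] .
  define x where "x = x0 * 2 ^ (5 + n)"
  have x: "4 \<le> x"
  proof -
    have "1/8 * (2 ^ (5 + n)) \<le> x" unfolding x_def using x0 by (intro mult_right_mono) auto
    then have "4 * 2 ^ n \<le> x" by (simp add: power_add)
    moreover have "(1::real) \<le> 2 ^ n" by simp
    ultimately show ?thesis by linarith
  qed
  have "1 - chi2_cdf x \<le> 3 / x\<^sup>2" using x by (intro chi2_cdf_tail) auto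
  also have "\<dots> \<le> 3 / 4\<^sup>2" using x by (intro divide_left_mono power_mono) auto
  finally have "13/16 \<le> chi2_cdf x" by simp
  \<comment> \<open>13/16 - 1/2 - 1/100 exceeds 3/10; the 1/100 bounds what the signal changes in
    the distribution function.\<close>
  then have "3/10 \<le> \<bar>dev x \<omega>\<bar>" using n(2) V[of x] unfolding dev_def x_def[symmetric] by linarith
  then have ind: "indicator {\<omega> \<in> space M. 3/10 \<le> \<bar>dev (x0 * 2 ^ (5 + n)) \<omega>\<bar>} \<omega> = (1::ennreal)"
    using \<omega> by (simp add: x_def)
  have "ennreal (that d S Y / \<sigma>\<^sup>2) = ennreal (2 * (x0 * 2 ^ (5 + n))) * indicator {\<omega> \<in> space M. 3/10 \<le> \<bar>dev (x0 * 2 ^ (5 + n)) \<omega>\<bar>} \<omega>"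
    using \<sigma> unfolding ind n(1) by simp
  also have "\<dots> \<le> tailT x0 \<omega>"
    unfolding tailT_def
    using sum_le_suminf[of "\<lambda>k. ennreal (2 * (x0 * 2 ^ (5 + k))) * indicator {\<omega> \<in> space M. 3/10 \<le> \<bar>dev (x0 * 2 ^ (5 + k)) \<omega>\<bar>} \<omega>" "{n}"]
    by (simp only: sum.insert sum.empty finite.emptyI finite.insertI empty_iff not_False_eq_True add_0_right summableI zero_le simp_thms)
  also have "\<dots> \<le> 8 + tailT x0 \<omega>" by simp
  finally show ?thesis .
qed

text \<open>Outside this set, hard thresholding at \<open>\<tau>\<close> and at any threshold within
  relative distance \<open>r\<close> of it make the same decision.\<close>

definition box :: "real \<Rightarrow> real \<Rightarrow> real set" where
  "box \<tau> r = {x. \<bar>\<bar>x\<bar> - \<tau>\<bar> \<le> \<tau> * r}"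

lemma box_measurable [measurable]: "box \<tau> r \<in> sets borel"
  unfolding box_def by measurable

lemma box_mono: "0 \<le> \<tau> \<Longrightarrow> r \<le> r' \<Longrightarrow> box \<tau> r \<subseteq> box \<tau> r'"
  unfolding box_def by (auto intro: order_trans mult_left_mono)

definition H :: "real \<Rightarrow> real \<Rightarrow> 'a \<Rightarrow> real" where
  "H \<tau> r \<omega> = (\<Sum>i<d. (\<xi> i \<omega>)\<^sup>2 * indicator (box \<tau> r) (\<xi> i \<omega>))"

lemma H_nonneg: "0 \<le> H \<tau> r \<omega>"
  by (simp add: H_def sum_nonneg)

lemma H_mono: "0 \<le> \<tau> \<Longrightarrow> r \<le> r' \<Longrightarrow> H \<tau> r \<omega> \<le> H \<tau> r' \<omega>"
  unfolding H_def using box_mono[of \<tau> r r'] by (intro sum_mono mult_left_mono) (auto split: split_indicator)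

lemma H_measurable [measurable]: "H \<tau> r \<in> borel_measurable M"
  unfolding H_def[abs_def] by (intro borel_measurable_sum measurable_compose[OF xi_measurable]) auto

text \<open>\<open>H\<close> splits into its mean, at most \<open>d * E\<close> with
  \<open>E\<close> from \<open>std_gauss_box4\<close>, and a centred sum with second moment at most
  \<open>4 * K\<^sup>2 * E\<close>. On the event \<open>B\<close> the mean gains the probability and
  the centred sum its square root. Restriction to an event is what permits a different radius on
  each scale.\<close>

lemma H_restricted:
  assumes \<tau>: "4/3 \<le> \<tau>" and r: "0 \<le> r" "r \<le> 1/4" and [measurable]: "B \<in> sets M" and p: "emeasure M B \<le> ennreal p" "0 \<le> p"
  shows "(\<integral>\<^sup>+\<omega>. ennreal (H \<tau> r \<omega>) * indicator B \<omega> \<partial>M)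
     \<le> ennreal (768 * real d * r * exp (- \<tau>\<^sup>2 / 9) * p + 2 * K * sqrt (768 * r * exp (- \<tau>\<^sup>2 / 9)) * sqrt p)"
proof -
  let ?g = "\<lambda>x::real. x\<^sup>2 * indicator (box \<tau> r) x"
  define m where "m = (\<integral>x. ?g x \<partial>std_gauss)"
  define E where "E = 768 * r * exp (- \<tau>\<^sup>2 / 9)"
  have E0: "0 \<le> E" using r by (simp add: E_def)
  have g2: "(?g x)\<^sup>2 = x ^ 4 * indicator (box \<tau> r) x" for x by (simp split: split_indicator)
  have i4: "integrable std_gauss (\<lambda>x. x ^ 4 * indicator (box \<tau> r) x :: real)"
    by (rule Bochner_Integration.integrable_bound[OF std_gauss_power[of 4]]) (auto split: split_indicator)
  have b4: "(\<integral>x. x ^ 4 * indicator (box \<tau> r) x \<partial>std_gauss) \<le> E"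
    unfolding box_def E_def using \<tau> r by (intro std_gauss_box4) auto
  \<comment> \<open>The bounds 4/3 for the threshold and 1/4 for the radius keep the box out of the
    open unit interval, so that squares there are at most fourth powers.\<close>
  have ge1: "1 \<le> \<bar>x\<bar>" if "x \<in> box \<tau> r" for x
  proof -
    have "\<tau> * r \<le> \<tau> * (1/4)" using \<tau> r by (intro mult_left_mono) auto
    moreover have "\<bar>\<bar>x\<bar> - \<tau>\<bar> \<le> \<tau> * r" using that by (simp add: box_def)
    ultimately show ?thesis using \<tau> by linarith
  qed
  have m: "m \<le> E"
  proof -
    have "m \<le> (\<integral>x. x ^ 4 * indicator (box \<tau> r) x \<partial>std_gauss)"
      unfolding m_def
    proof (rule integral_mono[OF _ i4])
      show "integrable std_gauss (\<lambda>x. ?g x)"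
        by (rule std_gauss_square_integrable_imp_integrable) (use i4 in \<open>auto simp: g2\<close>)
      fix x :: real
      show "?g x \<le> x ^ 4 * indicator (box \<tau> r) x"
      proof (cases "x \<in> box \<tau> r")
        case True
        then have "\<bar>x\<bar> ^ 2 \<le> \<bar>x\<bar> ^ 4" using ge1 by (intro power_increasing) auto
        then show ?thesis using True by simp
      qed simp
    qed
    then show ?thesis using b4 by simp
  qed
  have m0: "0 \<le> m" by (simp add: m_def)
  let ?Z = "\<lambda>\<omega>. \<Sum>i<d. 1 * (?g (\<xi> i \<omega>) - m)"
  have Zm [measurable]: "?Z \<in> borel_measurable M" by (rule sum_xi_measurable) measurable
  have HZ: "H \<tau> r \<omega> = real d * m + ?Z \<omega>" for \<omega> by (simp add: H_def sum_subtractf)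
  have "(\<integral>\<^sup>+\<omega>. ennreal ((?Z \<omega>)\<^sup>2) \<partial>M) \<le> ennreal (4 * K\<^sup>2 * (\<integral>x. (?g x)\<^sup>2 \<partial>std_gauss))"
    unfolding m_def by (rule nn_second_moment_even) (use i4 in \<open>auto simp: g2\<close>, auto simp: box_def indicator_def)
  also have "\<dots> \<le> ennreal (4 * K\<^sup>2 * E)" unfolding g2 using b4 by (intro ennreal_leI mult_left_mono) auto
  finally have V: "(\<integral>\<^sup>+\<omega>. ennreal ((?Z \<omega>)\<^sup>2) \<partial>M) \<le> ennreal (4 * K\<^sup>2 * E)" .
  have "(\<integral>\<^sup>+\<omega>. ennreal (H \<tau> r \<omega>) * indicator B \<omega> \<partial>M) \<le> (\<integral>\<^sup>+\<omega>. ennreal (real d * E) * indicator B \<omega> + ennreal \<bar>?Z \<omega>\<bar> * indicator B \<omega> \<partial>M)"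
  proof (rule nn_integral_mono)
    fix \<omega>
    have "H \<tau> r \<omega> \<le> real d * E + \<bar>?Z \<omega>\<bar>"
      unfolding HZ using mult_left_mono[OF m, of "real d"] abs_ge_self[of "?Z \<omega>"] by linarith
    then have "ennreal (H \<tau> r \<omega>) \<le> ennreal (real d * E) + ennreal \<bar>?Z \<omega>\<bar>"
      using E0 by (intro ennreal_le_add) auto
    then show "ennreal (H \<tau> r \<omega>) * indicator B \<omega> \<le> ennreal (real d * E) * indicator B \<omega> + ennreal \<bar>?Z \<omega>\<bar> * indicator B \<omega>"
      by (auto split: split_indicator)
  qed
  also have "\<dots> = (\<integral>\<^sup>+\<omega>. ennreal (real d * E) * indicator B \<omega> \<partial>M) + (\<integral>\<^sup>+\<omega>. ennreal \<bar>?Z \<omega>\<bar> * indicator B \<omega> \<partial>M)"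
    by (rule nn_integral_add) measurable
  also have "\<dots> \<le> ennreal (real d * E * p) + ennreal (sqrt (4 * K\<^sup>2 * E) * sqrt p)"
  proof (rule add_mono)
    have "(\<integral>\<^sup>+\<omega>. ennreal (real d * E) * indicator B \<omega> \<partial>M) = ennreal (real d * E) * emeasure M B"
      by (rule nn_integral_cmult_indicator) simp
    also have "\<dots> \<le> ennreal (real d * E) * ennreal p" by (intro mult_left_mono p) simp
    also have "\<dots> = ennreal (real d * E * p)" using E0 p by (simp add: ennreal_mult)
    finally show "(\<integral>\<^sup>+\<omega>. ennreal (real d * E) * indicator B \<omega> \<partial>M) \<le> ennreal (real d * E * p)" .
    show "(\<integral>\<^sup>+\<omega>. ennreal \<bar>?Z \<omega>\<bar> * indicator B \<omega> \<partial>M) \<le> ennreal (sqrt (4 * K\<^sup>2 * E) * sqrt p)"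
      using E0 p V by (intro nn_integral_abs_le_sqrt) auto
  qed
  also have "\<dots> = ennreal (real d * E * p + sqrt (4 * K\<^sup>2 * E) * sqrt p)"
    using E0 p K_nonneg by (intro ennreal_plus[symmetric]) auto
  also have "sqrt (4 * K\<^sup>2 * E) = 2 * K * sqrt E" using K_nonneg by (simp add: real_sqrt_mult)
  finally show ?thesis by (simp add: E_def mult_ac)
qed

end


section \<open>Peeling and moment bounds\<close>

text \<open>Cauchy-Schwarz over pairs of indices. Unit weights give \<open>card S * K\<close>;
  weights coming from the signal give its squared norm times \<open>K\<close>.\<close>

lemma sum_sum_abs_le:
  fixes R :: "nat \<Rightarrow> nat \<Rightarrow> real" and a :: "nat \<Rightarrow> real"
  assumes "S \<subseteq> {..<d}"
  shows "(\<Sum>i\<in>S. \<Sum>j\<in>S. \<bar>a i\<bar> * \<bar>a j\<bar> * \<bar>R i j\<bar>) \<le> (\<Sum>i\<in>S. (a i)\<^sup>2) * sqrt (\<Sum>i<d. \<Sum>j<d. (R i j)\<^sup>2)"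
proof -
  have fS: "finite S" using assms finite_subset by blast
  let ?P = "S \<times> S"
  have "(\<Sum>i\<in>S. \<Sum>j\<in>S. \<bar>a i\<bar> * \<bar>a j\<bar> * \<bar>R i j\<bar>) = (\<Sum>p\<in>?P. (\<bar>a (fst p)\<bar> * \<bar>a (snd p)\<bar>) * \<bar>R (fst p) (snd p)\<bar>)"
    by (simp add: sum.cartesian_product case_prod_unfold)
  also have "\<dots> \<le> sqrt ((\<Sum>p\<in>?P. (\<bar>a (fst p)\<bar> * \<bar>a (snd p)\<bar>)\<^sup>2) * (\<Sum>p\<in>?P. \<bar>R (fst p) (snd p)\<bar>\<^sup>2))"
    by (rule real_le_rsqrt, rule Cauchy_Schwarz_ineq_sum)
  also have "(\<Sum>p\<in>?P. (\<bar>a (fst p)\<bar> * \<bar>a (snd p)\<bar>)\<^sup>2) = (\<Sum>i\<in>S. (a i)\<^sup>2)\<^sup>2"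
    unfolding power2_eq_square[of "\<Sum>i\<in>S. (a i)\<^sup>2"] sum_product
    by (simp add: sum.cartesian_product case_prod_unfold power_mult_distrib)
  also have "(\<Sum>p\<in>?P. \<bar>R (fst p) (snd p)\<bar>\<^sup>2) = (\<Sum>i\<in>S. \<Sum>j\<in>S. (R i j)\<^sup>2)"
    by (simp add: sum.cartesian_product case_prod_unfold)
  also have "sqrt ((\<Sum>i\<in>S. (a i)\<^sup>2)\<^sup>2 * (\<Sum>i\<in>S. \<Sum>j\<in>S. (R i j)\<^sup>2)) = (\<Sum>i\<in>S. (a i)\<^sup>2) * sqrt (\<Sum>i\<in>S. \<Sum>j\<in>S. (R i j)\<^sup>2)"
    by (simp add: real_sqrt_mult sum_nonneg)
  also have "\<dots> \<le> (\<Sum>i\<in>S. (a i)\<^sup>2) * sqrt (\<Sum>i<d. \<Sum>j<d. (R i j)\<^sup>2)"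
  proof (intro mult_left_mono real_sqrt_le_mono)
    have "(\<Sum>i\<in>S. \<Sum>j\<in>S. (R i j)\<^sup>2) \<le> (\<Sum>i\<in>S. \<Sum>j<d. (R i j)\<^sup>2)"
      by (intro sum_mono sum_mono2) (use assms in auto)
    also have "\<dots> \<le> (\<Sum>i<d. \<Sum>j<d. (R i j)\<^sup>2)"
      by (intro sum_mono2) (use assms in \<open>auto intro: sum_nonneg\<close>)
    finally show "(\<Sum>i\<in>S. \<Sum>j\<in>S. (R i j)\<^sup>2) \<le> (\<Sum>i<d. \<Sum>j<d. (R i j)\<^sup>2)" .
  qed (simp add: sum_nonneg)
  finally show ?thesis .
qed

context gauss_noise
begin

text \<open>A random radius is replaced by the first dyadic radius above it; the probability that a given
  scale is needed decays fast enough for the bounds of \<open>H_restricted\<close> to be summed over the scales.\<close>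

definition peel_radius :: "real \<Rightarrow> nat \<Rightarrow> real" where
  "peel_radius a k = min (2 * a * (K / real d) * 2 ^ k) (1/4)"

definition peel_event :: "real \<Rightarrow> nat \<Rightarrow> 'a set" where
  "peel_event x0 k = {\<omega> \<in> space M. K / real d * 2 ^ k \<le> \<bar>devsum x0 \<omega>\<bar>}"

definition peel :: "real \<Rightarrow> real \<Rightarrow> real \<Rightarrow> 'a \<Rightarrow> ennreal" where
  "peel x0 a \<tau> \<omega> = ennreal (H \<tau> (peel_radius a 0) \<omega>) +
     (\<Sum>k. ennreal (H \<tau> (peel_radius a (Suc k)) \<omega>) * indicator (peel_event x0 k) \<omega>)"

lemma peel_event_measurable [measurable]: "1 \<le> d \<Longrightarrow> peel_event x0 k \<in> sets M"
  unfolding peel_event_def by measurable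

lemma peel_measurable [measurable]: "1 \<le> d \<Longrightarrow> peel x0 a \<tau> \<in> borel_measurable M"
  unfolding peel_def[abs_def] by measurable

text \<open>If the radius is first reached at scale n + 1, minimality gives 2 a kappa 2^n < a (kappa
  + devsum), hence devsum >= kappa 2^n and the indicator of that summand is one. The factor 2 in
  \<open>peel_radius\<close> pays for the deterministic part kappa.\<close>

lemma H_le_peel:
  assumes d: "1 \<le> d" and K: "0 < K" and a: "0 < a" and \<tau>: "0 \<le> \<tau>" and \<omega>: "\<omega> \<in> space M"
    and v: "v \<le> 1/4" "v \<le> a * (K / real d + devsum x0 \<omega>)"
  shows "ennreal (H \<tau> v \<omega>) \<le> peel x0 a \<tau> \<omega>"
proof -
  define \<kappa> where "\<kappa> = K / real d"
  have \<kappa>: "0 < \<kappa>" using d K by (simp add: \<kappa>_def)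
  have ak: "0 < 2 * a * \<kappa>" using a \<kappa> by simp
  let ?P = "\<lambda>k. v \<le> 2 * a * \<kappa> * 2 ^ k"
  have "\<exists>k. ?P k"
  proof -
    obtain n where n: "v / (2 * a * \<kappa>) < real n" using reals_Archimedean2 by blast
    have "real n \<le> 2 ^ n" using of_nat_less_two_power[of n] by (metis less_imp_le)
    then have "2 * a * \<kappa> * real n \<le> 2 * a * \<kappa> * 2 ^ n" using ak by (intro mult_left_mono) auto
    moreover have "v < 2 * a * \<kappa> * real n" using n ak by (simp add: divide_less_eq mult.commute)
    ultimately have "v \<le> 2 * a * \<kappa> * 2 ^ n" by linarith
    then show ?thesis by blast
  qed
  define k where "k = (LEAST k. ?P k)"
  have k: "?P k" unfolding k_def using \<open>\<exists>k. ?P k\<close> by (rule LeastI_ex)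
  have le: "H \<tau> v \<omega> \<le> H \<tau> (peel_radius a k) \<omega>"
    using k v by (intro H_mono \<tau>) (auto simp: peel_radius_def \<kappa>_def)
  show ?thesis
  proof (cases k)
    case 0
    have "ennreal (H \<tau> v \<omega>) \<le> ennreal (H \<tau> (peel_radius a 0) \<omega>)" using le 0 by (auto intro: ennreal_leI)
    also have "\<dots> \<le> peel x0 a \<tau> \<omega>" unfolding peel_def by simp
    finally show ?thesis .
  next
    case (Suc n)
    have "\<not> ?P n" using not_less_Least[of n ?P] Suc k_def by auto
    then have "2 * a * \<kappa> * 2 ^ n < a * (\<kappa> + devsum x0 \<omega>)" using v by (simp add: \<kappa>_def)
    then have "2 * \<kappa> * 2 ^ n < \<kappa> + devsum x0 \<omega>" using a by (simp add: mult.assoc mult.left_commute[of _ a])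
    moreover have "\<kappa> * 1 \<le> \<kappa> * 2 ^ n" using \<kappa> by (intro mult_left_mono) auto
    ultimately have "\<kappa> * 2 ^ n \<le> devsum x0 \<omega>" by (simp add: mult.assoc)
    then have ev: "\<omega> \<in> peel_event x0 n" using \<omega> by (simp add: peel_event_def \<kappa>_def abs_of_nonneg devsum_nonneg)
    let ?f = "\<lambda>k. ennreal (H \<tau> (peel_radius a (Suc k)) \<omega>) * indicator (peel_event x0 k) \<omega>"
    have "ennreal (H \<tau> v \<omega>) \<le> ?f n" using le Suc ev by (auto intro: ennreal_leI)
    also have "\<dots> \<le> suminf ?f"
      using sum_le_suminf[of ?f "{n}"]
      by (simp only: sum.insert sum.empty finite.emptyI finite.insertI empty_iff not_False_eq_True add_0_right summableI zero_le simp_thms)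
    also have "\<dots> \<le> peel x0 a \<tau> \<omega>" unfolding peel_def by simp
    finally show ?thesis .
  qed
qed

text \<open>At scale k the radius is at most of order 2^k and the event has probability of order
  4^(-k). The mean part of \<open>H_restricted\<close> is then of order 2^(-k); in the fluctuation
  part the radius is replaced by its cap 1/4, and the square root of the probability alone supplies
  2^(-k).\<close>

lemma peel_integral:
  assumes d: "1 \<le> d" and K: "0 < K" and a: "0 < a" and \<tau>: "4/3 \<le> \<tau>"
  shows "(\<integral>\<^sup>+\<omega>. peel x0 a \<tau> \<omega> \<partial>M) \<le> ennreal ((900000 * a + 700) * K * exp (- \<tau>\<^sup>2 / 18))"
proof -
  define q where "q = exp (- \<tau>\<^sup>2 / 18)"
  have q: "0 < q" "q \<le> 1" by (auto simp: q_def)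
  have eq: "exp (- \<tau>\<^sup>2 / 9) = q * q" unfolding q_def exp_add[symmetric] by simp
  define \<kappa> where "\<kappa> = K / real d"
  have \<kappa>: "0 < \<kappa>" using d K by (simp add: \<kappa>_def)
  have dk: "real d * \<kappa> = K" using d by (simp add: \<kappa>_def)
  have r: "0 \<le> peel_radius a k" "peel_radius a k \<le> 1/4" "peel_radius a k \<le> 2 * a * \<kappa> * 2 ^ k" for k
    using a K by (auto simp: peel_radius_def \<kappa>_def)
  have bnd: "768 * real d * peel_radius a k * (q * q) * p + 2 * K * sqrt (768 * peel_radius a k * (q * q)) * sqrt p
     \<le> K * q * (1536 * a * 2 ^ k * p + 28 * sqrt p)" if "0 \<le> p" for k p
  proof -
    have "768 * real d * peel_radius a k * (q * q) * p \<le> 768 * real d * (2 * a * \<kappa> * 2 ^ k) * (q * 1) * p"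
      using q r[of k] that a \<kappa> by (intro mult_mono) auto
    also have "\<dots> = (real d * \<kappa>) * q * (1536 * a * 2 ^ k * p)" by simp
    finally have 1: "768 * real d * peel_radius a k * (q * q) * p \<le> K * q * (1536 * a * 2 ^ k * p)" unfolding dk .
    \<comment> \<open>The cap on the radius gives 768/4 = 192, rounded up to the square 196.\<close>
    have "sqrt (768 * peel_radius a k * (q * q)) \<le> 14 * q"
    proof (rule real_le_lsqrt)
      have "768 * peel_radius a k * (q * q) \<le> 196 * (q * q)" using r[of k] by (intro mult_right_mono) auto
      then show "768 * peel_radius a k * (q * q) \<le> (14 * q)\<^sup>2" by (simp add: power2_eq_square)
    qed (use q in auto)
    then have "2 * K * sqrt (768 * peel_radius a k * (q * q)) * sqrt p \<le> 2 * K * (14 * q) * sqrt p"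
      using K that q r[of k] by (intro mult_mono) auto
    then show ?thesis using 1 by (simp add: algebra_simps)
  qed
  have P: "emeasure M (peel_event x0 k) \<le> ennreal (144 * (1/4) ^ k)" for k
  proof -
    have "emeasure M (peel_event x0 k) \<le> ennreal (144 * \<kappa>\<^sup>2 / (\<kappa> * 2 ^ k)\<^sup>2)"
      unfolding peel_event_def \<kappa>_def using d K by (intro emeasure_abs_ge_le devsum_second_moment) auto
    also have "144 * \<kappa>\<^sup>2 / (\<kappa> * 2 ^ k)\<^sup>2 = 144 * (1/4) ^ k"
    proof -
      have "((2::real) ^ k)\<^sup>2 = 4 ^ k" by (simp add: power2_eq_square power_mult_distrib[symmetric])
      then show ?thesis using \<kappa> by (simp add: power_mult_distrib power_divide)
    qed
    finally show ?thesis .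
  qed
  have t0: "(\<integral>\<^sup>+\<omega>. ennreal (H \<tau> (peel_radius a 0) \<omega>) \<partial>M) \<le> ennreal (K * q * (1536 * a + 28))"
  proof -
    have "(\<integral>\<^sup>+\<omega>. ennreal (H \<tau> (peel_radius a 0) \<omega>) * indicator (space M) \<omega> \<partial>M) \<le>
      ennreal (768 * real d * peel_radius a 0 * exp (- \<tau>\<^sup>2 / 9) * 1 + 2 * K * sqrt (768 * peel_radius a 0 * exp (- \<tau>\<^sup>2 / 9)) * sqrt 1)"
      using r \<tau> by (intro H_restricted) (auto simp: emeasure_space_1)
    also have "\<dots> \<le> ennreal (K * q * (1536 * a + 28))"
      unfolding eq using bnd[of 1 0] by (intro ennreal_leI) simp
    finally show ?thesis by (simp cong: nn_integral_cong)
  qed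
  have tk: "(\<integral>\<^sup>+\<omega>. ennreal (H \<tau> (peel_radius a (Suc k)) \<omega>) * indicator (peel_event x0 k) \<omega> \<partial>M)
     \<le> ennreal (K * q * (442368 * a + 336) * (1/2) ^ k)" for k
  proof -
    have "(\<integral>\<^sup>+\<omega>. ennreal (H \<tau> (peel_radius a (Suc k)) \<omega>) * indicator (peel_event x0 k) \<omega> \<partial>M) \<le>
      ennreal (768 * real d * peel_radius a (Suc k) * exp (- \<tau>\<^sup>2 / 9) * (144 * (1/4) ^ k)
        + 2 * K * sqrt (768 * peel_radius a (Suc k) * exp (- \<tau>\<^sup>2 / 9)) * sqrt (144 * (1/4) ^ k))"
      using r \<tau> P d by (intro H_restricted) auto
    also have "\<dots> \<le> ennreal (K * q * (1536 * a * 2 ^ Suc k * (144 * (1/4) ^ k) + 28 * sqrt (144 * (1/4) ^ k)))"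
      unfolding eq by (intro ennreal_leI bnd) simp
    \<comment> \<open>Here 442368 is 1536 times 2 times 144, and 336 is 28 times 12, with 12 the
      square root of 144.\<close>
    also have "1536 * a * 2 ^ Suc k * (144 * (1/4) ^ k) + 28 * sqrt (144 * (1/4) ^ k) = (442368 * a + 336) * (1/2) ^ k"
    proof -
      have 1: "(2::real) ^ k * (1/4) ^ k = (1/2) ^ k" by (simp add: power_mult_distrib[symmetric])
      have 2: "sqrt (144 * (1/4) ^ k) = 12 * (1/2) ^ k"
      proof (rule real_sqrt_unique)
        have "((1/2::real) ^ k)\<^sup>2 = (1/4) ^ k" by (simp add: power2_eq_square power_mult_distrib[symmetric])
        then show "(12 * (1/2) ^ k)\<^sup>2 = 144 * (1/4 :: real) ^ k" by (simp only: power_mult_distrib) simp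
      qed simp
      have "1536 * a * 2 ^ Suc k * (144 * (1/4) ^ k) = 442368 * a * (2 ^ k * (1/4) ^ k)" by simp
      then show ?thesis unfolding 1 2 by (simp add: algebra_simps)
    qed
    finally show ?thesis by (simp only: mult.assoc)
  qed
  have "(\<integral>\<^sup>+\<omega>. peel x0 a \<tau> \<omega> \<partial>M) = (\<integral>\<^sup>+\<omega>. ennreal (H \<tau> (peel_radius a 0) \<omega>) \<partial>M) +
     (\<Sum>k. \<integral>\<^sup>+\<omega>. ennreal (H \<tau> (peel_radius a (Suc k)) \<omega>) * indicator (peel_event x0 k) \<omega> \<partial>M)"
    unfolding peel_def using d by (subst nn_integral_add) (auto simp: nn_integral_suminf)
  also have "\<dots> \<le> ennreal (K * q * (1536 * a + 28)) + (\<Sum>k. ennreal (K * q * (442368 * a + 336) * (1/2) ^ k))"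
    by (intro add_mono t0 suminf_le tk) auto
  also have "(\<Sum>k. ennreal (K * q * (442368 * a + 336) * (1/2) ^ k)) = ennreal (\<Sum>k. K * q * (442368 * a + 336) * (1/2) ^ k)"
    using K q a by (intro suminf_ennreal2) (auto intro!: summable_mult summable_geometric)
  also have "(\<Sum>k. K * q * (442368 * a + 336) * (1/2) ^ k) = K * q * (442368 * a + 336) * 2"
    by (subst suminf_mult) (auto simp: suminf_geometric intro!: summable_geometric)
  also have "ennreal (K * q * (1536 * a + 28)) + ennreal (K * q * (442368 * a + 336) * 2)
     = ennreal (K * q * (1536 * a + 28) + K * q * (442368 * a + 336) * 2)"
    using K q a by (intro ennreal_plus[symmetric]) auto
  also have "\<dots> \<le> ennreal ((900000 * a + 700) * K * q)"
  proof (rule ennreal_leI)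
    have "K * q * (1536 * a + 28) + K * q * (442368 * a + 336) * 2 = K * q * (886272 * a + 700)" by (simp add: algebra_simps)
    also have "\<dots> \<le> K * q * (900000 * a + 700)" using K q a by (intro mult_left_mono) auto
    finally show "K * q * (1536 * a + 28) + K * q * (442368 * a + 336) * 2 \<le> (900000 * a + 700) * K * q" by (simp add: mult_ac)
  qed
  finally show ?thesis by (simp add: q_def)
qed

section \<open>Second moments of the sums that make up the error\<close>

lemma chi_sum_second_moment:
  assumes c: "\<And>i. i < d \<Longrightarrow> \<bar>c i\<bar> \<le> 1"
  shows "(\<integral>\<^sup>+\<omega>. ennreal ((\<Sum>i<d. c i * ((\<xi> i \<omega>)\<^sup>2 - 1))\<^sup>2) \<partial>M) \<le> ennreal (12 * K\<^sup>2)"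
proof -
  have "(\<integral>\<^sup>+\<omega>. ennreal ((\<Sum>i<d. c i * ((\<xi> i \<omega>)\<^sup>2 - (\<integral>x. x\<^sup>2 \<partial>std_gauss)))\<^sup>2) \<partial>M) \<le> ennreal (4 * K\<^sup>2 * (\<integral>x. (x\<^sup>2)\<^sup>2 \<partial>std_gauss))"
    by (rule nn_second_moment_even[OF c]) (use std_gauss_power[of 4] in auto)
  then show ?thesis by (simp add: std_gauss_moment2 std_gauss_moment4)
qed

definition tailmean :: "real \<Rightarrow> real" where
  "tailmean \<tau> = (\<integral>z. z\<^sup>2 * indicator {z. \<tau> \<le> \<bar>z\<bar>} z \<partial>std_gauss)"

lemma tail4_integrable: "integrable std_gauss (\<lambda>x. x ^ 4 * indicator {x. \<tau> \<le> \<bar>x\<bar>} x :: real)"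
  by (rule Bochner_Integration.integrable_bound[OF std_gauss_power[of 4]]) (auto split: split_indicator)

lemma tail2_integrable: "integrable std_gauss (\<lambda>x. x ^ 2 * indicator {x. \<tau> \<le> \<bar>x\<bar>} x :: real)"
  by (rule Bochner_Integration.integrable_bound[OF std_gauss_power[of 2]]) (auto split: split_indicator)

lemma tailmean_bounds:
  assumes "1 \<le> \<tau>"
  shows "0 \<le> tailmean \<tau>" "tailmean \<tau> \<le> 192 * exp (- \<tau>\<^sup>2 / 9)"
proof -
  show "0 \<le> tailmean \<tau>" by (simp add: tailmean_def)
  have "tailmean \<tau> \<le> (\<integral>x. x ^ 4 * indicator {x. \<tau> \<le> \<bar>x\<bar>} x \<partial>std_gauss)"
    unfolding tailmean_def
  proof (rule integral_mono[OF tail2_integrable tail4_integrable])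
    fix x :: real
    show "x\<^sup>2 * indicator {z. \<tau> \<le> \<bar>z\<bar>} x \<le> x ^ 4 * indicator {x. \<tau> \<le> \<bar>x\<bar>} x"
    proof (cases "\<tau> \<le> \<bar>x\<bar>")
      case True
      then have "\<bar>x\<bar> ^ 2 \<le> \<bar>x\<bar> ^ 4" using assms by (intro power_increasing) auto
      then show ?thesis using True by simp
    qed simp
  qed
  also have "\<dots> \<le> 192 * exp (- \<tau>\<^sup>2 / 9)" using assms by (intro std_gauss_tail4) auto
  finally show "tailmean \<tau> \<le> 192 * exp (- \<tau>\<^sup>2 / 9)" .
qed

lemma tailmean_le_1: "tailmean \<tau> \<le> 1"
proof -
  have "tailmean \<tau> \<le> (\<integral>x. x\<^sup>2 \<partial>std_gauss)"
    unfolding tailmean_def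
    by (rule integral_mono[OF tail2_integrable std_gauss_power]) (auto split: split_indicator)
  then show ?thesis by (simp add: std_gauss_moment2)
qed

lemma tail_sum_second_moment:
  assumes c: "\<And>i. i < d \<Longrightarrow> \<bar>c i\<bar> \<le> 1" and \<tau>: "0 \<le> \<tau>"
  shows "(\<integral>\<^sup>+\<omega>. ennreal ((\<Sum>i<d. c i * ((\<xi> i \<omega>)\<^sup>2 * indicator {z. \<tau> \<le> \<bar>z\<bar>} (\<xi> i \<omega>) - tailmean \<tau>))\<^sup>2) \<partial>M)
     \<le> ennreal (768 * K\<^sup>2 * exp (- \<tau>\<^sup>2 / 9))"
proof -
  let ?g = "\<lambda>x::real. x\<^sup>2 * indicator {z. \<tau> \<le> \<bar>z\<bar>} x"
  have g2: "(?g x)\<^sup>2 = x ^ 4 * indicator {z. \<tau> \<le> \<bar>z\<bar>} x" for x by (simp split: split_indicator)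
  have "(\<integral>\<^sup>+\<omega>. ennreal ((\<Sum>i<d. c i * (?g (\<xi> i \<omega>) - tailmean \<tau>))\<^sup>2) \<partial>M) \<le> ennreal (4 * K\<^sup>2 * (\<integral>x. (?g x)\<^sup>2 \<partial>std_gauss))"
    unfolding tailmean_def
    by (rule nn_second_moment_even[OF c]) (use tail4_integrable in \<open>auto simp: g2\<close>, auto simp: indicator_def)
  also have "\<dots> \<le> ennreal (4 * K\<^sup>2 * (192 * exp (- \<tau>\<^sup>2 / 9)))"
    unfolding g2 using std_gauss_tail4[OF \<tau>] by (intro ennreal_leI mult_left_mono) auto
  finally show ?thesis by (simp add: mult_ac)
qed

lemma lin_second_moment:
  assumes S: "S \<subseteq> {..<d}"
  shows "(\<integral>\<^sup>+\<omega>. ennreal ((\<Sum>i\<in>S. a i * \<xi> i \<omega>)\<^sup>2) \<partial>M) \<le> ennreal (4 * (\<Sum>i\<in>S. \<Sum>j\<in>S. \<bar>a i\<bar> * \<bar>a j\<bar> * \<bar>R i j\<bar>))"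
proof -
  have "(\<integral>\<^sup>+\<omega>. ennreal ((\<Sum>i\<in>S. a i * (\<xi> i \<omega> - (\<integral>x. x \<partial>std_gauss)))\<^sup>2) \<partial>M)
     \<le> ennreal (\<Sum>i\<in>S. \<Sum>j\<in>S. \<bar>a i\<bar> * \<bar>a j\<bar> * (4 * \<bar>R i j\<bar> * (sqrt (\<integral>x. x\<^sup>2 \<partial>std_gauss) * sqrt (\<integral>x. x\<^sup>2 \<partial>std_gauss))))"
    by (rule nn_second_moment_general[OF S]) (use std_gauss_power[of 2] in auto)
  then show ?thesis by (simp add: std_gauss_mean std_gauss_moment2 sum_distrib_left mult_ac)
qed

text \<open>The subtracted term is the exact mean of the cosine, by
  \<open>std_gauss_cos_shift\<close>. In it the Gaussian factor separates from the signal, and for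
  this reason the signal biases the empirical characteristic function only multiplicatively.\<close>

definition cosdev :: "(nat \<Rightarrow> real) \<Rightarrow> real \<Rightarrow> 'a \<Rightarrow> real" where
  "cosdev \<mu> u \<omega> = (\<Sum>i<d. cos (u * (\<mu> i + \<xi> i \<omega>)) - cos (u * \<mu> i) * exp (- u\<^sup>2 / 2)) / real d"

lemma cosdev_measurable [measurable]: "cosdev \<mu> u \<in> borel_measurable M"
  unfolding cosdev_def[abs_def]
  by (intro borel_measurable_divide borel_measurable_sum borel_measurable_diff borel_measurable_const
      measurable_compose[OF xi_measurable, where g="\<lambda>x. cos (u * (\<mu> _ + x))"]) auto

text \<open>Off the support all summands are one even function, which gives
  \<open>4 * K\<^sup>2\<close>; on the support the shifts destroy evenness and the general bound
  gives \<open>4 * s * K\<close>. The weights \<open>c\<close> vanish on the support, so that the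
  first part is still a sum over all coordinates.\<close>

lemma cosdev_second_moment:
  assumes d: "1 \<le> d" and s: "real (card {i. i < d \<and> \<mu> i \<noteq> 0}) \<le> s"
  shows "(\<integral>\<^sup>+\<omega>. ennreal ((cosdev \<mu> u \<omega>)\<^sup>2) \<partial>M) \<le> ennreal (8 * K * (K + s) / (real d)\<^sup>2)"
proof -
  define S where "S = {i. i < d \<and> \<mu> i \<noteq> 0}"
  have S: "S \<subseteq> {..<d}" by (auto simp: S_def)
  have fS: "finite S" by (simp add: S_def)
  define c where "c i = (if i \<in> S then 0 else 1 :: real)" for i
  define h where "h i x = cos (u * (\<mu> i + x))" for i x
  have hm: "h i \<in> borel_measurable borel" for i unfolding h_def by measurable
  have hi: "(\<integral>x. h i x \<partial>std_gauss) = cos (u * \<mu> i) * exp (- u\<^sup>2 / 2)" for i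
    unfolding h_def by (rule std_gauss_cos_shift)
  have h1: "(h i x)\<^sup>2 \<le> 1" for i x unfolding h_def by (simp add: abs_square_le_1)
  have h2: "integrable std_gauss (\<lambda>x. (h i x)\<^sup>2)" for i
    by (rule std_gauss_bounded_integrable[of _ 1]) (use h1 hm in auto)
  have h3: "(\<integral>x. (h i x)\<^sup>2 \<partial>std_gauss) \<le> 1" for i
    using integral_mono[OF h2 std_gauss_bounded_integrable[of "\<lambda>_. 1" 1]] h1 by (simp add: std_gauss.prob_space[simplified])
  define Z1 where "Z1 \<omega> = (\<Sum>i\<in>S. 1 * (h i (\<xi> i \<omega>) - (\<integral>x. h i x \<partial>std_gauss)))" for \<omega>
  define g where "g x = cos (u * x)" for x
  define Z2 where "Z2 \<omega> = (\<Sum>i<d. c i * (g (\<xi> i \<omega>) - (\<integral>x. g x \<partial>std_gauss)))" for \<omega>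
  have gm: "g \<in> borel_measurable borel" unfolding g_def by measurable
  have g1: "(g x)\<^sup>2 \<le> 1" for x unfolding g_def by (simp add: abs_square_le_1)
  have g2: "integrable std_gauss (\<lambda>x. (g x)\<^sup>2)"
    by (rule std_gauss_bounded_integrable[of _ 1]) (use g1 gm in auto)
  have g3: "(\<integral>x. (g x)\<^sup>2 \<partial>std_gauss) \<le> 1"
    using integral_mono[OF g2 std_gauss_bounded_integrable[of "\<lambda>_. 1" 1]] g1 by (simp add: std_gauss.prob_space[simplified])
  have Z1m [measurable]: "Z1 \<in> borel_measurable M"
    unfolding Z1_def[abs_def] using S
    by (intro borel_measurable_sum borel_measurable_times borel_measurable_diff borel_measurable_const measurable_compose[OF xi_measurable hm]) auto
  have Z2m [measurable]: "Z2 \<in> borel_measurable M"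
    unfolding Z2_def[abs_def] by (rule sum_xi_measurable[OF gm])
  have card: "real (card S) \<le> s" using s by (simp add: S_def)
  have v1: "(\<integral>\<^sup>+\<omega>. ennreal ((Z1 \<omega>)\<^sup>2) \<partial>M) \<le> ennreal (4 * s * K)"
  proof -
    have "(\<integral>\<^sup>+\<omega>. ennreal ((Z1 \<omega>)\<^sup>2) \<partial>M) \<le> ennreal (\<Sum>i\<in>S. \<Sum>j\<in>S. \<bar>1\<bar> * \<bar>1\<bar> * (4 * \<bar>R i j\<bar> * (sqrt (\<integral>x. (h i x)\<^sup>2 \<partial>std_gauss) * sqrt (\<integral>x. (h j x)\<^sup>2 \<partial>std_gauss))))"
      unfolding Z1_def by (rule nn_second_moment_general[OF S hm h2])
    also have "\<dots> \<le> ennreal (\<Sum>i\<in>S. \<Sum>j\<in>S. 4 * (\<bar>1::real\<bar> * \<bar>1::real\<bar> * \<bar>R i j\<bar>))"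
    proof (intro ennreal_leI sum_mono)
      fix i j
      have "sqrt (\<integral>x. (h i x)\<^sup>2 \<partial>std_gauss) * sqrt (\<integral>x. (h j x)\<^sup>2 \<partial>std_gauss) \<le> 1 * 1"
        using h3 by (intro mult_mono) auto
      then show "\<bar>1::real\<bar> * \<bar>1::real\<bar> * (4 * \<bar>R i j\<bar> * (sqrt (\<integral>x. (h i x)\<^sup>2 \<partial>std_gauss) * sqrt (\<integral>x. (h j x)\<^sup>2 \<partial>std_gauss))) \<le> 4 * (\<bar>1::real\<bar> * \<bar>1::real\<bar> * \<bar>R i j\<bar>)"
        using mult_left_mono[of "sqrt (\<integral>x. (h i x)\<^sup>2 \<partial>std_gauss) * sqrt (\<integral>x. (h j x)\<^sup>2 \<partial>std_gauss)" 1 "4 * \<bar>R i j\<bar>"] by simp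
    qed
    also have "\<dots> \<le> ennreal (4 * s * K)"
    proof (rule ennreal_leI)
      have "(\<Sum>i\<in>S. \<Sum>j\<in>S. 4 * (\<bar>1::real\<bar> * \<bar>1::real\<bar> * \<bar>R i j\<bar>)) = 4 * (\<Sum>i\<in>S. \<Sum>j\<in>S. \<bar>1::real\<bar> * \<bar>1::real\<bar> * \<bar>R i j\<bar>)"
        by (simp add: sum_distrib_left)
      also have "\<dots> \<le> 4 * (real (card S) * K)"
        using sum_sum_abs_le[OF S, of "\<lambda>_. 1" R] by (simp add: K_def)
      also have "\<dots> \<le> 4 * (s * K)" using card K_nonneg by (intro mult_left_mono mult_right_mono) auto
      finally show "(\<Sum>i\<in>S. \<Sum>j\<in>S. 4 * (\<bar>1::real\<bar> * \<bar>1::real\<bar> * \<bar>R i j\<bar>)) \<le> 4 * s * K" by (simp add: mult.assoc)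
    qed
    finally show ?thesis .
  qed
  have v2: "(\<integral>\<^sup>+\<omega>. ennreal ((Z2 \<omega>)\<^sup>2) \<partial>M) \<le> ennreal (4 * K\<^sup>2)"
  proof -
    have "(\<integral>\<^sup>+\<omega>. ennreal ((Z2 \<omega>)\<^sup>2) \<partial>M) \<le> ennreal (4 * K\<^sup>2 * (\<integral>x. (g x)\<^sup>2 \<partial>std_gauss))"
      unfolding Z2_def by (rule nn_second_moment_even[OF _ gm g2]) (auto simp: c_def g_def)
    also have "\<dots> \<le> ennreal (4 * K\<^sup>2 * 1)" using g3 by (intro ennreal_leI mult_left_mono) auto
    finally show ?thesis by simp
  qed
  have eq: "cosdev \<mu> u \<omega> = (Z1 \<omega> + Z2 \<omega>) / real d" for \<omega>
  proof -
    have "(\<Sum>i<d. cos (u * (\<mu> i + \<xi> i \<omega>)) - cos (u * \<mu> i) * exp (- u\<^sup>2 / 2)) =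
      (\<Sum>i\<in>S. h i (\<xi> i \<omega>) - (\<integral>x. h i x \<partial>std_gauss)) + (\<Sum>i\<in>{..<d} - S. h i (\<xi> i \<omega>) - (\<integral>x. h i x \<partial>std_gauss))"
      unfolding hi using S by (subst sum.subset_diff[OF S]) (auto simp: h_def)
    moreover have "(\<Sum>i\<in>{..<d} - S. h i (\<xi> i \<omega>) - (\<integral>x. h i x \<partial>std_gauss)) = (\<Sum>i\<in>{..<d} - S. c i * (g (\<xi> i \<omega>) - (\<integral>x. g x \<partial>std_gauss)))"
      by (intro sum.cong refl) (auto simp: c_def S_def h_def g_def)
    moreover have "\<dots> = Z2 \<omega>" unfolding Z2_def by (intro sum.mono_neutral_left) (auto simp: c_def)
    ultimately show ?thesis by (simp add: cosdev_def Z1_def)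
  qed
  have "(\<integral>\<^sup>+\<omega>. ennreal ((cosdev \<mu> u \<omega>)\<^sup>2) \<partial>M) \<le> (\<integral>\<^sup>+\<omega>. ennreal (2 / (real d)\<^sup>2) * (ennreal ((Z1 \<omega>)\<^sup>2) + ennreal ((Z2 \<omega>)\<^sup>2)) \<partial>M)"
  proof (rule nn_integral_mono)
    fix \<omega>
    have "(Z1 \<omega> + Z2 \<omega>)\<^sup>2 \<le> 2 * ((Z1 \<omega>)\<^sup>2 + (Z2 \<omega>)\<^sup>2)"
      using zero_le_power2[of "Z1 \<omega> - Z2 \<omega>"] by (simp add: power2_eq_square algebra_simps)
    then have "(cosdev \<mu> u \<omega>)\<^sup>2 \<le> 2 / (real d)\<^sup>2 * ((Z1 \<omega>)\<^sup>2 + (Z2 \<omega>)\<^sup>2)"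
      unfolding eq power_divide using d by (simp add: divide_right_mono)
    then have "ennreal ((cosdev \<mu> u \<omega>)\<^sup>2) \<le> ennreal (2 / (real d)\<^sup>2 * ((Z1 \<omega>)\<^sup>2 + (Z2 \<omega>)\<^sup>2))" by (rule ennreal_leI)
    also have "\<dots> = ennreal (2 / (real d)\<^sup>2) * (ennreal ((Z1 \<omega>)\<^sup>2) + ennreal ((Z2 \<omega>)\<^sup>2))"
      by (subst ennreal_mult) auto
    finally show "ennreal ((cosdev \<mu> u \<omega>)\<^sup>2) \<le> ennreal (2 / (real d)\<^sup>2) * (ennreal ((Z1 \<omega>)\<^sup>2) + ennreal ((Z2 \<omega>)\<^sup>2))" .
  qed
  also have "\<dots> = ennreal (2 / (real d)\<^sup>2) * ((\<integral>\<^sup>+\<omega>. ennreal ((Z1 \<omega>)\<^sup>2) \<partial>M) + (\<integral>\<^sup>+\<omega>. ennreal ((Z2 \<omega>)\<^sup>2) \<partial>M))"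
    by (subst nn_integral_cmult) (auto simp: nn_integral_add)
  also have "\<dots> \<le> ennreal (2 / (real d)\<^sup>2) * (ennreal (4 * s * K) + ennreal (4 * K\<^sup>2))"
    by (intro mult_left_mono add_mono v1 v2) simp
  also have "\<dots> = ennreal (2 / (real d)\<^sup>2 * (4 * s * K + 4 * K\<^sup>2))"
  proof -
    have s0: "0 \<le> s" using s by (meson of_nat_0_le_iff order_trans)
    then show ?thesis using K_nonneg by (subst ennreal_mult) auto
  qed
  also have "2 / (real d)\<^sup>2 * (4 * s * K + 4 * K\<^sup>2) = 8 * K * (K + s) / (real d)\<^sup>2"
    by (simp add: power2_eq_square algebra_simps add_divide_distrib)
  finally show ?thesis .
qed

end


section \<open>Spectrum of the inverse and measurability\<close>

lemma mat_mult_vec_index: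
  fixes S :: "nat \<Rightarrow> nat \<Rightarrow> 'a :: comm_ring_1"
  assumes "i < d"
  shows "vec_index (mat d d (\<lambda>(i, j). S i j) *\<^sub>v Matrix.vec d v) i = (\<Sum>j<d. S i j * v j)"
  using assms by (simp add: scalar_prod_def lessThan_atLeast0)

lemma mat_mult_mat_index:
  fixes S T :: "nat \<Rightarrow> nat \<Rightarrow> 'a :: comm_ring_1"
  assumes "i < d" "j < d"
  shows "(mat d d (\<lambda>(i, j). S i j) * mat d d (\<lambda>(i, j). T i j)) $$ (i, j) = (\<Sum>k<d. S i k * T k j)"
  using assms by (simp add: scalar_prod_def lessThan_atLeast0)

text \<open>\<open>mat_inv\<close> is a choice and tells nothing until some inverse is exhibited. A
  nonzero kernel vector would make the quadratic form vanish, so the determinant is nonzero.\<close>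

lemma mat_inv_inverse:
  assumes pd: "pos_def d S"
  shows "\<forall>i<d. \<forall>j<d. (\<Sum>k<d. S i k * mat_inv d S k j) = (if i = j then 1 else 0) \<and>
       (\<Sum>k<d. mat_inv d S i k * S k j) = (if i = j then 1 else 0)"
proof -
  let ?A = "mat d d (\<lambda>(i, j). S i j)"
  have A: "?A \<in> carrier_mat d d" by simp
  have "det ?A \<noteq> 0"
  proof
    assume "det ?A = 0"
    then obtain v where v: "v \<in> carrier_vec d" "v \<noteq> 0\<^sub>v d" "?A *\<^sub>v v = 0\<^sub>v d"
      using det_0_iff_vec_prod_zero_field[OF A] by blast
    define u where "u i = vec_index v i" for i
    have vu: "v = Matrix.vec d u" using v by (intro eq_vecI) (auto simp: u_def)
    have "\<exists>i<d. u i \<noteq> 0"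
    proof (rule ccontr)
      assume "\<not> (\<exists>i<d. u i \<noteq> 0)"
      then have "v = 0\<^sub>v d" unfolding vu by (intro eq_vecI) auto
      then show False using v by simp
    qed
    then have pos: "(\<Sum>i<d. \<Sum>j<d. u i * S i j * u j) > 0" using pd unfolding pos_def_def by blast
    have "(\<Sum>j<d. S i j * u j) = 0" if "i < d" for i
      using v(3) that mat_mult_vec_index[OF that, of S u] unfolding vu by simp
    then have "(\<Sum>i<d. u i * (\<Sum>j<d. S i j * u j)) = 0" by simp
    then show False using pos by (simp add: sum_distrib_left mult.assoc)
  qed
  then have "?A \<in> Units (ring_mat TYPE(real) d ())" by (rule det_non_zero_imp_unit[OF A])
  then obtain C where C: "C \<in> carrier_mat d d" "C * ?A = 1\<^sub>m d" "?A * C = 1\<^sub>m d"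
    unfolding Units_def by (auto simp: ring_mat_simps)
  define B where "B i j = C $$ (i, j)" for i j
  have large_const: "C = mat d d (\<lambda>(i, j). B i j)" using C by (intro eq_matI) (auto simp: B_def)
  have ex: "\<forall>i<d. \<forall>j<d. (\<Sum>k<d. S i k * B k j) = (if i = j then 1 else 0) \<and>
       (\<Sum>k<d. B i k * S k j) = (if i = j then 1 else 0)"
  proof (intro allI impI conjI)
    fix i j assume ij: "i < d" "j < d"
    show "(\<Sum>k<d. S i k * B k j) = (if i = j then 1 else 0)"
      using mat_mult_mat_index[OF ij, of S B] C(3) ij unfolding large_const by simp
    show "(\<Sum>k<d. B i k * S k j) = (if i = j then 1 else 0)"
      using mat_mult_mat_index[OF ij, of B S] C(2) ij unfolding large_const by simp
  qed
  show ?thesis unfolding mat_inv_def by (rule someI[where P="\<lambda>B. \<forall>i<d. \<forall>j<d.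
       (\<Sum>k<d. S i k * B k j) = (if i = j then 1 else 0) \<and>
       (\<Sum>k<d. B i k * S k j) = (if i = j then 1 else 0)", OF ex])
qed

lemma sum_inverse_apply:
  fixes P Q :: "nat \<Rightarrow> nat \<Rightarrow> real"
  assumes "\<And>i j. i < d \<Longrightarrow> j < d \<Longrightarrow> (\<Sum>k<d. P i k * Q k j) = (if i = j then 1 else 0)" "i < d"
  shows "(\<Sum>k<d. P i k * (\<Sum>j<d. Q k j * v j)) = v i"
proof -
  have "(\<Sum>k<d. P i k * (\<Sum>j<d. Q k j * v j)) = (\<Sum>k<d. \<Sum>j<d. P i k * Q k j * v j)"
    by (simp add: sum_distrib_left mult.assoc)
  also have "\<dots> = (\<Sum>j<d. (\<Sum>k<d. P i k * Q k j) * v j)"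
    by (subst sum.swap) (simp add: sum_distrib_right)
  also have "\<dots> = (\<Sum>j<d. if j = i then v j else 0)"
    using assms by (intro sum.cong) auto
  also have "\<dots> = v i" using assms by simp
  finally show ?thesis .
qed

text \<open>Over the complex numbers the spectrum is nonempty. The form \<open>Q\<close> of a real
  symmetric matrix equals its own conjugate, so the eigenvalue is real; the real or the imaginary
  part of the eigenvector, whichever is nonzero, is then a real eigenvector.\<close>

lemma symmetric_real_eigenvalue:
  fixes S :: "nat \<Rightarrow> nat \<Rightarrow> real"
  assumes d: "1 \<le> d" and sym: "\<And>i j. i < d \<Longrightarrow> j < d \<Longrightarrow> S i j = S j i"
  shows "\<exists>\<mu>. is_eigenvalue d S \<mu>"
proof -
  let ?S = "\<lambda>i j. complex_of_real (S i j)"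
  let ?A = "mat d d (\<lambda>(i, j). ?S i j)"
  have "spectrum ?A \<noteq> {}" using d by (intro spectrum_non_empty[of _ d]) auto
  then obtain l v where v: "v \<in> carrier_vec d" "v \<noteq> 0\<^sub>v d" "?A *\<^sub>v v = l \<cdot>\<^sub>v v"
    unfolding spectrum_def eigenvalue_def eigenvector_def by auto
  define w where "w i = vec_index v i" for i
  have vw: "v = Matrix.vec d w" using v by (intro eq_vecI) (auto simp: w_def)
  have nz: "\<exists>i<d. w i \<noteq> 0"
  proof (rule ccontr)
    assume "\<not> (\<exists>i<d. w i \<noteq> 0)"
    then have "v = 0\<^sub>v d" unfolding vw by (intro eq_vecI) auto
    then show False using v by simp
  qed
  have ev: "(\<Sum>j<d. ?S i j * w j) = l * w i" if "i < d" for i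
    using v(3) that mat_mult_vec_index[OF that, of ?S w] unfolding vw by simp
  define Q where "Q = (\<Sum>i<d. \<Sum>j<d. cnj (w i) * ?S i j * w j)"
  define n where "n = (\<Sum>i<d. (cmod (w i))\<^sup>2)"
  have n: "0 < n"
  proof -
    obtain i where i: "i < d" "w i \<noteq> 0" using nz by blast
    then have "0 < (cmod (w i))\<^sup>2" by simp
    also have "\<dots> \<le> n" unfolding n_def using i by (intro member_le_sum) auto
    finally show ?thesis .
  qed
  have "Q = (\<Sum>i<d. cnj (w i) * (\<Sum>j<d. ?S i j * w j))"
    unfolding Q_def by (simp add: sum_distrib_left mult.assoc)
  also have "\<dots> = (\<Sum>i<d. l * (cnj (w i) * w i))"
    using ev by (intro sum.cong) auto
  also have "\<dots> = l * complex_of_real n"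
    unfolding n_def of_real_sum complex_norm_square by (simp add: sum_distrib_left mult_ac)
  finally have Ql: "Q = l * complex_of_real n" .
  have "cnj Q = (\<Sum>i<d. \<Sum>j<d. w i * ?S i j * cnj (w j))" by (simp add: Q_def)
  also have "\<dots> = (\<Sum>j<d. \<Sum>i<d. w i * ?S i j * cnj (w j))" by (rule sum.swap)
  also have "\<dots> = Q" unfolding Q_def using sym by (intro sum.cong refl) (auto simp: mult_ac)
  finally have "Im (cnj Q) = Im Q" by simp
  then have "Im Q = 0" by simp
  then have "Im l = 0" using Ql n by simp
  then have l: "l = complex_of_real (Re l)" by (simp add: complex_eq_iff)
  have re: "(\<Sum>j<d. S i j * Re (w j)) = Re l * Re (w i)" and im: "(\<Sum>j<d. S i j * Im (w j)) = Re l * Im (w i)" if "i < d" for i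
    using arg_cong[OF ev[OF that], of Re] arg_cong[OF ev[OF that], of Im] l \<open>Im l = 0\<close> by (simp_all add: Re_sum Im_sum)
  show ?thesis
  proof (cases "\<exists>i<d. Re (w i) \<noteq> 0")
    case True
    then show ?thesis unfolding is_eigenvalue_def
      by (intro exI[of _ "Re l"] exI[of _ "\<lambda>i. Re (w i)"] conjI) (simp_all add: re)
  next
    case False
    then have "\<exists>i<d. Im (w i) \<noteq> 0" using nz by (auto simp: complex_eq_iff)
    then show ?thesis unfolding is_eigenvalue_def
      by (intro exI[of _ "Re l"] exI[of _ "\<lambda>i. Im (w i)"] conjI) (simp_all add: im)
  qed
qed

text \<open>\<open>lambda_max\<close> is a \<open>Max\<close>, which is meaningful only once the set
  of eigenvalues is finite and nonempty. An eigenvector of \<open>S\<close> also serves for the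
  inverse, so symmetry of the inverse need not be shown; positivity of the eigenvalues comes from
  the quadratic form of \<open>S\<close>.\<close>

lemma lambda_max_mat_inv_nonneg:
  assumes d: "1 \<le> d" and sym: "\<And>i j. i < d \<Longrightarrow> j < d \<Longrightarrow> S i j = S j i" and pd: "pos_def d S"
  shows "0 \<le> lambda_max d (mat_inv d S)"
proof -
  define B where "B = mat_inv d S"
  have SB: "(\<Sum>k<d. S i k * B k j) = (if i = j then 1 else 0)"
    and BS: "(\<Sum>k<d. B i k * S k j) = (if i = j then 1 else 0)" if "i < d" "j < d" for i j
    using mat_inv_inverse[OF pd] that unfolding B_def by blast+
  have quad: "(\<Sum>i<d. (v i)\<^sup>2) = \<mu> * (\<Sum>i<d. \<Sum>j<d. v i * S i j * v j)"
    if "\<And>i. i < d \<Longrightarrow> v i = \<mu> * (\<Sum>j<d. S i j * v j)" for v \<mu>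
  proof -
    have "(\<Sum>i<d. (v i)\<^sup>2) = (\<Sum>i<d. v i * (\<mu> * (\<Sum>j<d. S i j * v j)))"
      by (intro sum.cong refl) (simp add: power2_eq_square that[symmetric])
    also have "\<dots> = \<mu> * (\<Sum>i<d. \<Sum>j<d. v i * S i j * v j)" by (simp add: sum_distrib_left mult_ac)
    finally show ?thesis .
  qed
  have sq: "0 < (\<Sum>i<d. (v i)\<^sup>2)" if nz: "\<exists>i<d. v i \<noteq> 0" for v :: "nat \<Rightarrow> real"
  proof -
    obtain i where i: "i < d" "v i \<noteq> 0" using nz by blast
    then have "0 < (v i)\<^sup>2" by simp
    also have "\<dots> \<le> (\<Sum>i<d. (v i)\<^sup>2)" using i by (intro member_le_sum) auto
    finally show ?thesis .
  qed
  have pos: "0 < \<mu>" if ev: "is_eigenvalue d B \<mu>" for \<mu>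
  proof -
    obtain v where v: "\<exists>i<d. v i \<noteq> 0" "\<And>i. i < d \<Longrightarrow> (\<Sum>j<d. B i j * v j) = \<mu> * v i"
      using ev unfolding is_eigenvalue_def by blast
    have "v i = \<mu> * (\<Sum>j<d. S i j * v j)" if "i < d" for i
    proof -
      have "v i = (\<Sum>k<d. S i k * (\<Sum>j<d. B k j * v j))" using sum_inverse_apply[of d S B i v] SB that by simp
      also have "\<dots> = \<mu> * (\<Sum>j<d. S i j * v j)" using v(2) by (simp add: sum_distrib_left mult_ac)
      finally show ?thesis .
    qed
    from quad[OF this] sq[OF v(1)] have "0 < \<mu> * (\<Sum>i<d. \<Sum>j<d. v i * S i j * v j)" by simp
    moreover have "0 < (\<Sum>i<d. \<Sum>j<d. v i * S i j * v j)" using pd v(1) unfolding pos_def_def by blast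
    ultimately show ?thesis by (simp add: zero_less_mult_iff)
  qed
  have ne: "{\<mu>. is_eigenvalue d B \<mu>} \<noteq> {}"
  proof -
    obtain l where l: "is_eigenvalue d S l" using symmetric_real_eigenvalue[of d S] d sym by metis
    then obtain u where u: "\<exists>i<d. u i \<noteq> 0" "\<And>i. i < d \<Longrightarrow> (\<Sum>j<d. S i j * u j) = l * u i"
      unfolding is_eigenvalue_def by blast
    have Bu: "u i = l * (\<Sum>j<d. B i j * u j)" if "i < d" for i
    proof -
      have "u i = (\<Sum>k<d. B i k * (\<Sum>j<d. S k j * u j))" using sum_inverse_apply[of d B S i u] BS that by simp
      also have "\<dots> = l * (\<Sum>j<d. B i j * u j)" using u(2) by (simp add: sum_distrib_left mult_ac)
      finally show ?thesis .
    qed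
    have "l \<noteq> 0" using Bu u(1) by (metis mult_zero_left)
    then have "(\<Sum>j<d. B i j * u j) = inverse l * u i" if "i < d" for i using Bu[OF that] by (simp add: field_simps)
    then have "is_eigenvalue d B (inverse l)" unfolding is_eigenvalue_def using u(1) by (intro exI[of _ u] conjI) simp_all
    then show ?thesis by blast
  qed
  have fin: "finite {\<mu>. is_eigenvalue d B \<mu>}"
  proof (rule finite_subset)
    let ?B = "mat d d (\<lambda>(i, j). B i j)"
    show "finite (spectrum ?B)" by (rule card_finite_spectrum[of _ d]) simp
    show "{\<mu>. is_eigenvalue d B \<mu>} \<subseteq> spectrum ?B"
    proof
      fix \<mu> assume "\<mu> \<in> {\<mu>. is_eigenvalue d B \<mu>}"
      then obtain v where v: "\<exists>i<d. v i \<noteq> 0" "\<And>i. i < d \<Longrightarrow> (\<Sum>j<d. B i j * v j) = \<mu> * v i"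
        unfolding is_eigenvalue_def by blast
      have "Matrix.vec d v \<noteq> 0\<^sub>v d"
      proof
        assume *: "Matrix.vec d v = 0\<^sub>v d"
        obtain i where i: "i < d" "v i \<noteq> 0" using v by blast
        have "vec_index (Matrix.vec d v) i = vec_index (0\<^sub>v d) i" using * by simp
        then show False using i by simp
      qed
      moreover have "?B *\<^sub>v Matrix.vec d v = \<mu> \<cdot>\<^sub>v Matrix.vec d v"
        using v(2) mat_mult_vec_index[of _ d B v] by (intro eq_vecI) auto
      ultimately show "\<mu> \<in> spectrum ?B"
        unfolding spectrum_def eigenvalue_def eigenvector_def by (auto intro!: exI[of _ "Matrix.vec d v"])
    qed
  qed
  have "Max {\<mu>. is_eigenvalue d B \<mu>} \<in> {\<mu>. is_eigenvalue d B \<mu>}" by (rule Max_in[OF fin ne])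
  then show ?thesis unfolding lambda_max_def B_def[symmetric] using pos by (auto intro: less_imp_le)
qed

section \<open>Measurability of the estimators as functions of the observation\<close>

context
  fixes d :: nat and S :: "nat \<Rightarrow> nat \<Rightarrow> real"
  assumes d: "1 \<le> d"
begin

abbreviation (input) "obsM \<equiv> PiM {0..<d} (\<lambda>_. borel :: real measure)"

lemma component_measurable: "i < d \<Longrightarrow> (\<lambda>Y. Y i) \<in> borel_measurable obsM"
  by (rule measurable_component_singleton) simp

lemma Ytil_measurable: "i < d \<Longrightarrow> (\<lambda>Y. Ytil S Y i) \<in> borel_measurable obsM"
  unfolding Ytil_def by (intro borel_measurable_divide component_measurable borel_measurable_const)

lemma Fhat_sum: "Fhat d S Y t = (\<Sum>i<d. if (Ytil S Y i)\<^sup>2 \<le> t then 1 else 0) / real d"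
  by (simp add: Fhat_def sum.If_cases Int_def lessThan_atLeast0)

lemma Fhat_measurable:
  assumes "T \<in> borel_measurable obsM"
  shows "(\<lambda>Y. Fhat d S Y (T Y)) \<in> borel_measurable obsM"
  unfolding Fhat_sum
proof (intro borel_measurable_divide borel_measurable_sum borel_measurable_const)
  fix i assume "i \<in> {..<d}"
  then have [measurable]: "(\<lambda>Y. Ytil S Y i) \<in> borel_measurable obsM" by (intro Ytil_measurable) simp
  note assms [measurable]
  show "(\<lambda>Y. if (Ytil S Y i)\<^sup>2 \<le> T Y then 1 else 0 :: real) \<in> borel_measurable obsM" by measurable
qed

text \<open>An infimum lies below \<open>a\<close> exactly when an integer level witnesses it, so
  sublevel sets of \<open>that\<close> are countable unions.\<close>

lemma that_less_iff: "that d S Y < a \<longleftrightarrow> (\<exists>l::int. 1/2 \<le> Fhat d S Y (2 powr real_of_int l) \<and> 2 powr real_of_int l < a)"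
  unfolding that_def cInf_less_iff[OF that_set_nonempty[OF d] that_set_bdd] by blast

lemma that_measurable: "that d S \<in> borel_measurable obsM"
  unfolding borel_measurable_iff_less
proof
  fix a
  have "{Y \<in> space obsM. that d S Y < a} =
    (\<Union>l::int. {Y \<in> space obsM. 1/2 \<le> Fhat d S Y (2 powr real_of_int l) \<and> 2 powr real_of_int l < a})"
    unfolding that_less_iff by blast
  also have "\<dots> \<in> sets obsM"
  proof -
    have [measurable]: "(\<lambda>Y. Fhat d S Y (2 powr real_of_int l)) \<in> borel_measurable obsM" for l :: int by (rule Fhat_measurable) simp
    show ?thesis by measurable
  qed
  finally show "{Y \<in> space obsM. that d S Y < a} \<in> sets obsM" .
qed

text \<open>\<open>Fhat\<close> takes only the values \<open>k / d\<close>, so the estimate is a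
  finite combination of indicators with constant quantiles, and the quantile function is never
  composed with a random variable.\<close>

lemma sigmaS2_formula:
  "sigmaS2 d S Y = (\<Sum>k\<le>d. (if Fhat d S Y (that d S Y) = real k / real d then 1 else 0) *
     (if 0 < real k / real d then that d S Y * real_of_ereal (1 / chi2_quantile (real k / real d)) else 0))"
proof -
  define k where "k = card {i\<in>{0..<d}. (Ytil S Y i)\<^sup>2 \<le> that d S Y}"
  have kd: "k \<le> d" 
  proof -
    have "k \<le> card {0..<d}" unfolding k_def by (intro card_mono) auto
    then show ?thesis by simp
  qed
  have F: "Fhat d S Y (that d S Y) = real k / real d" by (simp add: Fhat_def k_def)
  \<comment> \<open>Valid for zero and infinite \<open>q\<close> as well, because
    \<open>real_of_ereal\<close> maps infinities to zero.\<close>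
  have q: "real_of_ereal (ereal t / q) = t * real_of_ereal (1 / q)" for t q
    by (cases q; cases "q = 0") (auto simp: zero_ereal_def divide_ereal_def)
  have "(\<Sum>j\<le>d. (if Fhat d S Y (that d S Y) = real j / real d then 1 else 0) *
     (if 0 < real j / real d then that d S Y * real_of_ereal (1 / chi2_quantile (real j / real d)) else 0)) =
    (\<Sum>j\<le>d. if j = k then (if 0 < real j / real d then that d S Y * real_of_ereal (1 / chi2_quantile (real j / real d)) else 0) else 0)"
    unfolding F using d by (intro sum.cong refl) auto
  also have "\<dots> = (if 0 < real k / real d then that d S Y * real_of_ereal (1 / chi2_quantile (real k / real d)) else 0)"
    using kd by simp
  also have "\<dots> = sigmaS2 d S Y" unfolding sigmaS2_def sigmaS2_fun_def F using q by simp
  finally show ?thesis by simp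
qed

lemma sigmaS2_measurable: "sigmaS2 d S \<in> borel_measurable obsM"
proof -
  note that_measurable [measurable]
  have [measurable]: "(\<lambda>Y. Fhat d S Y (that d S Y)) \<in> borel_measurable obsM" by (rule Fhat_measurable) simp
  show ?thesis unfolding sigmaS2_formula[abs_def] by measurable
qed

lemma Nstar_measurable: "Nstar d s S \<in> borel_measurable obsM"
proof -
  note [measurable] = that_measurable sigmaS2_measurable
  have [measurable]: "sigmaS d S \<in> borel_measurable obsM" unfolding sigmaS_def[abs_def] by measurable
  have "(\<lambda>Y. phihat d S Y (sqrt (lam d s S / that d S Y))) \<in> borel_measurable obsM"
    unfolding phihat_def
  proof (intro borel_measurable_divide borel_measurable_sum borel_measurable_const)
    fix i assume "i \<in> {..<d}"
    then have [measurable]: "(\<lambda>Y. Ytil S Y i) \<in> borel_measurable obsM" by (intro Ytil_measurable) simp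
    show "(\<lambda>Y. cos (sqrt (lam d s S / that d S Y) * Ytil S Y i)) \<in> borel_measurable obsM" by measurable
  qed
  note [measurable] = this
  have [measurable]: "sigmaD2 d s S \<in> borel_measurable obsM"
    unfolding sigmaD2_def[abs_def] sigmaD2til_def by measurable
  have 1: "(\<lambda>Y. \<Sum>i<d. (Y i)\<^sup>2 * indicator {y. sigmaS d S Y * sd S i * tau d s S < \<bar>y\<bar>} (Y i)) \<in> borel_measurable obsM"
  proof (rule borel_measurable_sum)
    fix i assume "i \<in> {..<d}"
    then have [measurable]: "(\<lambda>Y. Y i) \<in> borel_measurable obsM" by (intro component_measurable) simp
    have "(\<lambda>Y. (Y i)\<^sup>2 * indicator {y. sigmaS d S Y * sd S i * tau d s S < \<bar>y\<bar>} (Y i)) =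
      (\<lambda>Y. (Y i)\<^sup>2 * (if sigmaS d S Y * sd S i * tau d s S < \<bar>Y i\<bar> then 1 else 0 :: real))"
      by (auto simp: indicator_def)
    also have "\<dots> \<in> borel_measurable obsM" by measurable
    finally show "(\<lambda>Y. (Y i)\<^sup>2 * indicator {y. sigmaS d S Y * sd S i * tau d s S < \<bar>y\<bar>} (Y i)) \<in> borel_measurable obsM" .
  qed
  have 2: "(\<lambda>Y. \<Sum>i<d. (Y i)\<^sup>2 - sigmaD2 d s S Y * (sd S i)\<^sup>2) \<in> borel_measurable obsM"
  proof (rule borel_measurable_sum)
    fix i assume "i \<in> {..<d}"
    then have [measurable]: "(\<lambda>Y. Y i) \<in> borel_measurable obsM" by (intro component_measurable) simp
    show "(\<lambda>Y. (Y i)\<^sup>2 - sigmaD2 d s S Y * (sd S i)\<^sup>2) \<in> borel_measurable obsM" by measurable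
  qed
  note [measurable] = 1 2
  have [measurable]: "Qstar d s S \<in> borel_measurable obsM" unfolding Qstar_def[abs_def] by measurable
  show ?thesis unfolding Nstar_def[abs_def] by measurable
qed

end


section \<open>The sparse model\<close>

text \<open>With q the square root, |q^2 - b^2| = |q - b| (q + b) gives both (q - b)^2 <= |q^2 -
  b^2| and |q - b| b <= |q^2 - b^2|. The first is used when the remainder \<open>r\<close>
  dominates, the second when \<open>A\<close> does: \<open>A\<close> will be the linear term,
  proportional to the signal, and division by \<open>b\<close> removes that growth. The premise on
  \<open>b = 0\<close> is needed since division by zero yields zero.\<close>

lemma sqrt_abs_diff_sq_le:
  fixes A b Q r :: real
  assumes b: "0 \<le> b" and Q: "Q = b\<^sup>2 + A + r" and A: "b = 0 \<longrightarrow> A = 0"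
  shows "(sqrt \<bar>Q\<bar> - b)\<^sup>2 \<le> 2 * \<bar>r\<bar> + 4 * A\<^sup>2 / b\<^sup>2"
proof -
  define q where "q = sqrt \<bar>Q\<bar>"
  have q: "0 \<le> q" "q\<^sup>2 = \<bar>Q\<bar>" by (auto simp: q_def)
  have D: "\<bar>q\<^sup>2 - b\<^sup>2\<bar> \<le> \<bar>A\<bar> + \<bar>r\<bar>"
  proof -
    have "\<bar>\<bar>Q\<bar> - \<bar>b\<^sup>2\<bar>\<bar> \<le> \<bar>Q - b\<^sup>2\<bar>" by (rule abs_triangle_ineq3)
    then show ?thesis unfolding q Q by simp
  qed
  have f: "\<bar>q\<^sup>2 - b\<^sup>2\<bar> = \<bar>q - b\<bar> * (q + b)"
  proof -
    have "q\<^sup>2 - b\<^sup>2 = (q - b) * (q + b)" by (simp add: power2_eq_square algebra_simps)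
    then show ?thesis using q(1) b by (simp only: abs_mult abs_of_nonneg add_nonneg_nonneg)
  qed
  have "\<bar>q - b\<bar> \<le> q + b" using q b by linarith
  then have "\<bar>q - b\<bar> * \<bar>q - b\<bar> \<le> \<bar>q - b\<bar> * (q + b)" by (intro mult_left_mono) auto
  then have 1: "(q - b)\<^sup>2 \<le> \<bar>A\<bar> + \<bar>r\<bar>" using D f by (simp add: power2_eq_square abs_mult_self_eq)
  show ?thesis
  proof (cases "\<bar>A\<bar> \<le> \<bar>r\<bar>")
    case True
    have "0 \<le> 4 * A\<^sup>2 / b\<^sup>2" by simp
    then show ?thesis using 1 True unfolding q_def by linarith
  next
    case False
    then have bp: "0 < b" using A b by (cases "b = 0") auto
    have "\<bar>q - b\<bar> * b \<le> \<bar>q - b\<bar> * (q + b)" using q by (intro mult_left_mono) auto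
    also have "\<dots> \<le> 2 * \<bar>A\<bar>" using D f False by simp
    finally have "\<bar>q - b\<bar> \<le> 2 * \<bar>A\<bar> / b" using bp by (simp add: field_simps)
    then have "\<bar>q - b\<bar>\<^sup>2 \<le> (2 * \<bar>A\<bar> / b)\<^sup>2" by (intro power_mono) auto
    then have "(q - b)\<^sup>2 \<le> 4 * A\<^sup>2 / b\<^sup>2" by (simp add: power_divide power_mult_distrib)
    then show ?thesis unfolding q_def by (smt (verit) abs_ge_zero)
  qed
qed

context prob_space
begin

lemma nn_real_add:
  fixes f g :: "'a \<Rightarrow> real"
  assumes [measurable]: "f \<in> borel_measurable M" "g \<in> borel_measurable M"
    and "\<And>\<omega>. 0 \<le> f \<omega>" "\<And>\<omega>. 0 \<le> g \<omega>"
    and "(\<integral>\<^sup>+\<omega>. ennreal (f \<omega>) \<partial>M) \<le> ennreal a" "(\<integral>\<^sup>+\<omega>. ennreal (g \<omega>) \<partial>M) \<le> ennreal b" "0 \<le> a" "0 \<le> b"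
  shows "(\<integral>\<^sup>+\<omega>. ennreal (f \<omega> + g \<omega>) \<partial>M) \<le> ennreal (a + b)"
proof -
  have "(\<integral>\<^sup>+\<omega>. ennreal (f \<omega> + g \<omega>) \<partial>M) = (\<integral>\<^sup>+\<omega>. ennreal (f \<omega>) + ennreal (g \<omega>) \<partial>M)"
    using assms by (simp add: ennreal_plus)
  also have "\<dots> = (\<integral>\<^sup>+\<omega>. ennreal (f \<omega>) \<partial>M) + (\<integral>\<^sup>+\<omega>. ennreal (g \<omega>) \<partial>M)"
    by (rule nn_integral_add) measurable
  also have "\<dots> \<le> ennreal a + ennreal b" using assms by (intro add_mono)
  also have "\<dots> = ennreal (a + b)" using assms by (simp add: ennreal_plus)
  finally show ?thesis .
qed

lemma nn_real_cmult:
  fixes f :: "'a \<Rightarrow> real"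
  assumes [measurable]: "f \<in> borel_measurable M" and "\<And>\<omega>. 0 \<le> f \<omega>"
    and "(\<integral>\<^sup>+\<omega>. ennreal (f \<omega>) \<partial>M) \<le> ennreal a" "0 \<le> a" "0 \<le> k"
  shows "(\<integral>\<^sup>+\<omega>. ennreal (k * f \<omega>) \<partial>M) \<le> ennreal (k * a)"
proof -
  have "(\<integral>\<^sup>+\<omega>. ennreal (k * f \<omega>) \<partial>M) = (\<integral>\<^sup>+\<omega>. ennreal k * ennreal (f \<omega>) \<partial>M)"
    using assms by (simp add: ennreal_mult)
  also have "\<dots> = ennreal k * (\<integral>\<^sup>+\<omega>. ennreal (f \<omega>) \<partial>M)" by (rule nn_integral_cmult) measurable
  also have "\<dots> \<le> ennreal k * ennreal a" using assms by (intro mult_left_mono) auto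
  also have "\<dots> = ennreal (k * a)" using assms by (simp add: ennreal_mult)
  finally show ?thesis .
qed

lemma nn_real_const: "0 \<le> a \<Longrightarrow> (\<integral>\<^sup>+\<omega>. ennreal a \<partial>M) \<le> ennreal a"
  by (simp add: emeasure_space_1)

end

text \<open>Chebyshev's constant for \<open>devsum\<close> exceeding \<open>ell / 128\<close>, with
  144 from \<open>devsum_second_moment\<close>.\<close>

definition bad_const :: real where "bad_const = 144 * (128 / ell)\<^sup>2"

lemma bad_const_ge1: "1 \<le> bad_const"
proof -
  have "1 \<le> 128 / ell" using ell_pos ell_le by (simp add: field_simps)
  then have "1\<^sup>2 \<le> (128 / ell)\<^sup>2" by (intro power_mono) auto
  then show ?thesis unfolding bad_const_def by simp
qed

text \<open>The sparsity bound \<open>ell / 128\<close> leaves room for two equal contributions to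
  the tolerance \<open>ell / 64\<close> of \<open>estimator_good\<close>: \<open>s / d\<close> from
  the coordinates carrying signal, and \<open>devsum\<close> from the noise.\<close>

locale sparse_model = gauss_noise M d \<xi> R for M :: "'a measure" and d \<xi> R +
  fixes \<sigma> :: real and \<theta> :: "nat \<Rightarrow> real" and Sg :: "nat \<Rightarrow> nat \<Rightarrow> real" and s :: nat and c :: real
  assumes d1: "1 \<le> d" and s1: "1 \<le> s" and s_le: "real s \<le> ell / 128 * real d" and sig: "0 < \<sigma>"
    and sparse: "card {i\<in>{0..<d}. \<theta> i \<noteq> 0} \<le> s"
    and c0: "0 < c" and Sl: "i < d \<Longrightarrow> c \<le> Sg i i" and Su: "i < d \<Longrightarrow> Sg i i \<le> 1"
    and R_eq: "i < d \<Longrightarrow> j < d \<Longrightarrow> R i j = Stil Sg i j" and R_abs: "i < d \<Longrightarrow> j < d \<Longrightarrow> \<bar>R i j\<bar> \<le> 1"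
begin

definition obs :: "'a \<Rightarrow> nat \<Rightarrow> real" where
  "obs \<omega> = restrict (\<lambda>i. \<theta> i + \<sigma> * (sd Sg i * \<xi> i \<omega>)) {0..<d}"

definition mu :: "nat \<Rightarrow> real" where "mu i = \<theta> i / (\<sigma> * sd Sg i)"

definition V :: "'a \<Rightarrow> nat \<Rightarrow> real" where "V \<omega> i = mu i + \<xi> i \<omega>"

definition supp :: "nat set" where "supp = {i. i < d \<and> \<theta> i \<noteq> 0}"

definition err :: "'a \<Rightarrow> real" where "err \<omega> = (Nstar d (real s) Sg (obs \<omega>) - l2norm d \<theta>)\<^sup>2"

definition lin :: "'a \<Rightarrow> real" where "lin \<omega> = (\<Sum>i\<in>supp. (\<theta> i * sd Sg i) * \<xi> i \<omega>)"

abbreviation F where "F \<equiv> frob d Sg"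
abbreviation \<tau> where "\<tau> \<equiv> tau d (real s) Sg"

lemma sd_sq: "i < d \<Longrightarrow> (sd Sg i)\<^sup>2 = Sg i i"
  using Sl[of i] c0 by (simp add: sd_def)

lemma sd_pos: "i < d \<Longrightarrow> 0 < sd Sg i"
  using Sl[of i] c0 by (simp add: sd_def)

lemma sd_le1: "i < d \<Longrightarrow> sd Sg i \<le> 1"
  using Su[of i] by (simp add: sd_def)

lemma sd_sq_le1: "i < d \<Longrightarrow> (sd Sg i)\<^sup>2 \<le> 1"
  using sd_sq Su by simp

lemma sum_sd_le: "(\<Sum>i<d. (sd Sg i)\<^sup>2) \<le> real d"
  using sum_mono[of "{..<d}" "\<lambda>i. (sd Sg i)\<^sup>2" "\<lambda>_. 1"] sd_sq_le1 by simp

lemma supp_sub: "supp \<subseteq> {..<d}" by (auto simp: supp_def)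

lemma finite_supp: "finite supp" by (simp add: supp_def)

lemma card_supp: "card supp \<le> s"
proof -
  have "supp = {i\<in>{0..<d}. \<theta> i \<noteq> 0}" by (auto simp: supp_def)
  then show ?thesis using sparse by simp
qed

lemma obs_eq: "i < d \<Longrightarrow> obs \<omega> i = \<sigma> * sd Sg i * V \<omega> i"
  using sd_pos[of i] sig by (simp add: obs_def V_def mu_def field_simps)

lemma Ytil_obs: "i < d \<Longrightarrow> Ytil Sg (obs \<omega>) i = \<sigma> * V \<omega> i"
  using sd_pos[of i] by (simp add: Ytil_def obs_eq)

lemma theta_mu: "i < d \<Longrightarrow> \<theta> i = \<sigma> * sd Sg i * mu i"
  using sd_pos[of i] sig by (simp add: mu_def)

lemma V_nosupp: "i < d \<Longrightarrow> i \<notin> supp \<Longrightarrow> V \<omega> i = \<xi> i \<omega>"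
  by (simp add: V_def mu_def supp_def)

lemma c_le1: "c \<le> 1"
  using Sl[of 0] Su[of 0] d1 by simp

lemma Sg_R: "i < d \<Longrightarrow> j < d \<Longrightarrow> Sg i j = R i j * (sd Sg i * sd Sg j)"
  using sd_pos[of i] sd_pos[of j] by (simp add: R_eq Stil_def)

lemma F_le_K: "F \<le> K"
  unfolding frob_def K_def
proof (intro real_sqrt_le_mono sum_mono)
  fix i j assume ij: "i \<in> {..<d}" "j \<in> {..<d}"
  have "sd Sg i * sd Sg j \<le> 1 * 1"
    using ij sd_pos[of i] sd_pos[of j] sd_le1[of i] sd_le1[of j] by (intro mult_mono) auto
  then have "\<bar>R i j\<bar> * (sd Sg i * sd Sg j) \<le> \<bar>R i j\<bar> * 1" by (intro mult_left_mono) auto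
  then have "\<bar>Sg i j\<bar> \<le> \<bar>R i j\<bar>"
    using ij Sg_R[of i j] sd_pos[of i] sd_pos[of j] by (simp add: abs_mult)
  then show "(Sg i j)\<^sup>2 \<le> (R i j)\<^sup>2" by (simp add: abs_le_square_iff)
qed

text \<open>Entries of the two matrices differ by products of standard deviations, which lie between
  c and 1. Together with \<open>F_le_K\<close> this translates fluctuation bounds, which involve the
  correlation matrix, into rates, which involve the covariance matrix.\<close>

lemma K_le_F: "c * K \<le> F"
proof -
  have "c * K = sqrt (c\<^sup>2 * (\<Sum>i<d. \<Sum>j<d. (R i j)\<^sup>2))" using c0 by (simp add: K_def real_sqrt_mult)
  also have "\<dots> = sqrt (\<Sum>i<d. \<Sum>j<d. c\<^sup>2 * (R i j)\<^sup>2)" by (simp add: sum_distrib_left)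
  also have "\<dots> \<le> F" unfolding frob_def
  proof (intro real_sqrt_le_mono sum_mono)
    fix i j assume ij: "i \<in> {..<d}" "j \<in> {..<d}"
    have "(Sg i j)\<^sup>2 = (R i j)\<^sup>2 * (Sg i i * Sg j j)" using ij by (simp add: Sg_R[of i j] power_mult_distrib sd_sq)
    moreover have "c * c \<le> Sg i i * Sg j j" using ij Sl[of i] Sl[of j] c0 by (intro mult_mono) auto
    ultimately show "c\<^sup>2 * (R i j)\<^sup>2 \<le> (Sg i j)\<^sup>2"
      using mult_left_mono[of "c * c" "Sg i i * Sg j j" "(R i j)\<^sup>2"] by (simp add: power2_eq_square mult_ac)
  qed
  finally show ?thesis .
qed

lemma K_ge1: "1 \<le> K"
proof -
  have "R 0 0 = 1" using R_eq[of 0 0] d1 sd_sq[of 0] sd_pos[of 0] Sl[of 0] c0 by (simp add: Stil_def power2_eq_square)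
  then have "1 = (R 0 0)\<^sup>2" by simp
  also have "\<dots> \<le> (\<Sum>j<d. (R 0 j)\<^sup>2)" using d1 by (intro member_le_sum) auto
  also have "\<dots> \<le> (\<Sum>i<d. \<Sum>j<d. (R i j)\<^sup>2)" using d1 by (intro member_le_sum) (auto intro: sum_nonneg)
  finally show ?thesis by (simp add: K_def)
qed

lemma K_pos: "0 < K" using K_ge1 by simp

lemma K_le_d: "K \<le> real d"
proof -
  have "(\<Sum>i<d. \<Sum>j<d. (R i j)\<^sup>2) \<le> (\<Sum>i<d. \<Sum>j<d. 1)"
    using R_abs by (intro sum_mono) (auto simp: abs_square_le_1)
  also have "\<dots> = (real d)\<^sup>2" by (simp add: power2_eq_square)
  finally show ?thesis unfolding K_def by (intro real_le_lsqrt) auto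
qed

lemma F_pos: "0 < F"
proof -
  have "0 < c * K" using K_pos c0 by simp
  then show ?thesis using K_le_F by linarith
qed

lemma K_le_Fc: "K \<le> F / c"
  using K_le_F c0 by (simp add: field_simps)

lemma frob_Stil: "frob d (Stil Sg) = K"
  unfolding frob_def K_def by (simp add: R_eq)

definition l0 :: int where
  "l0 = (SOME l. 1/8 < 2 powr real_of_int l / \<sigma>\<^sup>2 \<and> 2 powr real_of_int l / \<sigma>\<^sup>2 \<le> 1/4)"

definition x0 :: real where "x0 = 2 powr real_of_int l0 / \<sigma>\<^sup>2"

lemma x0_bounds: "1/8 < x0" "x0 \<le> 1/4"
proof -
  have "\<exists>l. 1/8 < 2 powr real_of_int l / \<sigma>\<^sup>2 \<and> 2 powr real_of_int l / \<sigma>\<^sup>2 \<le> 1/4"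
    using dyadic_base[OF sig] by metis
  then have "1/8 < x0 \<and> x0 \<le> 1/4" unfolding x0_def l0_def by (rule someI_ex)
  then show "1/8 < x0" "x0 \<le> 1/4" by auto
qed

lemma Fhat_obs: "Fhat d Sg (obs \<omega>) t = ecdf d (V \<omega>) (t / \<sigma>\<^sup>2)"
  by (rule Fhat_eq_ecdf[OF sig Ytil_obs])

lemma ecdf_V: "\<bar>ecdf d (V \<omega>) x - ecdf d (\<lambda>i. \<xi> i \<omega>) x\<bar> \<le> real s / real d"
proof -
  have "\<bar>ecdf d (V \<omega>) x - ecdf d (\<lambda>i. \<xi> i \<omega>) x\<bar> \<le> real (card supp) / real d"
    by (rule ecdf_perturb[OF d1 finite_supp V_nosupp])
  also have "\<dots> \<le> real s / real d" using card_supp by (intro divide_right_mono) auto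
  finally show ?thesis .
qed

lemma s_over_d: "real s / real d \<le> ell / 128"
  using s_le d1 by (simp add: field_simps)

abbreviation that_n :: "'a \<Rightarrow> real" where "that_n \<omega> \<equiv> that d Sg (obs \<omega>) / \<sigma>\<^sup>2"

definition X2 :: "'a \<Rightarrow> real" where "X2 \<omega> = sigmaS2 d Sg (obs \<omega>) / \<sigma>\<^sup>2"

lemma X2_bounds: "0 \<le> X2 \<omega>" "X2 \<omega> \<le> 4 * that_n \<omega>"
  using sigmaS2_bounds[OF d1, of Sg "obs \<omega>"] sig by (auto simp: X2_def divide_right_mono)

lemma that_n_le: "\<omega> \<in> space M \<Longrightarrow> ennreal (that_n \<omega>) \<le> 8 + tailT x0 \<omega>"
proof (rule that_le_tailT[OF d1 sig Fhat_obs x0_def x0_bounds])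
  show "\<bar>ecdf d (V \<omega>) x - ecdf d (\<lambda>i. \<xi> i \<omega>) x\<bar> \<le> 1/100" for x
    using ecdf_V[of \<omega> x] s_over_d ell_le by linarith
qed

text \<open>Defined through the noise alone, so that its probability does not involve the
  signal.\<close>

definition good :: "'a set" where "good = {\<omega> \<in> space M. devsum x0 \<omega> \<le> ell / 128}"

definition bad :: "'a set" where "bad = space M - good"

lemma good_sets [measurable]: "good \<in> sets M" "bad \<in> sets M"
  using d1 unfolding good_def bad_def by measurable

lemma bad_prob: "emeasure M bad \<le> ennreal (bad_const * (K / real d)\<^sup>2)"
proof -
  have "emeasure M bad \<le> emeasure M {\<omega> \<in> space M. ell / 128 \<le> \<bar>devsum x0 \<omega>\<bar>}"
    using d1 by (intro emeasure_mono) (auto simp: bad_def good_def)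
  also have "\<dots> \<le> ennreal (144 * (K / real d)\<^sup>2 / (ell / 128)\<^sup>2)"
    using d1 ell_pos by (intro emeasure_abs_ge_le devsum_second_moment) auto
  also have "144 * (K / real d)\<^sup>2 / (ell / 128)\<^sup>2 = bad_const * (K / real d)\<^sup>2"
    by (simp add: bad_const_def power_divide)
  finally show ?thesis .
qed

lemma good_facts:
  assumes "\<omega> \<in> good"
  obtains j w where "1 \<le> j" "j < 6" "that_n \<omega> = x0 * 2 ^ j" "X2 \<omega> = 1 / w"
    "\<bar>w - 1\<bar> \<le> 4 * (real s / real d + devsum x0 \<omega>) / ell" "\<bar>w - 1\<bar> \<le> 1/16"
proof -
  define e where "e = real s / real d + devsum x0 \<omega>"
  have e: "0 \<le> e" "e \<le> ell / 64" 
  proof -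
    have "devsum x0 \<omega> \<le> ell / 128" using assms by (simp add: good_def)
    moreover have "0 \<le> real s / real d" by simp
    ultimately show "0 \<le> e" "e \<le> ell / 64" using s_over_d devsum_nonneg[of x0 \<omega>] unfolding e_def by linarith+
  qed
  have dv: "\<bar>ecdf d (V \<omega>) (x0 * 2 ^ j) - chi2_cdf (x0 * 2 ^ j)\<bar> \<le> e" if "j < 6" for j
    using ecdf_V[of \<omega> "x0 * 2 ^ j"] dev_le_devsum[OF that, of x0 \<omega>] unfolding e_def dev_def by linarith
  obtain j w where j: "1 \<le> j" "j < 6" "that d Sg (obs \<omega>) = \<sigma>\<^sup>2 * (x0 * 2 ^ j)" "sigmaS2 d Sg (obs \<omega>) = \<sigma>\<^sup>2 / w" "\<bar>w - 1\<bar> \<le> 4 * e / ell"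
    using estimator_good[OF d1 sig Fhat_obs x0_def x0_bounds e dv] by metis
  have "4 * e / ell \<le> 1/16" using e ell_pos by (simp add: field_simps)
  then have "\<bar>w - 1\<bar> \<le> 1/16" using j(5) by linarith
  moreover have "that_n \<omega> = x0 * 2 ^ j" "X2 \<omega> = 1 / w" using j sig by (simp_all add: X2_def)
  ultimately show ?thesis using that[OF j(1,2)] j(5) unfolding e_def by blast
qed

lemma l2norm_sq_supp: "(l2norm d \<theta>)\<^sup>2 = (\<Sum>i\<in>supp. (\<theta> i)\<^sup>2)"
proof -
  have "(l2norm d \<theta>)\<^sup>2 = (\<Sum>i<d. (\<theta> i)\<^sup>2)" by (simp add: l2norm_def sum_nonneg)
  also have "\<dots> = (\<Sum>i\<in>supp. (\<theta> i)\<^sup>2)" by (intro sum.mono_neutral_right) (auto simp: supp_def)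
  finally show ?thesis .
qed

lemma lin_measurable [measurable]: "lin \<in> borel_measurable M"
  unfolding lin_def[abs_def] using supp_sub
  by (intro borel_measurable_sum borel_measurable_times borel_measurable_const xi_measurable) auto

text \<open>The contribution of the linear term in \<open>sqrt_abs_diff_sq_le\<close>, in units of
  the variance: with \<open>A = 2 * \<sigma> * lin\<close> the quotient
  \<open>4 * A\<^sup>2 / b\<^sup>2\<close> is \<open>\<sigma>\<^sup>2 * linq\<close>. Without signal
  it is zero.\<close>

definition linq :: "'a \<Rightarrow> real" where "linq \<omega> = 16 * (lin \<omega>)\<^sup>2 / (l2norm d \<theta>)\<^sup>2"

lemma linq_measurable [measurable]: "linq \<in> borel_measurable M"
  unfolding linq_def[abs_def] by measurable

lemma linq_nonneg: "0 \<le> linq \<omega>"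
  by (simp add: linq_def)

text \<open>The second moment of the linear form is at most \<open>4 * B\<close> times the squared
  norm of the signal, which the denominator of \<open>linq\<close> cancels. Later \<open>B\<close>
  is \<open>K\<close> when s exceeds F and \<open>s\<close> otherwise, the choice that fits the rate
  in each regime.\<close>

lemma linq_integral:
  assumes B: "(\<Sum>i\<in>supp. \<Sum>j\<in>supp. \<bar>\<theta> i * sd Sg i\<bar> * \<bar>\<theta> j * sd Sg j\<bar> * \<bar>R i j\<bar>) \<le> B * (\<Sum>i\<in>supp. (\<theta> i * sd Sg i)\<^sup>2)" and "0 \<le> B"
  shows "(\<integral>\<^sup>+\<omega>. ennreal (linq \<omega>) \<partial>M) \<le> ennreal (64 * B)"
proof (cases "l2norm d \<theta> = 0")
  case True
  then show ?thesis by (simp add: linq_def)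
next
  case False
  define b where "b = (l2norm d \<theta>)\<^sup>2"
  have b: "0 < b" using False by (simp add: b_def)
  have "(\<Sum>i\<in>supp. (\<theta> i * sd Sg i)\<^sup>2) \<le> b"
    unfolding b_def l2norm_sq_supp
  proof (rule sum_mono)
    fix i assume "i \<in> supp"
    then have "(sd Sg i)\<^sup>2 \<le> 1" using supp_sub sd_sq_le1 by auto
    then show "(\<theta> i * sd Sg i)\<^sup>2 \<le> (\<theta> i)\<^sup>2" using mult_left_mono[of "(sd Sg i)\<^sup>2" 1 "(\<theta> i)\<^sup>2"] by (simp add: power_mult_distrib)
  qed
  then have "(\<Sum>i\<in>supp. \<Sum>j\<in>supp. \<bar>\<theta> i * sd Sg i\<bar> * \<bar>\<theta> j * sd Sg j\<bar> * \<bar>R i j\<bar>) \<le> B * b"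
    using B mult_left_mono[of _ b B] \<open>0 \<le> B\<close> by (meson order_trans)
  then have "(\<integral>\<^sup>+\<omega>. ennreal ((lin \<omega>)\<^sup>2) \<partial>M) \<le> ennreal (4 * (B * b))"
    unfolding lin_def using order_trans[OF lin_second_moment[OF supp_sub, of "\<lambda>i. \<theta> i * sd Sg i"] ennreal_leI] by simp
  then have "(\<integral>\<^sup>+\<omega>. ennreal (16 / b * (lin \<omega>)\<^sup>2) \<partial>M) \<le> ennreal (16 / b * (4 * (B * b)))"
    using b \<open>0 \<le> B\<close> by (intro nn_real_cmult) auto
  then show ?thesis using b by (simp add: linq_def b_def)
qed

lemma linq_integral_K: "(\<integral>\<^sup>+\<omega>. ennreal (linq \<omega>) \<partial>M) \<le> ennreal (64 * K)"
  using sum_sum_abs_le[OF supp_sub, of "\<lambda>i. \<theta> i * sd Sg i" R] K_nonneg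
  by (intro linq_integral) (simp_all add: K_def mult.commute)

lemma linq_integral_s: "(\<integral>\<^sup>+\<omega>. ennreal (linq \<omega>) \<partial>M) \<le> ennreal (64 * real s)"
proof (rule linq_integral)
  let ?a = "\<lambda>i. \<bar>\<theta> i * sd Sg i\<bar>"
  have "(\<Sum>i\<in>supp. \<Sum>j\<in>supp. ?a i * ?a j * \<bar>R i j\<bar>) \<le> (\<Sum>i\<in>supp. \<Sum>j\<in>supp. ?a i * ?a j)"
  proof (intro sum_mono)
    fix i j assume "i \<in> supp" "j \<in> supp"
    then have "\<bar>R i j\<bar> \<le> 1" using supp_sub R_abs by auto
    then have "(?a i * ?a j) * \<bar>R i j\<bar> \<le> (?a i * ?a j) * 1" by (intro mult_left_mono) auto
    then show "?a i * ?a j * \<bar>R i j\<bar> \<le> ?a i * ?a j" by simp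
  qed
  also have "\<dots> = (\<Sum>i\<in>supp. 1 * ?a i)\<^sup>2" by (simp add: power2_eq_square sum_product)
  also have "\<dots> \<le> (\<Sum>i\<in>supp. 1\<^sup>2) * (\<Sum>i\<in>supp. (?a i)\<^sup>2)" by (rule Cauchy_Schwarz_ineq_sum)
  also have "\<dots> \<le> real s * (\<Sum>i\<in>supp. (\<theta> i * sd Sg i)\<^sup>2)"
    using card_supp by (auto intro!: mult_right_mono sum_nonneg)
  finally show "(\<Sum>i\<in>supp. \<Sum>j\<in>supp. ?a i * ?a j * \<bar>R i j\<bar>) \<le> real s * (\<Sum>i\<in>supp. (\<theta> i * sd Sg i)\<^sup>2)" .
qed simp

lemma err_le:
  assumes "Qstar d (real s) Sg (obs \<omega>) = (l2norm d \<theta>)\<^sup>2 + 2 * \<sigma> * lin \<omega> + \<sigma>\<^sup>2 * r" "\<bar>r\<bar> \<le> B"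
  shows "err \<omega> \<le> \<sigma>\<^sup>2 * (2 * B + linq \<omega>)"
proof -
  have z: "l2norm d \<theta> = 0 \<longrightarrow> 2 * \<sigma> * lin \<omega> = 0"
  proof
    assume "l2norm d \<theta> = 0"
    then have "(\<Sum>i\<in>supp. (\<theta> i)\<^sup>2) = 0" using l2norm_sq_supp by simp
    then have "\<forall>i\<in>supp. \<theta> i = 0" using finite_supp by (subst (asm) sum_nonneg_eq_0_iff) auto
    then show "2 * \<sigma> * lin \<omega> = 0" by (simp add: lin_def)
  qed
  have "err \<omega> \<le> 2 * \<bar>\<sigma>\<^sup>2 * r\<bar> + 4 * (2 * \<sigma> * lin \<omega>)\<^sup>2 / (l2norm d \<theta>)\<^sup>2"
    unfolding err_def Nstar_def by (rule sqrt_abs_diff_sq_le[OF _ assms(1) z]) (simp add: l2norm_def sum_nonneg)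
  also have "\<dots> = \<sigma>\<^sup>2 * (2 * \<bar>r\<bar> + linq \<omega>)"
    by (simp add: linq_def abs_mult power_mult_distrib algebra_simps)
  also have "\<dots> \<le> \<sigma>\<^sup>2 * (2 * B + linq \<omega>)" using assms(2) by (intro mult_left_mono) auto
  finally show ?thesis .
qed

lemma X2_le_tailT: "\<omega> \<in> space M \<Longrightarrow> ennreal (X2 \<omega>) \<le> 32 + 4 * tailT x0 \<omega>"
proof -
  assume \<omega>: "\<omega> \<in> space M"
  have "ennreal (X2 \<omega>) \<le> ennreal (4 * that_n \<omega>)" using X2_bounds by (intro ennreal_leI)
  also have "\<dots> = 4 * ennreal (that_n \<omega>)" 
    using ennreal_mult[of 4 "that_n \<omega>"] that_nonneg[OF d1, of Sg "obs \<omega>"] by simp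
  also have "\<dots> \<le> 4 * (8 + tailT x0 \<omega>)" by (intro mult_left_mono that_n_le[OF \<omega>]) simp
  also have "\<dots> = 32 + 4 * tailT x0 \<omega>" by (simp add: distrib_left)
  finally show ?thesis .
qed

end


section \<open>Sparsity below the Frobenius norm\<close>

definition small_const :: "real \<Rightarrow> real" where "small_const c = 164 + 4 * (728 + 7300000 / ell) / c"

context sparse_model
begin

lemma tailT_integral': "(\<integral>\<^sup>+\<omega>. tailT x0 \<omega> \<partial>M) \<le> ennreal (200 * (K / real d)\<^sup>2)"
  by (rule tailT_integral[OF d1 x0_bounds(1)])

lemma kappa_sq_bounds: "0 \<le> (K / real d)\<^sup>2" "(K / real d)\<^sup>2 \<le> 1"
proof -
  show "0 \<le> (K / real d)\<^sup>2" by simp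
  have "K / real d \<le> 1" using K_le_d d1 by simp
  then show "(K / real d)\<^sup>2 \<le> 1" using K_nonneg by (intro power_le_one) auto
qed

text \<open>The compensated thresholded noise at the deterministic threshold \<open>\<tau>\<close>,
  to which the version \<open>W\<close> with estimated threshold is compared.\<close>

definition Z2 :: "'a \<Rightarrow> real" where
  "Z2 \<omega> = (\<Sum>i<d. (sd Sg i)\<^sup>2 * ((\<xi> i \<omega>)\<^sup>2 * indicator {z. \<tau> \<le> \<bar>z\<bar>} (\<xi> i \<omega>) - tailmean \<tau>))"

definition Z3 :: "'a \<Rightarrow> real" where
  "Z3 \<omega> = (\<Sum>i<d. (sd Sg i)\<^sup>2 * ((\<xi> i \<omega>)\<^sup>2 - 1))"

lemma Z2_measurable [measurable]: "Z2 \<in> borel_measurable M"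
  unfolding Z2_def[abs_def] by (rule sum_xi_measurable) measurable

lemma Z3_measurable [measurable]: "Z3 \<in> borel_measurable M"
  unfolding Z3_def[abs_def] by (rule sum_xi_measurable) measurable

lemma sd_abs_le: "i < d \<Longrightarrow> \<bar>(sd Sg i)\<^sup>2\<bar> \<le> 1"
  using sd_sq_le1 by simp

lemma tau_nonneg: "0 \<le> \<tau>"
  by (simp add: tau_def)

lemma Z2_second: "(\<integral>\<^sup>+\<omega>. ennreal ((Z2 \<omega>)\<^sup>2) \<partial>M) \<le> ennreal (768 * K\<^sup>2 * exp (- \<tau>\<^sup>2 / 9))"
  unfolding Z2_def by (rule tail_sum_second_moment[OF sd_abs_le tau_nonneg])

lemma Z3_second: "(\<integral>\<^sup>+\<omega>. ennreal ((Z3 \<omega>)\<^sup>2) \<partial>M) \<le> ennreal (12 * K\<^sup>2)"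
  unfolding Z3_def by (rule chi_sum_second_moment[OF sd_abs_le])

lemma alpha_eq: "alpha_s d (real s) Sg = tailmean \<tau>"
  by (simp add: alpha_s_def tailmean_def)

definition thr :: "'a \<Rightarrow> real" where "thr \<omega> = sqrt (X2 \<omega>) * \<tau>"

definition W :: "'a \<Rightarrow> real" where
  "W \<omega> = (\<Sum>i<d. (sd Sg i)\<^sup>2 * ((\<xi> i \<omega>)\<^sup>2 * indicator {z. thr \<omega> < \<bar>z\<bar>} (\<xi> i \<omega>))) - X2 \<omega> * tailmean \<tau> * (\<Sum>i<d. (sd Sg i)\<^sup>2)"

text \<open>Writing an indicator above the threshold as one minus that below it, and expanding
  \<open>V\<close> into signal and noise, expresses the thresholded square of \<open>V\<close> as
  signal, cross term, thresholded noise and this correction. It vanishes off the support, and on it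
  each square is cut off at the threshold, however large the signal.\<close>

definition Bs :: "'a \<Rightarrow> real" where
  "Bs \<omega> = (\<Sum>i<d. (sd Sg i)\<^sup>2 * ((\<xi> i \<omega>)\<^sup>2 * indicator {z. \<bar>z\<bar> \<le> thr \<omega>} (\<xi> i \<omega>) - (V \<omega> i)\<^sup>2 * indicator {z. \<bar>z\<bar> \<le> thr \<omega>} (V \<omega> i)))"

lemma thr_sq: "(thr \<omega>)\<^sup>2 = X2 \<omega> * \<tau>\<^sup>2"
  using X2_bounds by (simp add: thr_def power_mult_distrib)

lemma Bs_bound: "\<bar>Bs \<omega>\<bar> \<le> real s * (X2 \<omega> * \<tau>\<^sup>2)"
proof -
  let ?t = "\<lambda>i. (sd Sg i)\<^sup>2 * ((\<xi> i \<omega>)\<^sup>2 * indicator {z. \<bar>z\<bar> \<le> thr \<omega>} (\<xi> i \<omega>) - (V \<omega> i)\<^sup>2 * indicator {z. \<bar>z\<bar> \<le> thr \<omega>} (V \<omega> i))"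
  have "Bs \<omega> = (\<Sum>i\<in>supp. ?t i)"
    unfolding Bs_def by (intro sum.mono_neutral_right) (use supp_sub V_nosupp in auto)
  then have "\<bar>Bs \<omega>\<bar> \<le> (\<Sum>i\<in>supp. \<bar>?t i\<bar>)" by simp
  also have "\<dots> \<le> (\<Sum>i\<in>supp. X2 \<omega> * \<tau>\<^sup>2)"
  proof (rule sum_mono)
    fix i assume "i \<in> supp"
    then have sd1: "(sd Sg i)\<^sup>2 \<le> 1" using supp_sub sd_sq_le1 by auto
    have b: "0 \<le> z\<^sup>2 * indicator {z. \<bar>z\<bar> \<le> thr \<omega>} z \<and> z\<^sup>2 * indicator {z. \<bar>z\<bar> \<le> thr \<omega>} z \<le> X2 \<omega> * \<tau>\<^sup>2" for z :: real
    proof (cases "\<bar>z\<bar> \<le> thr \<omega>")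
      case True
      then have "\<bar>z\<bar>\<^sup>2 \<le> (thr \<omega>)\<^sup>2" by (intro power_mono) auto
      then show ?thesis using True thr_sq[of \<omega>] by simp
    next
      case False
      then show ?thesis using X2_bounds by simp
    qed
    have "\<bar>(\<xi> i \<omega>)\<^sup>2 * indicator {z. \<bar>z\<bar> \<le> thr \<omega>} (\<xi> i \<omega>) - (V \<omega> i)\<^sup>2 * indicator {z. \<bar>z\<bar> \<le> thr \<omega>} (V \<omega> i)\<bar> \<le> X2 \<omega> * \<tau>\<^sup>2"
      using b[of "\<xi> i \<omega>"] b[of "V \<omega> i"] by linarith
    then have "(sd Sg i)\<^sup>2 * \<bar>(\<xi> i \<omega>)\<^sup>2 * indicator {z. \<bar>z\<bar> \<le> thr \<omega>} (\<xi> i \<omega>) - (V \<omega> i)\<^sup>2 * indicator {z. \<bar>z\<bar> \<le> thr \<omega>} (V \<omega> i)\<bar> \<le> 1 * (X2 \<omega> * \<tau>\<^sup>2)"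
      using sd1 by (intro mult_mono) auto
    then show "\<bar>?t i\<bar> \<le> X2 \<omega> * \<tau>\<^sup>2" by (simp add: abs_mult)
  qed
  also have "\<dots> \<le> real s * (X2 \<omega> * \<tau>\<^sup>2)"
    using card_supp X2_bounds by (auto intro!: mult_right_mono)
  finally show ?thesis .
qed

lemma l2norm_sq_sum: "(l2norm d \<theta>)\<^sup>2 = \<sigma>\<^sup>2 * (\<Sum>i<d. (sd Sg i)\<^sup>2 * (mu i)\<^sup>2)"
proof -
  have "(l2norm d \<theta>)\<^sup>2 = (\<Sum>i<d. (\<theta> i)\<^sup>2)" by (simp add: l2norm_def sum_nonneg)
  also have "\<dots> = (\<Sum>i<d. \<sigma>\<^sup>2 * ((sd Sg i)\<^sup>2 * (mu i)\<^sup>2))"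
    by (intro sum.cong refl) (simp add: theta_mu power_mult_distrib)
  finally show ?thesis by (simp add: sum_distrib_left)
qed

lemma lin_sum: "lin \<omega> = \<sigma> * (\<Sum>i<d. (sd Sg i)\<^sup>2 * (mu i * \<xi> i \<omega>))"
proof -
  have "lin \<omega> = (\<Sum>i<d. (\<theta> i * sd Sg i) * \<xi> i \<omega>)"
    unfolding lin_def by (intro sum.mono_neutral_left) (auto simp: supp_def)
  also have "\<dots> = (\<Sum>i<d. \<sigma> * ((sd Sg i)\<^sup>2 * (mu i * \<xi> i \<omega>)))"
    by (intro sum.cong refl) (simp add: theta_mu power2_eq_square)
  finally show ?thesis by (simp add: sum_distrib_left)
qed

lemma Qstar_small:
  assumes sF: "real s \<le> F"
  shows "Qstar d (real s) Sg (obs \<omega>) = (l2norm d \<theta>)\<^sup>2 + 2 * \<sigma> * lin \<omega> + \<sigma>\<^sup>2 * (Bs \<omega> + W \<omega>)"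
proof -
  have s2: "sigmaS2 d Sg (obs \<omega>) = \<sigma>\<^sup>2 * X2 \<omega>" using sig by (simp add: X2_def)
  have sS: "sigmaS d Sg (obs \<omega>) = \<sigma> * sqrt (X2 \<omega>)"
    unfolding sigmaS_def s2 using sig by (simp add: real_sqrt_mult)
  have t: "(obs \<omega> i)\<^sup>2 * indicator {y. sigmaS d Sg (obs \<omega>) * sd Sg i * \<tau> < \<bar>y\<bar>} (obs \<omega> i)
    = \<sigma>\<^sup>2 * ((sd Sg i)\<^sup>2 * (mu i)\<^sup>2 + 2 * ((sd Sg i)\<^sup>2 * (mu i * \<xi> i \<omega>)) +
       (sd Sg i)\<^sup>2 * ((\<xi> i \<omega>)\<^sup>2 * indicator {z. \<bar>z\<bar> \<le> thr \<omega>} (\<xi> i \<omega>) - (V \<omega> i)\<^sup>2 * indicator {z. \<bar>z\<bar> \<le> thr \<omega>} (V \<omega> i)) +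
       (sd Sg i)\<^sup>2 * ((\<xi> i \<omega>)\<^sup>2 * indicator {z. thr \<omega> < \<bar>z\<bar>} (\<xi> i \<omega>)))" if i: "i < d" for i
  proof -
    have p: "0 < \<sigma> * sd Sg i" using sig sd_pos[OF i] by simp
    have "sigmaS d Sg (obs \<omega>) * sd Sg i * \<tau> < \<bar>obs \<omega> i\<bar> \<longleftrightarrow> (\<sigma> * sd Sg i) * thr \<omega> < (\<sigma> * sd Sg i) * \<bar>V \<omega> i\<bar>"
      using p unfolding sS obs_eq[OF i] thr_def abs_mult[of "\<sigma> * sd Sg i"] by (simp add: mult_ac)
    also have "\<dots> \<longleftrightarrow> thr \<omega> < \<bar>V \<omega> i\<bar>" by (rule mult_less_cancel_left_pos[OF p])
    finally have ind: "indicator {y. sigmaS d Sg (obs \<omega>) * sd Sg i * \<tau> < \<bar>y\<bar>} (obs \<omega> i) = (1 - indicator {z. \<bar>z\<bar> \<le> thr \<omega>} (V \<omega> i) :: real)"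
      by (auto simp: indicator_def)
    have ind2: "indicator {z. thr \<omega> < \<bar>z\<bar>} (\<xi> i \<omega>) = (1 - indicator {z. \<bar>z\<bar> \<le> thr \<omega>} (\<xi> i \<omega>) :: real)"
      by (auto simp: indicator_def)
    have V2: "(V \<omega> i)\<^sup>2 = (mu i)\<^sup>2 + 2 * (mu i * \<xi> i \<omega>) + (\<xi> i \<omega>)\<^sup>2" by (simp add: V_def power2_sum)
    have o2: "(obs \<omega> i)\<^sup>2 = \<sigma>\<^sup>2 * ((sd Sg i)\<^sup>2 * (V \<omega> i)\<^sup>2)" using obs_eq[OF i] by (simp add: power_mult_distrib)
    define I J where "I = (indicator {z. \<bar>z\<bar> \<le> thr \<omega>} (V \<omega> i) :: real)" and "J = (indicator {z. \<bar>z\<bar> \<le> thr \<omega>} (\<xi> i \<omega>) :: real)"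
    show ?thesis unfolding ind ind2 o2 I_def[symmetric] J_def[symmetric] V2 by (simp add: algebra_simps)
  qed
  have "Qstar d (real s) Sg (obs \<omega>) = (\<Sum>i<d. (obs \<omega> i)\<^sup>2 * indicator {y. sigmaS d Sg (obs \<omega>) * sd Sg i * \<tau> < \<bar>y\<bar>} (obs \<omega> i))
      - \<sigma>\<^sup>2 * X2 \<omega> * tailmean \<tau> * (\<Sum>i<d. (sd Sg i)\<^sup>2)"
    using sF unfolding Qstar_def s2 alpha_eq by simp
  also have "\<dots> = \<sigma>\<^sup>2 * (\<Sum>i<d. (sd Sg i)\<^sup>2 * (mu i)\<^sup>2) + \<sigma>\<^sup>2 * (2 * (\<Sum>i<d. (sd Sg i)\<^sup>2 * (mu i * \<xi> i \<omega>))) + \<sigma>\<^sup>2 * Bs \<omega>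
    + \<sigma>\<^sup>2 * (\<Sum>i<d. (sd Sg i)\<^sup>2 * ((\<xi> i \<omega>)\<^sup>2 * indicator {z. thr \<omega> < \<bar>z\<bar>} (\<xi> i \<omega>))) - \<sigma>\<^sup>2 * X2 \<omega> * tailmean \<tau> * (\<Sum>i<d. (sd Sg i)\<^sup>2)"
  proof -
    have "(\<Sum>i<d. (obs \<omega> i)\<^sup>2 * indicator {y. sigmaS d Sg (obs \<omega>) * sd Sg i * \<tau> < \<bar>y\<bar>} (obs \<omega> i)) =
      (\<Sum>i<d. \<sigma>\<^sup>2 * ((sd Sg i)\<^sup>2 * (mu i)\<^sup>2 + 2 * ((sd Sg i)\<^sup>2 * (mu i * \<xi> i \<omega>)) +
       (sd Sg i)\<^sup>2 * ((\<xi> i \<omega>)\<^sup>2 * indicator {z. \<bar>z\<bar> \<le> thr \<omega>} (\<xi> i \<omega>) - (V \<omega> i)\<^sup>2 * indicator {z. \<bar>z\<bar> \<le> thr \<omega>} (V \<omega> i)) +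
       (sd Sg i)\<^sup>2 * ((\<xi> i \<omega>)\<^sup>2 * indicator {z. thr \<omega> < \<bar>z\<bar>} (\<xi> i \<omega>))))"
      by (intro sum.cong refl t) simp
    then show ?thesis unfolding Bs_def by (simp only: sum_distrib_left[symmetric] sum.distrib distrib_left)
  qed
  also have "\<dots> = (l2norm d \<theta>)\<^sup>2 + 2 * \<sigma> * lin \<omega> + \<sigma>\<^sup>2 * (Bs \<omega> + W \<omega>)"
    unfolding l2norm_sq_sum lin_sum W_def by (simp add: power2_eq_square algebra_simps)
  finally show ?thesis .
qed

text \<open>For the exceptional event, where the threshold is out of control: indicators are dropped
  and the compensating factor is bounded by one.\<close>

lemma W_always: "\<bar>W \<omega>\<bar> \<le> real d + \<bar>Z3 \<omega>\<bar> + X2 \<omega> * real d"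
proof -
  let ?A = "\<Sum>i<d. (sd Sg i)\<^sup>2 * ((\<xi> i \<omega>)\<^sup>2 * indicator {z. thr \<omega> < \<bar>z\<bar>} (\<xi> i \<omega>))"
  have A0: "0 \<le> ?A" by (intro sum_nonneg) auto
  have "?A \<le> (\<Sum>i<d. (sd Sg i)\<^sup>2 * (\<xi> i \<omega>)\<^sup>2)"
    by (intro sum_mono mult_left_mono) (auto split: split_indicator)
  also have "\<dots> = Z3 \<omega> + (\<Sum>i<d. (sd Sg i)\<^sup>2)" by (simp add: Z3_def algebra_simps sum_subtractf)
  also have "\<dots> \<le> \<bar>Z3 \<omega>\<bar> + real d" using sum_sd_le by linarith
  finally have A: "?A \<le> \<bar>Z3 \<omega>\<bar> + real d" .
  have tm: "0 \<le> tailmean \<tau>" by (simp add: tailmean_def)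
  have "X2 \<omega> * tailmean \<tau> * (\<Sum>i<d. (sd Sg i)\<^sup>2) \<le> X2 \<omega> * 1 * real d"
    using X2_bounds tm tailmean_le_1 sum_sd_le by (intro mult_mono) (auto intro: sum_nonneg)
  moreover have "0 \<le> X2 \<omega> * tailmean \<tau> * (\<Sum>i<d. (sd Sg i)\<^sup>2)" using X2_bounds tm by (auto intro!: mult_nonneg_nonneg sum_nonneg)
  ultimately show ?thesis unfolding W_def using A A0 by linarith
qed

text \<open>Twice the bound of \<open>good_facts\<close>, which concerns the reciprocal
  \<open>w\<close>; inverting a number within 1/16 of one at most doubles its distance to one. The
  form is affine in \<open>devsum\<close>, as peeling requires.\<close>

definition vr :: "'a \<Rightarrow> real" where "vr \<omega> = 8 / ell * (real s / real d + devsum x0 \<omega>)"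

lemma vr_nonneg: "0 \<le> vr \<omega>"
  using ell_pos devsum_nonneg[of x0 \<omega>] by (simp add: vr_def)

lemma vr_measurable [measurable]: "vr \<in> borel_measurable M"
  using d1 unfolding vr_def[abs_def] by measurable

lemma good_X2:
  assumes g: "\<omega> \<in> good"
  shows "\<bar>X2 \<omega> - 1\<bar> \<le> vr \<omega>" "\<bar>sqrt (X2 \<omega>) - 1\<bar> \<le> vr \<omega>" "X2 \<omega> \<le> 2" "1/2 \<le> X2 \<omega>" "vr \<omega> \<le> 1/4"
proof -
  obtain j w where w: "X2 \<omega> = 1 / w" "\<bar>w - 1\<bar> \<le> 4 * (real s / real d + devsum x0 \<omega>) / ell" "\<bar>w - 1\<bar> \<le> 1/16"
    using good_facts[OF g] by metis
  have w1: "15/16 \<le> w" "w \<le> 17/16" using w(3) by linarith+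
  have "\<bar>X2 \<omega> - 1\<bar> = \<bar>w - 1\<bar> / w" using w1 unfolding w(1) by (simp add: field_simps abs_if)
  also have "\<dots> \<le> \<bar>w - 1\<bar> / (1/2)" using w1 by (intro divide_left_mono) auto
  also have "\<dots> \<le> 2 * (4 * (real s / real d + devsum x0 \<omega>) / ell)"
  proof -
    have "a / (1/2) \<le> 2 * b" if "a \<le> b" for a b :: real using that by simp
    from this[OF w(2)] show ?thesis .
  qed
  also have "\<dots> = vr \<omega>" by (simp add: vr_def)
  finally show 1: "\<bar>X2 \<omega> - 1\<bar> \<le> vr \<omega>" .
  have "\<bar>sqrt (X2 \<omega>) - 1\<bar> * 1 \<le> \<bar>sqrt (X2 \<omega>) - 1\<bar> * (sqrt (X2 \<omega>) + 1)"
    using X2_bounds by (intro mult_left_mono) auto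
  also have "\<dots> = \<bar>(sqrt (X2 \<omega>) - 1) * (sqrt (X2 \<omega>) + 1)\<bar>" using X2_bounds by (simp add: abs_mult)
  also have "(sqrt (X2 \<omega>) - 1) * (sqrt (X2 \<omega>) + 1) = X2 \<omega> - 1" using X2_bounds by (simp add: algebra_simps)
  finally show "\<bar>sqrt (X2 \<omega>) - 1\<bar> \<le> vr \<omega>" using 1 by simp
  show "X2 \<omega> \<le> 2" "1/2 \<le> X2 \<omega>" using w1 unfolding w(1) by (auto simp: field_simps)
  have "devsum x0 \<omega> \<le> ell / 128" using g by (simp add: good_def)
  then have "real s / real d + devsum x0 \<omega> \<le> ell / 64" using s_over_d by linarith
  then have "vr \<omega> \<le> 8 / ell * (ell / 64)" unfolding vr_def using ell_pos by (intro mult_left_mono) auto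
  then show "vr \<omega> \<le> 1/4" using ell_pos by simp
qed

text \<open>Replacing the estimated threshold by \<open>\<tau>\<close> affects only coordinates in
  the box of relative width \<open>vr\<close>, which are collected in \<open>H\<close>; replacing
  the estimated variance in the compensation costs its relative error times
  \<open>tailmean \<tau> * d\<close>.\<close>

lemma W_good:
  assumes g: "\<omega> \<in> good"
  shows "\<bar>W \<omega>\<bar> \<le> \<bar>Z2 \<omega>\<bar> + H \<tau> (vr \<omega>) \<omega> + vr \<omega> * tailmean \<tau> * real d"
proof -
  note X = good_X2[OF g]
  let ?D = "\<lambda>i. (\<xi> i \<omega>)\<^sup>2 * indicator {z. thr \<omega> < \<bar>z\<bar>} (\<xi> i \<omega>) - (\<xi> i \<omega>)\<^sup>2 * indicator {z. \<tau> \<le> \<bar>z\<bar>} (\<xi> i \<omega>)"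
  have tm: "0 \<le> tailmean \<tau>" by (simp add: tailmean_def)
  have eq: "W \<omega> = Z2 \<omega> + (\<Sum>i<d. (sd Sg i)\<^sup>2 * ?D i) - (X2 \<omega> - 1) * tailmean \<tau> * (\<Sum>i<d. (sd Sg i)\<^sup>2)"
    unfolding W_def Z2_def by (simp add: algebra_simps sum.distrib sum_subtractf sum_distrib_left sum_distrib_right)
  have th: "\<bar>thr \<omega> - \<tau>\<bar> \<le> \<tau> * vr \<omega>"
  proof -
    have "\<bar>thr \<omega> - \<tau>\<bar> = \<tau> * \<bar>sqrt (X2 \<omega>) - 1\<bar>"
    proof -
      have "thr \<omega> - \<tau> = \<tau> * (sqrt (X2 \<omega>) - 1)" by (simp add: thr_def algebra_simps)
      then show ?thesis using tau_nonneg by (simp add: abs_mult)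
    qed
    also have "\<dots> \<le> \<tau> * vr \<omega>" using X(2) tau_nonneg by (intro mult_left_mono)
    finally show ?thesis .
  qed
  have "\<bar>\<Sum>i<d. (sd Sg i)\<^sup>2 * ?D i\<bar> \<le> (\<Sum>i<d. \<bar>(sd Sg i)\<^sup>2 * ?D i\<bar>)" by (rule sum_abs)
  also have "\<dots> \<le> H \<tau> (vr \<omega>) \<omega>"
    unfolding H_def
  proof (rule sum_mono)
    fix i assume "i \<in> {..<d}"
    then have sd1: "(sd Sg i)\<^sup>2 \<le> 1" using sd_sq_le1 by auto
    have "\<bar>?D i\<bar> \<le> (\<xi> i \<omega>)\<^sup>2 * indicator (box \<tau> (vr \<omega>)) (\<xi> i \<omega>)"
    proof (cases "\<xi> i \<omega> \<in> box \<tau> (vr \<omega>)")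
      case True
      then show ?thesis by (auto split: split_indicator)
    next
      case False
      then have "\<tau> * vr \<omega> < \<bar>\<bar>\<xi> i \<omega>\<bar> - \<tau>\<bar>" by (simp add: box_def)
      then have "thr \<omega> < \<bar>\<xi> i \<omega>\<bar> \<longleftrightarrow> \<tau> \<le> \<bar>\<xi> i \<omega>\<bar>" using th by linarith
      then show ?thesis by (simp add: indicator_def)
    qed
    then have "(sd Sg i)\<^sup>2 * \<bar>?D i\<bar> \<le> 1 * ((\<xi> i \<omega>)\<^sup>2 * indicator (box \<tau> (vr \<omega>)) (\<xi> i \<omega>))"
      using sd1 by (intro mult_mono) auto
    then show "\<bar>(sd Sg i)\<^sup>2 * ?D i\<bar> \<le> (\<xi> i \<omega>)\<^sup>2 * indicator (box \<tau> (vr \<omega>)) (\<xi> i \<omega>)" by (simp add: abs_mult)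
  qed
  finally have D: "\<bar>\<Sum>i<d. (sd Sg i)\<^sup>2 * ?D i\<bar> \<le> H \<tau> (vr \<omega>) \<omega>" .
  have "\<bar>(X2 \<omega> - 1) * tailmean \<tau> * (\<Sum>i<d. (sd Sg i)\<^sup>2)\<bar> = \<bar>X2 \<omega> - 1\<bar> * tailmean \<tau> * (\<Sum>i<d. (sd Sg i)\<^sup>2)"
    using tm by (simp add: abs_mult sum_nonneg)
  also have "\<dots> \<le> vr \<omega> * tailmean \<tau> * real d"
    using X(1) tm sum_sd_le vr_nonneg by (intro mult_mono) (auto intro: sum_nonneg)
  finally show ?thesis unfolding eq using D by linarith
qed

text \<open>The factor 3 in \<open>tau\<close> yields exp(-tau^2/9) = 1/(1 + F^2/s^2), so its square
  root is at most s/F and turns fluctuations of order K into order s. The condition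
  \<open>s \<le> F\<close> gives L >= ln 2, so constants can be absorbed in the logarithm and tau
  stays above 4/3.\<close>

lemma rate_facts:
  assumes sF: "real s \<le> F"
  defines "L \<equiv> ln (1 + F\<^sup>2 / (real s)\<^sup>2)"
  shows "1/2 \<le> L" "\<tau>\<^sup>2 = 9 * L" "4/3 \<le> \<tau>" "K * exp (- \<tau>\<^sup>2 / 18) \<le> real s / c" "psi_star d (real s) Sg = real s * L"
proof -
  have sp: "0 < real s" using s1 by simp
  have r: "1 \<le> F\<^sup>2 / (real s)\<^sup>2"
  proof -
    have "(real s)\<^sup>2 \<le> F\<^sup>2" using sF by (intro power_mono) auto
    then show ?thesis using sp by simp
  qed
  have "ln 2 \<le> L" unfolding L_def using r by (intro ln_mono) auto
  then show L: "1/2 \<le> L" using ln2_ge_two_thirds by linarith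
  show t2: "\<tau>\<^sup>2 = 9 * L" unfolding tau_def L_def[symmetric] using L by (simp add: power_mult_distrib)
  have "(4/3)\<^sup>2 \<le> \<tau>\<^sup>2" unfolding t2 using L by (simp add: power2_eq_square)
  then show "4/3 \<le> \<tau>" using tau_nonneg by (rule power2_le_imp_le)
  define q where "q = exp (- \<tau>\<^sup>2 / 18)"
  have "q * q = exp (- L)" unfolding q_def exp_add[symmetric] t2 by simp
  also have "\<dots> = 1 / (1 + F\<^sup>2 / (real s)\<^sup>2)" unfolding L_def using r by (simp add: exp_minus inverse_eq_divide)
  finally have qq: "q * q = 1 / (1 + F\<^sup>2 / (real s)\<^sup>2)" .
  have "(F * q)\<^sup>2 \<le> (real s)\<^sup>2"
  proof -
    have "(F * q)\<^sup>2 = F\<^sup>2 * (q * q)" by (simp add: power2_eq_square mult_ac)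
    also have "\<dots> = F\<^sup>2 / (1 + F\<^sup>2 / (real s)\<^sup>2)" unfolding qq by simp
    also have "\<dots> \<le> F\<^sup>2 / (F\<^sup>2 / (real s)\<^sup>2)" 
    proof (rule divide_left_mono)
      show "0 < (1 + F\<^sup>2 / (real s)\<^sup>2) * (F\<^sup>2 / (real s)\<^sup>2)" using r by (intro mult_pos_pos) linarith+
    qed auto
    also have "\<dots> = (real s)\<^sup>2" using F_pos sp by simp
    finally show ?thesis .
  qed
  then have Fq: "F * q \<le> real s" by (rule power2_le_imp_le) simp
  have "K * q \<le> F / c * q" using K_le_Fc by (intro mult_right_mono) (auto simp: q_def)
  also have "\<dots> \<le> real s / c" using Fq c0 by (simp add: field_simps)
  finally show "K * exp (- \<tau>\<^sup>2 / 18) \<le> real s / c" by (simp add: q_def)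
  show "psi_star d (real s) Sg = real s * L" using sF by (simp add: psi_star_def L_def)
qed

lemma devsum_mean: "(\<integral>\<^sup>+\<omega>. ennreal (devsum x0 \<omega>) \<partial>M) \<le> ennreal (12 * (K / real d))"
proof -
  have "(\<integral>\<^sup>+\<omega>. ennreal \<bar>devsum x0 \<omega>\<bar> \<partial>M) \<le> ennreal (sqrt (144 * (K / real d)\<^sup>2))"
    using d1 by (intro nn_integral_abs_le_sqrt' devsum_second_moment) auto
  moreover have "sqrt (144 * (K / real d)\<^sup>2) = 12 * (K / real d)"
    using K_nonneg by (intro real_sqrt_unique) (auto simp: power_mult_distrib power_divide)
  ultimately show ?thesis using devsum_nonneg by simp
qed

lemma vr_mean:
  assumes sF: "real s \<le> F"
  shows "(\<integral>\<^sup>+\<omega>. ennreal (vr \<omega>) \<partial>M) \<le> ennreal (8 / ell * (13 * (K / real d)))"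
proof -
  have sk: "real s / real d \<le> K / real d" using sF F_le_K by (intro divide_right_mono) auto
  have "(\<integral>\<^sup>+\<omega>. ennreal (real s / real d + devsum x0 \<omega>) \<partial>M) \<le> ennreal (real s / real d + 12 * (K / real d))"
    using d1 devsum_nonneg K_nonneg by (intro nn_real_add nn_real_const devsum_mean) auto
  then have "(\<integral>\<^sup>+\<omega>. ennreal (8 / ell * (real s / real d + devsum x0 \<omega>)) \<partial>M) \<le> ennreal (8 / ell * (real s / real d + 12 * (K / real d)))"
    using d1 devsum_nonneg K_nonneg ell_pos by (intro nn_real_cmult) auto
  also have "\<dots> \<le> ennreal (8 / ell * (13 * (K / real d)))"
    using ell_pos sk by (intro ennreal_leI mult_left_mono) auto
  finally show ?thesis unfolding vr_def .
qed

text \<open>Every noise term on the good event is of order K exp(-tau^2/18), hence of order s; the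
  correction \<open>Bs\<close> contributes s tau^2, which is the rate. The random width in
  \<open>H\<close> is removed by passing to \<open>peel\<close>, while in the compensation it enters
  linearly and its mean is enough.\<close>

lemma err_integral_small_good:
  assumes sF: "real s \<le> F"
  shows "(\<integral>\<^sup>+\<omega>. ennreal (err \<omega>) * indicator good \<omega> \<partial>M) \<le> ennreal (small_const c * \<sigma>\<^sup>2 * psi_star d (real s) Sg)"
proof -
  define L where "L = ln (1 + F\<^sup>2 / (real s)\<^sup>2)"
  note rf = rate_facts[OF sF, folded L_def]
  define q where "q = exp (- \<tau>\<^sup>2 / 18)"
  have q: "0 < q" "q \<le> 1" by (auto simp: q_def)
  have qq: "exp (- \<tau>\<^sup>2 / 9) = q * q" unfolding q_def exp_add[symmetric] by simp
  have Kq: "K * q \<le> real s / c" using rf(4) by (simp add: q_def)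
  have a: "0 < 8 / ell" using ell_pos by simp
  define f1 where "f1 = (\<lambda>\<omega>. 2 * \<bar>Z2 \<omega>\<bar>)"
  define f2 where "f2 = (\<lambda>\<omega>. (2 * tailmean \<tau> * real d) * vr \<omega>)"
  have tm: "0 \<le> tailmean \<tau>" "tailmean \<tau> \<le> 192 * (q * q)"
    using tailmean_bounds[of \<tau>] rf(3) unfolding qq by auto
  have pt: "ennreal (err \<omega>) * indicator good \<omega> \<le> ennreal (\<sigma>\<^sup>2) * (ennreal (((4 * real s * \<tau>\<^sup>2 + f1 \<omega>) + f2 \<omega>) + linq \<omega>) + 2 * peel x0 (8 / ell) \<tau> \<omega>)"
    if \<omega>: "\<omega> \<in> space M" for \<omega>
  proof (cases "\<omega> \<in> good")
    case True
    note X = good_X2[OF True]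
    have vk: "vr \<omega> \<le> 8 / ell * (K / real d + devsum x0 \<omega>)"
      unfolding vr_def using sF F_le_K ell_pos by (intro mult_left_mono add_right_mono divide_right_mono) auto
    have "real s * (X2 \<omega> * \<tau>\<^sup>2) \<le> real s * (2 * \<tau>\<^sup>2)" using X by (intro mult_left_mono mult_right_mono) auto
    then have B: "\<bar>Bs \<omega> + W \<omega>\<bar> \<le> 2 * real s * \<tau>\<^sup>2 + (\<bar>Z2 \<omega>\<bar> + H \<tau> (vr \<omega>) \<omega> + vr \<omega> * tailmean \<tau> * real d)"
      using Bs_bound[of \<omega>] W_good[OF True] by linarith
    have "err \<omega> \<le> \<sigma>\<^sup>2 * (2 * (2 * real s * \<tau>\<^sup>2 + (\<bar>Z2 \<omega>\<bar> + H \<tau> (vr \<omega>) \<omega> + vr \<omega> * tailmean \<tau> * real d)) + linq \<omega>)"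
      by (rule err_le[OF Qstar_small[OF sF] B])
    also have "\<dots> = \<sigma>\<^sup>2 * ((((4 * real s * \<tau>\<^sup>2 + f1 \<omega>) + f2 \<omega>) + linq \<omega>) + 2 * H \<tau> (vr \<omega>) \<omega>)"
      by (simp add: f1_def f2_def algebra_simps)
    finally have "ennreal (err \<omega>) \<le> ennreal (\<sigma>\<^sup>2 * ((((4 * real s * \<tau>\<^sup>2 + f1 \<omega>) + f2 \<omega>) + linq \<omega>) + 2 * H \<tau> (vr \<omega>) \<omega>))"
      by (rule ennreal_leI)
    also have "\<dots> = ennreal (\<sigma>\<^sup>2) * (ennreal (((4 * real s * \<tau>\<^sup>2 + f1 \<omega>) + f2 \<omega>) + linq \<omega>) + ennreal (2 * H \<tau> (vr \<omega>) \<omega>))"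
    proof -
      have "0 \<le> ((4 * real s * \<tau>\<^sup>2 + f1 \<omega>) + f2 \<omega>) + linq \<omega>"
        using linq_nonneg[of \<omega>] tm vr_nonneg[of \<omega>] by (simp add: f1_def f2_def)
      then show ?thesis using H_nonneg[of \<tau> "vr \<omega>" \<omega>] by (subst ennreal_mult) (auto simp: ennreal_plus)
    qed
    also have "ennreal (2 * H \<tau> (vr \<omega>) \<omega>) = 2 * ennreal (H \<tau> (vr \<omega>) \<omega>)"
      using ennreal_mult[of 2 "H \<tau> (vr \<omega>) \<omega>"] H_nonneg[of \<tau> "vr \<omega>" \<omega>] by simp
    also have "ennreal (\<sigma>\<^sup>2) * (ennreal (((4 * real s * \<tau>\<^sup>2 + f1 \<omega>) + f2 \<omega>) + linq \<omega>) + 2 * ennreal (H \<tau> (vr \<omega>) \<omega>)) \<le>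
      ennreal (\<sigma>\<^sup>2) * (ennreal (((4 * real s * \<tau>\<^sup>2 + f1 \<omega>) + f2 \<omega>) + linq \<omega>) + 2 * peel x0 (8 / ell) \<tau> \<omega>)"
      using H_le_peel[OF d1 K_pos a tau_nonneg \<omega> X(5) vk] by (intro mult_left_mono add_left_mono) auto
    finally show ?thesis using True by simp
  qed simp
  have i1: "(\<integral>\<^sup>+\<omega>. ennreal (f1 \<omega>) \<partial>M) \<le> ennreal (2 * (28 * (K * q)))"
    unfolding f1_def
  proof (rule nn_real_cmult)
    have "(\<integral>\<^sup>+\<omega>. ennreal \<bar>Z2 \<omega>\<bar> \<partial>M) \<le> ennreal (sqrt (768 * K\<^sup>2 * exp (- \<tau>\<^sup>2 / 9)))"
      by (intro nn_integral_abs_le_sqrt' Z2_second) auto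
    also have "\<dots> \<le> ennreal (28 * (K * q))"
    proof (intro ennreal_leI real_le_lsqrt)
      have "768 * (K * q)\<^sup>2 \<le> 784 * (K * q)\<^sup>2" by (intro mult_right_mono) auto
      then show "768 * K\<^sup>2 * exp (- \<tau>\<^sup>2 / 9) \<le> (28 * (K * q))\<^sup>2"
        unfolding qq by (simp add: power2_eq_square mult_ac)
    qed (use K_pos q in auto)
    finally show "(\<integral>\<^sup>+\<omega>. ennreal \<bar>Z2 \<omega>\<bar> \<partial>M) \<le> ennreal (28 * (K * q))" .
  qed (use K_pos q in auto)
  have i2: "(\<integral>\<^sup>+\<omega>. ennreal (f2 \<omega>) \<partial>M) \<le> ennreal (40000 / ell * (K * q))"
  proof -
    have "(\<integral>\<^sup>+\<omega>. ennreal (f2 \<omega>) \<partial>M) \<le> ennreal ((2 * tailmean \<tau> * real d) * (8 / ell * (13 * (K / real d))))"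
      unfolding f2_def using tm vr_nonneg ell_pos K_nonneg by (intro nn_real_cmult vr_mean[OF sF]) auto
    also have "(2 * tailmean \<tau> * real d) * (8 / ell * (13 * (K / real d))) = tailmean \<tau> * (208 / ell * K)"
      using d1 by simp
    also have "ennreal \<dots> \<le> ennreal (40000 / ell * (K * q))"
    proof (rule ennreal_leI)
      have "tailmean \<tau> * (208 / ell * K) \<le> (192 * (q * 1)) * (208 / ell * K)"
        using tm q ell_pos K_nonneg by (intro mult_right_mono order_trans[OF tm(2)] mult_left_mono) auto
      also have "\<dots> = 39936 / ell * (K * q)" by simp
      also have "\<dots> \<le> 40000 / ell * (K * q)" using ell_pos K_nonneg q by (intro mult_right_mono divide_right_mono) auto
      finally show "tailmean \<tau> * (208 / ell * K) \<le> 40000 / ell * (K * q)" .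
    qed
    finally show ?thesis .
  qed
  define A where "A = ((4 * real s * \<tau>\<^sup>2 + 2 * (28 * (K * q))) + 40000 / ell * (K * q)) + 64 * real s"
  have A0: "0 \<le> A" using K_nonneg q ell_pos by (simp add: A_def)
  have f0: "0 \<le> f1 \<omega>" "0 \<le> f2 \<omega>" for \<omega> using tm vr_nonneg[of \<omega>] by (simp_all add: f1_def f2_def)
  have [measurable]: "f1 \<in> borel_measurable M" "f2 \<in> borel_measurable M" unfolding f1_def f2_def by measurable
  have iA: "(\<integral>\<^sup>+\<omega>. ennreal (((4 * real s * \<tau>\<^sup>2 + f1 \<omega>) + f2 \<omega>) + linq \<omega>) \<partial>M) \<le> ennreal A"
    unfolding A_def using f0 linq_nonneg K_nonneg q ell_pos
    by (intro nn_real_add nn_real_const i1 i2 linq_integral_s) (auto intro!: add_nonneg_nonneg)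
  define Pc where "Pc = (900000 * (8 / ell) + 700) * K * q"
  have Pc0: "0 \<le> Pc" using ell_pos K_nonneg q by (simp add: Pc_def)
  have iP: "(\<integral>\<^sup>+\<omega>. peel x0 (8 / ell) \<tau> \<omega> \<partial>M) \<le> ennreal Pc"
    unfolding Pc_def q_def by (rule peel_integral[OF d1 K_pos a rf(3)])
  have "(\<integral>\<^sup>+\<omega>. ennreal (err \<omega>) * indicator good \<omega> \<partial>M) \<le> (\<integral>\<^sup>+\<omega>. ennreal (\<sigma>\<^sup>2) * (ennreal (((4 * real s * \<tau>\<^sup>2 + f1 \<omega>) + f2 \<omega>) + linq \<omega>) + 2 * peel x0 (8 / ell) \<tau> \<omega>) \<partial>M)"
    by (rule nn_integral_mono[OF pt])
  also have "\<dots> = ennreal (\<sigma>\<^sup>2) * ((\<integral>\<^sup>+\<omega>. ennreal (((4 * real s * \<tau>\<^sup>2 + f1 \<omega>) + f2 \<omega>) + linq \<omega>) \<partial>M) + 2 * (\<integral>\<^sup>+\<omega>. peel x0 (8 / ell) \<tau> \<omega> \<partial>M))"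
    using d1 by (simp add: nn_integral_cmult nn_integral_add)
  also have "\<dots> \<le> ennreal (\<sigma>\<^sup>2) * (ennreal A + 2 * ennreal Pc)"
    by (intro mult_left_mono add_mono iA iP) auto
  also have "\<dots> = ennreal (\<sigma>\<^sup>2 * (A + 2 * Pc))"
  proof -
    have "2 * ennreal Pc = ennreal (2 * Pc)" using ennreal_mult[of 2 Pc] Pc0 by simp
    then show ?thesis using A0 Pc0 by (simp add: ennreal_mult ennreal_plus)
  qed
  also have "\<dots> \<le> ennreal (\<sigma>\<^sup>2 * (small_const c * (real s * L)))"
  proof (intro ennreal_leI mult_left_mono)
    \<comment> \<open>36 comes from 4 tau^2 = 36 L and 64 from \<open>linq\<close>. In the last
      coefficient, 1456 = 56 + 1400 and 14440000 = 40000 + 14400000 collect \<open>Z2\<close>, the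
      compensation and the peeling sum.\<close>
    have "A + 2 * Pc = 36 * (real s * L) + 64 * real s + (1456 + 14440000 / ell) * (K * q)"
      unfolding A_def Pc_def rf(2) by (simp add: algebra_simps)
    also have "\<dots> \<le> 36 * (real s * L) + 64 * (2 * (real s * L)) + (1456 + 14440000 / ell) * (2 * (real s * L) / c)"
    proof -
      have "real s * 1 \<le> real s * (2 * L)" using rf(1) by (intro mult_left_mono) auto
      then have sL: "real s \<le> 2 * (real s * L)" by simp
      have "K * q \<le> 2 * (real s * L) / c" using Kq divide_right_mono[OF sL, of c] c0 by linarith
      then have "(1456 + 14440000 / ell) * (K * q) \<le> (1456 + 14440000 / ell) * (2 * (real s * L) / c)"
        using ell_pos by (intro mult_left_mono) auto
      then show ?thesis using sL by linarith
    qed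
    also have "\<dots> = (164 + (2912 + 28880000 / ell) / c) * (real s * L)" by (simp add: algebra_simps add_divide_distrib)
    also have "\<dots> \<le> small_const c * (real s * L)"
    proof (rule mult_right_mono)
      have "(2912 + 28880000 / ell) / c \<le> 4 * (728 + 7300000 / ell) / c"
        using ell_pos c0 by (intro divide_right_mono) (auto simp: field_simps)
      then show "164 + (2912 + 28880000 / ell) / c \<le> small_const c" by (simp add: small_const_def)
    qed (use rf(1) in simp)
    finally show "A + 2 * Pc \<le> small_const c * (real s * L)" .
  qed simp
  also have "\<sigma>\<^sup>2 * (small_const c * (real s * L)) = small_const c * \<sigma>\<^sup>2 * psi_star d (real s) Sg" unfolding rf(5) by simp
  finally show ?thesis .
qed

end

text \<open>The coefficient of K^2/d on the exceptional event; the factor 2 replaces 1 by 2 L, and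
  the division by \<open>c\<^sup>2\<close> replaces K by F.\<close>

definition small_tail_const :: "real \<Rightarrow> real" where "small_tail_const c = 2 * (74 * bad_const + 1600) / c\<^sup>2"

text \<open>The first summand collects the terms of order K. The second belongs to the
  characteristic function, where \<open>1 + ln (1 / c)\<close> is the cost of replacing ln (s/K),
  which enters \<open>lam\<close>, by ln (s/F), which enters the rate.\<close>

definition large_const :: "real \<Rightarrow> real" where
  "large_const c = (3272 + 130 * bad_const) / c + 4608 * (1 + 48 / c\<^sup>2) * (1 + ln (1 / c))"

lemma abs_ln_le:
  fixes y :: real
  assumes "\<bar>y - 1\<bar> \<le> 1/2"
  shows "\<bar>ln y\<bar> \<le> 2 * \<bar>y - 1\<bar>"
proof (cases "1 \<le> y")
  case True
  then have "ln y \<le> y - 1" by (intro ln_le_minus_one) auto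
  moreover have a: "\<bar>ln y\<bar> = ln y" "\<bar>y - 1\<bar> = y - 1" using True by auto
  ultimately show ?thesis unfolding a using True by simp
next
  case False
  have y: "1/2 \<le> y" using assms by linarith
  have "ln (1 / y) \<le> 1 / y - 1" using y by (intro ln_le_minus_one) auto
  then have "- ln y \<le> (1 - y) / y" using y by (simp add: ln_div diff_divide_distrib)
  also have "\<dots> \<le> (1 - y) / (1/2)" using y False by (intro divide_left_mono) auto
  finally have "- ln y \<le> 2 * (1 - y)" by simp
  moreover have "ln y \<le> 0" using y False by (subst ln_le_zero_iff) auto
  ultimately have "- ln y \<le> 2 * (1 - y)" "\<bar>ln y\<bar> = - ln y" by simp_all
  moreover have "\<bar>y - 1\<bar> = 1 - y" using False by simp
  ultimately show ?thesis by simp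
qed

section \<open>The exceptional event below the Frobenius norm, and the noise estimate from the
  characteristic function\<close>

context sparse_model
begin

lemma d_times_kappa_sq: "real d * (K / real d)\<^sup>2 = K\<^sup>2 / real d"
  using d1 by (simp add: power_divide power2_eq_square)

lemma bad_nn_integral: "(\<integral>\<^sup>+\<omega>. ennreal a * indicator bad \<omega> \<partial>M) \<le> ennreal (a * (bad_const * (K / real d)\<^sup>2))" if "0 \<le> a"
proof -
  have "(\<integral>\<^sup>+\<omega>. ennreal a * indicator bad \<omega> \<partial>M) = ennreal a * emeasure M bad" by (rule nn_integral_cmult_indicator) simp
  also have "\<dots> \<le> ennreal a * ennreal (bad_const * (K / real d)\<^sup>2)" by (intro mult_left_mono bad_prob) simp
  also have "\<dots> = ennreal (a * (bad_const * (K / real d)\<^sup>2))" using that bad_const_ge1 by (simp add: ennreal_mult)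
  finally show ?thesis .
qed

lemma tailT_nn_integral: "(\<integral>\<^sup>+\<omega>. ennreal a * tailT x0 \<omega> \<partial>M) \<le> ennreal (a * (200 * (K / real d)\<^sup>2))" if "0 \<le> a"
proof -
  have "(\<integral>\<^sup>+\<omega>. ennreal a * tailT x0 \<omega> \<partial>M) = ennreal a * (\<integral>\<^sup>+\<omega>. tailT x0 \<omega> \<partial>M)" using d1 by (intro nn_integral_cmult) simp
  also have "\<dots> \<le> ennreal a * ennreal (200 * (K / real d)\<^sup>2)" by (intro mult_left_mono tailT_integral') simp
  also have "\<dots> = ennreal (a * (200 * (K / real d)\<^sup>2))" using that by (simp add: ennreal_mult)
  finally show ?thesis .
qed

lemma nn_integral_add_le:
  assumes [measurable]: "f \<in> borel_measurable M" "g \<in> borel_measurable M"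
    and "(\<integral>\<^sup>+\<omega>. f \<omega> \<partial>M) \<le> ennreal a" "(\<integral>\<^sup>+\<omega>. g \<omega> \<partial>M) \<le> ennreal b" "0 \<le> a" "0 \<le> b"
  shows "(\<integral>\<^sup>+\<omega>. f \<omega> + g \<omega> \<partial>M) \<le> ennreal (a + b)"
proof -
  have "(\<integral>\<^sup>+\<omega>. f \<omega> + g \<omega> \<partial>M) = (\<integral>\<^sup>+\<omega>. f \<omega> \<partial>M) + (\<integral>\<^sup>+\<omega>. g \<omega> \<partial>M)" by (rule nn_integral_add) measurable
  also have "\<dots> \<le> ennreal a + ennreal b" using assms by (intro add_mono)
  also have "\<dots> = ennreal (a + b)" using assms by (simp add: ennreal_plus)
  finally show ?thesis .
qed

lemma Z3_bad: "(\<integral>\<^sup>+\<omega>. ennreal \<bar>Z3 \<omega>\<bar> * indicator bad \<omega> \<partial>M) \<le> ennreal (4 * bad_const * (K\<^sup>2 / real d))"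
proof -
  have "(\<integral>\<^sup>+\<omega>. ennreal \<bar>Z3 \<omega>\<bar> * indicator bad \<omega> \<partial>M) \<le> ennreal (sqrt (12 * K\<^sup>2) * sqrt (bad_const * (K / real d)\<^sup>2))"
    using bad_const_ge1 by (intro nn_integral_abs_le_sqrt Z3_second bad_prob) auto
  also have "\<dots> \<le> ennreal (4 * bad_const * (K\<^sup>2 / real d))"
  proof (rule ennreal_leI)
    have "sqrt (12 * K\<^sup>2) \<le> 4 * K" using K_nonneg by (intro real_le_lsqrt) (auto simp: power_mult_distrib)
    moreover have "sqrt (bad_const * (K / real d)\<^sup>2) \<le> bad_const * (K / real d)"
    proof (rule real_le_lsqrt)
      have "bad_const * 1 \<le> bad_const * bad_const" using bad_const_ge1 by (intro mult_left_mono) auto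
      then have "bad_const * (K / real d)\<^sup>2 \<le> bad_const * bad_const * (K / real d)\<^sup>2" by (intro mult_right_mono) auto
      then show "bad_const * (K / real d)\<^sup>2 \<le> (bad_const * (K / real d))\<^sup>2" by (simp add: power2_eq_square mult_ac)
    qed (use bad_const_ge1 K_nonneg in auto)
    ultimately have "sqrt (12 * K\<^sup>2) * sqrt (bad_const * (K / real d)\<^sup>2) \<le> (4 * K) * (bad_const * (K / real d))"
      using K_nonneg bad_const_ge1 by (intro mult_mono) auto
    then show "sqrt (12 * K\<^sup>2) * sqrt (bad_const * (K / real d)\<^sup>2) \<le> 4 * bad_const * (K\<^sup>2 / real d)" by (simp add: power2_eq_square mult_ac)
  qed
  finally show ?thesis .
qed

text \<open>Here the error is bounded by terms of order d, and the estimated variance by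
  \<open>32 + 4 * tailT\<close>. Both the exceptional event and the mean of \<open>tailT\<close> are
  of order (K/d)^2, so these terms contribute K^2/d, the source of the second summand in the third
  claim.\<close>

lemma err_integral_small_bad:
  assumes sF: "real s \<le> F"
  shows "(\<integral>\<^sup>+\<omega>. ennreal (err \<omega>) * indicator bad \<omega> \<partial>M) \<le>
    ennreal (\<sigma>\<^sup>2 * (15104 * psi_star d (real s) Sg + small_tail_const c * (F\<^sup>2 / real d) * ln (1 + F\<^sup>2 / (real s)\<^sup>2)))"
proof -
  define L where "L = ln (1 + F\<^sup>2 / (real s)\<^sup>2)"
  note rf = rate_facts[OF sF, folded L_def]
  define a where "a = 2 * real s * \<tau>\<^sup>2"
  have a0: "0 \<le> a" by (simp add: a_def)
  define D where "D \<omega> = ((ennreal (32 * a) + ennreal (4 * a) * tailT x0 \<omega>) + (ennreal (66 * real d) * indicator bad \<omega>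
     + ennreal (8 * real d) * tailT x0 \<omega>)) + (ennreal 2 * (ennreal \<bar>Z3 \<omega>\<bar> * indicator bad \<omega>) + ennreal (linq \<omega>))" for \<omega>
  have pt: "ennreal (err \<omega>) * indicator bad \<omega> \<le> ennreal (\<sigma>\<^sup>2) * D \<omega>" if \<omega>: "\<omega> \<in> space M" for \<omega>
  proof (cases "\<omega> \<in> bad")
    case True
    have X0: "0 \<le> X2 \<omega>" by (rule X2_bounds)
    have B: "\<bar>Bs \<omega> + W \<omega>\<bar> \<le> real s * (X2 \<omega> * \<tau>\<^sup>2) + (real d + \<bar>Z3 \<omega>\<bar> + X2 \<omega> * real d)"
      using Bs_bound[of \<omega>] W_always[of \<omega>] by linarith
    have "err \<omega> \<le> \<sigma>\<^sup>2 * (2 * (real s * (X2 \<omega> * \<tau>\<^sup>2) + (real d + \<bar>Z3 \<omega>\<bar> + X2 \<omega> * real d)) + linq \<omega>)"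
      by (rule err_le[OF Qstar_small[OF sF] B])
    also have "\<dots> = \<sigma>\<^sup>2 * (((a * X2 \<omega>) + (2 * real d + 2 * real d * X2 \<omega>)) + (2 * \<bar>Z3 \<omega>\<bar> + linq \<omega>))"
      by (simp add: a_def algebra_simps)
    finally have "ennreal (err \<omega>) \<le> ennreal (\<sigma>\<^sup>2 * (((a * X2 \<omega>) + (2 * real d + 2 * real d * X2 \<omega>)) + (2 * \<bar>Z3 \<omega>\<bar> + linq \<omega>)))"
      by (rule ennreal_leI)
    also have "\<dots> = ennreal (\<sigma>\<^sup>2) * ((ennreal a * ennreal (X2 \<omega>) + (ennreal (2 * real d) + ennreal (2 * real d) * ennreal (X2 \<omega>))) + (ennreal 2 * ennreal \<bar>Z3 \<omega>\<bar> + ennreal (linq \<omega>)))"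
      using a0 X0 linq_nonneg[of \<omega>]
      by (simp only: ennreal_mult ennreal_plus zero_le_power2 mult_nonneg_nonneg add_nonneg_nonneg abs_ge_zero zero_le_numeral of_nat_0_le_iff)
    also have "\<dots> \<le> ennreal (\<sigma>\<^sup>2) * ((ennreal a * (32 + 4 * tailT x0 \<omega>) + (ennreal (2 * real d) + ennreal (2 * real d) * (32 + 4 * tailT x0 \<omega>))) + (ennreal 2 * ennreal \<bar>Z3 \<omega>\<bar> + ennreal (linq \<omega>)))"
      using X2_le_tailT[OF \<omega>] by (intro mult_left_mono add_mono order_refl) auto
    also have "\<dots> = ennreal (\<sigma>\<^sup>2) * D \<omega>"
    proof -
      have m: "ennreal y * 32 = ennreal (32 * y)" "ennreal y * (4 * t) = ennreal (4 * y) * t" if "0 \<le> y" for y t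
        using that by (simp_all add: ennreal_mult mult_ac)
      have p: "ennreal (2 * real d) + ennreal (32 * (2 * real d)) = ennreal (66 * real d)"
        by (subst ennreal_plus[symmetric]) auto
      have e1: "ennreal a * (32 + 4 * tailT x0 \<omega>) = ennreal (32 * a) + ennreal (4 * a) * tailT x0 \<omega>"
        unfolding distrib_left m(1)[OF a0] m(2)[OF a0] ..
      have d0: "0 \<le> 2 * real d" by simp
      have e2: "ennreal (2 * real d) + ennreal (2 * real d) * (32 + 4 * tailT x0 \<omega>) = ennreal (66 * real d) + ennreal (8 * real d) * tailT x0 \<omega>"
        unfolding distrib_left m(1)[OF d0] m(2)[OF d0] add.assoc[symmetric] p by simp
      show ?thesis unfolding e1 e2 D_def using True by simp
    qed
    finally show ?thesis using True by simp
  qed simp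
  have Dm [measurable]: "D \<in> borel_measurable M" unfolding D_def[abs_def] using d1 by measurable
  define k where "k = (K / real d)\<^sup>2"
  have k: "0 \<le> k" "k \<le> 1" using kappa_sq_bounds by (auto simp: k_def)
  have Dint: "(\<integral>\<^sup>+\<omega>. D \<omega> \<partial>M) \<le> ennreal (((32 * a + 4 * a * (200 * k)) + (66 * real d * (bad_const * k) + 8 * real d * (200 * k))) + (2 * (4 * bad_const * (K\<^sup>2 / real d)) + 64 * real s))"
    unfolding D_def
  proof (intro nn_integral_add_le)
    show "(\<integral>\<^sup>+\<omega>. ennreal (32 * a) \<partial>M) \<le> ennreal (32 * a)" by (simp add: emeasure_space_1)
    show "(\<integral>\<^sup>+\<omega>. ennreal (4 * a) * tailT x0 \<omega> \<partial>M) \<le> ennreal (4 * a * (200 * k))" unfolding k_def using a0 by (intro tailT_nn_integral) simp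
    show "(\<integral>\<^sup>+\<omega>. ennreal (66 * real d) * indicator bad \<omega> \<partial>M) \<le> ennreal (66 * real d * (bad_const * k))" unfolding k_def by (intro bad_nn_integral) simp
    show "(\<integral>\<^sup>+\<omega>. ennreal (8 * real d) * tailT x0 \<omega> \<partial>M) \<le> ennreal (8 * real d * (200 * k))" unfolding k_def by (intro tailT_nn_integral) simp
    have "(\<integral>\<^sup>+\<omega>. ennreal 2 * (ennreal \<bar>Z3 \<omega>\<bar> * indicator bad \<omega>) \<partial>M) = ennreal 2 * (\<integral>\<^sup>+\<omega>. ennreal \<bar>Z3 \<omega>\<bar> * indicator bad \<omega> \<partial>M)"
      by (rule nn_integral_cmult) measurable
    also have "\<dots> \<le> ennreal 2 * ennreal (4 * bad_const * (K\<^sup>2 / real d))" by (intro mult_left_mono Z3_bad) simp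
    also have "\<dots> = ennreal (2 * (4 * bad_const * (K\<^sup>2 / real d)))" using bad_const_ge1 by (intro ennreal_mult[symmetric]) auto
    finally show "(\<integral>\<^sup>+\<omega>. ennreal 2 * (ennreal \<bar>Z3 \<omega>\<bar> * indicator bad \<omega>) \<partial>M) \<le> ennreal (2 * (4 * bad_const * (K\<^sup>2 / real d)))" .
  qed (use d1 a0 k bad_const_ge1 linq_integral_s in auto)
  have "(\<integral>\<^sup>+\<omega>. ennreal (err \<omega>) * indicator bad \<omega> \<partial>M) \<le> (\<integral>\<^sup>+\<omega>. ennreal (\<sigma>\<^sup>2) * D \<omega> \<partial>M)"
    by (rule nn_integral_mono[OF pt])
  also have "\<dots> = ennreal (\<sigma>\<^sup>2) * (\<integral>\<^sup>+\<omega>. D \<omega> \<partial>M)" by (rule nn_integral_cmult) measurable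
  also have "\<dots> \<le> ennreal (\<sigma>\<^sup>2) * ennreal (((32 * a + 4 * a * (200 * k)) + (66 * real d * (bad_const * k) + 8 * real d * (200 * k))) + (2 * (4 * bad_const * (K\<^sup>2 / real d)) + 64 * real s))"
    by (intro mult_left_mono Dint) simp
  also have "\<dots> \<le> ennreal (\<sigma>\<^sup>2) * ennreal (15104 * (real s * L) + small_tail_const c * (F\<^sup>2 / real d) * L)"
  proof (intro mult_left_mono ennreal_leI)
    \<comment> \<open>The terms in \<open>a = 18 * s * L\<close> are integrated without restriction
      to the event, as they already have the order of the rate; 832 = 32 + 800 and 14976 is 832
      times 18.\<close>
    have 1: "32 * a + 4 * a * (200 * k) \<le> 14976 * (real s * L)"
    proof -
      have "a * k \<le> a * 1" using a0 k by (intro mult_left_mono) auto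
      then have "32 * a + 4 * a * (200 * k) \<le> 832 * a" by simp
      also have "\<dots> = 14976 * (real s * L)" unfolding a_def rf(2) by simp
      finally show ?thesis .
    qed
    have dk: "real d * k = K\<^sup>2 / real d" unfolding k_def by (rule d_times_kappa_sq)
    have "66 * real d * (bad_const * k) + 8 * real d * (200 * k) + 2 * (4 * bad_const * (K\<^sup>2 / real d)) = (66 * bad_const + 1600) * (real d * k) + 8 * bad_const * (K\<^sup>2 / real d)"
      by (simp add: algebra_simps)
    also have "\<dots> = (74 * bad_const + 1600) * (K\<^sup>2 / real d)" unfolding dk by (simp add: algebra_simps)
    also have "\<dots> \<le> (74 * bad_const + 1600) * (F\<^sup>2 / c\<^sup>2 / real d * (2 * L))"
    proof (intro mult_left_mono)
      have "K\<^sup>2 \<le> (F / c)\<^sup>2" using K_le_Fc K_nonneg by (intro power_mono) auto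
      then have K2: "K\<^sup>2 / real d \<le> F\<^sup>2 / c\<^sup>2 / real d" by (intro divide_right_mono) (auto simp: power_divide)
      also have "\<dots> * 1 \<le> F\<^sup>2 / c\<^sup>2 / real d * (2 * L)" using rf(1) by (intro mult_left_mono) auto
      finally show "K\<^sup>2 / real d \<le> F\<^sup>2 / c\<^sup>2 / real d * (2 * L)" by simp
    qed (use bad_const_ge1 in simp)
    also have "\<dots> = small_tail_const c * (F\<^sup>2 / real d) * L" by (simp add: small_tail_const_def)
    finally have 2: "66 * real d * (bad_const * k) + 8 * real d * (200 * k) + 2 * (4 * bad_const * (K\<^sup>2 / real d)) \<le> small_tail_const c * (F\<^sup>2 / real d) * L" .
    have "real s * 1 \<le> real s * (2 * L)" using rf(1) by (intro mult_left_mono) auto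
    then have 3: "64 * real s \<le> 128 * (real s * L)" by (simp add: mult_ac)
    show "((32 * a + 4 * a * (200 * k)) + (66 * real d * (bad_const * k) + 8 * real d * (200 * k))) + (2 * (4 * bad_const * (K\<^sup>2 / real d)) + 64 * real s) \<le> 15104 * (real s * L) + small_tail_const c * (F\<^sup>2 / real d) * L"
      using 1 2 3 by linarith
  qed simp
  also have "\<dots> = ennreal (\<sigma>\<^sup>2 * (15104 * (real s * L) + small_tail_const c * (F\<^sup>2 / real d) * L))"
    by (rule ennreal_mult'[symmetric]) simp
  finally show ?thesis by (simp add: L_def rf(5)[unfolded L_def])
qed

definition Dr :: "'a \<Rightarrow> real" where "Dr \<omega> = sigmaD2 d (real s) Sg (obs \<omega>) / \<sigma>\<^sup>2"

lemma Dr_bounds: "0 \<le> Dr \<omega>" "Dr \<omega> \<le> 8 * that_n \<omega>"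
  using sigmaD2_bounds[OF d1, of "real s" Sg "obs \<omega>"] sig by (auto simp: Dr_def divide_right_mono)

lemma Qstar_large:
  assumes sF: "F < real s"
  shows "Qstar d (real s) Sg (obs \<omega>) = (l2norm d \<theta>)\<^sup>2 + 2 * \<sigma> * lin \<omega> + \<sigma>\<^sup>2 * (Z3 \<omega> + (1 - Dr \<omega>) * (\<Sum>i<d. (sd Sg i)\<^sup>2))"
proof -
  have D: "sigmaD2 d (real s) Sg (obs \<omega>) = \<sigma>\<^sup>2 * Dr \<omega>" using sig by (simp add: Dr_def)
  have "Qstar d (real s) Sg (obs \<omega>) = (\<Sum>i<d. (obs \<omega> i)\<^sup>2 - \<sigma>\<^sup>2 * Dr \<omega> * (sd Sg i)\<^sup>2)"
    using sF unfolding Qstar_def D by simp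
  also have "\<dots> = (\<Sum>i<d. \<sigma>\<^sup>2 * ((sd Sg i)\<^sup>2 * (mu i)\<^sup>2) + \<sigma>\<^sup>2 * (2 * ((sd Sg i)\<^sup>2 * (mu i * \<xi> i \<omega>))) + \<sigma>\<^sup>2 * ((sd Sg i)\<^sup>2 * ((\<xi> i \<omega>)\<^sup>2 - 1))
      + \<sigma>\<^sup>2 * ((1 - Dr \<omega>) * (sd Sg i)\<^sup>2))"
  proof (intro sum.cong refl)
    fix i assume "i \<in> {..<d}"
    then have "(obs \<omega> i)\<^sup>2 = \<sigma>\<^sup>2 * ((sd Sg i)\<^sup>2 * (V \<omega> i)\<^sup>2)" using obs_eq[of i \<omega>] by (simp add: power_mult_distrib)
    also have "(V \<omega> i)\<^sup>2 = (mu i)\<^sup>2 + 2 * (mu i * \<xi> i \<omega>) + (\<xi> i \<omega>)\<^sup>2" by (simp add: V_def power2_sum)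
    finally show "(obs \<omega> i)\<^sup>2 - \<sigma>\<^sup>2 * Dr \<omega> * (sd Sg i)\<^sup>2 = \<sigma>\<^sup>2 * ((sd Sg i)\<^sup>2 * (mu i)\<^sup>2) + \<sigma>\<^sup>2 * (2 * ((sd Sg i)\<^sup>2 * (mu i * \<xi> i \<omega>))) + \<sigma>\<^sup>2 * ((sd Sg i)\<^sup>2 * ((\<xi> i \<omega>)\<^sup>2 - 1))
      + \<sigma>\<^sup>2 * ((1 - Dr \<omega>) * (sd Sg i)\<^sup>2)"
      by (simp add: algebra_simps)
  qed
  also have "\<dots> = \<sigma>\<^sup>2 * (\<Sum>i<d. (sd Sg i)\<^sup>2 * (mu i)\<^sup>2) + \<sigma>\<^sup>2 * (2 * (\<Sum>i<d. (sd Sg i)\<^sup>2 * (mu i * \<xi> i \<omega>))) + \<sigma>\<^sup>2 * Z3 \<omega> + \<sigma>\<^sup>2 * ((1 - Dr \<omega>) * (\<Sum>i<d. (sd Sg i)\<^sup>2))"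
    unfolding Z3_def by (simp only: sum.distrib sum_distrib_left[symmetric])
  also have "\<dots> = (l2norm d \<theta>)\<^sup>2 + 2 * \<sigma> * lin \<omega> + \<sigma>\<^sup>2 * (Z3 \<omega> + (1 - Dr \<omega>) * (\<Sum>i<d. (sd Sg i)\<^sup>2))"
    unfolding l2norm_sq_sum lin_sum by (simp add: power2_eq_square algebra_simps)
  finally show ?thesis .
qed

abbreviation \<Lambda> where "\<Lambda> \<equiv> lam d (real s) Sg"

text \<open>The frequency used by the estimator is random, but on the good event it takes only
  values indexed by the levels \<open>j\<close>. Fixing \<open>j\<close> makes the frequency
  deterministic, so that the second-moment bound for \<open>cosdev\<close> applies.\<close>

definition Zc :: "nat \<Rightarrow> 'a \<Rightarrow> real" where "Zc j = cosdev mu (sqrt (\<Lambda> / (x0 * 2 ^ j)))"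

text \<open>Summing over the levels dominates the term of whichever level is selected. The first
  part is the error when the logarithm can be linearised, the quadratic part covers the remaining
  case.\<close>

definition Gd :: "'a \<Rightarrow> real" where
  "Gd \<omega> = (\<Sum>j<6. 32 / \<Lambda> * (2 * real s / real d + exp (2 * \<Lambda>) * \<bar>Zc j \<omega>\<bar>) + 64 * (exp (2 * \<Lambda>))\<^sup>2 * (Zc j \<omega>)\<^sup>2)"

text \<open>With phi = exp(-u^2/2) the empirical characteristic function is phi (1 + b) + Z, where b
  is the bias from the support. Since u^2 = Lambda/t, the logarithm of phi reproduces the true
  variance exactly and the error is (2 t/Lambda) ln y with y = 1 + b + Z/phi.\<close>

lemma Dr_good:
  assumes g: "\<omega> \<in> good"
  shows "\<bar>1 - Dr \<omega>\<bar> \<le> Gd \<omega>"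
proof -
  obtain j w where j: "1 \<le> j" "j < 6" "that_n \<omega> = x0 * 2 ^ j"
    using good_facts[OF g] by metis
  note X = good_X2[OF g]
  define t where "t = x0 * 2 ^ j"
  have t: "1/4 < t" "t \<le> 8"
  proof -
    have "(2::real) ^ 1 \<le> 2 ^ j" using j by (intro power_increasing) auto
    moreover have "1/8 * 2 ^ j < x0 * 2 ^ j" using x0_bounds by (intro mult_strict_right_mono) auto
    ultimately show "1/4 < t" unfolding t_def power_one_right by linarith
    have "(2::real) ^ j \<le> 2 ^ 5" using j by (intro power_increasing) auto
    then show "t \<le> 8" unfolding t_def using mult_mono[OF x0_bounds(2), of "2 ^ j" 32] by simp
  qed
  have L0: "0 < \<Lambda>" by (rule lam_pos)
  define u where "u = sqrt (\<Lambda> / t)"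
  have u2: "u\<^sup>2 = \<Lambda> / t" using L0 t by (simp add: u_def)
  have thatt: "that d Sg (obs \<omega>) = \<sigma>\<^sup>2 * t" using j(3) sig by (simp add: t_def field_simps)
  define p where "p = phihat d Sg (obs \<omega>) (sqrt (\<Lambda> / that d Sg (obs \<omega>)))"
  have p: "p = (\<Sum>i<d. cos (u * V \<omega> i)) / real d"
  proof -
    have "sqrt (\<Lambda> / (\<sigma>\<^sup>2 * t)) * \<sigma> = u"
      using sig by (simp add: u_def real_sqrt_divide real_sqrt_mult)
    then have "sqrt (\<Lambda> / that d Sg (obs \<omega>)) * Ytil Sg (obs \<omega>) i = u * V \<omega> i" if "i < d" for i
      unfolding thatt Ytil_obs[OF that] by (simp add: mult.assoc[symmetric])
    then show ?thesis unfolding p_def phihat_def by simp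
  qed
  define \<phi> where "\<phi> = exp (- u\<^sup>2 / 2)"
  have \<phi>: "0 < \<phi>" by (simp add: \<phi>_def)
  define Z where "Z = Zc j \<omega>"
  define b where "b = (\<Sum>i<d. cos (u * mu i) - 1) / real d"
  have b: "\<bar>b\<bar> \<le> 2 * real s / real d"
  proof -
    have "(\<Sum>i<d. cos (u * mu i) - 1) = (\<Sum>i\<in>supp. cos (u * mu i) - 1)"
      by (intro sum.mono_neutral_right) (auto simp: supp_def mu_def)
    then have "\<bar>\<Sum>i<d. cos (u * mu i) - 1\<bar> \<le> (\<Sum>i\<in>supp. \<bar>cos (u * mu i) - 1\<bar>)" by (simp only: sum_abs)
    also have "\<dots> \<le> (\<Sum>i\<in>supp. 2)"
    proof (rule sum_mono)
      fix i show "\<bar>cos (u * mu i) - 1\<bar> \<le> 2" using cos_ge_minus_one[of "u * mu i"] cos_le_one[of "u * mu i"] by linarith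
    qed
    also have "\<dots> \<le> 2 * real s" using card_supp by simp
    finally show ?thesis unfolding b_def abs_divide by (simp add: divide_right_mono)
  qed
  have pe: "p = \<phi> * (1 + b) + Z"
  proof -
    have "Z = (\<Sum>i<d. cos (u * V \<omega> i)) / real d - (\<Sum>i<d. cos (u * mu i)) / real d * \<phi>"
      unfolding Z_def Zc_def cosdev_def t_def[symmetric] u_def[symmetric] \<phi>_def[symmetric] V_def
      by (simp add: sum_subtractf diff_divide_distrib sum_distrib_right)
    moreover have "(\<Sum>i<d. cos (u * mu i)) / real d = 1 + b"
      using d1 unfolding b_def by (simp add: sum_subtractf diff_divide_distrib)
    ultimately show ?thesis unfolding p by simp
  qed
  define E where "E = exp (2 * \<Lambda>)"
  \<comment> \<open>The level satisfies t > 1/4, so u^2/2 = Lambda/(2 t) is at most 2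
    Lambda.\<close>
  have E: "1 / \<phi> \<le> E"
  proof -
    have "1 / \<phi> = exp (u\<^sup>2 / 2)" by (simp add: \<phi>_def exp_minus inverse_eq_divide)
    moreover have "u\<^sup>2 / 2 \<le> 2 * \<Lambda>"
    proof -
      have "\<Lambda> / t \<le> \<Lambda> / (1/4)" using L0 t by (intro divide_left_mono) auto
      then show ?thesis unfolding u2 by simp
    qed
    ultimately show ?thesis unfolding E_def by simp
  qed
  have ZE: "\<bar>Z\<bar> / \<phi> \<le> E * \<bar>Z\<bar>" using mult_right_mono[OF E, of "\<bar>Z\<bar>"] by simp
  have term_le: "32 / \<Lambda> * (2 * real s / real d + E * \<bar>Z\<bar>) + 64 * E\<^sup>2 * Z\<^sup>2 \<le> Gd \<omega>"
    unfolding Gd_def Z_def E_def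
    by (rule member_le_sum[of j "{..<6}" "\<lambda>j. 32 / \<Lambda> * (2 * real s / real d + exp (2 * \<Lambda>) * \<bar>Zc j \<omega>\<bar>) + 64 * (exp (2 * \<Lambda>))\<^sup>2 * (Zc j \<omega>)\<^sup>2"])
       (use j L0 in \<open>auto intro!: add_nonneg_nonneg mult_nonneg_nonneg\<close>)
  have Dmin: "Dr \<omega> = min (sigmaD2til d (real s) Sg (obs \<omega>) / \<sigma>\<^sup>2) (2 * X2 \<omega>)"
    unfolding Dr_def sigmaD2_def X2_def using sig by (simp add: min_divide_distrib_right)
  have D0: "0 \<le> Dr \<omega>" by (rule Dr_bounds)
  have D4: "Dr \<omega> \<le> 4" unfolding Dmin using X(3) by simp
  show ?thesis
  proof (cases "\<bar>Z\<bar> / \<phi> \<le> 1/4")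
    case True
    define y where "y = 1 + b + Z / \<phi>"
    have py: "p = \<phi> * y" unfolding pe y_def using \<phi> by (simp add: algebra_simps)
    have y1: "\<bar>y - 1\<bar> \<le> 2 * real s / real d + \<bar>Z\<bar> / \<phi>"
      using b abs_triangle_ineq[of b "Z / \<phi>"] \<phi> by (simp add: y_def abs_divide)
    have "2 * real s / real d \<le> 1/4" using s_over_d ell_le by simp
    then have y2: "\<bar>y - 1\<bar> \<le> 1/2" using y1 True by linarith
    have y0: "0 < y" using y2 by linarith
    have "ln \<bar>p\<bar> = ln \<phi> + ln y" unfolding py using \<phi> y0 by (simp add: ln_mult abs_mult)
    also have "ln \<phi> = - (\<Lambda> / t) / 2" by (simp add: \<phi>_def u2)
    finally have lnp: "ln \<bar>p\<bar> = - (\<Lambda> / t) / 2 + ln y" .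
    have "sigmaD2til d (real s) Sg (obs \<omega>) = - (2 * (\<sigma>\<^sup>2 * t) / \<Lambda>) * ln \<bar>p\<bar>"
      unfolding sigmaD2til_def p_def by (simp add: thatt)
    then have "sigmaD2til d (real s) Sg (obs \<omega>) / \<sigma>\<^sup>2 = - (2 * t / \<Lambda>) * ln \<bar>p\<bar>" using sig by simp
    also have "\<dots> = 1 - 2 * t / \<Lambda> * ln y" unfolding lnp using L0 t by (simp add: field_simps)
    finally have til: "sigmaD2til d (real s) Sg (obs \<omega>) / \<sigma>\<^sup>2 = 1 - 2 * t / \<Lambda> * ln y" .
    have "\<bar>1 - Dr \<omega>\<bar> \<le> \<bar>2 * t / \<Lambda> * ln y\<bar>" 
    proof -
      \<comment> \<open>Truncation at a value of at least one cannot increase the distance to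
        one.\<close>
      have *: "\<bar>1 - min (1 - A) B\<bar> \<le> \<bar>A\<bar>" if "1 \<le> B" for A B :: real using that by (auto simp: min_def)
      have "1 \<le> 2 * X2 \<omega>" using X(4) by simp
      then show ?thesis unfolding Dmin til by (rule *)
    qed
    also have "\<dots> = 2 * t / \<Lambda> * \<bar>ln y\<bar>" using L0 t by (simp add: abs_mult)
    also have "\<dots> \<le> 16 / \<Lambda> * (2 * \<bar>y - 1\<bar>)"
      using L0 t abs_ln_le[OF y2] by (intro mult_mono divide_right_mono) auto
    also have "\<dots> = 32 / \<Lambda> * \<bar>y - 1\<bar>" by simp
    also have "\<dots> \<le> 32 / \<Lambda> * (2 * real s / real d + E * \<bar>Z\<bar>)"
      using y1 ZE L0 by (intro mult_left_mono) auto
    also have "\<dots> \<le> 32 / \<Lambda> * (2 * real s / real d + E * \<bar>Z\<bar>) + 64 * E\<^sup>2 * Z\<^sup>2" by simp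
    finally show ?thesis using term_le by linarith
  next
    case False
    \<comment> \<open>Without control of the logarithm, the truncation by \<open>2 * sigmaS2\<close>
      still bounds the error by 4, and the factor 64 makes the quadratic part of \<open>Gd\<close>
      at least as large.\<close>
    then have "1/4 \<le> E * \<bar>Z\<bar>" using ZE by linarith
    then have "(1/4)\<^sup>2 \<le> (E * \<bar>Z\<bar>)\<^sup>2" by (intro power_mono) auto
    moreover have "(E * \<bar>Z\<bar>)\<^sup>2 = E\<^sup>2 * Z\<^sup>2" by (simp add: power_mult_distrib)
    ultimately have "1/16 \<le> E\<^sup>2 * Z\<^sup>2" by (simp add: power_divide)
    then have "4 \<le> 64 * E\<^sup>2 * Z\<^sup>2" by simp
    moreover have "0 \<le> 32 / \<Lambda> * (2 * real s / real d + E * \<bar>Z\<bar>)" using L0 by (auto simp: E_def)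
    moreover have "\<bar>1 - Dr \<omega>\<bar> \<le> 4" using D0 D4 by linarith
    ultimately show ?thesis using term_le by linarith
  qed
qed

end


section \<open>Sparsity above the Frobenius norm\<close>

context sparse_model
begin

lemma Zc_measurable [measurable]: "Zc j \<in> borel_measurable M"
  unfolding Zc_def by measurable

lemma Gd_measurable [measurable]: "Gd \<in> borel_measurable M"
  unfolding Gd_def[abs_def] by measurable

lemma Gd_nonneg: "0 \<le> Gd \<omega>"
  using lam_pos[of d "real s" Sg] unfolding Gd_def by (intro sum_nonneg add_nonneg_nonneg mult_nonneg_nonneg) auto

lemma Zc_second: "(\<integral>\<^sup>+\<omega>. ennreal ((Zc j \<omega>)\<^sup>2) \<partial>M) \<le> ennreal (8 * K * (K + real s) / (real d)\<^sup>2)"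
  unfolding Zc_def
proof (rule cosdev_second_moment[OF d1])
  have "{i. i < d \<and> mu i \<noteq> 0} = supp"
    using sig by (auto simp: supp_def mu_def dest: sd_pos)
  then show "real (card {i. i < d \<and> mu i \<noteq> 0}) \<le> real s" using card_supp by simp
qed

lemma Gd_integral:
  defines "Vz \<equiv> 8 * K * (K + real s) / (real d)\<^sup>2"
  shows "(\<integral>\<^sup>+\<omega>. ennreal (Gd \<omega>) \<partial>M) \<le> ennreal (6 * (32 / \<Lambda> * (2 * real s / real d + exp (2 * \<Lambda>) * sqrt Vz) + 64 * (exp (2 * \<Lambda>))\<^sup>2 * Vz))"
proof -
  have L0: "0 < \<Lambda>" by (rule lam_pos)
  have V0: "0 \<le> Vz" using K_nonneg by (simp add: Vz_def)
  let ?f = "\<lambda>j \<omega>. 32 / \<Lambda> * (2 * real s / real d + exp (2 * \<Lambda>) * \<bar>Zc j \<omega>\<bar>) + 64 * (exp (2 * \<Lambda>))\<^sup>2 * (Zc j \<omega>)\<^sup>2"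
  let ?v = "32 / \<Lambda> * (2 * real s / real d + exp (2 * \<Lambda>) * sqrt Vz) + 64 * (exp (2 * \<Lambda>))\<^sup>2 * Vz"
  have f0: "0 \<le> ?f j \<omega>" for j \<omega> using L0 by (intro add_nonneg_nonneg mult_nonneg_nonneg) auto
  have v0: "0 \<le> ?v" using L0 V0 by (intro add_nonneg_nonneg mult_nonneg_nonneg) auto
  have one: "(\<integral>\<^sup>+\<omega>. ennreal (?f j \<omega>) \<partial>M) \<le> ennreal ?v" for j
  proof (intro nn_real_add nn_real_cmult nn_real_const)
    show "(\<integral>\<^sup>+\<omega>. ennreal \<bar>Zc j \<omega>\<bar> \<partial>M) \<le> ennreal (sqrt Vz)"
      unfolding Vz_def using K_nonneg by (intro nn_integral_abs_le_sqrt' Zc_second) auto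
    show "(\<integral>\<^sup>+\<omega>. ennreal ((Zc j \<omega>)\<^sup>2) \<partial>M) \<le> ennreal Vz" unfolding Vz_def by (rule Zc_second)
  qed (use L0 V0 in auto)
  have "(\<integral>\<^sup>+\<omega>. ennreal (Gd \<omega>) \<partial>M) = (\<integral>\<^sup>+\<omega>. (\<Sum>j<6::nat. ennreal (?f j \<omega>)) \<partial>M)"
    unfolding Gd_def by (intro nn_integral_cong sum_ennreal[symmetric] f0)
  also have "\<dots> = (\<Sum>j<6::nat. \<integral>\<^sup>+\<omega>. ennreal (?f j \<omega>) \<partial>M)" by (rule nn_integral_sum) measurable
  also have "\<dots> \<le> (\<Sum>j<6::nat. ennreal ?v)" by (intro sum_mono one)
  also have "\<dots> = ennreal (6 * ?v)" using v0 by (subst sum_ennreal) auto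
  finally show ?thesis .
qed

text \<open>6 Lambda is the maximum of 1 and ln (s/K). Where the logarithm wins, its exponential is
  exactly s/K; otherwise the comparison K <= s/c is used, and the factor 3 bounds e.\<close>

lemma K_over_s:
  assumes sF: "F < real s"
  shows "K \<le> real s / c" "K \<le> real s * (3 / c) * exp (- (6 * \<Lambda>))"
proof -
  have sp: "0 < real s" using s1 by simp
  show Ks: "K \<le> real s / c" using K_le_Fc sF c0 divide_right_mono[of F "real s" c] by linarith
  have m: "6 * \<Lambda> = max 1 (ln (real s / K))" by (simp add: lam_def frob_Stil)
  have e3: "exp (1::real) \<le> 3" by (rule exp_le)
  show "K \<le> real s * (3 / c) * exp (- (6 * \<Lambda>))"
  proof (cases "1 \<le> ln (real s / K)")
    case True
    then have "exp (- (6 * \<Lambda>)) = K / real s" unfolding m using sp K_pos by (simp add: exp_minus max_def)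
    moreover have "1 \<le> 3 / c" using c_le1 c0 by simp
    ultimately show ?thesis using sp mult_right_mono[of 1 "3 / c" K] K_nonneg by simp
  next
    case False
    then have e: "exp (- (6 * \<Lambda>)) = exp (- 1)" unfolding m by (simp add: max_def)
    have "1 \<le> 3 * exp (- 1 :: real)" using e3 by (simp add: exp_minus field_simps)
    then have "real s / c * 1 \<le> real s / c * (3 * exp (- 1))" using sp c0 by (intro mult_left_mono) auto
    then show ?thesis using Ks unfolding e by simp
  qed
qed

text \<open>F is below the rate because ln x <= x at x = s/F. The second inequality passes from the
  logarithm of s/K to that of s/F, which exceeds it by at most ln (1/c).\<close>

lemma psi_large:
  assumes sF: "F < real s"
  shows "F \<le> psi_star d (real s) Sg" "real s / (6 * \<Lambda>) \<le> (1 + ln (1 / c)) * psi_star d (real s) Sg" "0 \<le> psi_star d (real s) Sg"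
proof -
  have sp: "0 < real s" using s1 by simp
  define m' where "m' = max 1 (ln (real s / F))"
  have psi: "psi_star d (real s) Sg = real s / m'" using sF by (simp add: psi_star_def m'_def)
  have m'1: "1 \<le> m'" by (simp add: m'_def)
  show "0 \<le> psi_star d (real s) Sg" unfolding psi using m'1 by simp
  have "m' \<le> real s / F"
  proof -
    have "1 \<le> real s / F" using sF F_pos by simp
    moreover have "ln (real s / F) \<le> real s / F" using ln_le_minus_one[of "real s / F"] sp F_pos by simp
    ultimately show ?thesis by (simp add: m'_def)
  qed
  then show "F \<le> psi_star d (real s) Sg" unfolding psi using F_pos m'1 by (simp add: field_simps)
  define m where "m = 6 * \<Lambda>"
  have m: "m = max 1 (ln (real s / K))" by (simp add: m_def lam_def frob_Stil)
  have m1: "1 \<le> m" unfolding m by simp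
  have lc: "0 \<le> ln (1 / c)" using c_le1 c0 by simp
  have "m' \<le> (1 + ln (1 / c)) * m"
  proof -
    have "ln (real s / F) \<le> ln (real s / K * (1 / c))"
    proof (intro ln_mono)
      have "real s / F \<le> real s / (c * K)" using K_le_F sp c0 K_pos F_pos by (intro divide_left_mono) auto
      then show "real s / F \<le> real s / K * (1 / c)" by (simp add: mult.commute)
    qed (use sp F_pos in auto)
    also have "\<dots> = ln (real s / K) + ln (1 / c)" by (rule ln_mult_pos) (use sp K_pos c0 in auto)
    also have "\<dots> \<le> m + ln (1 / c) * m"
      using mult_left_mono[OF m1 lc] by (intro add_mono) (auto simp: m)
    also have "\<dots> = (1 + ln (1 / c)) * m" by (simp add: algebra_simps)
    finally have 1: "ln (real s / F) \<le> (1 + ln (1 / c)) * m" .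
    have "1 * 1 \<le> (1 + ln (1 / c)) * m" using lc m1 by (intro mult_mono) auto
    then show ?thesis using 1 by (simp add: m'_def)
  qed
  then have "real s * m' \<le> real s * ((1 + ln (1 / c)) * m)" using sp by (intro mult_left_mono) auto
  then show "real s / (6 * \<Lambda>) \<le> (1 + ln (1 / c)) * psi_star d (real s) Sg"
    unfolding psi m_def[symmetric] using m1 m'1 by (simp add: field_simps)
qed

text \<open>With m = 6 Lambda, dividing by the characteristic function costs exp(2 Lambda) =
  exp(m/3), while the variance is of order (s/d)^2 exp(-m) by \<open>K_over_s\<close>. The squared
  cost exp(2m/3) is thus overcompensated, and exp(-m/3) remains.\<close>

lemma Gd_bound:
  assumes sF: "F < real s"
  shows "(\<integral>\<^sup>+\<omega>. ennreal (Gd \<omega>) \<partial>M) \<le> ennreal (2304 * (1 + 48 / c\<^sup>2) * (real s / real d / (6 * \<Lambda>)))"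
proof -
  define Vz where "Vz = 8 * K * (K + real s) / (real d)\<^sup>2"
  define m where "m = 6 * \<Lambda>"
  have m1: "1 \<le> m" by (simp add: m_def lam_def)
  define E where "E = exp (2 * \<Lambda>)"
  define C where "C = 48 / c\<^sup>2"
  define r where "r = real s / real d"
  have sp: "0 < real s" "0 < real d" using s1 d1 by auto
  have r: "0 \<le> r" "r \<le> 1" using s_over_d ell_le by (auto simp: r_def)
  have C1: "1 \<le> C"
  proof -
    have "c\<^sup>2 \<le> 1" using c_le1 c0 by (intro power_le_one) auto
    then show ?thesis using c0 by (simp add: C_def)
  qed
  have E2: "E\<^sup>2 = exp (2 * m / 3)" unfolding E_def m_def by (simp add: exp_double[symmetric])
  have V0: "0 \<le> Vz" using K_nonneg by (simp add: Vz_def)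
  have EV: "E\<^sup>2 * Vz \<le> C * r\<^sup>2 * exp (- (m / 3))"
  proof -
    have cs: "real s \<le> real s / c" using c_le1 c0 sp by (simp add: field_simps)
    have "K * (K + real s) \<le> (real s * (3 / c) * exp (- m)) * (2 * real s / c)"
      using K_over_s[OF sF] cs K_nonneg by (intro mult_mono) (auto simp: m_def)
    then have "Vz \<le> 8 * ((real s * (3 / c) * exp (- m)) * (2 * real s / c)) / (real d)\<^sup>2"
      unfolding Vz_def by (intro divide_right_mono) auto
    also have "\<dots> = C * r\<^sup>2 * exp (- m)" by (simp add: C_def r_def power2_eq_square)
    finally have "E\<^sup>2 * Vz \<le> exp (2 * m / 3) * (C * r\<^sup>2 * exp (- m))" unfolding E2 by (intro mult_left_mono) auto
    also have "\<dots> = C * r\<^sup>2 * exp (2 * m / 3 + - m)" unfolding exp_add by simp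
    also have "2 * m / 3 + - m = - (m / 3)" by simp
    finally show ?thesis .
  qed
  \<comment> \<open>The quadratic part of \<open>Gd\<close> has no prefactor 1/Lambda, so the
    remaining exponential must supply the logarithmic gain of the rate.\<close>
  have em: "exp (- (m / 3)) \<le> 3 / m"
  proof -
    have "m / 3 \<le> exp (m / 3)" using exp_ge_add_one_self[of "m / 3"] by linarith
    then show ?thesis using m1 by (simp add: exp_minus field_simps)
  qed
  have EsV: "E * sqrt Vz \<le> C * r"
  proof (rule power2_le_imp_le)
    have "(E * sqrt Vz)\<^sup>2 = E\<^sup>2 * Vz" using V0 by (simp add: power_mult_distrib)
    also have "\<dots> \<le> C * r\<^sup>2 * 1" using EV m1 C1 by (intro order_trans[OF EV] mult_left_mono) auto
    also have "\<dots> \<le> (C * r)\<^sup>2"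
    proof -
      have "C * 1 \<le> C * C" using C1 by (intro mult_left_mono) auto
      then have "C * r\<^sup>2 \<le> C * C * r\<^sup>2" by (intro mult_right_mono) auto
      then show ?thesis by (simp add: power2_eq_square mult_ac)
    qed
    finally show "(E * sqrt Vz)\<^sup>2 \<le> (C * r)\<^sup>2" .
  qed (use C1 r in simp)
  have l: "32 / \<Lambda> = 192 / m" using lam_pos[of d "real s" Sg] by (simp add: m_def)
  have "(\<integral>\<^sup>+\<omega>. ennreal (Gd \<omega>) \<partial>M) \<le> ennreal (6 * (32 / \<Lambda> * (2 * real s / real d + E * sqrt Vz) + 64 * E\<^sup>2 * Vz))"
    using Gd_integral unfolding E_def Vz_def .
  also have "\<dots> \<le> ennreal (2304 * (1 + C) * (r / m))"
  proof (rule ennreal_leI)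
    have 1: "32 / \<Lambda> * (2 * real s / real d + E * sqrt Vz) \<le> 192 / m * ((2 + C) * r)"
    proof -
      have "2 * real s / real d + E * sqrt Vz \<le> 2 * r + C * r" using EsV by (simp add: r_def)
      also have "\<dots> = (2 + C) * r" by (simp add: distrib_right)
      finally show ?thesis unfolding l using m1 by (intro mult_left_mono) auto
    qed
    have "C * r\<^sup>2 * exp (- (m / 3)) \<le> C * r * (3 / m)"
    proof (intro mult_mono em mult_left_mono)
      show "r\<^sup>2 \<le> r" using mult_left_mono[OF r(2) r(1)] by (simp add: power2_eq_square)
    qed (use C1 r in auto)
    then have 2: "64 * E\<^sup>2 * Vz \<le> 192 / m * (C * r)" using EV by simp
    have "6 * (32 / \<Lambda> * (2 * real s / real d + E * sqrt Vz) + 64 * E\<^sup>2 * Vz) \<le> 6 * (192 / m * ((2 + C) * r) + 192 / m * (C * r))"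
      by (intro mult_left_mono add_mono 1 2) simp
    also have "\<dots> = 2304 * (1 + C) * (r / m)" by (simp add: algebra_simps add_divide_distrib)
    finally show "6 * (32 / \<Lambda> * (2 * real s / real d + E * sqrt Vz) + 64 * E\<^sup>2 * Vz) \<le> 2304 * (1 + C) * (r / m)" .
  qed
  finally show ?thesis by (simp add: C_def r_def m_def)
qed

text \<open>The sum of variances is at most d, so the bound for \<open>Gd\<close> is multiplied by d
  and becomes s/(6 Lambda). On the exceptional event the noise estimate is bounded by
  \<open>that\<close>, hence by \<open>tailT\<close>, and contributes K^2/d <= K.\<close>

lemma err_integral_large:
  assumes sF: "F < real s"
  shows "(\<integral>\<^sup>+\<omega>. ennreal (err \<omega>) \<partial>M) \<le> ennreal (large_const c * \<sigma>\<^sup>2 * psi_star d (real s) Sg)"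
proof -
  define \<psi> where "\<psi> = psi_star d (real s) Sg"
  note ps = psi_large[OF sF, folded \<psi>_def]
  define C where "C = 1 + 48 / c\<^sup>2"
  have C0: "0 \<le> C" by (simp add: C_def)
  define D where "D \<omega> = (ennreal ((2 * \<bar>Z3 \<omega>\<bar> + linq \<omega>) + 2 * real d * Gd \<omega>)) + (ennreal (130 * real d) * indicator bad \<omega> + ennreal (16 * real d) * tailT x0 \<omega>)" for \<omega>
  have pt: "ennreal (err \<omega>) \<le> ennreal (\<sigma>\<^sup>2) * D \<omega>" if \<omega>: "\<omega> \<in> space M" for \<omega>
  proof -
    have "\<bar>(1 - Dr \<omega>) * (\<Sum>i<d. (sd Sg i)\<^sup>2)\<bar> \<le> \<bar>1 - Dr \<omega>\<bar> * real d"
      unfolding abs_mult using sum_sd_le by (intro mult_left_mono) (auto simp: sum_nonneg)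
    then have B: "\<bar>Z3 \<omega> + (1 - Dr \<omega>) * (\<Sum>i<d. (sd Sg i)\<^sup>2)\<bar> \<le> \<bar>Z3 \<omega>\<bar> + \<bar>1 - Dr \<omega>\<bar> * real d" by linarith
    have e: "err \<omega> \<le> \<sigma>\<^sup>2 * (2 * (\<bar>Z3 \<omega>\<bar> + \<bar>1 - Dr \<omega>\<bar> * real d) + linq \<omega>)"
      by (rule err_le[OF Qstar_large[OF sF] B])
    show ?thesis
    proof (cases "\<omega> \<in> good")
      case True
      have "2 * (\<bar>Z3 \<omega>\<bar> + \<bar>1 - Dr \<omega>\<bar> * real d) + linq \<omega> \<le> (2 * \<bar>Z3 \<omega>\<bar> + linq \<omega>) + 2 * real d * Gd \<omega>"
        using mult_right_mono[OF Dr_good[OF True], of "real d"] by (simp add: algebra_simps)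
      then have "err \<omega> \<le> \<sigma>\<^sup>2 * ((2 * \<bar>Z3 \<omega>\<bar> + linq \<omega>) + 2 * real d * Gd \<omega>)"
        using e mult_left_mono[OF _ zero_le_power2[of \<sigma>]] by (meson order_trans)
      then have "ennreal (err \<omega>) \<le> ennreal (\<sigma>\<^sup>2) * ennreal ((2 * \<bar>Z3 \<omega>\<bar> + linq \<omega>) + 2 * real d * Gd \<omega>)"
        by (subst ennreal_mult'[symmetric]) (auto intro: ennreal_leI)
      also have "\<dots> \<le> ennreal (\<sigma>\<^sup>2) * D \<omega>" unfolding D_def by (intro mult_left_mono) auto
      finally show ?thesis .
    next
      case False
      then have bad: "\<omega> \<in> bad" using \<omega> by (simp add: bad_def)
      define T where "T = that_n \<omega>"
      have T0: "0 \<le> T" using that_nonneg[OF d1, of Sg "obs \<omega>"] by (simp add: T_def)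
      have "\<bar>1 - Dr \<omega>\<bar> \<le> 1 + 8 * T" using Dr_bounds[of \<omega>] T0 unfolding T_def by linarith
      then have "\<bar>1 - Dr \<omega>\<bar> * real d \<le> (1 + 8 * T) * real d" by (rule mult_right_mono) simp
      then have "2 * (\<bar>Z3 \<omega>\<bar> + \<bar>1 - Dr \<omega>\<bar> * real d) + linq \<omega> \<le> (2 * \<bar>Z3 \<omega>\<bar> + linq \<omega>) + (2 * real d + (16 * real d) * T)"
        by (simp add: algebra_simps)
      then have "err \<omega> \<le> \<sigma>\<^sup>2 * ((2 * \<bar>Z3 \<omega>\<bar> + linq \<omega>) + (2 * real d + (16 * real d) * T))"
        using e mult_left_mono[OF _ zero_le_power2[of \<sigma>]] by (meson order_trans)
      then have "ennreal (err \<omega>) \<le> ennreal (\<sigma>\<^sup>2) * ennreal ((2 * \<bar>Z3 \<omega>\<bar> + linq \<omega>) + (2 * real d + (16 * real d) * T))"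
        by (subst ennreal_mult'[symmetric]) (auto intro: ennreal_leI)
      also have "\<dots> \<le> ennreal (\<sigma>\<^sup>2) * D \<omega>"
      proof (intro mult_left_mono)
        have "ennreal ((2 * \<bar>Z3 \<omega>\<bar> + linq \<omega>) + (2 * real d + (16 * real d) * T)) =
          ennreal (2 * \<bar>Z3 \<omega>\<bar> + linq \<omega>) + (ennreal (2 * real d) + ennreal (16 * real d) * ennreal (T))"
          using T0 linq_nonneg[of \<omega>]
          by (simp only: ennreal_plus ennreal_mult mult_nonneg_nonneg add_nonneg_nonneg abs_ge_zero zero_le_numeral of_nat_0_le_iff)
        also have "\<dots> \<le> ennreal ((2 * \<bar>Z3 \<omega>\<bar> + linq \<omega>) + 2 * real d * Gd \<omega>) + (ennreal (2 * real d) + ennreal (16 * real d) * (8 + tailT x0 \<omega>))"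
        proof -
          have a: "ennreal (2 * \<bar>Z3 \<omega>\<bar> + linq \<omega>) \<le> ennreal ((2 * \<bar>Z3 \<omega>\<bar> + linq \<omega>) + 2 * real d * Gd \<omega>)"
            using Gd_nonneg[of \<omega>] by (intro ennreal_leI) simp
          have b: "ennreal (16 * real d) * ennreal T \<le> ennreal (16 * real d) * (8 + tailT x0 \<omega>)"
            using that_n_le[OF \<omega>, folded T_def] by (intro mult_left_mono) auto
          show ?thesis by (intro add_mono a b order_refl)
        qed
        also have "ennreal (2 * real d) + ennreal (16 * real d) * (8 + tailT x0 \<omega>) = ennreal (130 * real d) + ennreal (16 * real d) * tailT x0 \<omega>"
        proof -
          have "ennreal (16 * real d) * 8 = ennreal (128 * real d)" using ennreal_mult[of "16 * real d" 8] by simp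
          moreover have "ennreal (2 * real d) + ennreal (128 * real d) = ennreal (130 * real d)"
            by (subst ennreal_plus[symmetric]) auto
          ultimately show ?thesis by (simp only: distrib_left add.assoc[symmetric])
        qed
        finally show "ennreal ((2 * \<bar>Z3 \<omega>\<bar> + linq \<omega>) + (2 * real d + (16 * real d) * T)) \<le> D \<omega>"
          unfolding D_def using bad by simp
      qed simp
      finally show ?thesis .
    qed
  qed
  have Dm [measurable]: "D \<in> borel_measurable M" unfolding D_def[abs_def] using d1 by measurable
  define k where "k = (K / real d)\<^sup>2"
  have k0: "0 \<le> k" by (simp add: k_def)
  have L0: "0 < \<Lambda>" by (rule lam_pos)
  define g where "g = 2304 * C * (real s / real d / (6 * \<Lambda>))"
  have g0: "0 \<le> g" using C0 L0 by (simp add: g_def)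
  have Z: "(\<integral>\<^sup>+\<omega>. ennreal \<bar>Z3 \<omega>\<bar> \<partial>M) \<le> ennreal (4 * K)"
  proof -
    have "(\<integral>\<^sup>+\<omega>. ennreal \<bar>Z3 \<omega>\<bar> \<partial>M) \<le> ennreal (sqrt (12 * K\<^sup>2))" by (intro nn_integral_abs_le_sqrt' Z3_second) auto
    also have "\<dots> \<le> ennreal (4 * K)" using K_nonneg by (intro ennreal_leI real_le_lsqrt) (auto simp: power_mult_distrib)
    finally show ?thesis .
  qed
  have Dint: "(\<integral>\<^sup>+\<omega>. D \<omega> \<partial>M) \<le> ennreal (((2 * (4 * K) + 64 * K) + 2 * real d * g) + (130 * real d * (bad_const * k) + 16 * real d * (200 * k)))"
    unfolding D_def
  proof (intro nn_integral_add_le nn_real_add nn_real_cmult)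
    show "(\<integral>\<^sup>+\<omega>. ennreal (Gd \<omega>) \<partial>M) \<le> ennreal g" unfolding g_def C_def by (rule Gd_bound[OF sF])
    show "(\<integral>\<^sup>+\<omega>. ennreal (130 * real d) * indicator bad \<omega> \<partial>M) \<le> ennreal (130 * real d * (bad_const * k))" unfolding k_def by (intro bad_nn_integral) simp
    show "(\<integral>\<^sup>+\<omega>. ennreal (16 * real d) * tailT x0 \<omega> \<partial>M) \<le> ennreal (16 * real d * (200 * k))" unfolding k_def by (intro tailT_nn_integral) simp
  qed (use d1 k0 g0 bad_const_ge1 K_nonneg linq_nonneg Gd_nonneg linq_integral_K Z in auto)
  have "(\<integral>\<^sup>+\<omega>. ennreal (err \<omega>) \<partial>M) \<le> (\<integral>\<^sup>+\<omega>. ennreal (\<sigma>\<^sup>2) * D \<omega> \<partial>M)" by (rule nn_integral_mono[OF pt])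
  also have "\<dots> = ennreal (\<sigma>\<^sup>2) * (\<integral>\<^sup>+\<omega>. D \<omega> \<partial>M)" by (rule nn_integral_cmult) measurable
  also have "\<dots> \<le> ennreal (\<sigma>\<^sup>2) * ennreal (((2 * (4 * K) + 64 * K) + 2 * real d * g) + (130 * real d * (bad_const * k) + 16 * real d * (200 * k)))"
    by (intro mult_left_mono Dint) simp
  also have "\<dots> \<le> ennreal (\<sigma>\<^sup>2) * ennreal (large_const c * \<psi>)"
  proof (intro mult_left_mono ennreal_leI)
    have "real d * k = K\<^sup>2 / real d" unfolding k_def by (rule d_times_kappa_sq)
    also have "\<dots> \<le> K" using K_le_d K_nonneg d1 mult_left_mono[OF K_le_d K_nonneg] by (simp add: power2_eq_square divide_le_eq)
    finally have dk: "real d * k \<le> K" .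
    have "130 * real d * (bad_const * k) + 16 * real d * (200 * k) = (130 * bad_const + 3200) * (real d * k)" by (simp add: algebra_simps)
    also have "\<dots> \<le> (130 * bad_const + 3200) * K" using dk bad_const_ge1 by (intro mult_left_mono) auto
    finally have 1: "130 * real d * (bad_const * k) + 16 * real d * (200 * k) \<le> (130 * bad_const + 3200) * K" .
    have "K \<le> \<psi> / c" using K_le_Fc ps(1) divide_right_mono[OF ps(1), of c] c0 by linarith
    then have "(3272 + 130 * bad_const) * K \<le> (3272 + 130 * bad_const) * (\<psi> / c)" using bad_const_ge1 by (intro mult_left_mono) auto
    then have 2: "72 * K + (130 * bad_const + 3200) * K \<le> (3272 + 130 * bad_const) / c * \<psi>" by (simp add: algebra_simps add_divide_distrib)
    have "2 * real d * g = 4608 * C * (real s / (6 * \<Lambda>))" unfolding g_def using d1 by simp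
    also have "\<dots> \<le> 4608 * C * ((1 + ln (1 / c)) * \<psi>)" using ps(2) C0 by (intro mult_left_mono) auto
    finally have 3: "2 * real d * g \<le> 4608 * C * (1 + ln (1 / c)) * \<psi>" by (simp add: mult.assoc)
    have "large_const c * \<psi> = (3272 + 130 * bad_const) / c * \<psi> + 4608 * C * (1 + ln (1 / c)) * \<psi>" by (simp add: large_const_def C_def distrib_right)
    then show "((2 * (4 * K) + 64 * K) + 2 * real d * g) + (130 * real d * (bad_const * k) + 16 * real d * (200 * k)) \<le> large_const c * \<psi>"
      using 1 2 3 by linarith
  qed simp
  also have "\<dots> = ennreal (large_const c * \<sigma>\<^sup>2 * \<psi>)" by (subst ennreal_mult'[symmetric]) (auto simp: mult_ac)
  finally show ?thesis by (simp add: \<psi>_def)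
qed

lemma obs_measurable: "obs \<in> measurable M (PiM {0..<d} (\<lambda>_. borel))"
  unfolding obs_def[abs_def] by (intro measurable_restrict borel_measurable_add borel_measurable_times borel_measurable_const xi_measurable) auto

lemma err_measurable [measurable]: "err \<in> borel_measurable M"
proof -
  note Nstar_measurable[OF d1, of "real s" Sg, measurable] obs_measurable[measurable]
  show ?thesis unfolding err_def[abs_def] by measurable
qed

lemma err_integral_small:
  assumes sF: "real s \<le> F"
  shows "(\<integral>\<^sup>+\<omega>. ennreal (err \<omega>) \<partial>M) \<le>
    ennreal ((small_const c + 15104) * \<sigma>\<^sup>2 * psi_star d (real s) Sg + small_tail_const c * \<sigma>\<^sup>2 * (F\<^sup>2 / real d) * ln (1 + F\<^sup>2 / (real s)\<^sup>2))"
proof -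
  define L where "L = ln (1 + F\<^sup>2 / (real s)\<^sup>2)"
  note rf = rate_facts[OF sF, folded L_def]
  have L0: "0 \<le> L" using rf(1) by simp
  have p0: "0 \<le> psi_star d (real s) Sg" unfolding rf(5) using L0 by simp
  have C: "0 \<le> small_const c" "0 \<le> small_tail_const c" using ell_pos c0 bad_const_ge1 by (auto simp: small_const_def small_tail_const_def)
  have "(\<integral>\<^sup>+\<omega>. ennreal (err \<omega>) \<partial>M) = (\<integral>\<^sup>+\<omega>. ennreal (err \<omega>) * indicator good \<omega> + ennreal (err \<omega>) * indicator bad \<omega> \<partial>M)"
    by (intro nn_integral_cong) (auto simp: bad_def split: split_indicator)
  also have "\<dots> \<le> ennreal (small_const c * \<sigma>\<^sup>2 * psi_star d (real s) Sg + \<sigma>\<^sup>2 * (15104 * psi_star d (real s) Sg + small_tail_const c * (F\<^sup>2 / real d) * L))"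
    using err_integral_small_good[OF sF] err_integral_small_bad[OF sF, folded L_def] C p0 L0 by (intro nn_integral_add_le) auto
  finally show ?thesis by (simp add: L_def algebra_simps)
qed

text \<open>Half of eta is spent on each of two events: Markov's inequality on the good event fixes
  the constant \<open>2 * small_const c / \<eta>\<close>, and the probability of the exceptional
  event, at most \<open>bad_const\<close> times K/d <= F/(c d), explains the lower limit on
  eta.\<close>

lemma err_prob_small:
  assumes sF: "real s \<le> F" and eta: "2 * bad_const / c * F / real d < \<eta>" "\<eta> < 1"
  shows "measure M {\<omega> \<in> space M. err \<omega> \<le> 2 * small_const c / \<eta> * \<sigma>\<^sup>2 * psi_star d (real s) Sg} \<ge> 1 - \<eta>"
proof -
  note rf = rate_facts[OF sF]
  define \<psi> where "\<psi> = psi_star d (real s) Sg"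
  have psi: "0 < \<psi>" unfolding \<psi>_def rf(5) using rf(1) s1 by (intro mult_pos_pos) auto
  have C: "0 < small_const c" unfolding small_const_def using ell_pos c0 by (intro add_pos_nonneg) auto
  have "0 \<le> 2 * bad_const / c * F / real d" using bad_const_ge1 c0 F_pos by simp
  then have e0: "0 < \<eta>" using eta by linarith
  define t where "t = 2 * small_const c / \<eta> * \<sigma>\<^sup>2 * \<psi>"
  have t0: "0 < t" unfolding t_def using C e0 sig psi by simp
  let ?N = "{\<omega> \<in> space M. t < err \<omega>}"
  have b: "measure M bad \<le> \<eta> / 2"
  proof -
    have "emeasure M bad \<le> ennreal (\<eta> / 2)"
    proof (rule order_trans[OF bad_prob ennreal_leI])
      have "(K / real d)\<^sup>2 = K / real d * (K / real d)" by (simp add: power2_eq_square)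
      also have "\<dots> \<le> K / real d * 1" using K_nonneg K_le_d d1 by (intro mult_left_mono) auto
      also have "\<dots> \<le> F / c / real d" using divide_right_mono[OF K_le_Fc, of "real d"] by simp
      finally have "bad_const * (K / real d)\<^sup>2 \<le> bad_const * (F / c / real d)" using bad_const_ge1 by (intro mult_left_mono) auto
      also have "\<dots> = (2 * bad_const / c * F / real d) / 2" by simp
      also have "\<dots> \<le> \<eta> / 2" by (rule divide_right_mono[OF less_imp_le[OF eta(1)]]) simp
      finally show "bad_const * (K / real d)\<^sup>2 \<le> \<eta> / 2" .
    qed
    then show ?thesis using e0 by (simp add: emeasure_eq_measure)
  qed
  have g: "measure M (?N \<inter> good) \<le> \<eta> / 2"
  proof -
    have "ennreal t * emeasure M (?N \<inter> good) = (\<integral>\<^sup>+\<omega>. ennreal t * indicator (?N \<inter> good) \<omega> \<partial>M)"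
      by (rule nn_integral_cmult_indicator[symmetric]) measurable
    also have "\<dots> \<le> (\<integral>\<^sup>+\<omega>. ennreal (err \<omega>) * indicator good \<omega> \<partial>M)"
      by (intro nn_integral_mono) (auto split: split_indicator intro!: ennreal_leI)
    also have "\<dots> \<le> ennreal (small_const c * \<sigma>\<^sup>2 * \<psi>)" unfolding \<psi>_def by (rule err_integral_small_good[OF sF])
    finally have "ennreal (t * measure M (?N \<inter> good)) \<le> ennreal (small_const c * \<sigma>\<^sup>2 * \<psi>)"
      using t0 by (simp add: emeasure_eq_measure ennreal_mult)
    then have "t * measure M (?N \<inter> good) \<le> small_const c * \<sigma>\<^sup>2 * \<psi>"
      using C psi by (subst (asm) ennreal_le_iff) auto
    also have "\<dots> = t * (\<eta> / 2)" unfolding t_def using e0 by simp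
    finally show ?thesis using t0 by simp
  qed
  have "?N \<subseteq> (?N \<inter> good) \<union> bad" by (auto simp: bad_def)
  then have "measure M ?N \<le> measure M ((?N \<inter> good) \<union> bad)" by (intro finite_measure_mono) measurable
  also have "\<dots> \<le> measure M (?N \<inter> good) + measure M bad" by (rule measure_Un_le) measurable
  also have "\<dots> \<le> \<eta>" using b g by simp
  finally have N: "measure M ?N \<le> \<eta>" .
  have "measure M {\<omega> \<in> space M. err \<omega> \<le> t} = 1 - measure M ?N"
  proof -
    have "{\<omega> \<in> space M. err \<omega> \<le> t} = space M - ?N" by auto
    then show ?thesis by (simp add: prob_compl)
  qed
  then show ?thesis using N by (simp add: t_def \<psi>_def)
qed

end

text \<open>Dividing row i of \<open>A\<close> by the standard deviation gives unit vectors whose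
  Gram matrix is the correlation matrix, the setting of \<open>gauss_noise_linear\<close>;
  Cauchy-Schwarz for these rows bounds the correlations by one.\<close>

lemma sparse_model_factor:
  fixes A \<Sigma> :: "nat \<Rightarrow> nat \<Rightarrow> real"
  assumes d: "1 \<le> d" and s: "1 \<le> s" "real s \<le> ell / 128 * real d" and sig: "0 < \<sigma>" and th: "\<theta> \<in> B0 (real s) d"
    and A: "\<forall>i<d. \<forall>j<d. \<Sigma> i j = (\<Sum>k<d. A i k * A j k)"
    and Su: "\<forall>i<d. \<Sigma> i i \<le> 1" and Sl: "\<forall>i<d. c \<le> \<Sigma> i i" and c: "0 < c"
  shows "sparse_model (PiM {0..<d} (\<lambda>_. std_gauss)) d (\<lambda>i z. \<Sum>k<d. A i k / sd \<Sigma> i * z k) (Stil \<Sigma>) \<sigma> \<theta> \<Sigma> s c"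
proof -
  have sd2: "(sd \<Sigma> i)\<^sup>2 = \<Sigma> i i" "0 < sd \<Sigma> i" if "i < d" for i
  proof -
    have "0 < \<Sigma> i i" using Sl c that by (meson less_le_trans)
    then show "(sd \<Sigma> i)\<^sup>2 = \<Sigma> i i" "0 < sd \<Sigma> i" by (auto simp: sd_def)
  qed
  have R: "Stil \<Sigma> i j = (\<Sum>k<d. A i k / sd \<Sigma> i * (A j k / sd \<Sigma> j))" if "i < d" "j < d" for i j
    using A that by (simp add: Stil_def sum_divide_distrib)
  have u: "(\<Sum>k<d. (A i k / sd \<Sigma> i)\<^sup>2) = 1" if "i < d" for i
  proof -
    have "(\<Sum>k<d. (A i k / sd \<Sigma> i)\<^sup>2) = (\<Sum>k<d. A i k * A i k) / (sd \<Sigma> i)\<^sup>2"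
      by (simp add: power_divide sum_divide_distrib power2_eq_square)
    also have "\<dots> = \<Sigma> i i / (sd \<Sigma> i)\<^sup>2" using A that by simp
    also have "\<dots> = 1"
    proof -
      have "(sd \<Sigma> i)\<^sup>2 \<noteq> 0" using sd2(2)[OF that] by simp
      then show ?thesis using sd2(1)[OF that] by simp
    qed
    finally show ?thesis .
  qed
  have Rabs: "\<bar>Stil \<Sigma> i j\<bar> \<le> 1" if "i < d" "j < d" for i j
  proof -
    have "(Stil \<Sigma> i j)\<^sup>2 \<le> (\<Sum>k<d. (A i k / sd \<Sigma> i)\<^sup>2) * (\<Sum>k<d. (A j k / sd \<Sigma> j)\<^sup>2)"
      unfolding R[OF that] by (rule Cauchy_Schwarz_ineq_sum)
    then have "(Stil \<Sigma> i j)\<^sup>2 \<le> 1" using u that by simp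
    then show ?thesis by (simp add: abs_square_le_1)
  qed
  interpret gauss_noise "PiM {0..<d} (\<lambda>_. std_gauss)" d "\<lambda>i z. \<Sum>k<d. A i k / sd \<Sigma> i * z k" "Stil \<Sigma>"
    by (rule gauss_noise_linear) (use u R in auto)
  show ?thesis
    by unfold_locales (use d s sig th Su Sl c Rabs in \<open>auto simp: B0_def\<close>)
qed

lemma obs_measure_eq:
  assumes "sparse_model (PiM {0..<d} (\<lambda>_. std_gauss)) d (\<lambda>i z. \<Sum>k<d. A i k / sd \<Sigma> i * z k) (Stil \<Sigma>) \<sigma> \<theta> \<Sigma> s c"
  shows "obs_measure d \<theta> \<sigma> A = distr (PiM {0..<d} (\<lambda>_. std_gauss)) (PiM {0..<d} (\<lambda>_. borel))
    (sparse_model.obs d (\<lambda>i z. \<Sum>k<d. A i k / sd \<Sigma> i * z k) \<sigma> \<theta> \<Sigma>)"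
proof -
  interpret sparse_model "PiM {0..<d} (\<lambda>_. std_gauss)" d "\<lambda>i z. \<Sum>k<d. A i k / sd \<Sigma> i * z k" "Stil \<Sigma>" \<sigma> \<theta> \<Sigma> s c
    by (rule assms)
  have "restrict (\<lambda>i. \<theta> i + \<sigma> * (\<Sum>k<d. A i k * z k)) {0..<d} = obs z" for z
    unfolding obs_def
  proof (intro restrict_ext arg_cong2[where f=plus] arg_cong2[where f=times] refl)
    fix i assume "i \<in> {0..<d}"
    then have "sd \<Sigma> i \<noteq> 0" using sd_pos[of i] by simp
    then show "(\<Sum>k<d. A i k * z k) = sd \<Sigma> i * (\<Sum>k<d. A i k / sd \<Sigma> i * z k)"
      by (simp add: sum_distrib_left)
  qed
  then show ?thesis unfolding obs_measure_def by simp
qed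

theorem theorem7:
  fixes c_star :: real
  assumes "c_star > 0"
  shows "\<exists>\<alpha>::real. 0 < \<alpha> \<and> \<alpha> < 1 \<and>
   (\<exists>c1 c2 c3::real. \<exists>c_eta :: real \<Rightarrow> real.
     0 < c1 \<and> 0 < c2 \<and> 0 < c3 \<and> (\<forall>\<eta>. 0 < \<eta> \<and> \<eta> < 1 \<longrightarrow> 0 < c_eta \<eta>) \<and>
     (\<forall>(d::nat) (s::nat) (\<sigma>::real) (\<theta>::nat \<Rightarrow> real)
         (\<Sigma>::nat \<Rightarrow> nat \<Rightarrow> real) (A::nat \<Rightarrow> nat \<Rightarrow> real).
       1 \<le> d \<longrightarrow> 1 \<le> s \<longrightarrow> real s \<le> \<alpha> * real d \<longrightarrow> 0 < \<sigma> \<longrightarrow>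
       \<theta> \<in> B0 (real s) d \<longrightarrow>
       (\<forall>i<d. \<forall>j<d. \<Sigma> i j = (\<Sum>k<d. A i k * A j k)) \<longrightarrow>
       (\<forall>i<d. \<Sigma> i i \<le> 1) \<longrightarrow>
       (\<forall>i<d. c_star \<le> \<Sigma> i i) \<longrightarrow>
       (let M = obs_measure d \<theta> \<sigma> A;
            err = (\<lambda>Y. (Nstar d (real s) \<Sigma> Y - l2norm d \<theta>)\<^sup>2);
            \<psi> = psi_star d (real s) \<Sigma>;
            F = frob d \<Sigma>
        in
         (real s > F \<longrightarrow>
            (\<integral>\<^sup>+ Y. ennreal (err Y) \<partial>M) \<le> ennreal (c1 * \<sigma>\<^sup>2 * \<psi>)) \<and>
         (real s \<le> F \<longrightarrow>
            (\<forall>\<eta>. c2 * F / real d < \<eta> \<and> \<eta> < 1 \<longrightarrow>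
               measure M {Y \<in> space M. err Y \<le> c_eta \<eta> * \<sigma>\<^sup>2 * \<psi>} \<ge> 1 - \<eta>)) \<and>
         (pos_def d \<Sigma> \<longrightarrow>
            (\<integral>\<^sup>+ Y. ennreal (err Y) \<partial>M) \<le>
              ennreal (c3 * (sqrt (lambda_max d (mat_inv d \<Sigma>)) + 1) * \<sigma>\<^sup>2 * \<psi>
                       + c3 * \<sigma>\<^sup>2 * (F\<^sup>2 / real d) * ln (1 + F\<^sup>2 / (real s)\<^sup>2))))))"
proof (rule exI[of _ "ell / 128"], intro conjI)
  show "0 < ell / 128" "ell / 128 < 1" using ell_pos ell_le by auto
  \<comment> \<open>The maximum with 1 secures positivity; \<open>?c3\<close> dominates the
    constants of both regimes because the third claim fixes no order between s and F.\<close>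
  let ?c1 = "max 1 (large_const c_star)" and ?c2 = "2 * bad_const / c_star"
    and ?c3 = "max (max 1 (large_const c_star)) (small_const c_star + 15104 + small_tail_const c_star)" and ?ce = "\<lambda>\<eta>. 2 * small_const c_star / \<eta>"
  have CA: "0 < small_const c_star" "0 \<le> small_tail_const c_star" using assms ell_pos bad_const_ge1
    by (auto simp: small_const_def small_tail_const_def intro!: add_pos_nonneg)
  show "\<exists>c1 c2 c3::real. \<exists>c_eta :: real \<Rightarrow> real.
     0 < c1 \<and> 0 < c2 \<and> 0 < c3 \<and> (\<forall>\<eta>. 0 < \<eta> \<and> \<eta> < 1 \<longrightarrow> 0 < c_eta \<eta>) \<and>
     (\<forall>(d::nat) (s::nat) (\<sigma>::real) (\<theta>::nat \<Rightarrow> real)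
         (\<Sigma>::nat \<Rightarrow> nat \<Rightarrow> real) (A::nat \<Rightarrow> nat \<Rightarrow> real).
       1 \<le> d \<longrightarrow> 1 \<le> s \<longrightarrow> real s \<le> ell / 128 * real d \<longrightarrow> 0 < \<sigma> \<longrightarrow>
       \<theta> \<in> B0 (real s) d \<longrightarrow>
       (\<forall>i<d. \<forall>j<d. \<Sigma> i j = (\<Sum>k<d. A i k * A j k)) \<longrightarrow>
       (\<forall>i<d. \<Sigma> i i \<le> 1) \<longrightarrow>
       (\<forall>i<d. c_star \<le> \<Sigma> i i) \<longrightarrow>
       (let M = obs_measure d \<theta> \<sigma> A;
            err = (\<lambda>Y. (Nstar d (real s) \<Sigma> Y - l2norm d \<theta>)\<^sup>2);
            \<psi> = psi_star d (real s) \<Sigma>;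
            F = frob d \<Sigma>
        in
         (real s > F \<longrightarrow>
            (\<integral>\<^sup>+ Y. ennreal (err Y) \<partial>M) \<le> ennreal (c1 * \<sigma>\<^sup>2 * \<psi>)) \<and>
         (real s \<le> F \<longrightarrow>
            (\<forall>\<eta>. c2 * F / real d < \<eta> \<and> \<eta> < 1 \<longrightarrow>
               measure M {Y \<in> space M. err Y \<le> c_eta \<eta> * \<sigma>\<^sup>2 * \<psi>} \<ge> 1 - \<eta>)) \<and>
         (pos_def d \<Sigma> \<longrightarrow>
            (\<integral>\<^sup>+ Y. ennreal (err Y) \<partial>M) \<le>
              ennreal (c3 * (sqrt (lambda_max d (mat_inv d \<Sigma>)) + 1) * \<sigma>\<^sup>2 * \<psi>
                       + c3 * \<sigma>\<^sup>2 * (F\<^sup>2 / real d) * ln (1 + F\<^sup>2 / (real s)\<^sup>2)))))"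
  proof (rule exI[of _ ?c1], rule exI[of _ ?c2], rule exI[of _ ?c3], rule exI[of _ ?ce], intro conjI allI impI)
    show "0 < ?c1" "0 < ?c3" by auto
    show "0 < ?c2" using assms bad_const_ge1 by simp
    show "0 < ?ce \<eta>" if "0 < \<eta> \<and> \<eta> < 1" for \<eta> using that CA by simp
  next
    fix d s :: nat and \<sigma> :: real and \<theta> :: "nat \<Rightarrow> real" and \<Sigma> A :: "nat \<Rightarrow> nat \<Rightarrow> real"
    assume d: "1 \<le> d" and s: "1 \<le> s" "real s \<le> ell / 128 * real d" and sig: "0 < \<sigma>" and th: "\<theta> \<in> B0 (real s) d"
      and A: "\<forall>i<d. \<forall>j<d. \<Sigma> i j = (\<Sum>k<d. A i k * A j k)" and Su: "\<forall>i<d. \<Sigma> i i \<le> 1" and Sl: "\<forall>i<d. c_star \<le> \<Sigma> i i"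
    let ?P = "PiM {0..<d} (\<lambda>_. std_gauss)" and ?N = "PiM {0..<d} (\<lambda>_. borel :: real measure)"
    note sm = sparse_model_factor[OF d s sig th A Su Sl assms]
    interpret sparse_model ?P d "\<lambda>i z. \<Sum>k<d. A i k / sd \<Sigma> i * z k" "Stil \<Sigma>" \<sigma> \<theta> \<Sigma> s c_star
      by (rule sm)
    let ?err = "\<lambda>Y. (Nstar d (real s) \<Sigma> Y - l2norm d \<theta>)\<^sup>2"
    let ?psi = "psi_star d (real s) \<Sigma>" and ?L = "ln (1 + (frob d \<Sigma>)\<^sup>2 / (real s)\<^sup>2)"
    have M: "obs_measure d \<theta> \<sigma> A = distr ?P ?N obs" by (rule obs_measure_eq[OF sm])
    note [measurable] = Nstar_measurable[OF d, of "real s" \<Sigma>] obs_measurable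
    have errm [measurable]: "?err \<in> borel_measurable ?N" by measurable
    have int: "(\<integral>\<^sup>+Y. ennreal (?err Y) \<partial>obs_measure d \<theta> \<sigma> A) = (\<integral>\<^sup>+z. ennreal (err z) \<partial>?P)"
      unfolding M err_def by (rule nn_integral_distr) measurable
    have prob: "measure (obs_measure d \<theta> \<sigma> A) {Y \<in> space (obs_measure d \<theta> \<sigma> A). ?err Y \<le> t} = measure ?P {z \<in> space ?P. err z \<le> t}" for t
    proof -
      have "measure (distr ?P ?N obs) {Y \<in> space ?N. ?err Y \<le> t} = measure ?P (obs -` {Y \<in> space ?N. ?err Y \<le> t} \<inter> space ?P)"
        by (rule measure_distr) measurable
      also have "obs -` {Y \<in> space ?N. ?err Y \<le> t} \<inter> space ?P = {z \<in> space ?P. err z \<le> t}"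
        unfolding err_def using measurable_space[OF obs_measurable] by blast
      finally show ?thesis unfolding M by simp
    qed
    have psi0: "0 \<le> ?psi"
    proof (cases "real s \<le> frob d \<Sigma>")
      case True
      then show ?thesis using rate_facts[OF True] by simp
    next
      case False
      then show ?thesis using psi_large(3) by simp
    qed
    have L0: "0 \<le> ?L" by (simp add: ln_ge_zero)
    show "let M = obs_measure d \<theta> \<sigma> A; err = ?err; \<psi> = ?psi; F = frob d \<Sigma> in
         (real s > F \<longrightarrow> (\<integral>\<^sup>+ Y. ennreal (err Y) \<partial>M) \<le> ennreal (?c1 * \<sigma>\<^sup>2 * \<psi>)) \<and>
         (real s \<le> F \<longrightarrow> (\<forall>\<eta>. ?c2 * F / real d < \<eta> \<and> \<eta> < 1 \<longrightarrow>
               measure M {Y \<in> space M. err Y \<le> ?ce \<eta> * \<sigma>\<^sup>2 * \<psi>} \<ge> 1 - \<eta>)) \<and>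
         (pos_def d \<Sigma> \<longrightarrow> (\<integral>\<^sup>+ Y. ennreal (err Y) \<partial>M) \<le>
              ennreal (?c3 * (sqrt (lambda_max d (mat_inv d \<Sigma>)) + 1) * \<sigma>\<^sup>2 * \<psi>
                       + ?c3 * \<sigma>\<^sup>2 * (F\<^sup>2 / real d) * ln (1 + F\<^sup>2 / (real s)\<^sup>2)))"
      unfolding Let_def
    proof (intro conjI impI allI)
      assume "frob d \<Sigma> < real s"
      then have "(\<integral>\<^sup>+Y. ennreal (?err Y) \<partial>obs_measure d \<theta> \<sigma> A) \<le> ennreal (large_const c_star * \<sigma>\<^sup>2 * ?psi)"
        unfolding int by (rule err_integral_large)
      also have "\<dots> \<le> ennreal (?c1 * \<sigma>\<^sup>2 * ?psi)"
        using psi0 by (intro ennreal_leI mult_right_mono) auto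
      finally show "(\<integral>\<^sup>+Y. ennreal (?err Y) \<partial>obs_measure d \<theta> \<sigma> A) \<le> ennreal (?c1 * \<sigma>\<^sup>2 * ?psi)" .
    next
      fix \<eta> assume sF: "real s \<le> frob d \<Sigma>" and "?c2 * frob d \<Sigma> / real d < \<eta> \<and> \<eta> < 1"
      then show "1 - \<eta> \<le> measure (obs_measure d \<theta> \<sigma> A) {Y \<in> space (obs_measure d \<theta> \<sigma> A). ?err Y \<le> ?ce \<eta> * \<sigma>\<^sup>2 * ?psi}"
        unfolding prob using err_prob_small[OF sF] by blast
    next
      assume pd: "pos_def d \<Sigma>"
      \<comment> \<open>Makes the prefactor at least one, so that a bound with prefactor one implies
        the claim.\<close>
      have "0 \<le> lambda_max d (mat_inv d \<Sigma>)"
        by (rule lambda_max_mat_inv_nonneg[OF d _ pd]) (use A in \<open>simp add: mult.commute\<close>)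
      then have l1: "1 \<le> sqrt (lambda_max d (mat_inv d \<Sigma>)) + 1" by simp
      have c3: "?c3 * \<sigma>\<^sup>2 * ?psi \<le> ?c3 * (sqrt (lambda_max d (mat_inv d \<Sigma>)) + 1) * \<sigma>\<^sup>2 * ?psi"
      proof -
        have "?c3 * 1 \<le> ?c3 * (sqrt (lambda_max d (mat_inv d \<Sigma>)) + 1)" using l1 by (intro mult_left_mono) auto
        then show ?thesis using psi0 by (intro mult_right_mono) auto
      qed
      have e0: "0 \<le> ?c3 * \<sigma>\<^sup>2 * ((frob d \<Sigma>)\<^sup>2 / real d) * ?L" using L0 by (intro mult_nonneg_nonneg) auto
      show "(\<integral>\<^sup>+Y. ennreal (?err Y) \<partial>obs_measure d \<theta> \<sigma> A) \<le>
         ennreal (?c3 * (sqrt (lambda_max d (mat_inv d \<Sigma>)) + 1) * \<sigma>\<^sup>2 * ?psi + ?c3 * \<sigma>\<^sup>2 * ((frob d \<Sigma>)\<^sup>2 / real d) * ?L)"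
      proof (cases "real s \<le> frob d \<Sigma>")
        case True
        have "(\<integral>\<^sup>+Y. ennreal (?err Y) \<partial>obs_measure d \<theta> \<sigma> A) \<le>
           ennreal ((small_const c_star + 15104) * \<sigma>\<^sup>2 * ?psi + small_tail_const c_star * \<sigma>\<^sup>2 * ((frob d \<Sigma>)\<^sup>2 / real d) * ?L)"
          unfolding int by (rule err_integral_small[OF True])
        also have "\<dots> \<le> ennreal (?c3 * \<sigma>\<^sup>2 * ?psi + ?c3 * \<sigma>\<^sup>2 * ((frob d \<Sigma>)\<^sup>2 / real d) * ?L)"
        proof (intro ennreal_leI add_mono)
          show "(small_const c_star + 15104) * \<sigma>\<^sup>2 * ?psi \<le> ?c3 * \<sigma>\<^sup>2 * ?psi"
            using CA psi0 by (intro mult_right_mono) auto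
          show "small_tail_const c_star * \<sigma>\<^sup>2 * ((frob d \<Sigma>)\<^sup>2 / real d) * ?L \<le> ?c3 * \<sigma>\<^sup>2 * ((frob d \<Sigma>)\<^sup>2 / real d) * ?L"
            using CA L0 by (intro mult_right_mono) auto
        qed
        also have "\<dots> \<le> ennreal (?c3 * (sqrt (lambda_max d (mat_inv d \<Sigma>)) + 1) * \<sigma>\<^sup>2 * ?psi + ?c3 * \<sigma>\<^sup>2 * ((frob d \<Sigma>)\<^sup>2 / real d) * ?L)"
          by (intro ennreal_leI add_right_mono c3)
        finally show ?thesis .
      next
        case False
        then have "(\<integral>\<^sup>+Y. ennreal (?err Y) \<partial>obs_measure d \<theta> \<sigma> A) \<le> ennreal (large_const c_star * \<sigma>\<^sup>2 * ?psi)"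
          unfolding int by (intro err_integral_large) simp
        also have "\<dots> \<le> ennreal (?c3 * (sqrt (lambda_max d (mat_inv d \<Sigma>)) + 1) * \<sigma>\<^sup>2 * ?psi + ?c3 * \<sigma>\<^sup>2 * ((frob d \<Sigma>)\<^sup>2 / real d) * ?L)"
        proof (rule ennreal_leI)
          have "large_const c_star * \<sigma>\<^sup>2 * ?psi \<le> ?c3 * \<sigma>\<^sup>2 * ?psi" using psi0 by (intro mult_right_mono) auto
          then show "large_const c_star * \<sigma>\<^sup>2 * ?psi \<le> ?c3 * (sqrt (lambda_max d (mat_inv d \<Sigma>)) + 1) * \<sigma>\<^sup>2 * ?psi + ?c3 * \<sigma>\<^sup>2 * ((frob d \<Sigma>)\<^sup>2 / real d) * ?L"
            using c3 e0 by linarith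
        qed
        finally show ?thesis .
      qed
    qed
  qed
qed

end
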